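(* Let $d\ge3$, let $K\subset\mathbb R^d$ be a $d$-simplex, and let $\boldsymbol\Sigma(K):=\mathbb P_2(K;\mathbb S)\oplus\mathbb B_{\partial K}^{nn}$, where $\mathbb B_{\partial K}^{nn}\subset\mathbb P_{d+1}(K;\mathbb S)$ is the normal-normal face bubble space defined in the context. Then the following degrees of freedom are unisolvent for $\boldsymbol\Sigma(K)$: (a) $\boldsymbol\tau(\mathtt v)$ for $\mathtt v\in\Delta_0(K)$; (b) $(\boldsymbol n_i^{\intercal}\boldsymbol\tau\boldsymbol n_j,q)_e$ for $q\in\mathbb P_0(e)$, $e\in\Delta_1(K)$, $1\le i\le j\le d-1$; (c) $(\boldsymbol n^{\intercal}\boldsymbol\tau\boldsymbol n,q)_F$ for $q\in\mathbb P_1(F)$, $F\in\Delta_{d-1}(K)$; (d) $(\Pi_F\boldsymbol\tau\boldsymbol n,\boldsymbol q)_F$ for $\boldsymbol q\in\mathrm{ND}_0(F)$, $F\in\Delta_{d-1}(K)$; (e) $(\boldsymbol\tau,\boldsymbol q)_K$ for $\boldsymbol q\in\mathbb P_0(K;\mathbb S)$.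
   Context: $\mathbb S$: symmetric $d\times d$ matrices. $\mathbb P_k(D;\mathbb X)$: $\mathbb X$-valued polynomials of total degree at most $k$ on $D$; $\mathbb H_k$: homogeneous polynomials of degree $k$. $\Delta_r(K)$: set of $r$-dimensional subsimplices of $K$. For $f\in\Delta_r(K)$, $\boldsymbol n_1,\dots,\boldsymbol n_{d-r}$ is a fixed orthonormal basis of the space of vectors normal to $f$; for $F\in\Delta_{d-1}(K)$ write $\boldsymbol n$ for its unit normal and $\Pi_F\boldsymbol v=(\boldsymbol I-\boldsymbol n\boldsymbol n^{\intercal})\boldsymbol v$. $\operatorname{div}$ is row-wise; $(\cdot,\cdot)_D$ is the $L^2(D)$ inner product. $\mathbf{RM}=\{\boldsymbol a+\boldsymbol B\boldsymbol x:\boldsymbol a\in\mathbb R^d,\boldsymbol B\text{ skew-symmetric}\}$. $\mathbb P_k(K;\mathbb R^d)/\mathbf{RM}$ denotes the $L^2(K)$-orthogonal complement of $\mathbf{RM}$ in $\mathbb P_k(K;\mathbb R^d)$. For a face $F$ with tangent space identified with $\mathbb R^{d-1}$ and $\mathbb K_F$ the skew-symmetric matrices on that tangent space, $\mathrm{ND}_k(F)=\mathbb P_k(F;\mathbb R^{d-1})\oplus\mathbb H_k(F;\mathbb K_F)\boldsymbol x_F$ (tangential vector fields), $\boldsymbol x_F$ being the coordinate in $F$; in particular $\mathrm{ND}_0(F)$ is the rigid motion space of $F$. $\mathbb B_{\partial K}^{nn}$ is the set of $\boldsymbol\tau\in\mathbb P_{d+1}(K;\mathbb S)$ for which all of the following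 vanish: $\boldsymbol\tau(\mathtt v)$ for $\mathtt v\in\Delta_0(K)$; $(\boldsymbol n_i^{\intercal}\boldsymbol\tau\boldsymbol n_j,q)_f$ for $q\in\mathbb P_{d-r}(f)$, $f\in\Delta_r(K)$, $1\le i\le j\le d-r$, $r=1,\dots,d-2$; $(\Pi_F\boldsymbol\tau\boldsymbol n,\boldsymbol q)_F$ for $\boldsymbol q\in\mathrm{ND}_{d-1}(F)$, $F\in\Delta_{d-1}(K)$; $(\operatorname{div}\boldsymbol\tau,\boldsymbol q)_K$ for $\boldsymbol q\in\mathbb P_d(K;\mathbb R^d)/\mathbf{RM}$; $(\boldsymbol\tau,\boldsymbol q)_K$ for $\boldsymbol q\in\mathbb P_{d-1}(K;\mathbb S)$ with $\boldsymbol q\boldsymbol x=0$. It is known (from the literature) that these functionals together with $(\boldsymbol n^{\intercal}\boldsymbol\tau\boldsymbol n,q)_F$, $q\in\mathbb P_1(F)$, $F\in\Delta_{d-1}(K)$, are unisolvent for $\mathbb P_{d+1}(K;\mathbb S)$; and $\mathbb P_2(K;\mathbb S)\cap\mathbb B^{nn}_{\partial K}=\{0\}$. "Unisolvent" means: the linear functionals obtained by letting the test functions run over bases of the indicated test spaces form a basis of the dual of $\boldsymbol\Sigma(K)$ (their number equals $\dim\boldsymbol\Sigma(K)$ and only $\boldsymbol\tau=0$ annihilates all of them). *)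

theory Defs
  imports "HOL-Analysis.Analysis" "HOL-Library.Function_Algebras"
begin

section \<open>Spaces of functions, bases and unisolvence\<close>

instantiation "fun" :: (type, real_vector) real_vector
begin

definition scaleR_fun :: "real \<Rightarrow> ('a \<Rightarrow> 'b) \<Rightarrow> 'a \<Rightarrow> 'b" where
  "scaleR_fun c f = (\<lambda>x. c *\<^sub>R f x)"

instance
  by standard (simp_all add: scaleR_fun_def fun_eq_iff scaleR_add_right scaleR_add_left)

end

definition basis_of :: "'a::real_vector set \<Rightarrow> 'a set \<Rightarrow> bool" where
  "basis_of B V \<longleftrightarrow> independent B \<and> span B = V"

text \<open>A function on \<open>D\<close> is represented by its extension by zero, so that the functions on
  \<open>D\<close> form a vector space in which equality is equality on \<open>D\<close>.\<close>

definition restrict0 :: "'a set \<Rightarrow> ('a \<Rightarrow> 'b::zero) \<Rightarrow> 'a \<Rightarrow> 'b" where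
  "restrict0 D f = (\<lambda>x. if x \<in> D then f x else 0)"

definition dual_space :: "'a::real_vector set \<Rightarrow> ('a \<Rightarrow> real) set" where
  "dual_space V = {\<phi>. (\<forall>x\<in>V. \<forall>y\<in>V. \<phi> (x + y) = \<phi> x + \<phi> y) \<and>
                       (\<forall>c. \<forall>x\<in>V. \<phi> (c *\<^sub>R x) = c * \<phi> x) \<and>
                       (\<forall>x. x \<notin> V \<longrightarrow> \<phi> x = 0)}"

text \<open>The functionals \<open>L i\<close>, \<open>i \<in> I\<close>, form (without repetition) a basis of the dual of \<open>V\<close>.
  The last three conjuncts are implied when \<open>V\<close> is finite-dimensional.\<close>

definition unisolvent :: "'i set \<Rightarrow> ('i \<Rightarrow> 'a \<Rightarrow> real) \<Rightarrow> 'a::real_vector set \<Rightarrow> bool" where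
  "unisolvent I L V \<longleftrightarrow>
     inj_on (\<lambda>i. restrict0 V (L i)) I \<and>
     basis_of ((\<lambda>i. restrict0 V (L i)) ` I) (dual_space V) \<and>
     finite I \<and> card I = dim V \<and>
     (\<forall>\<tau>\<in>V. (\<forall>i\<in>I. L i \<tau> = 0) \<longrightarrow> \<tau> = 0)"


section \<open>Polynomials\<close>

definition monomial :: "('n::finite \<Rightarrow> nat) \<Rightarrow> real ^ 'n \<Rightarrow> real" where
  "monomial \<alpha> x = (\<Prod>i\<in>UNIV. x $ i ^ \<alpha> i)"

definition polys :: "nat \<Rightarrow> 'b::real_vector set \<Rightarrow> (real ^ 'n::finite \<Rightarrow> 'b) set" where
  "polys k X = {\<lambda>x. \<Sum>\<alpha> | sum \<alpha> UNIV \<le> k. monomial \<alpha> x *\<^sub>R c \<alpha> | c. \<forall>\<alpha>. c \<alpha> \<in> X}"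

definition hpolys :: "nat \<Rightarrow> 'b::real_vector set \<Rightarrow> (real ^ 'n::finite \<Rightarrow> 'b) set" where
  "hpolys k X = {\<lambda>x. \<Sum>\<alpha> | sum \<alpha> UNIV = k. monomial \<alpha> x *\<^sub>R c \<alpha> | c. \<forall>\<alpha>. c \<alpha> \<in> X}"

text \<open>Polynomials on a subset \<open>D\<close>. On a full-dimensional simplex restriction is injective, so
  there \<open>polys k X\<close> itself is used for the polynomials on the simplex.\<close>

definition polys_on ::
    "nat \<Rightarrow> (real ^ 'n::finite) set \<Rightarrow> 'b::real_vector set \<Rightarrow> (real ^ 'n \<Rightarrow> 'b) set" where
  "polys_on k D X = restrict0 D ` polys k X"

definition sym_mats :: "(real ^ 'n ^ 'n) set" where
  "sym_mats = {A. transpose A = A}"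

definition skew_mats :: "(real ^ 'n ^ 'n) set" where
  "skew_mats = {A. transpose A = - A}"


section \<open>Subsimplices, normal vectors and integration over subsimplices\<close>

definition subsimplices :: "nat \<Rightarrow> 'a::euclidean_space set \<Rightarrow> 'a set set" where
  "subsimplices r K = {f. f face_of K \<and> int r simplex f}"

definition tangent_space :: "'a::euclidean_space set \<Rightarrow> 'a set" where
  "tangent_space f = span {x - y | x y. x \<in> f \<and> y \<in> f}"

text \<open>\<open>nv f 1, \<dots>, nv f (d - r)\<close> is the chosen orthonormal basis of the space normal to the
  \<open>r\<close>-dimensional subsimplex \<open>f\<close>. In particular \<open>nv F 1\<close> is the unit normal of a facet \<open>F\<close>.\<close>

definition normal_frames ::
    "('a::euclidean_space) set \<Rightarrow> ('a set \<Rightarrow> nat \<Rightarrow> 'a) \<Rightarrow> bool" where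
  "normal_frames K nv \<longleftrightarrow>
     (\<forall>r. \<forall>f\<in>subsimplices r K.
        (\<forall>i\<in>{1..DIM('a) - r}. \<forall>j\<in>{1..DIM('a) - r}. nv f i \<bullet> nv f j = (if i = j then 1 else 0)) \<and>
        span (nv f ` {1..DIM('a) - r}) = (tangent_space f)\<^sup>\<bottom>)"

text \<open>Lebesgue measure of dimension \<open>dim (tangent_space f)\<close> on \<open>f\<close>: Lebesgue measure on the
  coordinates with respect to an orthonormal basis \<open>U\<close> of the tangent space and an origin \<open>a\<close>
  in \<open>f\<close>, transported by the isometry \<open>y \<mapsto> a + (\<Sum>u\<in>U. y u *\<^sub>R u)\<close>. The measure does not depend
  on the choice of \<open>U\<close> and \<open>a\<close>.\<close>

definition orthonormal_basis_of :: "'a::euclidean_space set \<Rightarrow> 'a set \<Rightarrow> bool" where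
  "orthonormal_basis_of U S \<longleftrightarrow> pairwise orthogonal U \<and> (\<forall>u\<in>U. norm u = 1) \<and> span U = S"

definition face_measure :: "'a::euclidean_space set \<Rightarrow> 'a measure" where
  "face_measure f =
     (let U = (SOME U. orthonormal_basis_of U (tangent_space f)); a = (SOME a. a \<in> f)
      in restrict_space (distr (Pi\<^sub>M U (\<lambda>_. lborel)) borel (\<lambda>y. a + (\<Sum>u\<in>U. y u *\<^sub>R u))) f)"

text \<open>On matrices \<open>\<bullet>\<close> is the Frobenius inner product.\<close>

definition L2_inner :: "'a measure \<Rightarrow> ('a \<Rightarrow> 'b::real_inner) \<Rightarrow> ('a \<Rightarrow> 'b) \<Rightarrow> real" where
  "L2_inner M u v = (\<integral>x. u x \<bullet> v x \<partial>M)"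


section \<open>Tangential fields, divergence and rigid motions\<close>

definition proj_normal :: "real ^ 'n \<Rightarrow> real ^ 'n \<Rightarrow> real ^ 'n" where
  "proj_normal n v = v - (n \<bullet> v) *\<^sub>R n"

text \<open>Skew-symmetric endomorphisms of the tangent space of \<open>F\<close>, extended by zero to the normal
  direction.\<close>

definition skew_on_tangent :: "(real ^ 'n) set \<Rightarrow> (real ^ 'n ^ 'n) set" where
  "skew_on_tangent F = {A \<in> skew_mats. \<forall>v\<in>(tangent_space F)\<^sup>\<bottom>. A *v v = 0}"

text \<open>Here \<open>n\<close> is a unit normal of the facet \<open>F\<close>, and the coordinate in \<open>F\<close> is the orthogonal
  projection \<open>proj_normal n x\<close> of \<open>x\<close> to the tangent space. Another origin in the plane of \<open>F\<close>
  yields the same space.\<close>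

definition ND :: "nat \<Rightarrow> (real ^ 'n) set \<Rightarrow> real ^ 'n \<Rightarrow> (real ^ 'n \<Rightarrow> real ^ 'n) set" where
  "ND k F n = {restrict0 F (\<lambda>x. p x + A (proj_normal n x) *v proj_normal n x) | p A.
                 p \<in> polys k (tangent_space F) \<and> A \<in> hpolys k (skew_on_tangent F)}"

definition row_div :: "(real ^ 'n \<Rightarrow> real ^ 'n ^ 'n) \<Rightarrow> real ^ 'n \<Rightarrow> real ^ 'n" where
  "row_div \<tau> x = (\<chi> i. \<Sum>j\<in>UNIV. frechet_derivative \<tau> (at x) (axis j 1) $ i $ j)"

definition rigid_motions :: "(real ^ 'n \<Rightarrow> real ^ 'n) set" where
  "rigid_motions = {\<lambda>x. a + B *v x | a B. B \<in> skew_mats}"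

definition polys_mod_RM :: "nat \<Rightarrow> (real ^ 'n) set \<Rightarrow> (real ^ 'n \<Rightarrow> real ^ 'n) set" where
  "polys_mod_RM k K = {q \<in> polys k UNIV. \<forall>w\<in>rigid_motions. L2_inner (lebesgue_on K) q w = 0}"


section \<open>The bubble space, the shape function space and the degrees of freedom\<close>

text \<open>The matrix-valued functional \<open>\<tau> \<mapsto> \<tau> v\<close> is split into scalar ones by pairing with the elements
  \<open>M\<close> of a basis of the symmetric matrices; \<open>M = (E i j + E j i) / 2\<close> gives the entries of \<open>\<tau> v\<close>.
  A change of sign of the unit normal of \<open>F\<close> only changes the sign of the tangential functionals.\<close>

datatype 'n dof =
    Vertex_Dof "real ^ 'n" "real ^ 'n ^ 'n"
  | Normal_Dof "(real ^ 'n) set" nat nat "real ^ 'n \<Rightarrow> real"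
  | Tangential_Dof "(real ^ 'n) set" "real ^ 'n \<Rightarrow> real ^ 'n"
  | Interior_Dof "real ^ 'n \<Rightarrow> real ^ 'n ^ 'n"

fun dof_value :: "(real ^ 'n) set \<Rightarrow> ((real ^ 'n) set \<Rightarrow> nat \<Rightarrow> real ^ 'n) \<Rightarrow>
    'n dof \<Rightarrow> (real ^ 'n \<Rightarrow> real ^ 'n ^ 'n) \<Rightarrow> real" where
  "dof_value K nv (Vertex_Dof v M) \<tau> = \<tau> v \<bullet> M"
| "dof_value K nv (Normal_Dof f i j q) \<tau> =
     L2_inner (face_measure f) (\<lambda>x. nv f i \<bullet> (\<tau> x *v nv f j)) q"
| "dof_value K nv (Tangential_Dof F q) \<tau> =
     L2_inner (face_measure F) (\<lambda>x. proj_normal (nv F 1) (\<tau> x *v nv F 1)) q"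
| "dof_value K nv (Interior_Dof q) \<tau> = L2_inner (lebesgue_on K) \<tau> q"

definition nn_bubbles :: "(real ^ 'n) set \<Rightarrow> ((real ^ 'n) set \<Rightarrow> nat \<Rightarrow> real ^ 'n) \<Rightarrow>
    (real ^ 'n \<Rightarrow> real ^ 'n ^ 'n) set" where
  "nn_bubbles K nv = {\<tau> \<in> polys (CARD('n) + 1) sym_mats.
     (\<forall>v. {v} \<in> subsimplices 0 K \<longrightarrow> \<tau> v = 0) \<and>
     (\<forall>r\<in>{1..CARD('n) - 2}. \<forall>f\<in>subsimplices r K. \<forall>i j. 1 \<le> i \<and> i \<le> j \<and> j \<le> CARD('n) - r \<longrightarrow>
        (\<forall>q\<in>polys_on (CARD('n) - r) f UNIV. dof_value K nv (Normal_Dof f i j q) \<tau> = 0)) \<and>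
     (\<forall>F\<in>subsimplices (CARD('n) - 1) K. \<forall>q\<in>ND (CARD('n) - 1) F (nv F 1).
        dof_value K nv (Tangential_Dof F q) \<tau> = 0) \<and>
     (\<forall>q\<in>polys_mod_RM (CARD('n)) K. L2_inner (lebesgue_on K) (row_div \<tau>) q = 0) \<and>
     (\<forall>q\<in>polys (CARD('n) - 1) sym_mats. (\<forall>x\<in>K. q x *v x = 0) \<longrightarrow>
        dof_value K nv (Interior_Dof q) \<tau> = 0)}"

definition shape_space :: "(real ^ 'n) set \<Rightarrow> ((real ^ 'n) set \<Rightarrow> nat \<Rightarrow> real ^ 'n) \<Rightarrow>
    (real ^ 'n \<Rightarrow> real ^ 'n ^ 'n) set" where
  "shape_space K nv = {p + b | p b. p \<in> polys 2 sym_mats \<and> b \<in> nn_bubbles K nv}"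

end

theory Submission
  imports Defs
begin

text \<open>Unisolvence amounts to two implications: a field of the shape space annihilated by all functionals
  is zero, and a linear combination of the functionals that vanishes on the shape space is trivial.

  All integrals over a face are handled through one identity, obtained by comparing the integral of a
  polynomial with that over a homothetic image of the face; summed over the vertices it becomes the
  divergence theorem for fields with vanishing normal trace.

  For the first implication write \<open>\<tau> = p + b\<close> with \<open>p\<close> quadratic and \<open>b\<close> a bubble, and let \<open>g c\<close> be the
  gradient of the barycentric coordinate \<open>lam c\<close>. The vertex and edge functionals of \<open>b\<close> vanish, so those
  of \<open>p\<close> do and the normal-normal trace of \<open>p\<close> is zero on every facet. Hence the normal-normal moments of
  \<open>b\<close> vanish as well, which forces \<open>b = 0\<close>, and then \<open>p = 0\<close>. Both times a tangential trace
  \<open>\<Sum>j. lam j q j (j - c)\<close> on a facet is killed by testing first with its own divergence and then with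
  \<open>\<Sum>j. q j (j - c)\<close>, reduced to a Nedelec field by the Koszul decomposition; in the interior, the
  fields with vanishing trace are tested with their own barycentric components, every symmetric field being
  a symmetric gradient plus a field annihilating \<open>x\<close>.

  For the second implication the coefficients are removed block by block with explicit fields:
  \<open>lam i lam j\<close> times a symmetric product of \<open>i - j\<close> with itself for the interior, bubbles with prescribed
  normal-normal trace for the facets, \<open>lam i lam j\<close> times symmetric products of \<open>i - j\<close> and \<open>i - c\<close> for the
  tangential functionals and of edge normals for the edges, and \<open>lam v\<close> times a constant for the vertices.\<close>

section \<open>Polynomials\<close>

text \<open>The space mixes degree 2 with degree d + 1, and the dimension of neither summand is
  computed. The split is tractable because the functionals (a), (b) and (d) vanish on bubbles: their
  tests lie in the spaces that define the bubbles, for (b) because d \<ge> 3 puts the edges among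
  the faces of dimension at most d - 2. Only (c) and (e) couple \<open>p\<close> and
  \<open>b\<close>; (c) is separated by the vanishing normal-normal trace of \<open>p\<close>, and
  (e) is used once \<open>b = 0\<close>. The vanishing arguments rest on positivity: a component is
  a product of barycentric coordinates times some \<open>q\<close>, and testing with
  \<open>q\<close>, or with a field assembled from such factors, gives a weighted integral of
  squares. Divisibility concerns polynomials on the whole space, so a face is replaced by its affine
  hull and polynomials are composed with affine projections onto it. The measure on a face is built
  from an arbitrary orthonormal basis and origin. The proof uses local finiteness, positivity on
  relatively open sets and scaling under homotheties; integrals over the boundary of a face do not
  occur.\<close>

lemma sum_fun_apply: "(\<Sum>i\<in>A. f i) x = (\<Sum>i\<in>A. f i x)"
  by (induction A rule: infinite_finite_induct) auto

text \<open>\<open>polys\<close> and \<open>hpolys\<close> differ only in the set of admissible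
  exponents; the closure properties are proved once for an arbitrary set \<open>M\<close>.\<close>

definition mpolys :: "('n::finite \<Rightarrow> nat) set \<Rightarrow> 'b::real_vector set \<Rightarrow> (real ^ 'n \<Rightarrow> 'b) set" where
  "mpolys M X = {\<lambda>x. \<Sum>\<alpha>\<in>M. monomial \<alpha> x *\<^sub>R c \<alpha> | c. \<forall>\<alpha>. c \<alpha> \<in> X}"

lemma polys_eq_mpolys: "polys k X = mpolys {\<alpha>. sum \<alpha> UNIV \<le> k} X"
  by (simp add: polys_def mpolys_def)

lemma hpolys_eq_mpolys: "hpolys k X = mpolys {\<alpha>. sum \<alpha> UNIV = k} X"
  by (simp add: hpolys_def mpolys_def)

lemma finite_degree_le [simp]: "finite {\<alpha>::'n::finite \<Rightarrow> nat. sum \<alpha> UNIV \<le> k}"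
proof (rule finite_subset)
  show "{\<alpha>::'n \<Rightarrow> nat. sum \<alpha> UNIV \<le> k} \<subseteq> UNIV \<rightarrow>\<^sub>E {..k}"
  proof (clarsimp simp: PiE_UNIV_domain)
    fix \<alpha> :: "'n \<Rightarrow> nat" and i assume "sum \<alpha> UNIV \<le> k"
    moreover have "\<alpha> i \<le> sum \<alpha> UNIV" by (rule member_le_sum) auto
    ultimately show "\<alpha> i \<le> k" by simp
  qed
qed (simp add: finite_PiE)

lemma finite_degree_eq [simp]: "finite {\<alpha>::'n::finite \<Rightarrow> nat. sum \<alpha> UNIV = k}"
  by (rule finite_subset[OF _ finite_degree_le[of k]]) auto

lemma subspace_mpolys:
  fixes X :: "'b::real_vector set"
  assumes "subspace X" shows "subspace (mpolys M X)"
  unfolding subspace_def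
proof (intro conjI ballI allI)
  have "0 = (\<lambda>x. \<Sum>\<alpha>\<in>M. monomial \<alpha> x *\<^sub>R (0::'b))"
    by (auto simp: fun_eq_iff)
  then show "0 \<in> mpolys M X"
    unfolding mpolys_def using subspace_0[OF assms] by (intro CollectI exI[of _ "\<lambda>_. 0"]) auto
next
  fix p q assume "p \<in> mpolys M X" "q \<in> mpolys M X"
  then obtain c e where p: "p = (\<lambda>x. \<Sum>\<alpha>\<in>M. monomial \<alpha> x *\<^sub>R c \<alpha>)" "\<forall>\<alpha>. c \<alpha> \<in> X"
    and q: "q = (\<lambda>x. \<Sum>\<alpha>\<in>M. monomial \<alpha> x *\<^sub>R e \<alpha>)" "\<forall>\<alpha>. e \<alpha> \<in> X"
    unfolding mpolys_def by blast
  have "p + q = (\<lambda>x. \<Sum>\<alpha>\<in>M. monomial \<alpha> x *\<^sub>R (c \<alpha> + e \<alpha>))"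
    unfolding p(1) q(1) by (auto simp: fun_eq_iff scaleR_add_right sum.distrib)
  then show "p + q \<in> mpolys M X" unfolding mpolys_def
    using p q subspace_add[OF assms] by (intro CollectI exI[of _ "\<lambda>\<alpha>. c \<alpha> + e \<alpha>"]) auto
next
  fix r p assume "p \<in> mpolys M X"
  then obtain c where p: "p = (\<lambda>x. \<Sum>\<alpha>\<in>M. monomial \<alpha> x *\<^sub>R c \<alpha>)" "\<forall>\<alpha>. c \<alpha> \<in> X"
    unfolding mpolys_def by blast
  have "r *\<^sub>R p = (\<lambda>x. \<Sum>\<alpha>\<in>M. monomial \<alpha> x *\<^sub>R (r *\<^sub>R c \<alpha>))"
    unfolding p(1) by (auto simp: fun_eq_iff scaleR_fun_def scaleR_sum_right mult.commute)
  then show "r *\<^sub>R p \<in> mpolys M X" unfolding mpolys_def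
    using p subspace_scale[OF assms] by (intro CollectI exI[of _ "\<lambda>\<alpha>. r *\<^sub>R c \<alpha>"]) auto
qed

lemma monomial_mem_mpolys:
  assumes "finite M" "\<alpha> \<in> M" "subspace X" "a \<in> X"
  shows "(\<lambda>x. monomial \<alpha> x *\<^sub>R a) \<in> mpolys M X"
proof -
  have "(\<Sum>\<beta>\<in>M. monomial \<beta> x *\<^sub>R (if \<beta> = \<alpha> then a else 0)) = monomial \<alpha> x *\<^sub>R a" for x
  proof -
    have "(\<Sum>\<beta>\<in>M. monomial \<beta> x *\<^sub>R (if \<beta> = \<alpha> then a else 0))
        = (\<Sum>\<beta>\<in>M. if \<beta> = \<alpha> then monomial \<beta> x *\<^sub>R a else 0)" by (intro sum.cong) auto
    then show ?thesis using assms by simp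
  qed
  then show ?thesis unfolding mpolys_def
    using assms subspace_0[OF assms(3)]
    by (intro CollectI exI[of _ "\<lambda>\<beta>. if \<beta> = \<alpha> then a else 0"]) auto
qed

lemma mpolys_linear:
  assumes "p \<in> mpolys M X" "linear f" "f ` X \<subseteq> Y"
  shows "(\<lambda>x. f (p x)) \<in> mpolys M Y"
proof -
  obtain c where p: "p = (\<lambda>x. \<Sum>\<alpha>\<in>M. monomial \<alpha> x *\<^sub>R c \<alpha>)" "\<forall>\<alpha>. c \<alpha> \<in> X"
    using assms unfolding mpolys_def by blast
  have "(\<lambda>x. f (p x)) = (\<lambda>x. \<Sum>\<alpha>\<in>M. monomial \<alpha> x *\<^sub>R f (c \<alpha>))"
    unfolding p(1) by (simp add: linear_sum[OF assms(2)] linear_scale[OF assms(2)])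
  then show ?thesis unfolding mpolys_def
    using p assms by (intro CollectI exI[of _ "\<lambda>\<alpha>. f (c \<alpha>)"]) auto
qed

lemma mpolys_value: "p \<in> mpolys M X \<Longrightarrow> subspace X \<Longrightarrow> p x \<in> X"
  unfolding mpolys_def by (auto intro!: subspace_sum subspace_scale)

text \<open>A linear map \<open>g\<close> into \<open>X\<close> that is the identity on
  \<open>X\<close> leaves \<open>p\<close> unchanged but moves its coefficients into
  \<open>X\<close>. Hence degrees may be checked componentwise and the range pointwise.\<close>

lemma mpolys_valued:
  fixes X :: "'b::real_vector set"
  assumes "subspace X" "p \<in> mpolys M UNIV" "\<And>x. p x \<in> X"
  shows "p \<in> mpolys M X"
proof -
  obtain g :: "'b \<Rightarrow> 'b" where g: "g ` UNIV \<subseteq> X" "linear g" "\<forall>v\<in>X. g v = v"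
    using real_vector.linear_exists_left_inverse_on[of id X] linear_id assms(1)
    by (auto simp: linear_def real_vector.module_hom_id)
  have "(\<lambda>x. g (p x)) \<in> mpolys M X" using mpolys_linear[OF assms(2) g(2)] g(1) by blast
  then show ?thesis using g(3) assms(3) by simp
qed

lemma mpolys_mono:
  assumes "M \<subseteq> N" "finite N" "0 \<in> Y" "X \<subseteq> Y"
  shows "mpolys M X \<subseteq> mpolys N Y"
proof
  fix p assume "p \<in> mpolys M X"
  then obtain c where p: "p = (\<lambda>x. \<Sum>\<alpha>\<in>M. monomial \<alpha> x *\<^sub>R c \<alpha>)" "\<forall>\<alpha>. c \<alpha> \<in> X"
    unfolding mpolys_def by blast
  have "p = (\<lambda>x. \<Sum>\<alpha>\<in>N. monomial \<alpha> x *\<^sub>R (if \<alpha> \<in> M then c \<alpha> else 0))"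
    unfolding p(1) using assms(1,2) by (intro ext sum.mono_neutral_cong_left) auto
  then show "p \<in> mpolys N Y" unfolding mpolys_def using p(2) assms
    by (intro CollectI exI[of _ "\<lambda>\<alpha>. if \<alpha> \<in> M then c \<alpha> else 0"]) auto
qed

lemma mpolys_scalar_times:
  assumes "p \<in> mpolys M UNIV" "finite M" "subspace X" "a \<in> X"
  shows "(\<lambda>x. p x *\<^sub>R a) \<in> mpolys M X"
proof (rule mpolys_linear[OF assms(1)])
  show "linear (\<lambda>r. r *\<^sub>R a)" by (rule linearI) (auto simp: algebra_simps)
  show "range (\<lambda>r. r *\<^sub>R a) \<subseteq> X" using assms by (auto simp: subspace_scale)
qed

lemma mpolys_sum:
  assumes "subspace X" "\<And>i. i \<in> I \<Longrightarrow> f i \<in> mpolys M X"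
  shows "(\<lambda>x. \<Sum>i\<in>I. f i x) \<in> mpolys M X"
proof -
  have "sum f I \<in> mpolys M X" using subspace_sum[OF subspace_mpolys[OF assms(1)]] assms(2) by blast
  moreover have "sum f I = (\<lambda>x. \<Sum>i\<in>I. f i x)" by (auto simp: fun_eq_iff sum_fun_apply)
  ultimately show ?thesis by simp
qed

lemma mpolys_componentwise:
  fixes p :: "real ^ 'n \<Rightarrow> 'b::euclidean_space"
  assumes "\<And>b. b \<in> Basis \<Longrightarrow> (\<lambda>x. p x \<bullet> b) \<in> mpolys M UNIV" "finite M"
  shows "p \<in> mpolys M UNIV"
proof -
  have "(\<lambda>x. \<Sum>b\<in>Basis. (p x \<bullet> b) *\<^sub>R b) \<in> mpolys M UNIV"
    using assms by (intro mpolys_sum mpolys_scalar_times) auto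
  then show ?thesis by (simp add: euclidean_representation)
qed

text \<open>Together with independence this bounds the size of every basis of a polynomial test
  space, and hence makes the set of functionals finite.\<close>

lemma mpolys_finite_span:
  assumes "finite M" 
  shows "\<exists>B. finite B \<and> mpolys M (UNIV::'b::euclidean_space set) \<subseteq> span B"
proof (intro exI conjI subsetI)
  let ?B = "(\<lambda>(\<alpha>,b) x. monomial \<alpha> x *\<^sub>R b) ` (M \<times> (Basis::'b set))"
  show "finite ?B" using assms by auto
  fix p :: "real^'a \<Rightarrow> 'b" assume "p \<in> mpolys M UNIV"
  then obtain c where p: "p = (\<lambda>x. \<Sum>\<alpha>\<in>M. monomial \<alpha> x *\<^sub>R c \<alpha>)" 
    unfolding mpolys_def by blast
  have "p = (\<Sum>\<alpha>\<in>M. \<Sum>b\<in>Basis. (c \<alpha> \<bullet> b) *\<^sub>R (\<lambda>x. monomial \<alpha> x *\<^sub>R b))"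
  proof
    fix x
    have "p x = (\<Sum>\<alpha>\<in>M. monomial \<alpha> x *\<^sub>R (\<Sum>b\<in>Basis. (c \<alpha> \<bullet> b) *\<^sub>R b))"
      unfolding p by (simp add: euclidean_representation)
    also have "\<dots> = (\<Sum>\<alpha>\<in>M. \<Sum>b\<in>Basis. (c \<alpha> \<bullet> b) *\<^sub>R (\<lambda>x. monomial \<alpha> x *\<^sub>R b)) x"
      by (simp add: sum_fun_apply scaleR_fun_def scaleR_sum_right mult.commute)
    finally show "p x = (\<Sum>\<alpha>\<in>M. \<Sum>b\<in>Basis. (c \<alpha> \<bullet> b) *\<^sub>R (\<lambda>x. monomial \<alpha> x *\<^sub>R b)) x" .
  qed
  also have "\<dots> \<in> span ?B"
    by (intro span_sum span_scale span_base) force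
  finally show "p \<in> span ?B" .
qed

section \<open>Scalar polynomials: induction on the degree, products, substitutions\<close>

abbreviation spolys :: "nat \<Rightarrow> (real ^ 'n::finite \<Rightarrow> real) set" where
  "spolys k \<equiv> polys k UNIV"

abbreviation shpolys :: "nat \<Rightarrow> (real ^ 'n::finite \<Rightarrow> real) set" where
  "shpolys k \<equiv> hpolys k UNIV"

lemma monomial_induct [consumes 1, case_names one coord]:
  fixes \<alpha> :: "'n::finite \<Rightarrow> nat"
  assumes "sum \<alpha> UNIV = k"
    and one: "R 0 (\<lambda>x::real^'n. 1)"
    and coord: "\<And>k \<beta> i. sum \<beta> UNIV = k \<Longrightarrow> R k (monomial \<beta>) \<Longrightarrow> R (Suc k) (\<lambda>x. x $ i * monomial \<beta> x)"
  shows "R k (monomial \<alpha>)"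
  using assms(1)
proof (induction k arbitrary: \<alpha>)
  case 0
  then have "\<alpha> = (\<lambda>_. 0)" by auto
  then have "monomial \<alpha> = (\<lambda>x. 1)" by (auto simp: monomial_def fun_eq_iff)
  then show ?case using one by simp
next
  case (Suc k)
  then obtain i where i: "\<alpha> i > 0" by (metis gr0I nat.distinct(1) sum.neutral)
  define \<beta> where "\<beta> = \<alpha>(i := \<alpha> i - 1)"
  have s: "sum \<alpha> UNIV = \<alpha> i + sum \<alpha> (UNIV - {i})" by (simp add: sum.remove)
  have "sum \<beta> UNIV = \<beta> i + sum \<beta> (UNIV - {i})" by (simp add: sum.remove)
  also have "sum \<beta> (UNIV - {i}) = sum \<alpha> (UNIV - {i})" by (intro sum.cong) (auto simp: \<beta>_def)
  finally have b: "sum \<beta> UNIV = k" using s i Suc.prems by (simp add: \<beta>_def)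
  have "monomial \<alpha> x = x $ i * monomial \<beta> x" for x
  proof -
    have "monomial \<alpha> x = x $ i ^ \<alpha> i * (\<Prod>j\<in>UNIV-{i}. x $ j ^ \<alpha> j)"
      unfolding monomial_def by (simp add: prod.remove)
    also have "(\<Prod>j\<in>UNIV-{i}. x $ j ^ \<alpha> j) = (\<Prod>j\<in>UNIV-{i}. x $ j ^ \<beta> j)"
      by (intro prod.cong) (auto simp: \<beta>_def)
    also have "x $ i ^ \<alpha> i = x $ i * x $ i ^ \<beta> i" using i by (simp add: \<beta>_def flip: power_Suc)
    also have "x $ i * x $ i ^ \<beta> i * (\<Prod>j\<in>UNIV-{i}. x $ j ^ \<beta> j) = x $ i * monomial \<beta> x"
      unfolding monomial_def by (simp add: prod.remove[of UNIV i])
    finally show ?thesis .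
  qed
  then have "monomial \<alpha> = (\<lambda>x. x $ i * monomial \<beta> x)" by auto
  then show ?case using coord[OF b Suc.IH[OF b], of i] by simp
qed

text \<open>The degree is an argument of \<open>R\<close>, so that claims such as "the derivative
  has degree \<open>k - 1\<close>" can be carried through multiplication by a coordinate, the only
  case that raises the degree.\<close>

lemma shpolys_induct [consumes 1, case_names zero const add scale coord]:
  fixes p :: "real ^ 'n::finite \<Rightarrow> real"
  assumes "p \<in> shpolys k"
    and zero: "\<And>k. R k (\<lambda>x. 0)"
    and const: "R 0 (\<lambda>x::real^'n. 1)"
    and add: "\<And>k p q. R k p \<Longrightarrow> R k q \<Longrightarrow> R k (\<lambda>x. p x + q x)"
    and scale: "\<And>k p c. R k p \<Longrightarrow> R k (\<lambda>x. c * p x)"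
    and coord: "\<And>k p i. p \<in> shpolys k \<Longrightarrow> R k p \<Longrightarrow> R (Suc k) (\<lambda>x. x $ i * p x)"
  shows "R k p"
proof -
  have mono: "R k (monomial \<alpha>)" if "sum \<alpha> UNIV = k" for \<alpha> :: "'n \<Rightarrow> nat" and k
    using that
  proof (induction rule: monomial_induct)
    case one then show ?case using const by simp
  next
    case (coord k \<beta> i)
    have "(\<lambda>x. monomial \<beta> x *\<^sub>R 1) \<in> shpolys k" unfolding hpolys_eq_mpolys
      using coord by (intro monomial_mem_mpolys) auto
    then show ?case using assms(6)[of "monomial \<beta>" k i] coord by simp
  qed
  have sum: "R k (\<lambda>x. \<Sum>\<alpha>\<in>M. monomial \<alpha> x * c \<alpha>)" if "\<And>\<alpha>. \<alpha> \<in> M \<Longrightarrow> sum \<alpha> UNIV = k" for M and c :: "('n\<Rightarrow>nat) \<Rightarrow> real"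
    using that
  proof (induction M rule: infinite_finite_induct)
    case (insert \<alpha> M)
    have "R k (\<lambda>x. c \<alpha> * monomial \<alpha> x + (\<Sum>\<alpha>\<in>M. monomial \<alpha> x * c \<alpha>))"
      using insert by (intro add scale mono) auto
    then show ?case using insert by (simp add: mult.commute)
  qed (auto simp: zero)
  from assms(1) obtain c where "p = (\<lambda>x. \<Sum>\<alpha> | sum \<alpha> UNIV = k. monomial \<alpha> x * c \<alpha>)"
    unfolding hpolys_def by auto
  then show ?thesis using sum[of "{\<alpha>. sum \<alpha> UNIV = k}" c] by simp
qed

text \<open>As in the homogeneous case, with the additional case \<open>mono\<close> by which
  monomials of lower degree are lifted to the bound \<open>k\<close>.\<close>

lemma spolys_induct [consumes 1, case_names zero const add scale mono coord]:
  fixes p :: "real ^ 'n::finite \<Rightarrow> real"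
  assumes "p \<in> spolys k"
    and zero: "\<And>k. R k (\<lambda>x. 0)"
    and const: "R 0 (\<lambda>x::real^'n. 1)"
    and add: "\<And>k p q. R k p \<Longrightarrow> R k q \<Longrightarrow> R k (\<lambda>x. p x + q x)"
    and scale: "\<And>k p c. R k p \<Longrightarrow> R k (\<lambda>x. c * p x)"
    and mono: "\<And>k p. R k p \<Longrightarrow> R (Suc k) p"
    and coord: "\<And>k p i. p \<in> spolys k \<Longrightarrow> R k p \<Longrightarrow> R (Suc k) (\<lambda>x. x $ i * p x)"
  shows "R k p"
proof -
  have mono': "R k (monomial \<alpha>)" if "sum \<alpha> UNIV = k" for \<alpha> :: "'n \<Rightarrow> nat" and k
    using that
  proof (induction rule: monomial_induct)
    case one then show ?case using const by simp
  next
    case (coord k \<beta> i)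
    have "(\<lambda>x. monomial \<beta> x *\<^sub>R 1) \<in> spolys k" unfolding polys_eq_mpolys
      using coord by (intro monomial_mem_mpolys) auto
    then show ?case using assms(7)[of "monomial \<beta>" k i] coord by simp
  qed
  have up: "R j q \<Longrightarrow> j \<le> k \<Longrightarrow> R k q" for j k q
    using mono by (induction k) (auto simp: le_Suc_eq)
  have sum: "R k (\<lambda>x. \<Sum>\<alpha>\<in>M. monomial \<alpha> x * c \<alpha>)" if "\<And>\<alpha>. \<alpha> \<in> M \<Longrightarrow> sum \<alpha> UNIV \<le> k" for M and c :: "('n\<Rightarrow>nat) \<Rightarrow> real"
    using that
  proof (induction M rule: infinite_finite_induct)
    case (insert \<alpha> M)
    have "R k (\<lambda>x. c \<alpha> * monomial \<alpha> x + (\<Sum>\<alpha>\<in>M. monomial \<alpha> x * c \<alpha>))"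
      using insert up[OF mono'[OF refl], of \<alpha> k] by (intro add scale) auto
    then show ?case using insert by (simp add: mult.commute)
  qed (auto simp: zero)
  from assms(1) obtain c where "p = (\<lambda>x. \<Sum>\<alpha> | sum \<alpha> UNIV \<le> k. monomial \<alpha> x * c \<alpha>)"
    unfolding polys_def by auto
  then show ?thesis using sum[of "{\<alpha>. sum \<alpha> UNIV \<le> k}" c] by simp
qed

lemma subspace_polys: "subspace X \<Longrightarrow> subspace (polys k X)"
  by (simp add: polys_eq_mpolys subspace_mpolys)

lemma subspace_hpolys: "subspace X \<Longrightarrow> subspace (hpolys k X)"
  by (simp add: hpolys_eq_mpolys subspace_mpolys)

lemma subspace_pointwise:
  assumes "subspace V"
  shows "p \<in> V \<Longrightarrow> q \<in> V \<Longrightarrow> (\<lambda>x. p x + q x) \<in> V"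
    and "p \<in> V \<Longrightarrow> q \<in> V \<Longrightarrow> (\<lambda>x. p x - q x) \<in> V"
    and "p \<in> V \<Longrightarrow> (\<lambda>x. c *\<^sub>R p x) \<in> V"
    and "p \<in> V \<Longrightarrow> (\<lambda>x. - p x) \<in> V"
    and "(\<lambda>x. 0) \<in> V"
    and "(\<And>i. i \<in> I \<Longrightarrow> f i \<in> V) \<Longrightarrow> (\<lambda>x. \<Sum>i\<in>I. f i x) \<in> V"
proof -
  show "p \<in> V \<Longrightarrow> q \<in> V \<Longrightarrow> (\<lambda>x. p x + q x) \<in> V"
    using subspace_add[OF assms, of p q] by (simp add: plus_fun_def)
  show "p \<in> V \<Longrightarrow> q \<in> V \<Longrightarrow> (\<lambda>x. p x - q x) \<in> V"
    using subspace_diff[OF assms, of p q] by (simp add: fun_diff_def)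
  show "p \<in> V \<Longrightarrow> (\<lambda>x. c *\<^sub>R p x) \<in> V"
    using subspace_scale[OF assms, of p c] by (simp add: scaleR_fun_def)
  show "p \<in> V \<Longrightarrow> (\<lambda>x. - p x) \<in> V"
    using subspace_neg[OF assms, of p] by (simp add: fun_Compl_def)
  show "(\<lambda>x. 0) \<in> V"
    using subspace_0[OF assms] by (simp add: zero_fun_def)
  show "(\<lambda>x. \<Sum>i\<in>I. f i x) \<in> V" if "\<And>i. i \<in> I \<Longrightarrow> f i \<in> V"
    using subspace_sum[OF assms, of I f] that by (simp add: sum_fun_apply[abs_def] fun_eq_iff)
qed

lemmas spolys_pointwise = subspace_pointwise[OF subspace_polys[OF subspace_UNIV]]
lemmas shpolys_pointwise = subspace_pointwise[OF subspace_hpolys[OF subspace_UNIV]]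

lemma spolys_scale: "p \<in> spolys k \<Longrightarrow> (\<lambda>x. c * p x) \<in> spolys k"
  using spolys_pointwise(3)[of p k c] by simp

lemma shpolys_scale: "p \<in> shpolys k \<Longrightarrow> (\<lambda>x. c * p x) \<in> shpolys k"
  using shpolys_pointwise(3)[of p k c] by simp

lemma polys_mono: "j \<le> k \<Longrightarrow> 0 \<in> Y \<Longrightarrow> X \<subseteq> Y \<Longrightarrow> polys j X \<subseteq> polys k Y"
  unfolding polys_eq_mpolys by (rule mpolys_mono) auto

lemma hpolys_subset_polys: "0 \<in> X \<Longrightarrow> hpolys k X \<subseteq> polys k X"
  unfolding polys_eq_mpolys hpolys_eq_mpolys by (rule mpolys_mono) auto

lemma spolys_mono: "p \<in> spolys j \<Longrightarrow> j \<le> k \<Longrightarrow> p \<in> spolys k"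
  using polys_mono[of j k UNIV UNIV] by auto

lemma const_polys: "subspace X \<Longrightarrow> a \<in> X \<Longrightarrow> (\<lambda>x. a) \<in> polys k X"
  using monomial_mem_mpolys[of "{\<alpha>. sum \<alpha> UNIV \<le> k}" "\<lambda>_. 0" X a]
  by (simp add: polys_eq_mpolys monomial_def)

lemma const_hpolys: "subspace X \<Longrightarrow> a \<in> X \<Longrightarrow> (\<lambda>x. a) \<in> hpolys 0 X"
  using monomial_mem_mpolys[OF finite_degree_eq[of 0], of "\<lambda>_. 0" X a]
  by (simp add: hpolys_eq_mpolys monomial_def)

lemma polys_0: "p \<in> polys 0 X \<Longrightarrow> \<exists>a\<in>X. p = (\<lambda>x. a)"
proof -
  assume "p \<in> polys 0 X"
  moreover have "{\<alpha>::'a \<Rightarrow> nat. sum \<alpha> UNIV \<le> 0} = {\<lambda>_. 0}" by auto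
  ultimately obtain c where "p = (\<lambda>x. \<Sum>\<alpha>\<in>{\<lambda>_. 0}. monomial \<alpha> x *\<^sub>R c \<alpha>)" "\<forall>\<alpha>. c \<alpha> \<in> X"
    unfolding polys_def by auto
  then show ?thesis by (auto simp: monomial_def)
qed

lemma hpolys_0: "hpolys 0 X = polys 0 X"
  unfolding hpolys_def polys_def by simp

lemma monomial_mult: "monomial \<alpha> x * monomial \<beta> x = monomial (\<lambda>i. \<alpha> i + \<beta> i) x"
  by (simp add: monomial_def power_add prod.distrib)

lemma mpolys_mult:
  assumes "p \<in> mpolys M UNIV" "q \<in> mpolys N UNIV" "finite L"
    "\<And>\<alpha> \<beta>. \<alpha> \<in> M \<Longrightarrow> \<beta> \<in> N \<Longrightarrow> (\<lambda>i. \<alpha> i + \<beta> i) \<in> L"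
  shows "(\<lambda>x. p x * q x) \<in> mpolys L (UNIV::real set)"
proof -
  obtain c e where p: "p = (\<lambda>x. \<Sum>\<alpha>\<in>M. monomial \<alpha> x * c \<alpha>)" 
    and q: "q = (\<lambda>x. \<Sum>\<alpha>\<in>N. monomial \<alpha> x * e \<alpha>)" 
    using assms(1,2) unfolding mpolys_def by auto
  have *: "(\<lambda>x. p x * q x) = (\<lambda>x. \<Sum>\<alpha>\<in>M. \<Sum>\<beta>\<in>N. monomial (\<lambda>i. \<alpha> i + \<beta> i) x *\<^sub>R (c \<alpha> * e \<beta>))"
    unfolding p q sum_product by (simp add: algebra_simps flip: monomial_mult)
  show ?thesis unfolding * using assms(3,4)
    by (intro mpolys_sum monomial_mem_mpolys) auto
qed

lemma spolys_mult: "p \<in> spolys j \<Longrightarrow> q \<in> spolys k \<Longrightarrow> (\<lambda>x. p x * q x) \<in> spolys (j + k)"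
  unfolding polys_eq_mpolys by (erule (1) mpolys_mult) (auto simp: sum.distrib)

lemma shpolys_mult: "p \<in> shpolys j \<Longrightarrow> q \<in> shpolys k \<Longrightarrow> (\<lambda>x. p x * q x) \<in> shpolys (j + k)"
  unfolding hpolys_eq_mpolys by (erule (1) mpolys_mult) (auto simp: sum.distrib)

lemma coord_shpolys: "(\<lambda>x::real^'n::finite. x $ i) \<in> shpolys 1"
proof -
  let ?a = "\<lambda>j::'n. if j = i then 1 else (0::nat)"
  have "monomial ?a x = x $ i" for x :: "real^'n"
  proof -
    have "monomial ?a x = (\<Prod>j\<in>UNIV. if j = i then x $ j else 1)"
      unfolding monomial_def by (intro prod.cong) auto
    then show ?thesis by simp
  qed
  moreover have "(\<lambda>x. monomial ?a x *\<^sub>R 1) \<in> shpolys 1"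
    unfolding hpolys_eq_mpolys by (intro monomial_mem_mpolys) auto
  ultimately show ?thesis by simp
qed

lemma inner_shpolys: "(\<lambda>x::real^'n::finite. v \<bullet> x) \<in> shpolys 1"
proof -
  have "(\<lambda>x. \<Sum>i\<in>UNIV. v $ i * x $ i) \<in> shpolys 1"
    by (intro shpolys_pointwise(6) shpolys_scale coord_shpolys)
  then show ?thesis by (simp add: inner_vec_def)
qed

lemma affine_spolys: "(\<lambda>x::real^'n::finite. a + v \<bullet> x) \<in> spolys 1"
  using inner_shpolys hpolys_subset_polys[of UNIV 1]
  by (intro spolys_pointwise(1) const_polys) auto

lemma vec_mpolysI:
  fixes p :: "real ^ 'n \<Rightarrow> real ^ 'm::finite"
  assumes "\<And>i. (\<lambda>x. p x $ i) \<in> mpolys M UNIV" "finite M"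
  shows "p \<in> mpolys M UNIV"
  by (rule mpolys_componentwise) (auto simp: Basis_vec_def inner_axis assms)

lemma mat_mpolysI:
  fixes p :: "real ^ 'n \<Rightarrow> real ^ 'm::finite ^ 'l::finite"
  assumes "\<And>i j. (\<lambda>x. p x $ i $ j) \<in> mpolys M UNIV" "finite M"
  shows "p \<in> mpolys M UNIV"
  by (rule mpolys_componentwise) (auto simp: Basis_vec_def inner_axis assms)

lemma polys_hpolys_decompose:
  assumes "p \<in> polys (Suc k) X"
  shows "\<exists>q\<in>polys k X. \<exists>r\<in>hpolys (Suc k) X. p = (\<lambda>x. q x + r x)"
proof -
  obtain c where p: "p = (\<lambda>x. \<Sum>\<alpha> | sum \<alpha> UNIV \<le> Suc k. monomial \<alpha> x *\<^sub>R c \<alpha>)" "\<forall>\<alpha>. c \<alpha> \<in> X"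
    using assms unfolding polys_def by blast
  have e: "{\<alpha>::'a \<Rightarrow> nat. sum \<alpha> UNIV \<le> Suc k} = {\<alpha>. sum \<alpha> UNIV \<le> k} \<union> {\<alpha>. sum \<alpha> UNIV = Suc k}" by auto
  have "p = (\<lambda>x. (\<Sum>\<alpha> | sum \<alpha> UNIV \<le> k. monomial \<alpha> x *\<^sub>R c \<alpha>) + (\<Sum>\<alpha> | sum \<alpha> UNIV = Suc k. monomial \<alpha> x *\<^sub>R c \<alpha>))"
    unfolding p(1) e by (intro ext sum.union_disjoint) auto
  moreover have "(\<lambda>x. \<Sum>\<alpha> | sum \<alpha> UNIV \<le> k. monomial \<alpha> x *\<^sub>R c \<alpha>) \<in> polys k X"
    "(\<lambda>x. \<Sum>\<alpha> | sum \<alpha> UNIV = Suc k. monomial \<alpha> x *\<^sub>R c \<alpha>) \<in> hpolys (Suc k) X"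
    using p(2) unfolding polys_def hpolys_def by blast+
  ultimately show ?thesis by (intro bexI)
qed

lemma spolys_compose_affine:
  fixes L :: "real ^ 'm::finite \<Rightarrow> real ^ 'n::finite"
  assumes "p \<in> spolys k" "\<And>i. (\<lambda>x. L x $ i) \<in> spolys 1"
  shows "(\<lambda>x. p (L x)) \<in> spolys k"
  using assms(1)
proof (induction rule: spolys_induct)
  case (coord k p i)
  then show ?case using spolys_mult[OF assms(2)[of i] coord(2)] by simp
qed (auto intro: spolys_pointwise spolys_scale const_polys spolys_mono)

lemma shpolys_compose_linear:
  fixes L :: "real ^ 'm::finite \<Rightarrow> real ^ 'n::finite"
  assumes "p \<in> shpolys k" "\<And>i. (\<lambda>x. L x $ i) \<in> shpolys 1"
  shows "(\<lambda>x. p (L x)) \<in> shpolys k"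
  using assms(1)
proof (induction rule: shpolys_induct)
  case (coord k p i)
  then show ?case using shpolys_mult[OF assms(2)[of i] coord(2)] by simp
qed (auto intro: shpolys_pointwise shpolys_scale const_hpolys)

text \<open>Degrees are tracked by \<open>spolys\<close>, analytic facts are proved for
  \<open>real_polynomial_function\<close>; this is the passage between the two.\<close>

lemma spolys_rpf: "p \<in> spolys k \<Longrightarrow> real_polynomial_function p"
proof (induction rule: spolys_induct)
  case (coord k p i)
  show ?case by (rule real_polynomial_function.intros(4))
     (auto intro: real_polynomial_function.intros(1) bounded_linear_vec_nth coord)
next
  case (scale k p c)
  show ?case by (rule real_polynomial_function.intros(4))
     (auto intro: scale)
qed auto

section \<open>Directional derivatives\<close>

text \<open>The direction comes first, so that \<open>dd t p\<close> is a function again. It may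
  depend on the point, as in the radial derivative \<open>dd (x - v) p x\<close>.\<close>

definition dd :: "'a::real_normed_vector \<Rightarrow> ('a \<Rightarrow> real) \<Rightarrow> 'a \<Rightarrow> real" where
  "dd t p x = frechet_derivative p (at x) t"

lemma rpf_differentiable:
  fixes p :: "'a::euclidean_space \<Rightarrow> real"
  shows "real_polynomial_function p \<Longrightarrow> p differentiable (at x)"
  by (induction rule: real_polynomial_function.induct)
     (auto intro: bounded_linear_imp_differentiable)

lemma dd_works:
  "p differentiable (at x) \<Longrightarrow> (p has_derivative (\<lambda>t. dd t p x)) (at x)"
  by (simp add: dd_def[abs_def] frechet_derivative_works)

lemma dd_eqI: "(p has_derivative p') (at x) \<Longrightarrow> dd t p x = p' t"
  by (simp add: dd_def frechet_derivative_at[symmetric])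

lemma dd_add: "p differentiable (at x) \<Longrightarrow> q differentiable (at x) \<Longrightarrow> dd t (\<lambda>x. p x + q x) x = dd t p x + dd t q x"
  by (rule dd_eqI) (auto intro!: derivative_eq_intros dd_works)

lemma dd_mult: "p differentiable (at x) \<Longrightarrow> q differentiable (at x) \<Longrightarrow> dd t (\<lambda>x. p x * q x) x = p x * dd t q x + dd t p x * q x"
  by (rule dd_eqI) (rule has_derivative_mult[OF dd_works dd_works])

lemma dd_const: "dd t (\<lambda>x. c) x = 0"
  by (rule dd_eqI[where p'="\<lambda>_. 0"]) simp

lemma dd_scale: "p differentiable (at x) \<Longrightarrow> dd t (\<lambda>x. c * p x) x = c * dd t p x"
  by (rule dd_eqI) (auto intro!: derivative_eq_intros dd_works)

lemma dd_diff: "p differentiable (at x) \<Longrightarrow> q differentiable (at x) \<Longrightarrow> dd t (\<lambda>x. p x - q x) x = dd t p x - dd t q x"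
  by (rule dd_eqI) (auto intro!: derivative_eq_intros dd_works)

lemma dd_sum: "(\<And>i. i \<in> I \<Longrightarrow> f i differentiable (at x)) \<Longrightarrow> dd t (\<lambda>x. \<Sum>i\<in>I. f i x) x = (\<Sum>i\<in>I. dd t (f i) x)"
  by (rule dd_eqI) (auto intro!: derivative_eq_intros dd_works)

lemma dd_linear: "p differentiable (at x) \<Longrightarrow> linear (\<lambda>t. dd t p x)"
  using dd_works has_derivative_linear by blast

lemma dd_affine: "dd t (\<lambda>x. a + v \<bullet> x) x = v \<bullet> t"
  by (rule dd_eqI) (auto intro!: derivative_eq_intros)

lemma dd_inner: "dd t (\<lambda>x. v \<bullet> x) x = v \<bullet> t"
  by (rule dd_eqI) (auto intro!: derivative_eq_intros)

lemma dd_coord: "dd t (\<lambda>x. x $ i) x = t $ i"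
  by (rule dd_eqI) (intro bounded_linear_imp_has_derivative bounded_linear_vec_nth)

lemma coord_differentiable [simp]: "(\<lambda>x::real^'n::finite. x $ i) differentiable (at x)"
  by (intro bounded_linear_imp_differentiable bounded_linear_vec_nth)

lemma dd_line:
  fixes p :: "'a::real_normed_vector \<Rightarrow> real"
  assumes "p differentiable (at (x + s *\<^sub>R t))"
  shows "((\<lambda>s. p (x + s *\<^sub>R t)) has_real_derivative dd t p (x + s *\<^sub>R t)) (at s)"
proof -
  have "((\<lambda>s. x + s *\<^sub>R t) has_derivative (\<lambda>h. h *\<^sub>R t)) (at s)"
    by (auto intro!: derivative_eq_intros)
  from has_derivative_compose[OF this dd_works[OF assms]]
  have "((\<lambda>s. p (x + s *\<^sub>R t)) has_derivative (\<lambda>h. dd (h *\<^sub>R t) p (x + s *\<^sub>R t))) (at s)" .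
  moreover have "(\<lambda>h. dd (h *\<^sub>R t) p (x + s *\<^sub>R t)) = (*) (dd t p (x + s *\<^sub>R t))"
    using linear_scale[OF dd_linear[OF assms]] by (auto simp: fun_eq_iff)
  ultimately show ?thesis by (simp add: has_field_derivative_def)
qed

text \<open>The truncated \<open>k - 1\<close> says too little for \<open>k = 0\<close>. That the
  derivative of a constant is zero is carried along because the product rule for
  \<open>x $ i * p x\<close> calls for it.\<close>

lemma dd_spolys:
  assumes "p \<in> spolys k" 
  shows "dd t p \<in> spolys (k - 1) \<and> (k = 0 \<longrightarrow> dd t p = (\<lambda>x. 0)) \<and> (\<forall>x. p differentiable (at x))"
  using assms
proof (induction rule: spolys_induct)
  case (zero k)
  then show ?case by (auto simp: dd_const[abs_def] spolys_pointwise)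
next
  case const
  then show ?case by (auto simp: dd_const[abs_def] spolys_pointwise)
next
  case (add k p q)
  then have "dd t (\<lambda>x. p x + q x) = (\<lambda>x. dd t p x + dd t q x)" by (auto simp: fun_eq_iff dd_add)
  then show ?case using add by (auto intro: spolys_pointwise)
next
  case (scale k p c)
  then have "dd t (\<lambda>x. c * p x) = (\<lambda>x. c * dd t p x)" by (auto simp: fun_eq_iff dd_scale)
  then show ?case using scale by (auto intro: spolys_scale)
next
  case (mono k p)
  then show ?case by (auto intro: spolys_mono spolys_pointwise)
next
  case (coord k p i)
  then have e: "dd t (\<lambda>x. x $ i * p x) = (\<lambda>x. x $ i * dd t p x + t $ i * p x)"
    by (auto simp: fun_eq_iff dd_mult dd_coord)
  have "(\<lambda>x. x $ i * dd t p x) \<in> spolys k"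
  proof (cases k)
    case 0
    then show ?thesis using coord by (auto simp: spolys_pointwise)
  next
    case (Suc j)
    then show ?thesis using spolys_mult[of "\<lambda>x. x $ i" 1 "dd t p" j] affine_spolys[of 0 "axis i 1"] coord
      by (simp add: inner_axis' )
  qed
  moreover have "(\<lambda>x. t $ i * p x) \<in> spolys k" using coord spolys_scale by blast
  ultimately have "dd t (\<lambda>x. x $ i * p x) \<in> spolys k" unfolding e by (rule spolys_pointwise(1))
  then show ?case using coord by (auto intro!: differentiable_mult)
qed

lemmas spolys_differentiable = conjunct2[OF conjunct2[OF dd_spolys], rule_format]

text \<open>Euler's identity, the last conjunct, fits into the same induction: by the product rule
  each coordinate factor adds one to the degree.\<close>

lemma dd_shpolys:
  assumes "p \<in> shpolys k" 
  shows "dd t p \<in> shpolys (k - 1) \<and> (k = 0 \<longrightarrow> dd t p = (\<lambda>x. 0)) \<and> (\<forall>x. p differentiable (at x)) \<and> (\<forall>x. dd x p x = real k * p x)"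
  using assms
proof (induction rule: shpolys_induct)
  case (zero k)
  then show ?case by (auto simp: dd_const[abs_def] dd_const shpolys_pointwise)
next
  case const
  then show ?case by (auto simp: dd_const[abs_def] dd_const shpolys_pointwise)
next
  case (add k p q)
  then have "dd t (\<lambda>x. p x + q x) = (\<lambda>x. dd t p x + dd t q x)" for t by (auto simp: fun_eq_iff dd_add)
  then show ?case using add by (auto intro: shpolys_pointwise simp: algebra_simps)
next
  case (scale k p c)
  then have "dd t (\<lambda>x. c * p x) = (\<lambda>x. c * dd t p x)" for t by (auto simp: fun_eq_iff dd_scale)
  then show ?case using scale by (auto intro: shpolys_scale)
next
  case (coord k p i)
  then have e: "dd t (\<lambda>x. x $ i * p x) = (\<lambda>x. x $ i * dd t p x + t $ i * p x)" for t
    by (auto simp: fun_eq_iff dd_mult dd_coord)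
  have "(\<lambda>x. x $ i * dd t p x) \<in> shpolys k"
  proof (cases k)
    case 0
    then show ?thesis using coord by (auto simp: shpolys_pointwise)
  next
    case (Suc j)
    have "(\<lambda>x. x $ i * dd t p x) \<in> shpolys (1 + j)"
      using coord Suc by (intro shpolys_mult coord_shpolys) auto
    then show ?thesis using Suc by simp
  qed
  moreover have "(\<lambda>x. t $ i * p x) \<in> shpolys k" using coord shpolys_scale by blast
  ultimately have "dd t (\<lambda>x. x $ i * p x) \<in> shpolys k" unfolding e by (rule shpolys_pointwise(1))
  then show ?case using coord e by (auto intro!: differentiable_mult simp: algebra_simps)
qed

lemma euler_shpolys: "p \<in> shpolys k \<Longrightarrow> dd x p x = real k * p x"
  using dd_shpolys by blast

section \<open>Polynomials along rays and lines\<close>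

lemma rpf_inner_right [intro]: "real_polynomial_function (\<lambda>x. v \<bullet> (x :: 'a::euclidean_space))"
  by (intro real_polynomial_function.intros(1) bounded_linear_inner_right)

lemma rpf_continuous: "real_polynomial_function (p::'a::euclidean_space \<Rightarrow> real) \<Longrightarrow> continuous_on S p"
  by (simp add: continuous_at_imp_continuous_on continuous_real_polymonial_function)

lemma dd_bounded_linear: "bounded_linear f \<Longrightarrow> dd t f x = f t"
  by (rule dd_eqI) (rule bounded_linear_imp_has_derivative)

lemma rpf_dd_radial:
  fixes p :: "'a::euclidean_space \<Rightarrow> real"
  assumes "real_polynomial_function p"
  shows "real_polynomial_function (\<lambda>x. dd (x - v) p x)"
  using assms
proof (induction rule: real_polynomial_function.induct)
  case (linear f)
  then have "(\<lambda>x. dd (x - v) f x) = (\<lambda>x. f x - f v)"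
    by (auto simp: dd_bounded_linear linear_diff[OF bounded_linear.linear])
  then show ?case using linear by auto
next
  case (add f g)
  then show ?case by (auto simp: dd_add rpf_differentiable)
next
  case (mult f g)
  then show ?case by (auto simp: dd_mult rpf_differentiable)
qed (auto simp: dd_const)

text \<open>The remainder is jointly continuous in \<open>e\<close> and \<open>x\<close>, hence
  bounded for \<open>x\<close> in a compact set and \<open>e\<close> in a bounded interval; this
  uniformity is what the homothety argument uses.\<close>

lemma rpf_taylor:
  fixes p :: "'a::euclidean_space \<Rightarrow> real"
  assumes "real_polynomial_function p"
  shows "\<exists>Z. continuous_on UNIV (\<lambda>(e, x). Z e x) \<and>
    (\<forall>e x. p (x + e *\<^sub>R (x - v)) = p x + e * dd (x - v) p x + e\<^sup>2 * Z e x)"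
  using assms
proof (induction rule: real_polynomial_function.induct)
  case (linear f)
  then have "f (x + e *\<^sub>R (x - v)) = f x + e * dd (x - v) f x + e\<^sup>2 * 0" for e x
    by (simp add: dd_bounded_linear linear_add linear_scale bounded_linear.linear)
  then show ?case by (intro exI[of _ "\<lambda>_ _. 0"]) (auto simp: case_prod_beta)
next
  case (const c)
  then show ?case by (intro exI[of _ "\<lambda>_ _. 0"]) (auto simp: dd_const case_prod_beta)
next
  case (add f g)
  then obtain Z W where *: "continuous_on UNIV (\<lambda>(e, x). Z e x)" "continuous_on UNIV (\<lambda>(e, x). W e x)"
    "\<And>e x. f (x + e *\<^sub>R (x - v)) = f x + e * dd (x - v) f x + e\<^sup>2 * Z e x"
    "\<And>e x. g (x + e *\<^sub>R (x - v)) = g x + e * dd (x - v) g x + e\<^sup>2 * W e x" by blast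
  then have "continuous_on UNIV (\<lambda>(e, x). Z e x + W e x)"
    by (auto simp: case_prod_beta intro: continuous_on_add)
  then show ?case using add * 
    by (intro exI[of _ "\<lambda>e x. Z e x + W e x"]) (auto simp: dd_add rpf_differentiable algebra_simps)
next
  case (mult f g)
  then obtain Z W where *: "continuous_on UNIV (\<lambda>z. Z (fst z) (snd z))" "continuous_on UNIV (\<lambda>z. W (fst z) (snd z))"
    "\<And>e x. f (x + e *\<^sub>R (x - v)) = f x + e * dd (x - v) f x + e\<^sup>2 * Z e x"
    "\<And>e x. g (x + e *\<^sub>R (x - v)) = g x + e * dd (x - v) g x + e\<^sup>2 * W e x" 
    by (auto simp: case_prod_beta)
  define A B where "A = (\<lambda>x. dd (x - v) f x)" and "B = (\<lambda>x. dd (x - v) g x)"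
  have c: "continuous_on UNIV A" "continuous_on UNIV B" "continuous_on UNIV f" "continuous_on UNIV g"
    unfolding A_def B_def using mult by (auto intro!: rpf_continuous rpf_dd_radial)
  have c': "continuous_on UNIV (\<lambda>z. A (snd z))" "continuous_on UNIV (\<lambda>z. B (snd z))" 
     "continuous_on UNIV (\<lambda>z. f (snd z))" "continuous_on UNIV (\<lambda>z. g (snd z))"
    by (rule continuous_on_compose2[OF c(1)] continuous_on_compose2[OF c(2)]
             continuous_on_compose2[OF c(3)] continuous_on_compose2[OF c(4)];
        auto intro: continuous_intros)+
  \<comment> \<open>What remains of the product of the two expansions after its terms of order 0 and
    1 in \<open>e\<close>, divided by \<open>e\<^sup>2\<close>.\<close>
  let ?Y = "\<lambda>e x. f x * W e x + A x * B x + Z e x * g x + e * (A x * W e x + Z e x * B x) + e\<^sup>2 * (Z e x * W e x)"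
  have "continuous_on UNIV (\<lambda>z. ?Y (fst z) (snd z))"
    by (intro continuous_intros c' *)
  moreover have "f (x + e *\<^sub>R (x - v)) * g (x + e *\<^sub>R (x - v))
      = f x * g x + e * dd (x - v) (\<lambda>x. f x * g x) x + e\<^sup>2 * ?Y e x" for e x
    using mult by (simp add: * dd_mult rpf_differentiable A_def B_def) (simp add: algebra_simps power2_eq_square)
  ultimately show ?case by (intro exI[of _ ?Y]) (auto simp: case_prod_beta)
qed

lemma rpf_line:
  fixes p :: "'a::euclidean_space \<Rightarrow> real"
  assumes "real_polynomial_function p"
  shows "\<exists>a n. \<forall>s. p (x + s *\<^sub>R t) = (\<Sum>i\<le>n. a i * s ^ i)"
proof -
  have "real_polynomial_function (p \<circ> (\<lambda>s::real. x + s *\<^sub>R t))"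
  proof (rule real_polynomial_function_compose[OF _ assms])
    show "polynomial_function (\<lambda>s::real. x + s *\<^sub>R t)"
      by (intro polynomial_function_add polynomial_function_const polynomial_function_bounded_linear bounded_linear_scaleR_left)
  qed
  then obtain a n where "p \<circ> (\<lambda>s::real. x + s *\<^sub>R t) = (\<lambda>s. \<Sum>i\<le>n. a i * s ^ i)"
    using real_polynomial_function_imp_sum by blast
  then show ?thesis by (intro exI[of _ a] exI[of _ n]) (simp add: fun_eq_iff)
qed

text \<open>On a line \<open>p\<close> is a polynomial in the parameter \<open>s\<close>, here with
  infinitely many roots.\<close>

lemma rpf_zero_on_line:
  fixes p :: "'a::euclidean_space \<Rightarrow> real"
  assumes "real_polynomial_function p" "\<And>s. 0 < s \<Longrightarrow> s < d \<Longrightarrow> p (x + s *\<^sub>R t) = 0" "d > 0"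
  shows "p (x + s *\<^sub>R t) = 0"
proof -
  obtain a n where p: "\<And>s. p (x + s *\<^sub>R t) = (\<Sum>i\<le>n. a i * s ^ i)"
    using rpf_line[OF assms(1)] by blast
  have "{0<..<d} \<subseteq> {z. (\<Sum>i\<le>n. a i * z ^ i) = 0}" using assms(2) by (auto simp flip: p)
  moreover have "infinite {0<..<d}" using assms(3) by (rule infinite_Ioo)
  ultimately have "infinite {z. (\<Sum>i\<le>n. a i * z ^ i) = 0}" using finite_subset by blast
  then have "\<forall>k\<le>n. a k = 0" using polyfun_finite_roots[of a n] by blast
  then show ?thesis by (simp add: p)
qed

section \<open>Flat measures\<close>

text \<open>The properties of \<open>m\<close>-dimensional Lebesgue measure on the flat
  \<open>A\<close> on which the proof rests. The last is scaling: the image under the homothety of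
  ratio \<open>s\<close> about a point of \<open>A\<close>, multiplied by \<open>s ^ m\<close>, is
  the measure again. Both Lebesgue measure on the space and the measure behind
  \<open>face_measure\<close> are instances.\<close>

definition flat_measure :: "'a::euclidean_space set \<Rightarrow> nat \<Rightarrow> 'a measure \<Rightarrow> bool" where
  "flat_measure A m \<nu> \<longleftrightarrow> sets \<nu> = sets borel \<and>
     (\<forall>B\<in>sets borel. bounded B \<longrightarrow> emeasure \<nu> B < \<infinity>) \<and>
     (\<forall>x\<in>A. \<forall>e>0. emeasure \<nu> (ball x e \<inter> A) > 0) \<and>
     (\<forall>v\<in>A. \<forall>s>0. \<nu> = density (distr \<nu> borel (\<lambda>x. v + s *\<^sub>R (x - v))) (\<lambda>_. ennreal (s ^ m)))"

lemma flat_measure_lborel: "flat_measure UNIV DIM('a) (lborel :: 'a::euclidean_space measure)"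
  unfolding flat_measure_def
proof (intro conjI ballI allI impI)
  fix B :: "'a set" assume "bounded B"
  then show "emeasure lborel B < \<infinity>" by (rule emeasure_bounded_finite)
next
  fix x :: 'a and e :: real assume "e > 0"
  have "emeasure lborel (ball x e) \<noteq> 0"
  proof
    assume "emeasure lborel (ball x e) = 0"
    then have "ball x e \<in> null_sets lborel" by auto
    then have "negligible (ball x e)"
      by (simp add: negligible_iff_null_sets null_sets_completionI)
    then show False using \<open>e > 0\<close> open_not_negligible[of "ball x e"] by auto
  qed
  then show "emeasure lborel (ball x e \<inter> UNIV) > 0" using zero_less_iff_neq_zero by auto
next
  fix v :: 'a and s :: real assume "s > 0"
  have "(\<lambda>x. v + s *\<^sub>R (x - v)) = (\<lambda>x. (v - s *\<^sub>R v) + s *\<^sub>R x)" by (auto simp: algebra_simps)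
  then show "lborel = density (distr lborel borel (\<lambda>x. v + s *\<^sub>R (x - v))) (\<lambda>_. ennreal (s ^ DIM('a)))"
    using lborel_affine[of s "v - s *\<^sub>R v"] \<open>s > 0\<close> by simp
qed auto

text \<open>Each of the \<open>card U\<close> factors is scaled by \<open>s\<close> about
  \<open>y u\<close>, and measures on a finite product may be compared on boxes. The restriction of
  the function to \<open>U\<close> keeps the image in the space of the product measure.\<close>

lemma PiM_lborel_affine:
  fixes y :: "'i \<Rightarrow> real"
  assumes "finite U" "s > 0"
  shows "Pi\<^sub>M U (\<lambda>_. lborel) =
    density (distr (Pi\<^sub>M U (\<lambda>_. lborel)) (Pi\<^sub>M U (\<lambda>_. lborel)) (\<lambda>z. \<lambda>u\<in>U. y u + s * (z u - y u)))
      (\<lambda>_. ennreal (s ^ card U))" (is "?N = ?P")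
proof -
  interpret product_sigma_finite "\<lambda>_::'i. lborel :: real measure" ..
  let ?h = "\<lambda>z. \<lambda>u\<in>U. y u + s * (z u - y u)"
  have m: "?h \<in> measurable ?N ?N"
    by (intro measurable_restrict) (auto intro!: borel_measurable_add borel_measurable_times borel_measurable_diff)
  have "?P = ?N"
  proof (rule PiM_eqI[OF assms(1)])
    show "sets ?P = sets ?N" by simp
    fix A assume A: "\<And>i. i \<in> U \<Longrightarrow> A i \<in> sets (lborel::real measure)"
    have PA: "Pi\<^sub>E U A \<in> sets ?N" using A assms(1) by (intro sets_PiM_I_finite) auto
    let ?A' = "\<lambda>u. (\<lambda>x. (y u - s * y u) + s * x) -` A u"
    have "emeasure ?P (Pi\<^sub>E U A) = ennreal (s ^ card U) * emeasure (distr ?N ?N ?h) (Pi\<^sub>E U A)"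
      using PA by (subst emeasure_density_const) auto
    also have "emeasure (distr ?N ?N ?h) (Pi\<^sub>E U A) = emeasure ?N (?h -` Pi\<^sub>E U A \<inter> space ?N)"
      using PA m by (intro emeasure_distr) auto
    also have "?h -` Pi\<^sub>E U A \<inter> space ?N = Pi\<^sub>E U ?A'"
      by (auto simp: space_PiM PiE_iff algebra_simps)
    also have "emeasure ?N (Pi\<^sub>E U ?A') = (\<Prod>u\<in>U. emeasure lborel (?A' u))"
    proof (rule emeasure_PiM[OF assms(1)])
      fix u assume "u \<in> U"
      then have "A u \<in> sets borel" using A by auto
      then have "(\<lambda>x. (y u - s * y u) + s * x) -` A u \<inter> space borel \<in> sets borel"
        by (intro measurable_sets[of _ borel borel]) auto
      then show "?A' u \<in> sets lborel" by simp
    qed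
    also have "ennreal (s ^ card U) * \<dots> = (\<Prod>u\<in>U. ennreal s * emeasure lborel (?A' u))"
      using assms(2) by (simp add: prod.distrib ennreal_power)
    also have "\<dots> = (\<Prod>u\<in>U. emeasure lborel (A u))"
    proof (rule prod.cong[OF refl])
      fix u assume "u \<in> U"
      then have Au: "A u \<in> sets borel" using A by auto
      have "emeasure lborel (A u) = emeasure (density (distr lborel borel (\<lambda>x. (y u - s * y u) + s * x)) (\<lambda>_. ennreal \<bar>s\<bar>)) (A u)"
        using lborel_real_affine[of s "y u - s * y u"] assms(2) by simp
      also have "\<dots> = ennreal s * emeasure (distr lborel borel (\<lambda>x. (y u - s * y u) + s * x)) (A u)"
        using assms(2) Au by (subst emeasure_density_const) auto
      also have "emeasure (distr lborel borel (\<lambda>x. (y u - s * y u) + s * x)) (A u) = emeasure lborel (?A' u)"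
        using Au by (subst emeasure_distr) auto
      finally show "ennreal s * emeasure lborel (?A' u) = emeasure lborel (A u)" ..
    qed
    finally show "emeasure ?P (Pi\<^sub>E U A) = (\<Prod>u\<in>U. emeasure lborel (A u))" .
  qed
  then show ?thesis ..
qed

text \<open>The parametrization intertwines the homothety of the flat with the coordinatewise
  homothety about the coordinates \<open>y0\<close> of the centre, so scaling is inherited from the
  product measure.\<close>

lemma flat_measure_distr:
  fixes U :: "'a::euclidean_space set"
  assumes U: "orthonormal_basis_of U T" and fin: "finite U"
  shows "flat_measure {x. x - a \<in> T} (card U)
     (distr (Pi\<^sub>M U (\<lambda>_. lborel)) borel (\<lambda>y. a + (\<Sum>u\<in>U. y u *\<^sub>R u)))"
proof -
  interpret product_sigma_finite "\<lambda>_::'a. lborel :: real measure" ..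
  let ?N = "Pi\<^sub>M U (\<lambda>_. lborel :: real measure)"
  let ?E = "\<lambda>y. a + (\<Sum>u\<in>U. y u *\<^sub>R u)"
  let ?A = "{x. x - a \<in> T}"
  have E: "?E \<in> measurable ?N borel"
    by (intro borel_measurable_add borel_measurable_const borel_measurable_sum borel_measurable_scaleR) auto
  have orth: "u \<bullet> u' = (if u = u' then 1 else 0)" if "u \<in> U" "u' \<in> U" for u u'
    using U that unfolding orthonormal_basis_of_def pairwise_def orthogonal_def
    by (auto simp: norm_eq_1)
  have coord: "(?E y - a) \<bullet> u = y u" if "u \<in> U" for y u
    using that fin orth by (simp add: inner_sum_left if_distrib[of "\<lambda>x. _ * x"] cong: if_cong)
  have surj: "\<exists>y. x = ?E y" if "x \<in> ?A" for x
  proof -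
    have "x - a \<in> span U" using that U by (simp add: orthonormal_basis_of_def)
    then obtain y where "x - a = (\<Sum>u\<in>U. y u *\<^sub>R u)" using span_finite[OF fin] by auto
    then show ?thesis by (intro exI[of _ y]) (simp add: algebra_simps)
  qed
  have EA: "?E y \<in> ?A" for y
  proof -
    have "(\<Sum>u\<in>U. y u *\<^sub>R u) \<in> span U" by (intro span_sum span_scale span_base)
    then show ?thesis using U by (simp add: orthonormal_basis_of_def)
  qed
  show ?thesis
    unfolding flat_measure_def
  proof (intro conjI ballI allI impI)
    fix B :: "'a set" assume B: "B \<in> sets borel" "bounded B"
    then obtain r where r: "\<And>x. x \<in> B \<Longrightarrow> norm x \<le> r" by (auto simp: bounded_iff)
    let ?r = "r + norm a"
    have "emeasure (distr ?N borel ?E) B = emeasure ?N (?E -` B \<inter> space ?N)"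
      using B E by (simp add: emeasure_distr)
    \<comment> \<open>Coordinates are inner products with unit vectors, so the preimage of a bounded
      set lies in a cube.\<close>
    also have "\<dots> \<le> emeasure ?N (Pi\<^sub>E U (\<lambda>_. {-?r..?r}))"
    proof (rule emeasure_mono)
      show "?E -` B \<inter> space ?N \<subseteq> Pi\<^sub>E U (\<lambda>_. {-?r..?r})"
      proof
        fix y assume y: "y \<in> ?E -` B \<inter> space ?N"
        have "\<bar>y u\<bar> \<le> ?r" if "u \<in> U" for u
        proof -
          have "\<bar>y u\<bar> = \<bar>(?E y - a) \<bullet> u\<bar>" using coord[OF that] by simp
          also have "\<dots> \<le> norm (?E y - a) * norm u" by (rule Cauchy_Schwarz_ineq2)
          also have "\<dots> = norm (?E y - a)" using orth[OF that that] by (simp add: norm_eq_sqrt_inner)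
          also have "\<dots> \<le> norm (?E y) + norm a" by (rule norm_triangle_ineq4)
          also have "\<dots> \<le> ?r" using r[of "?E y"] y by auto
          finally show ?thesis .
        qed
        then have "u \<in> U \<Longrightarrow> - ?r \<le> y u \<and> y u \<le> ?r" for u by (fastforce simp: abs_le_iff)
        then show "y \<in> Pi\<^sub>E U (\<lambda>_. {-?r..?r})" using y by (auto simp: space_PiM PiE_iff)
      qed
      show "Pi\<^sub>E U (\<lambda>_. {-?r..?r}) \<in> sets ?N" using fin by (intro sets_PiM_I_finite) auto
    qed
    also have "\<dots> = (\<Prod>u\<in>U. emeasure lborel {-?r..?r})"
      using fin by (intro emeasure_PiM) auto
    also have "\<dots> < \<infinity>"
      using emeasure_bounded_finite[of "{-?r..?r}"] by (simp add: prod_constant power_less_top_ennreal)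
    finally show "emeasure (distr ?N borel ?E) B < \<infinity>" .
  next
    fix x and e :: real assume x: "x \<in> ?A" and "e > 0"
    obtain y0 where y0: "x = ?E y0" using surj[OF x] by blast
    \<comment> \<open>The \<open>+ 1\<close> makes the sum of \<open>card U\<close> errors strictly
      smaller than \<open>e\<close> and keeps \<open>\<delta>\<close> positive for
      \<open>U = {}\<close>, where the flat is a single point.\<close>
    define \<delta> where "\<delta> = e / (card U + 1)"
    have "\<delta> > 0" using \<open>e > 0\<close> by (simp add: \<delta>_def)
    have "closed T"
      using U closed_span unfolding orthonormal_basis_of_def by blast
    then have "closed ((+) a ` T)" by (rule closed_translation)
    moreover have "(+) a ` T = ?A" by (force simp: image_iff)
    ultimately have "?A \<in> sets borel" by (simp add: borel_closed)
    then have S: "ball x e \<inter> ?A \<in> sets borel" by auto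
    let ?D = "Pi\<^sub>E U (\<lambda>u. {y0 u - \<delta><..<y0 u + \<delta>})"
    have "0 < (\<Prod>u\<in>U. emeasure lborel {y0 u - \<delta><..<y0 u + \<delta>})"
      using \<open>\<delta> > 0\<close> fin by (simp add: zero_less_iff_neq_zero)
    also have "\<dots> = emeasure ?N ?D" using fin by (intro emeasure_PiM[symmetric]) auto
    also have "\<dots> \<le> emeasure ?N (?E -` (ball x e \<inter> ?A) \<inter> space ?N)"
    proof (rule emeasure_mono)
      show "?D \<subseteq> ?E -` (ball x e \<inter> ?A) \<inter> space ?N"
      proof
        fix y assume y: "y \<in> ?D"
        have "dist x (?E y) = norm (\<Sum>u\<in>U. (y0 u - y u) *\<^sub>R u)"
          unfolding y0 dist_norm by (simp add: sum_subtractf scaleR_diff_left)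
        also have "\<dots> \<le> (\<Sum>u\<in>U. norm ((y0 u - y u) *\<^sub>R u))" by (rule norm_sum)
        also have "\<dots> \<le> (\<Sum>u\<in>U. \<delta>)"
        proof (rule sum_mono)
          fix u assume u: "u \<in> U"
          have "\<bar>y0 u - y u\<bar> \<le> \<delta>" using y u by (force simp: PiE_iff abs_le_iff)
          then show "norm ((y0 u - y u) *\<^sub>R u) \<le> \<delta>" using orth[OF u u] by (simp add: norm_eq_sqrt_inner)
        qed
        also have "\<dots> < e" using \<open>e > 0\<close> by (simp add: \<delta>_def field_simps)
        finally have "?E y \<in> ball x e" by simp
        then show "y \<in> ?E -` (ball x e \<inter> ?A) \<inter> space ?N"
          using EA[of y] y by (auto simp: space_PiM PiE_iff)
      qed
      show "?E -` (ball x e \<inter> ?A) \<inter> space ?N \<in> sets ?N" using measurable_sets[OF E S] .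
    qed
    also have "\<dots> = emeasure (distr ?N borel ?E) (ball x e \<inter> ?A)"
      using S E by (simp add: emeasure_distr)
    finally show "0 < emeasure (distr ?N borel ?E) (ball x e \<inter> ?A)" .
  next
    fix v and s :: real assume v: "v \<in> ?A" and "s > 0"
    obtain y0 where y0: "v = ?E y0" using surj[OF v] by blast
    let ?h = "\<lambda>z. \<lambda>u\<in>U. y0 u + s * (z u - y0 u)"
    let ?\<eta> = "\<lambda>x. v + s *\<^sub>R (x - v)"
    have h: "?h \<in> measurable ?N ?N"
      by (intro measurable_restrict) (auto intro!: borel_measurable_add borel_measurable_times borel_measurable_diff)
    have eta: "?\<eta> \<in> measurable borel borel" by (auto intro!: borel_measurable_continuous_onI continuous_intros)
    have eq: "?\<eta> (?E y) = ?E (?h y)" for y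
    proof -
      have "?E (?h y) = a + (\<Sum>u\<in>U. (y0 u + s * (y u - y0 u)) *\<^sub>R u)" by simp
      also have "\<dots> = a + ((\<Sum>u\<in>U. y0 u *\<^sub>R u) + s *\<^sub>R ((\<Sum>u\<in>U. y u *\<^sub>R u) - (\<Sum>u\<in>U. y0 u *\<^sub>R u)))"
        by (simp add: algebra_simps sum.distrib sum_subtractf scaleR_sum_right)
      finally show ?thesis unfolding y0 by (simp add: algebra_simps)
    qed
    have "density (distr (distr ?N borel ?E) borel ?\<eta>) (\<lambda>_. ennreal (s ^ card U))
        = density (distr ?N borel (\<lambda>y. ?\<eta> (?E y))) (\<lambda>_. ennreal (s ^ card U))"
      using E eta by (simp add: distr_distr comp_def)
    also have "\<dots> = density (distr (distr ?N ?N ?h) borel ?E) (\<lambda>_. ennreal (s ^ card U))"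
      using E h by (simp add: distr_distr comp_def eq)
    also have "\<dots> = distr (density (distr ?N ?N ?h) (\<lambda>_. ennreal (s ^ card U))) borel ?E"
      using E by (subst density_distr) (auto simp: measurable_distr_eq1)
    also have "\<dots> = distr ?N borel ?E"
      using PiM_lborel_affine[OF fin \<open>s > 0\<close>, of y0] by simp
    finally show "distr ?N borel ?E = density (distr (distr ?N borel ?E) borel ?\<eta>) (\<lambda>_. ennreal (s ^ card U))" ..
  qed simp
qed

lemma flat_measure_integrable:
  fixes F :: "'a::euclidean_space \<Rightarrow> real"
  assumes \<nu>: "flat_measure A m \<nu>" and "compact f" "continuous_on UNIV F" "B \<in> sets borel" "B \<subseteq> f"
  shows "integrable \<nu> (\<lambda>x. indicator B x * F x)"
proof -
  have s: "sets \<nu> = sets borel" using \<nu> by (simp add: flat_measure_def)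
  have F: "F \<in> borel_measurable \<nu>"
    using borel_measurable_continuous_onI[OF assms(3)] measurable_cong_sets[OF s refl] by blast
  have "compact (F ` f)" using assms by (intro compact_continuous_image continuous_on_subset[OF assms(3)]) auto
  then obtain c where c: "\<And>x. x \<in> f \<Longrightarrow> norm (F x) \<le> c" using compact_imp_bounded by (force simp: bounded_iff)
  have "bounded B" using assms compact_imp_bounded bounded_subset by blast
  then have "emeasure \<nu> B < \<infinity>" using \<nu> assms unfolding flat_measure_def by blast
  then have "integrable \<nu> (\<lambda>x. indicator B x *\<^sub>R F x)"
    using c assms s F by (intro integrableI_bounded_set_indicator[where B=c]) auto
  then show ?thesis by simp
qed

lemma flat_measure_scaling:
  fixes F :: "'a::euclidean_space \<Rightarrow> real"
  assumes \<nu>: "flat_measure A m \<nu>" and f: "compact f" and F: "continuous_on UNIV F"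
    and v: "v \<in> A" and s: "s > 0"
  defines "\<eta> \<equiv> \<lambda>x. v + s *\<^sub>R (x - v)"
  shows "(\<integral>x. indicator (\<eta> ` f) x * F x \<partial>\<nu>) = s ^ m * (\<integral>x. indicator f x * F (\<eta> x) \<partial>\<nu>)"
proof -
  have e: "\<nu> = density (distr \<nu> borel \<eta>) (\<lambda>_. ennreal (s ^ m))"
    using \<nu> v s unfolding flat_measure_def \<eta>_def by blast
  have sets: "sets \<nu> = sets borel" using \<nu> by (simp add: flat_measure_def)
  have ceta: "continuous_on S \<eta>" for S unfolding \<eta>_def by (intro continuous_intros)
  have meta: "\<eta> \<in> measurable \<nu> borel"
    using borel_measurable_continuous_onI[OF ceta] measurable_cong_sets[OF sets refl] by blast
  have inj: "\<eta> x \<in> \<eta> ` f \<longleftrightarrow> x \<in> f" for x using s by (auto simp: \<eta>_def)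
  have "compact (\<eta> ` f)" using f ceta by (intro compact_continuous_image)
  then have B: "\<eta> ` f \<in> sets borel" by (simp add: borel_compact)
  have Fm: "F \<in> borel_measurable borel" by (rule borel_measurable_continuous_onI[OF F])
  have G: "(\<lambda>x. indicator (\<eta> ` f) x * F x) \<in> borel_measurable borel"
    using Fm B by (intro borel_measurable_times borel_measurable_indicator)
  have "(\<integral>x. indicator (\<eta> ` f) x * F x \<partial>\<nu>)
      = (\<integral>x. indicator (\<eta> ` f) x * F x \<partial>(density (distr \<nu> borel \<eta>) (\<lambda>_. ennreal (s ^ m))))"
    using e by simp
  also have "\<dots> = (\<integral>x. s ^ m *\<^sub>R (indicator (\<eta> ` f) x * F x) \<partial>(distr \<nu> borel \<eta>))"
    using G s by (subst integral_density) auto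
  also have "\<dots> = (\<integral>x. s ^ m *\<^sub>R (indicator (\<eta> ` f) (\<eta> x) * F (\<eta> x)) \<partial>\<nu>)"
    using G meta by (intro integral_distr) auto
  also have "\<dots> = s ^ m * (\<integral>x. indicator f x * F (\<eta> x) \<partial>\<nu>)"
    by (simp add: inj indicator_def)
  finally show ?thesis .
qed

text \<open>Compare \<open>f\<close> with its image under the homothety of ratio \<open>s < 1\<close> about \<open>v\<close>: the difference has
  measure \<open>O(1 - s)\<close>, and there \<open>P\<close> is \<open>O(1 - s)\<close>, so the derivative at \<open>s = 1\<close> of the integral
  of \<open>P\<close> over the image vanishes.\<close>

lemma flat_measure_homothety:
  fixes P Q :: "'a::euclidean_space \<Rightarrow> real"
  assumes \<nu>: "flat_measure A m \<nu>" and f: "compact f" and v: "v \<in> A"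
    and P: "real_polynomial_function P" and Q: "real_polynomial_function Q"
    and PQ: "\<And>x. x \<in> f \<Longrightarrow> P x = l x * Q x" and l: "\<And>x. x \<in> f \<Longrightarrow> 0 \<le> l x"
    and img: "\<And>s. 0 < s \<Longrightarrow> s < 1 \<Longrightarrow> (\<lambda>x. v + s *\<^sub>R (x - v)) ` f \<subseteq> f"
    and img': "\<And>s x. 0 < s \<Longrightarrow> s < 1 \<Longrightarrow> x \<in> f \<Longrightarrow> x \<notin> (\<lambda>x. v + s *\<^sub>R (x - v)) ` f \<Longrightarrow> l x \<le> 1 - s"
  shows "(\<integral>x. indicator f x * (real m * P x + dd (x - v) P x) \<partial>\<nu>) = 0"
proof -
  let ?I = "\<lambda>F::'a \<Rightarrow> real. \<integral>x. indicator f x * F x \<partial>\<nu>"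
  define A1 where "A1 = (\<lambda>x. dd (x - v) P x)"
  have rpfA: "real_polynomial_function A1" unfolding A1_def by (rule rpf_dd_radial[OF P])
  have cont: "continuous_on S P" "continuous_on S Q" "continuous_on S A1" for S
    using P Q rpfA by (auto intro: rpf_continuous)
  obtain Z where Z: "continuous_on UNIV (\<lambda>(e, x). Z e x)"
    "\<And>e x. P (x + e *\<^sub>R (x - v)) = P x + e * A1 x + e\<^sup>2 * Z e x"
    using rpf_taylor[OF P, of v] unfolding A1_def by blast
  have fb: "f \<in> sets borel" using f by (simp add: borel_compact)
  have sets: "sets \<nu> = sets borel" using \<nu> by (simp add: flat_measure_def)
  have int: "integrable \<nu> (\<lambda>x. indicator B x * F x)" if "continuous_on UNIV F" "B \<in> sets borel" "B \<subseteq> f" for F :: "'a \<Rightarrow> real" and B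
    by (rule flat_measure_integrable[OF \<nu> f that])
  define vol where "vol = ?I (\<lambda>_. 1)"
  have vol0: "vol \<ge> 0" unfolding vol_def by (intro integral_nonneg_AE) auto
  obtain Cq where Cq: "\<And>x. x \<in> f \<Longrightarrow> \<bar>Q x\<bar> \<le> Cq"
  proof -
    have "compact (Q ` f)" using f cont by (intro compact_continuous_image) auto
    then show ?thesis using compact_imp_bounded that by (force simp: bounded_iff)
  qed
  obtain Cz where Cz: "\<And>e x. -1 \<le> e \<Longrightarrow> e \<le> 0 \<Longrightarrow> x \<in> f \<Longrightarrow> \<bar>Z e x\<bar> \<le> Cz"
  proof -
    have "compact ({-1..0::real} \<times> f)" using f by (intro compact_Times) auto
    then have "compact ((\<lambda>(e, x). Z e x) ` ({-1..0} \<times> f))"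
      using Z(1) continuous_on_subset by (intro compact_continuous_image) blast+
    then obtain b where "\<And>y. y \<in> (\<lambda>(e, x). Z e x) ` ({-1..0} \<times> f) \<Longrightarrow> norm y \<le> b"
      using compact_imp_bounded by (metis bounded_iff)
    then show ?thesis by (intro that[of b]) force
  qed
  \<comment> \<open>By \<open>1 - s ^ m = (1 - s) * (\<Sum>k<m. s ^ k)\<close>, the difference of
    the two integrals without the quadratic Taylor remainder is \<open>(1 - s) * \<phi> s\<close>.
    The function \<open>\<phi>\<close> is a polynomial in \<open>s\<close>, and
    \<open>\<phi> 1\<close> is the integral in question.\<close>
  define \<phi> where "\<phi> s = ?I P * (\<Sum>k<m. s ^ k) + s ^ m * ?I A1" for s
  \<comment> \<open>The first summand bounds the contribution of the part missed by the image, the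
    second that of the Taylor remainder; both are of order two in \<open>1 - s\<close>, and one
    factor is cancelled.\<close>
  define D where "D = \<bar>Cq\<bar> * (real m * vol) + \<bar>Cz\<bar> * vol"
  have bound: "\<bar>\<phi> s\<bar> \<le> D * (1 - s)" if s: "0 < s" "s < 1" for s
  proof -
    let ?\<eta> = "\<lambda>x. v + s *\<^sub>R (x - v)"
    let ?B = "?\<eta> ` f"
    \<comment> \<open>The homothety is \<open>x + e *\<^sub>R (x - v)\<close> with
      \<open>-1 < e < 0\<close>, within the range on which the remainder \<open>Z\<close> has been
      bounded.\<close>
    define e where "e = s - 1"
    have eta: "?\<eta> x = x + e *\<^sub>R (x - v)" for x by (simp add: e_def algebra_simps)
    have "compact ?B" using f by (intro compact_continuous_image continuous_intros)
    then have Bb: "?B \<in> sets borel" by (simp add: borel_compact)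
    have Bf: "?B \<subseteq> f" using img s by blast
    have cZ: "continuous_on UNIV (Z e)"
    proof -
      have "continuous_on UNIV ((\<lambda>(e, x). Z e x) \<circ> (\<lambda>x. (e, x)))"
        by (intro continuous_on_compose continuous_intros continuous_on_subset[OF Z(1)]) auto
      then show ?thesis by (simp add: comp_def)
    qed
    have diff: "?I F - (\<integral>x. indicator ?B x * F x \<partial>\<nu>) = (\<integral>x. indicator (f - ?B) x * F x \<partial>\<nu>)"
      if "continuous_on UNIV F" for F
    proof -
      have "?I F - (\<integral>x. indicator ?B x * F x \<partial>\<nu>) = (\<integral>x. indicator f x * F x - indicator ?B x * F x \<partial>\<nu>)"
        using int that fb Bb Bf by (intro Bochner_Integration.integral_diff[symmetric]) auto
      also have "\<dots> = (\<integral>x. indicator (f - ?B) x * F x \<partial>\<nu>)"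
        using Bf by (intro Bochner_Integration.integral_cong) (auto simp: indicator_def)
      finally show ?thesis .
    qed
    have volB: "(\<integral>x. indicator (f - ?B) x * 1 \<partial>\<nu>) \<le> (1 - s) * (real m * vol)"
    proof -
      have "(\<integral>x. indicator (f - ?B) x * 1 \<partial>\<nu>) = vol - s ^ m * vol"
        using diff[of "\<lambda>_. 1"] flat_measure_scaling[OF \<nu> f _ v s(1), of "\<lambda>_. 1"] by (simp add: vol_def)
      also have "\<dots> = (1 - s ^ m) * vol" by (simp add: algebra_simps)
      also have "\<dots> = (1 - s) * ((\<Sum>k<m. s ^ k) * vol)" by (simp add: one_diff_power_eq)
      also have "\<dots> \<le> (1 - s) * (real m * vol)"
      proof (intro mult_left_mono mult_right_mono vol0)
        have "(\<Sum>k<m. s ^ k) \<le> (\<Sum>k<m. 1)" using s by (intro sum_mono power_le_one) auto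
        then show "(\<Sum>k<m. s ^ k) \<le> real m" by simp
      qed (use s in auto)
      finally show ?thesis .
    qed
    have "\<bar>\<integral>x. indicator (f - ?B) x * P x \<partial>\<nu>\<bar> \<le> (\<integral>x. ((1 - s) * \<bar>Cq\<bar>) * (indicator (f - ?B) x * 1) \<partial>\<nu>)"
    proof (rule order_trans[OF integral_abs_bound])
      show "(\<integral>x. \<bar>indicator (f - ?B) x * P x\<bar> \<partial>\<nu>) \<le> (\<integral>x. ((1 - s) * \<bar>Cq\<bar>) * (indicator (f - ?B) x * 1) \<partial>\<nu>)"
      proof (rule integral_mono)
        show "integrable \<nu> (\<lambda>x. \<bar>indicator (f - ?B) x * P x\<bar>)"
          using int[OF cont(1), of "f - ?B"] fb Bb by (intro integrable_abs) auto
        show "integrable \<nu> (\<lambda>x. ((1 - s) * \<bar>Cq\<bar>) * (indicator (f - ?B) x * 1))"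
          using int[of "\<lambda>_. 1" "f - ?B"] fb Bb by (intro integrable_mult_right) auto
        fix x
        have "\<bar>P x\<bar> \<le> (1 - s) * \<bar>Cq\<bar>" if "x \<in> f" "x \<notin> ?B"
        proof -
          have "\<bar>P x\<bar> = l x * \<bar>Q x\<bar>" using PQ[OF that(1)] l[OF that(1)] by (simp add: abs_mult)
          also have "\<dots> \<le> (1 - s) * \<bar>Cq\<bar>"
            using img'[OF s that] l[OF that(1)] Cq[OF that(1)] s by (intro mult_mono) auto
          finally show ?thesis .
        qed
        then show "\<bar>indicator (f - ?B) x * P x\<bar> \<le> ((1 - s) * \<bar>Cq\<bar>) * (indicator (f - ?B) x * 1)"
          by (auto simp: indicator_def)
      qed
    qed
    also have "\<dots> = ((1 - s) * \<bar>Cq\<bar>) * (\<integral>x. indicator (f - ?B) x * 1 \<partial>\<nu>)" by simp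
    also have "\<dots> \<le> ((1 - s) * \<bar>Cq\<bar>) * ((1 - s) * (real m * vol))"
      using volB s by (intro mult_left_mono) auto
    finally have b1: "\<bar>\<integral>x. indicator (f - ?B) x * P x \<partial>\<nu>\<bar> \<le> (1 - s)\<^sup>2 * (\<bar>Cq\<bar> * (real m * vol))"
      by (simp add: power2_eq_square algebra_simps)
    have "\<bar>?I (Z e)\<bar> \<le> (\<integral>x. \<bar>Cz\<bar> * (indicator f x * 1) \<partial>\<nu>)"
    proof (rule order_trans[OF integral_abs_bound integral_mono])
      show "integrable \<nu> (\<lambda>x. \<bar>indicator f x * Z e x\<bar>)" using int[OF cZ fb] by (intro integrable_abs) auto
      show "integrable \<nu> (\<lambda>x. \<bar>Cz\<bar> * (indicator f x * 1))" using int[of "\<lambda>_. 1" f] fb by (intro integrable_mult_right) auto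
      fix x
      show "\<bar>indicator f x * Z e x\<bar> \<le> \<bar>Cz\<bar> * (indicator f x * 1)"
        using Cz[of e x] s by (auto simp: indicator_def e_def)
    qed
    also have "\<dots> = \<bar>Cz\<bar> * vol" by (simp add: vol_def)
    finally have b2: "\<bar>?I (Z e)\<bar> \<le> \<bar>Cz\<bar> * vol" .
    have i3: "integrable \<nu> (\<lambda>x. indicator f x * P x)" "integrable \<nu> (\<lambda>x. indicator f x * A1 x)"
      "integrable \<nu> (\<lambda>x. indicator f x * Z e x)"
      using int cont cZ fb by auto
    have "?I (\<lambda>x. P (?\<eta> x)) = (\<integral>x. indicator f x * P x + (e * (indicator f x * A1 x) + e\<^sup>2 * (indicator f x * Z e x)) \<partial>\<nu>)"
      unfolding eta Z(2) by (simp add: algebra_simps)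
    also have "\<dots> = ?I P + (e * ?I A1 + e\<^sup>2 * ?I (Z e))"
      using i3 by simp
    finally have "?I P - s ^ m * (?I P + (e * ?I A1 + e\<^sup>2 * ?I (Z e))) = (\<integral>x. indicator (f - ?B) x * P x \<partial>\<nu>)"
      using diff[OF cont(1)] flat_measure_scaling[OF \<nu> f cont(1) v s(1)] by simp
    moreover have "?I P - s ^ m * (?I P + (e * ?I A1 + e\<^sup>2 * ?I (Z e)))
        = (1 - s ^ m) * ?I P + (1 - s) * (s ^ m * ?I A1) - (1 - s)\<^sup>2 * (s ^ m * ?I (Z e))"
      unfolding e_def by (simp add: algebra_simps power2_eq_square)
    moreover have "(1 - s ^ m) * ?I P + (1 - s) * (s ^ m * ?I A1) = (1 - s) * \<phi> s"
      unfolding \<phi>_def one_diff_power_eq by (simp add: algebra_simps)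
    ultimately have "(1 - s) * \<phi> s = (\<integral>x. indicator (f - ?B) x * P x \<partial>\<nu>) + (1 - s)\<^sup>2 * (s ^ m * ?I (Z e))"
      by simp
    then have "\<bar>(1 - s) * \<phi> s\<bar> \<le> (1 - s)\<^sup>2 * (\<bar>Cq\<bar> * (real m * vol)) + \<bar>(1 - s)\<^sup>2 * (s ^ m * ?I (Z e))\<bar>"
      using b1 by linarith
    also have "\<bar>(1 - s)\<^sup>2 * (s ^ m * ?I (Z e))\<bar> \<le> (1 - s)\<^sup>2 * (1 * (\<bar>Cz\<bar> * vol))"
      unfolding abs_mult using b2 s by (intro mult_mono) (auto simp: power_le_one)
    finally have "(1 - s) * \<bar>\<phi> s\<bar> \<le> (1 - s) * (D * (1 - s))"
      using s by (simp add: abs_mult D_def power2_eq_square distrib_left distrib_right mult_ac)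
    then show ?thesis using s by simp
  qed
  have "\<phi> 1 = 0"
  proof (rule tendsto_unique[of "at_left (1::real)"])
    have "isCont \<phi> 1" unfolding \<phi>_def by (intro continuous_intros)
    then show "(\<phi> \<longlongrightarrow> \<phi> 1) (at_left 1)" unfolding isCont_def using tendsto_within_subset by blast
    show "(\<phi> \<longlongrightarrow> 0) (at_left 1)"
    proof (rule Lim_null_comparison[where g="\<lambda>s. D * (1 - s)"])
      have "eventually (\<lambda>s::real. 0 < s \<and> s < 1) (at_left 1)"
        using eventually_at_left_real[of 0 1] by (auto elim: eventually_mono)
      then show "\<forall>\<^sub>F s in at_left 1. norm (\<phi> s) \<le> D * (1 - s)"
        by eventually_elim (use bound in auto)
      have "((\<lambda>s. D * (1 - s)) \<longlongrightarrow> D * (1 - 1)) (at_left 1)" by (intro tendsto_intros)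
      then show "((\<lambda>s. D * (1 - s)) \<longlongrightarrow> 0) (at_left 1)" by simp
    qed
  qed auto
  moreover have "(\<integral>x. indicator f x * (real m * P x + dd (x - v) P x) \<partial>\<nu>)
      = (\<integral>x. real m * (indicator f x * P x) + indicator f x * A1 x \<partial>\<nu>)"
    by (simp add: A1_def algebra_simps)
  moreover have "\<dots> = real m * ?I P + ?I A1"
    using int[OF cont(1) fb] int[OF cont(3) fb] by simp
  ultimately show ?thesis by (simp add: \<phi>_def mult.commute)
qed

text \<open>A nonnegative function with integral zero vanishes almost everywhere, whereas continuity
  and \<open>F x > 0\<close> would make it positive on a relatively open part of the flat, which has
  positive measure.\<close>

lemma flat_measure_positive:
  fixes F :: "'a::euclidean_space \<Rightarrow> real"
  assumes \<nu>: "flat_measure A m \<nu>" and f: "compact f" and F: "continuous_on UNIV F"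
    and nonneg: "\<And>x. x \<in> f \<Longrightarrow> 0 \<le> F x"
    and zero: "(\<integral>x. indicator f x * F x \<partial>\<nu>) = 0"
    and x: "x \<in> A" "e > 0" "ball x e \<inter> A \<subseteq> f"
  shows "F x = 0"
proof (rule ccontr)
  assume "F x \<noteq> 0"
  have xf: "x \<in> f" using x by auto
  then have "F x > 0" using nonneg \<open>F x \<noteq> 0\<close> by force
  then obtain d where d: "d > 0" "\<And>y. dist y x < d \<Longrightarrow> dist (F y) (F x) < F x"
    using F unfolding continuous_on_iff by (metis UNIV_I)
  have fb: "f \<in> sets borel" using f by (simp add: borel_compact)
  have sets: "sets \<nu> = sets borel" using \<nu> by (simp add: flat_measure_def)
  have "AE y in \<nu>. indicator f y * F y = 0"
    using integral_nonneg_eq_0_iff_AE[OF flat_measure_integrable[OF \<nu> f F fb]] zero nonneg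
    by (auto simp: indicator_def)
  then obtain N where N: "{y\<in>space \<nu>. \<not> indicator f y * F y = 0} \<subseteq> N" "N \<in> null_sets \<nu>"
    by (auto simp: eventually_ae_filter)
  let ?e = "min d e"
  have "ball x ?e \<inter> A \<subseteq> N"
  proof
    fix y assume y: "y \<in> ball x ?e \<inter> A"
    then have "y \<in> f" using x by auto
    moreover have "F y > 0" using d(2)[of y] y by (auto simp: dist_commute dist_real_def)
    ultimately show "y \<in> N" using N(1) sets_eq_imp_space_eq[OF sets] by auto
  qed
  then have "emeasure \<nu> (ball x ?e \<inter> A) \<le> emeasure \<nu> N" using N by (intro emeasure_mono) auto
  moreover have "emeasure \<nu> (ball x ?e \<inter> A) > 0" using \<nu> x d(1) unfolding flat_measure_def by auto
  ultimately show False using N(2) by auto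
qed

lemma rpf_dd:
  fixes p :: "'a::euclidean_space \<Rightarrow> real"
  assumes "real_polynomial_function p"
  shows "real_polynomial_function (dd t p)"
  using assms
proof (induction rule: real_polynomial_function.induct)
  case (linear f)
  then have "dd t f = (\<lambda>x. f t)" by (auto simp: dd_bounded_linear)
  then show ?case by auto
next
  case (const c)
  have "dd t (\<lambda>x::'a. c) = (\<lambda>x. 0)" by (auto simp: dd_const)
  then show ?case by auto
next
  case (add f g)
  then have "dd t (\<lambda>x. f x + g x) = (\<lambda>x. dd t f x + dd t g x)" by (auto simp: dd_add rpf_differentiable)
  then show ?case using add by auto
next
  case (mult f g)
  then have "dd t (\<lambda>x. f x * g x) = (\<lambda>x. f x * dd t g x + dd t f x * g x)" by (auto simp: dd_mult rpf_differentiable)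
  then show ?case using mult by auto
qed

section \<open>Division of polynomials by affine forms\<close>

text \<open>\<open>\<pi>\<close> projects along \<open>g\<close> onto the zero plane of the form,
  \<open>u\<close> being scaled so that \<open>g \<bullet> u = 1\<close>. Induction on
  \<open>p\<close> shows that \<open>p - p \<circ> \<pi>\<close> is divisible by the form, and
  \<open>p \<circ> \<pi>\<close> is zero by assumption. For \<open>k = 0\<close> the truncated
  degree would admit a constant quotient; the last conjunct excludes it.\<close>

lemma spolys_factor:
  fixes g :: "real ^ 'n::finite"
  assumes "p \<in> spolys k" "g \<noteq> 0" "\<And>x. a + g \<bullet> x = 0 \<Longrightarrow> p x = 0"
  shows "\<exists>q\<in>spolys (k - 1). (\<forall>x. p x = (a + g \<bullet> x) * q x) \<and> (k = 0 \<longrightarrow> q = (\<lambda>x. 0))"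
proof -
  define l where "l x = a + g \<bullet> x" for x
  define u where "u = (1 / (g \<bullet> g)) *\<^sub>R g"
  define \<pi> where "\<pi> x = x - l x *\<^sub>R u" for x
  have l1: "l \<in> spolys 1" unfolding l_def[abs_def] by (rule affine_spolys)
  have pi1: "(\<lambda>x. \<pi> x $ i) \<in> spolys 1" for i
  proof -
    have "(\<lambda>x. x $ i - u $ i * l x) \<in> spolys 1"
      using coord_shpolys[of i] hpolys_subset_polys[of UNIV 1] l1
      by (intro spolys_pointwise(2) spolys_scale) auto
    then show ?thesis by (simp add: \<pi>_def mult.commute)
  qed
  have "\<exists>q\<in>spolys (k - 1). (\<forall>x. p x - p (\<pi> x) = l x * q x) \<and> (k = 0 \<longrightarrow> q = (\<lambda>x. 0))"
    using assms(1)
  proof (induction rule: spolys_induct)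
    case (zero k)
    show ?case by (intro bexI[of _ "\<lambda>x. 0"]) (auto intro: spolys_pointwise)
  next
    case const
    show ?case by (intro bexI[of _ "\<lambda>x. 0"]) (auto intro: spolys_pointwise)
  next
    case (add k p q)
    then obtain r s where "r \<in> spolys (k - 1)" "s \<in> spolys (k - 1)"
      "\<forall>x. p x - p (\<pi> x) = l x * r x" "\<forall>x. q x - q (\<pi> x) = l x * s x" 
      "k = 0 \<longrightarrow> r = (\<lambda>x. 0)" "k = 0 \<longrightarrow> s = (\<lambda>x. 0)" by blast
    then show ?case by (intro bexI[of _ "\<lambda>x. r x + s x"]) (auto intro: spolys_pointwise(1) simp: add_diff_add distrib_left)
  next
    case (scale k p c)
    then obtain r where "r \<in> spolys (k - 1)" "\<forall>x. p x - p (\<pi> x) = l x * r x" "k = 0 \<longrightarrow> r = (\<lambda>x. 0)" by blast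
    then show ?case by (intro bexI[of _ "\<lambda>x. c * r x"]) (auto intro: spolys_scale simp flip: right_diff_distrib)
  next
    case (mono k p)
    then obtain r where r: "r \<in> spolys (k - 1)" "\<forall>x. p x - p (\<pi> x) = l x * r x" by blast
    then show ?case by (intro bexI[of _ r]) (auto intro: spolys_mono)
  next
    case (coord k p i)
    then obtain r where r: "r \<in> spolys (k - 1)" "\<forall>x. p x - p (\<pi> x) = l x * r x" "k = 0 \<longrightarrow> r = (\<lambda>x. 0)" by blast
    have x1: "(\<lambda>x::real^'n. x $ i) \<in> spolys 1" using coord_shpolys[of i] hpolys_subset_polys[of UNIV 1] by auto
    have "(\<lambda>x. x $ i * r x) \<in> spolys k"
    proof (cases k)
      case 0 then show ?thesis using r by (auto intro: spolys_pointwise)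
    next
      case (Suc j)
      then have "(\<lambda>x. x $ i * r x) \<in> spolys (1 + j)" using r x1 by (intro spolys_mult) auto
      then show ?thesis using Suc by simp
    qed
    moreover have "(\<lambda>x. u $ i * p (\<pi> x)) \<in> spolys k"
      by (rule spolys_scale[OF spolys_compose_affine[OF coord(1) pi1]])
    ultimately have "(\<lambda>x. x $ i * r x + u $ i * p (\<pi> x)) \<in> spolys k" by (rule spolys_pointwise(1))
    \<comment> \<open>The increment of the product is split into that of \<open>p\<close> and that
      of the coordinate; the latter is \<open>l x * u $ i\<close>.\<close>
    moreover have "x $ i * p x - \<pi> x $ i * p (\<pi> x) = l x * (x $ i * r x + u $ i * p (\<pi> x))" for x
    proof -
      have "x $ i * p x - \<pi> x $ i * p (\<pi> x) = x $ i * (p x - p (\<pi> x)) + l x * (u $ i * p (\<pi> x))"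
        by (simp add: \<pi>_def algebra_simps)
      then show ?thesis unfolding r(2)[rule_format] by (simp add: distrib_left mult_ac)
    qed
    ultimately show ?case by (intro bexI[of _ "\<lambda>x. x $ i * r x + u $ i * p (\<pi> x)"]) auto
  qed
  moreover have "p (\<pi> x) = 0" for x
    using assms(2) by (intro assms(3)) (simp add: \<pi>_def l_def u_def inner_diff_right)
  ultimately show ?thesis by (simp add: l_def)
qed

text \<open>The forms are divided out one after another. After division by form \<open>i\<close> the
  quotient must still vanish on the zero plane of form \<open>j\<close>, also where both forms are
  zero. There one moves along \<open>u\<close>, which stays on the plane of \<open>j\<close> and
  leaves that of \<open>i\<close>, and extends the vanishing along the line. Asking for
  \<open>u\<close> only at common zeros admits parallel planes, which occur for the two end points
  of an edge.\<close>

lemma spolys_factor_prod: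
  fixes h :: "'i \<Rightarrow> real ^ 'n::finite"
  assumes "finite A" "p \<in> spolys k" "\<And>i. i \<in> A \<Longrightarrow> h i \<noteq> 0"
    and "\<And>i x. i \<in> A \<Longrightarrow> b i + h i \<bullet> x = 0 \<Longrightarrow> p x = 0"
    and "\<And>i j x. i \<in> A \<Longrightarrow> j \<in> A \<Longrightarrow> i \<noteq> j \<Longrightarrow> b i + h i \<bullet> x = 0 \<Longrightarrow> b j + h j \<bullet> x = 0 \<Longrightarrow>
           \<exists>u. h j \<bullet> u = 0 \<and> h i \<bullet> u \<noteq> 0"
  shows "\<exists>q\<in>spolys (k - card A). (\<forall>x. p x = (\<Prod>i\<in>A. b i + h i \<bullet> x) * q x) \<and> (k < card A \<longrightarrow> q = (\<lambda>x. 0))"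
  using assms
proof (induction A arbitrary: p k rule: finite_induct)
  case empty
  then show ?case by auto
next
  case (insert i A)
  obtain q where q: "q \<in> spolys (k - 1)" "\<And>x. p x = (b i + h i \<bullet> x) * q x" "k = 0 \<longrightarrow> q = (\<lambda>x. 0)"
    using spolys_factor[of p k "h i" "b i"] insert.prems by auto
  show ?case
  proof (cases "k = 0")
    case True
    then show ?thesis using q by (intro bexI[of _ "\<lambda>x. 0"]) (auto intro: spolys_pointwise)
  next
    case False
    have "\<exists>r\<in>spolys (k - 1 - card A). (\<forall>x. q x = (\<Prod>i\<in>A. b i + h i \<bullet> x) * r x) \<and> (k - 1 < card A \<longrightarrow> r = (\<lambda>x. 0))"
    proof (rule insert.IH[OF q(1)])
      fix j x assume j: "j \<in> A" "b j + h j \<bullet> x = 0"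
      show "q x = 0"
      proof (cases "b i + h i \<bullet> x = 0")
        case False
        then show ?thesis using insert.prems(3)[of j x] j q(2)[of x] by auto
      next
        case True
        then obtain u where u: "h j \<bullet> u = 0" "h i \<bullet> u \<noteq> 0"
          using insert.prems(4)[of i j x] j insert.hyps by auto
        have "q (x + s *\<^sub>R u) = 0" if "s > 0" for s
        proof -
          have "p (x + s *\<^sub>R u) = 0"
            using insert.prems(3)[of j "x + s *\<^sub>R u"] j u by (simp add: inner_add_right)
          moreover have "b i + h i \<bullet> (x + s *\<^sub>R u) \<noteq> 0"
            using True u that by (simp add: inner_add_right flip: add.assoc)
          ultimately show ?thesis using q(2)[of "x + s *\<^sub>R u"] by simp
        qed
        then have "q (x + 0 *\<^sub>R u) = 0"
          using rpf_zero_on_line[OF spolys_rpf[OF q(1)], of 1 x u 0] by simp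
        then show ?thesis by simp
      qed
    qed (use insert.prems in auto)
    then obtain r where r: "r \<in> spolys (k - 1 - card A)" "\<And>x. q x = (\<Prod>i\<in>A. b i + h i \<bullet> x) * r x"
      "k - 1 < card A \<longrightarrow> r = (\<lambda>x. 0)" by auto
    show ?thesis using r q(2) insert.hyps False
      by (intro bexI[of _ r]) (auto simp: mult.assoc)
  qed
qed

section \<open>Barycentric coordinates\<close>

text \<open>The barycentric coordinates are data: affine functions
  \<open>a c + g c \<bullet> x\<close> on the whole space, characterized by duality to the vertices,
  partition of unity and reproduction of \<open>x\<close>. The gradient \<open>g c\<close> is normal
  to the facet opposite to \<open>c\<close>, so normal components of fields can be taken with
  respect to the \<open>g c\<close> instead of unit normals.\<close>

locale barycentric =
  fixes C :: "(real ^ 'n::finite) set" and a :: "real ^ 'n \<Rightarrow> real" and g :: "real ^ 'n \<Rightarrow> real ^ 'n"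
  assumes finite_C: "finite C" and card_C: "card C = CARD('n) + 1" and dim_ge: "CARD('n) \<ge> 3"
    and lam_vertex': "c \<in> C \<Longrightarrow> c' \<in> C \<Longrightarrow> a c + g c \<bullet> c' = (if c = c' then 1 else 0)"
    and sum_lam': "(\<Sum>c\<in>C. a c + g c \<bullet> x) = 1"
    and sum_lam_vertex': "(\<Sum>c\<in>C. (a c + g c \<bullet> x) *\<^sub>R c) = x"
begin

definition lam :: "real ^ 'n \<Rightarrow> real ^ 'n \<Rightarrow> real" where "lam c x = a c + g c \<bullet> x"

text \<open>The affine hull of \<open>S\<close>, written as the common zero set of the coordinates
  of the remaining vertices.\<close>

definition flat :: "(real ^ 'n) set \<Rightarrow> (real ^ 'n) set" where
  "flat S = {x. \<forall>c\<in>C-S. lam c x = 0}"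

lemma lam_vertex: "c \<in> C \<Longrightarrow> c' \<in> C \<Longrightarrow> lam c c' = (if c = c' then 1 else 0)"
  and sum_lam: "(\<Sum>c\<in>C. lam c x) = 1"
  and sum_lam_vertex: "(\<Sum>c\<in>C. lam c x *\<^sub>R c) = x"
  unfolding lam_def using lam_vertex' sum_lam' sum_lam_vertex' by auto

lemma inner_g_diff: "g c \<bullet> (x - y) = lam c x - lam c y"
  by (simp add: lam_def inner_diff_right)

lemma lam_add: "lam c (x + t) = lam c x + g c \<bullet> t"
  by (simp add: lam_def inner_add_right)

lemma lam_diff: "lam c (x - t) = lam c x - g c \<bullet> t"
  by (simp add: lam_def inner_diff_right)

lemma inner_g_vertex: "c \<in> C \<Longrightarrow> i \<in> C \<Longrightarrow> j \<in> C \<Longrightarrow> 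
    g c \<bullet> (i - j) = (if c = i then 1 else 0) - (if c = j then 1 else 0)"
  by (simp add: inner_g_diff lam_vertex)

lemma sum_g: "(\<Sum>c\<in>C. g c) = 0"
proof -
  have "(\<Sum>c\<in>C. g c) \<bullet> t = 0" for t
  proof -
    have "(\<Sum>c\<in>C. g c) \<bullet> t = (\<Sum>c\<in>C. lam c t) - (\<Sum>c\<in>C. lam c 0)"
      unfolding inner_sum_left by (simp add: lam_def sum.distrib)
    then show ?thesis by (simp add: sum_lam)
  qed
  then show ?thesis by (metis inner_eq_zero_iff)
qed

lemma sum_inner_g: "(\<Sum>c\<in>C. (g c \<bullet> t) *\<^sub>R c) = t"
proof -
  have "(\<Sum>c\<in>C. (g c \<bullet> t) *\<^sub>R c) = (\<Sum>c\<in>C. lam c t *\<^sub>R c) - (\<Sum>c\<in>C. lam c 0 *\<^sub>R c)"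
    by (simp add: lam_def sum_subtractf[symmetric] algebra_simps)
  then show ?thesis by (simp add: sum_lam_vertex)
qed

text \<open>The edge vectors \<open>c - c0\<close> and the gradients \<open>g c\<close>, for
  \<open>c \<noteq> c0\<close>, are dual bases; the term with \<open>c = c0\<close> vanishes. This
  expansion and \<open>sum_vertex_g\<close> convert between vectors and barycentric
  components.\<close>

lemma sum_inner_g_diff: "(\<Sum>c\<in>C. (g c \<bullet> t) *\<^sub>R (c - c0)) = t"
proof -
  have "(\<Sum>c\<in>C. (g c \<bullet> t) *\<^sub>R (c - c0)) = t - (\<Sum>c\<in>C. (g c \<bullet> t)) *\<^sub>R c0"
    by (simp add: scaleR_diff_right sum_subtractf sum_inner_g scaleR_sum_left)
  also have "(\<Sum>c\<in>C. (g c \<bullet> t)) = (\<Sum>c\<in>C. g c) \<bullet> t" by (simp add: inner_sum_left)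
  finally show ?thesis by (simp add: sum_g)
qed

lemma sum_vertex_g: "(\<Sum>c\<in>C. (n \<bullet> (c - c0)) *\<^sub>R g c) = n"
proof -
  have "(\<Sum>c\<in>C. (n \<bullet> (c - c0)) *\<^sub>R g c) \<bullet> t = n \<bullet> t" for t
  proof -
    have "(\<Sum>c\<in>C. (n \<bullet> (c - c0)) *\<^sub>R g c) \<bullet> t = n \<bullet> (\<Sum>c\<in>C. (g c \<bullet> t) *\<^sub>R (c - c0))"
      by (simp add: inner_sum_left inner_sum_right mult.commute)
    then show ?thesis by (simp add: sum_inner_g_diff)
  qed
  then show ?thesis by (metis vector_eq_rdot)
qed

lemma g_nonzero: "c \<in> C \<Longrightarrow> g c \<noteq> 0"
proof
  assume c: "c \<in> C" "g c = 0"
  have "card (C - {c}) > 0" using c card_C finite_C by simp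
  then obtain c' where "c' \<in> C" "c' \<noteq> c" by (metis Diff_iff card_gt_0_iff ex_in_conv insertI1)
  then show False using inner_g_vertex[of c c c'] c by auto
qed

lemma ex_other_vertex:
  assumes "i \<in> C" "j \<in> C"
  obtains l where "l \<in> C" "l \<noteq> i" "l \<noteq> j"
proof -
  have "card (C - {i, j}) > 0"
    using card_C finite_C dim_ge assms card_Diff_subset[of "{i,j}" C] card_insert_le_m1[of 2 "{j}" i] by simp
  then have "C - {i, j} \<noteq> {}" by (metis card.empty less_irrefl)
  then show thesis using that by auto
qed

lemma lam_spolys: "lam c \<in> spolys 1"
  unfolding lam_def[abs_def] by (rule affine_spolys)

lemma lam_rpf [intro]: "real_polynomial_function (lam c)"
  using lam_spolys spolys_rpf by blast

lemma dd_lam: "dd t (lam c) x = g c \<bullet> t"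
  unfolding lam_def[abs_def] by (rule dd_affine)

lemma convex_hull_eq:
  assumes "S \<subseteq> C"
  shows "convex hull S = {x \<in> flat S. \<forall>c\<in>S. lam c x \<ge> 0}"
proof
  have "convex {x \<in> flat S. \<forall>c\<in>S. lam c x \<ge> 0}"
  proof (rule convexI)
    fix x y :: "real^'n" and u v :: real 
    assume *: "x \<in> {x \<in> flat S. \<forall>c\<in>S. lam c x \<ge> 0}" "y \<in> {x \<in> flat S. \<forall>c\<in>S. lam c x \<ge> 0}" "0 \<le> u" "0 \<le> v" "u + v = 1"
    have "lam c (u *\<^sub>R x + v *\<^sub>R y) = (u + v) * a c + u * (g c \<bullet> x) + v * (g c \<bullet> y)" for c
      using * by (simp add: lam_def inner_add_right)
    then have "lam c (u *\<^sub>R x + v *\<^sub>R y) = u * lam c x + v * lam c y" for c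
      by (simp add: lam_def algebra_simps)
    then show "u *\<^sub>R x + v *\<^sub>R y \<in> {x \<in> flat S. \<forall>c\<in>S. lam c x \<ge> 0}"
      using * by (auto simp: flat_def)
  qed
  moreover have "S \<subseteq> {x \<in> flat S. \<forall>c\<in>S. lam c x \<ge> 0}"
    using assms by (auto simp: flat_def lam_vertex subset_eq)
  ultimately show "convex hull S \<subseteq> {x \<in> flat S. \<forall>c\<in>S. lam c x \<ge> 0}" by (intro hull_minimal)
  show "{x \<in> flat S. \<forall>c\<in>S. lam c x \<ge> 0} \<subseteq> convex hull S"
  proof
    fix x assume x: "x \<in> {x \<in> flat S. \<forall>c\<in>S. lam c x \<ge> 0}"
    have "(\<Sum>c\<in>S. lam c x) = (\<Sum>c\<in>C. lam c x)" "(\<Sum>c\<in>S. lam c x *\<^sub>R c) = (\<Sum>c\<in>C. lam c x *\<^sub>R c)"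
      using x assms finite_C by (auto simp: flat_def intro!: sum.mono_neutral_left)
    then show "x \<in> convex hull S"
      using x finite_subset[OF assms finite_C] by (auto simp: convex_hull_finite sum_lam sum_lam_vertex)
  qed
qed

lemma vertex_mem_flat: "c \<in> S \<Longrightarrow> S \<subseteq> C \<Longrightarrow> c \<in> flat S"
  by (auto simp: flat_def lam_vertex subset_eq)

lemma vertex_mem_hull: "c \<in> C \<Longrightarrow> S \<subseteq> C \<Longrightarrow> c \<in> convex hull S \<longleftrightarrow> c \<in> S"
proof
  assume *: "c \<in> C" "S \<subseteq> C" "c \<in> convex hull S"
  then have "c \<in> flat S" by (simp add: convex_hull_eq)
  then show "c \<in> S" using * lam_vertex[of c c] by (force simp: flat_def)
qed (auto intro: hull_inc)

lemma convex_hull_inj: "S \<subseteq> C \<Longrightarrow> T \<subseteq> C \<Longrightarrow> convex hull S = convex hull T \<Longrightarrow> S = T"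
  using vertex_mem_hull by blast

lemma flat_UNIV: "flat C = UNIV" by (simp add: flat_def)

lemma flat_facet: "c \<in> C \<Longrightarrow> flat (C - {c}) = {x. lam c x = 0}"
  by (auto simp: flat_def)

lemma compact_face: "S \<subseteq> C \<Longrightarrow> compact (convex hull S)"
  by (meson finite_C finite_imp_compact compact_convex_hull finite_subset)

lemma tangent_space_face:
  assumes "S \<subseteq> C" "S \<noteq> {}"
  shows "tangent_space (convex hull S) = {t. \<forall>c\<in>C-S. g c \<bullet> t = 0}"
proof
  let ?T = "{t. \<forall>c\<in>C-S. g c \<bullet> t = 0}"
  have "subspace ?T" by (auto simp: subspace_def inner_add_right)
  moreover have "{x - y |x y. x \<in> convex hull S \<and> y \<in> convex hull S} \<subseteq> ?T"
    using assms(1) by (auto simp: convex_hull_eq inner_g_diff flat_def)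
  ultimately show "tangent_space (convex hull S) \<subseteq> ?T"
    unfolding tangent_space_def by (intro span_minimal)
  obtain c0 where c0: "c0 \<in> S" using assms by blast
  show "?T \<subseteq> tangent_space (convex hull S)"
  proof
    fix t assume t: "t \<in> ?T"
    have "t = (\<Sum>c\<in>C. (g c \<bullet> t) *\<^sub>R (c - c0))" by (simp add: sum_inner_g_diff)
    also have "\<dots> = (\<Sum>c\<in>S. (g c \<bullet> t) *\<^sub>R (c - c0))"
      using t assms finite_C by (intro sum.mono_neutral_right) auto
    also have "\<dots> \<in> tangent_space (convex hull S)"
      unfolding tangent_space_def using c0 by (intro span_sum span_scale span_base) (auto intro: hull_inc)
    finally show "t \<in> tangent_space (convex hull S)" .
  qed
qed

lemma flat_eq_translate:
  assumes "x0 \<in> flat S" 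
  shows "flat S = {x. x - x0 \<in> {t. \<forall>c\<in>C-S. g c \<bullet> t = 0}}"
  using assms by (auto simp: flat_def inner_g_diff)

section \<open>Integration over faces\<close>

text \<open>One notation for both kinds of integral, so that interior and face moments obey the same
  lemmas.\<close>

definition meas :: "(real ^ 'n) set \<Rightarrow> (real ^ 'n) measure" where
  "meas S = (if S = C then lebesgue_on (convex hull C) else face_measure (convex hull S))"

abbreviation J :: "(real ^ 'n) set \<Rightarrow> (real ^ 'n \<Rightarrow> real) \<Rightarrow> real" where
  "J S u \<equiv> integral\<^sup>L (meas S) u"

text \<open>For \<open>S = C\<close> the flat measure is Lebesgue measure, the completion being
  removed since the integrand is Borel; otherwise it is the image of the product measure under the
  parametrization selected in \<open>face_measure\<close>.\<close>

lemma meas_flat: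
  assumes "S \<subseteq> C" "S \<noteq> {}"
  obtains \<nu> m where "flat_measure (flat S) m \<nu>"
    "\<And>u::real^'n \<Rightarrow> real. u \<in> borel_measurable borel \<Longrightarrow> J S u = (\<integral>x. indicator (convex hull S) x * u x \<partial>\<nu>)"
    "\<And>u::real^'n \<Rightarrow> real. u \<in> borel_measurable borel \<Longrightarrow>
       integrable (meas S) u \<longleftrightarrow> integrable \<nu> (\<lambda>x. indicator (convex hull S) x * u x)"
proof (cases "S = C")
  case True
  have b: "convex hull C \<in> sets borel" using compact_face[of C] borel_compact by blast
  have m: "(\<lambda>x. indicator (convex hull C) x * u x) \<in> borel_measurable lborel" 
    if "u \<in> borel_measurable borel" for u :: "real^'n \<Rightarrow> real"
    using b that by (simp add: borel_measurable_times)
  have b': "convex hull C \<inter> space lebesgue \<in> sets lebesgue" using b by (simp add: sets_completionI_sets)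
  show thesis
  proof (rule that[of "CARD('n)" lborel])
    show "flat_measure (flat S) CARD('n) lborel" using flat_measure_lborel[where 'a="real^'n"] True flat_UNIV by simp
    fix u :: "real^'n \<Rightarrow> real" assume u: "u \<in> borel_measurable borel"
    show "J S u = (\<integral>x. indicator (convex hull S) x * u x \<partial>lborel)"
      using integral_restrict_space[OF b', of u] integral_completion[OF m[OF u]] True by (simp add: meas_def)
    show "integrable (meas S) u \<longleftrightarrow> integrable lborel (\<lambda>x. indicator (convex hull S) x * u x)"
      using integrable_restrict_space[OF b', of u] integrable_completion[OF m[OF u]] True by (simp add: meas_def)
  qed
next
  case False
  let ?f = "convex hull S"
  have b: "?f \<in> sets borel" using compact_face[OF assms(1)] borel_compact by blast
  define U where "U = (SOME U. orthonormal_basis_of U (tangent_space ?f))"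
  define a0 where "a0 = (SOME a. a \<in> ?f)"
  have "subspace (tangent_space ?f)" by (simp add: tangent_space_def)
  then have "\<exists>U. orthonormal_basis_of U (tangent_space ?f)"
    unfolding orthonormal_basis_of_def by (metis orthonormal_basis_subspace)
  then have U: "orthonormal_basis_of U (tangent_space ?f)" unfolding U_def by (rule someI_ex)
  have "\<exists>x. x \<in> ?f" using assms by auto
  then have "a0 \<in> ?f" unfolding a0_def by (rule someI_ex)
  then have a0: "a0 \<in> flat S" using assms by (simp add: convex_hull_eq)
  have fin: "finite U"
    using U by (auto simp: orthonormal_basis_of_def intro!: pairwise_orthogonal_imp_finite)
  let ?\<nu> = "distr (Pi\<^sub>M U (\<lambda>_. lborel)) borel (\<lambda>y. a0 + (\<Sum>u\<in>U. y u *\<^sub>R u))"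
  have me: "meas S = restrict_space ?\<nu> ?f"
    using False by (simp add: meas_def face_measure_def U_def a0_def Let_def)
  have b': "?f \<inter> space ?\<nu> \<in> sets ?\<nu>" using b by simp
  show thesis
  proof (rule that[of "card U" ?\<nu>])
    show "flat_measure (flat S) (card U) ?\<nu>"
      using flat_measure_distr[OF U fin, of a0] flat_eq_translate[OF a0] tangent_space_face[OF assms] by simp
    fix u :: "real^'n \<Rightarrow> real" assume u: "u \<in> borel_measurable borel"
    show "J S u = (\<integral>x. indicator ?f x * u x \<partial>?\<nu>)"
      using integral_restrict_space[OF b', of u] me by simp
    show "integrable (meas S) u \<longleftrightarrow> integrable ?\<nu> (\<lambda>x. indicator ?f x * u x)"
      using integrable_restrict_space[OF b', of u] me by simp
  qed
qed

lemma rpf_borel: "real_polynomial_function (p::real^'n \<Rightarrow> real) \<Longrightarrow> p \<in> borel_measurable borel"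
  by (intro borel_measurable_continuous_onI rpf_continuous)

lemma J_integrable: 
  assumes "S \<subseteq> C" "S \<noteq> {}" "real_polynomial_function u"
  shows "integrable (meas S) u"
proof -
  obtain \<nu> m where "flat_measure (flat S) m \<nu>"
    "\<And>u::real^'n \<Rightarrow> real. u \<in> borel_measurable borel \<Longrightarrow>
       integrable (meas S) u \<longleftrightarrow> integrable \<nu> (\<lambda>x. indicator (convex hull S) x * u x)"
    using meas_flat[OF assms(1,2)] by metis
  then show ?thesis
    using flat_measure_integrable[OF _ compact_face[OF assms(1)] rpf_continuous[OF assms(3)] borel_closed] rpf_borel[OF assms(3)]
      compact_imp_closed[OF compact_face[OF assms(1)]] by blast
qed

lemma space_meas: "S \<subseteq> C \<Longrightarrow> space (meas S) = convex hull S"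
  by (auto simp: meas_def face_measure_def Let_def space_restrict_space)

text \<open>Equality is asked on the flat rather than on the face, since this is where identities
  obtained by division hold.\<close>

lemma J_cong: 
  assumes "S \<subseteq> C" "\<And>x. x \<in> flat S \<Longrightarrow> u x = v x"
  shows "J S u = J S v"
  using assms by (intro Bochner_Integration.integral_cong) (auto simp: space_meas convex_hull_eq)

lemma J_cong': 
  assumes "S \<subseteq> C" "\<And>x. x \<in> convex hull S \<Longrightarrow> u x = v x"
  shows "J S u = J S v"
  using assms by (intro Bochner_Integration.integral_cong) (auto simp: space_meas)

lemma J_zero: 
  assumes "S \<subseteq> C" "\<And>x. x \<in> flat S \<Longrightarrow> u x = 0"
  shows "J S u = 0"
  using J_cong[OF assms, of "\<lambda>x. x"] by simp

lemma J_add: 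
  assumes "S \<subseteq> C" "S \<noteq> {}" "real_polynomial_function u" "real_polynomial_function v"
  shows "J S (\<lambda>x. u x + v x) = J S u + J S v"
  using assms by (intro Bochner_Integration.integral_add J_integrable)

lemma J_diff: 
  assumes "S \<subseteq> C" "S \<noteq> {}" "real_polynomial_function u" "real_polynomial_function v"
  shows "J S (\<lambda>x. u x - v x) = J S u - J S v"
  using assms by (intro Bochner_Integration.integral_diff J_integrable)

lemma J_sum: 
  assumes "S \<subseteq> C" "S \<noteq> {}" "\<And>i. i \<in> I \<Longrightarrow> real_polynomial_function (u i)"
  shows "J S (\<lambda>x. \<Sum>i\<in>I. u i x) = (\<Sum>i\<in>I. J S (u i))"
  using assms by (intro Bochner_Integration.integral_sum J_integrable)

text \<open>Points with all coordinates in \<open>S\<close> positive form the relative interior: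
  near such a point the flat is contained in the face.\<close>

lemma J_positive_point:
  assumes S: "S \<subseteq> C" "S \<noteq> {}" and u: "real_polynomial_function u"
    and nonneg: "\<And>x. x \<in> convex hull S \<Longrightarrow> 0 \<le> u x" and zero: "J S u = 0"
    and x: "x \<in> flat S" "\<And>c. c \<in> S \<Longrightarrow> lam c x > 0"
  shows "u x = 0"
proof -
  obtain \<nu> m where \<nu>: "flat_measure (flat S) m \<nu>"
    "\<And>u::real^'n \<Rightarrow> real. u \<in> borel_measurable borel \<Longrightarrow> J S u = (\<integral>x. indicator (convex hull S) x * u x \<partial>\<nu>)"
    using meas_flat[OF S] by metis
  have finS: "finite S" using S finite_C finite_subset by blast
  have "open (\<Inter>c\<in>S. {y. lam c y > 0})"
    using finS unfolding lam_def by (intro open_INT ballI open_Collect_less continuous_intros) auto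
  moreover have "x \<in> (\<Inter>c\<in>S. {y. lam c y > 0})" using x by auto
  ultimately obtain e where e: "e > 0" "ball x e \<subseteq> (\<Inter>c\<in>S. {y. lam c y > 0})"
    using open_contains_ball by blast
  have "ball x e \<inter> flat S \<subseteq> convex hull S"
    using e(2) by (auto simp: convex_hull_eq[OF S(1)] intro: less_imp_le)
  then show ?thesis
    using flat_measure_positive[OF \<nu>(1) compact_face[OF S(1)] rpf_continuous[OF u] nonneg _ x(1) e(1)]
      zero \<nu>(2)[OF rpf_borel[OF u]] by auto
qed

text \<open>Every point of the flat is reached from the barycentre \<open>x0\<close> of
  \<open>S\<close> by a line which starts inside the relative interior, where \<open>u\<close> is
  zero.\<close>

lemma rpf_zero_flat:
  assumes S: "S \<subseteq> C" "S \<noteq> {}" and u: "real_polynomial_function u"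
    and zero: "\<And>x. x \<in> flat S \<Longrightarrow> (\<And>c. c \<in> S \<Longrightarrow> lam c x > 0) \<Longrightarrow> u x = 0"
    and x: "x \<in> flat S"
  shows "u x = 0"
proof -
  have finS: "finite S" using S finite_C finite_subset by blast
  then have cS: "card S > 0" using S by (simp add: card_gt_0_iff)
  define x0 where "x0 = (1 / card S) *\<^sub>R (\<Sum>c\<in>S. c)"
  have lx0: "lam c x0 = (if c \<in> S then 1 / card S else 0)" if "c \<in> C" for c
  proof -
    have "lam c x0 = (1 / card S) * (\<Sum>c'\<in>S. lam c c')"
      using cS by (simp add: x0_def lam_def inner_sum_right sum.distrib field_simps)
    also have "(\<Sum>c'\<in>S. lam c c') = (\<Sum>c'\<in>S. if c = c' then 1 else 0)"
      using S that by (intro sum.cong) (auto simp: lam_vertex subset_eq)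
    also have "\<dots> = (if c \<in> S then 1 else 0)" using finS by simp
    finally show ?thesis by simp
  qed
  have "\<exists>d>0. \<forall>s. 0 < s \<and> s < d \<longrightarrow> (\<forall>c\<in>S. lam c (x0 + s *\<^sub>R (x - x0)) > 0)"
  proof -
    have "\<forall>\<^sub>F s in at_right 0. \<forall>c\<in>S. lam c (x0 + s *\<^sub>R (x - x0)) > 0"
    proof (rule eventually_ball_finite[OF finS], rule ballI)
      fix c assume c: "c \<in> S"
      have "((\<lambda>s. lam c (x0 + s *\<^sub>R (x - x0))) \<longlongrightarrow> lam c (x0 + 0 *\<^sub>R (x - x0))) (at_right 0)"
        unfolding lam_def by (intro tendsto_intros)
      moreover have "lam c (x0 + 0 *\<^sub>R (x - x0)) > 0" using lx0[of c] c S cS by auto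
      ultimately show "\<forall>\<^sub>F s in at_right 0. lam c (x0 + s *\<^sub>R (x - x0)) > 0"
        by (rule order_tendstoD(1))
    qed
    then show ?thesis unfolding eventually_at_right_field by auto
  qed
  then obtain d where d: "d > 0" "\<And>s c. 0 < s \<Longrightarrow> s < d \<Longrightarrow> c \<in> S \<Longrightarrow> lam c (x0 + s *\<^sub>R (x - x0)) > 0" by blast
  have "u (x0 + s *\<^sub>R (x - x0)) = 0" if "0 < s" "s < d" for s
  proof (rule zero)
    show "x0 + s *\<^sub>R (x - x0) \<in> flat S"
      using x lx0 by (auto simp: flat_def lam_add inner_g_diff)
  qed (use d that in auto)
  then have "u (x0 + 1 *\<^sub>R (x - x0)) = 0" using rpf_zero_on_line[OF u _ d(1)] by blast
  then show ?thesis by simp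
qed

text \<open>The form in which positivity is used. The weight \<open>w\<close> is typically a product
  of barycentric coordinates; the conclusion reaches the whole flat, as polynomial identities
  require.\<close>

lemma J_positive:
  assumes S: "S \<subseteq> C" "S \<noteq> {}" and w: "real_polynomial_function w" and q: "real_polynomial_function q"
    and nonneg: "\<And>x. x \<in> convex hull S \<Longrightarrow> 0 \<le> w x" 
    and pos: "\<And>x. x \<in> flat S \<Longrightarrow> (\<And>c. c \<in> S \<Longrightarrow> lam c x > 0) \<Longrightarrow> w x \<noteq> 0"
    and zero: "J S (\<lambda>x. w x * (q x)\<^sup>2) = 0"
    and x: "x \<in> flat S"
  shows "q x = 0"
proof (rule rpf_zero_flat[OF S q _ x])
  fix x assume x: "x \<in> flat S" "\<And>c. c \<in> S \<Longrightarrow> lam c x > 0"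
  have "real_polynomial_function (\<lambda>x. w x * (q x)\<^sup>2)" using w q by auto
  then have "w x * (q x)\<^sup>2 = 0"
    by (rule J_positive_point[OF S _ _ zero x]) (use nonneg in auto)
  then show "q x = 0" using pos[OF x] by auto
qed

text \<open>The part of the face missed by its homothetic image about \<open>v\<close> lies in the
  layer \<open>lam v x \<le> 1 - s\<close>, so the factor \<open>lam v\<close> supplies the
  smallness asked for by the homothety argument. The number \<open>m\<close> depends neither on
  \<open>v\<close> nor on \<open>P\<close>, which allows summation over the vertices.\<close>

lemma J_homothety:
  assumes S: "S \<subseteq> C" "S \<noteq> {}"
  obtains m :: nat where "\<And>v P Q. v \<in> S \<Longrightarrow> real_polynomial_function P \<Longrightarrow> real_polynomial_function Q \<Longrightarrow>
    (\<And>x. x \<in> convex hull S \<Longrightarrow> P x = lam v x * Q x) \<Longrightarrow> J S (\<lambda>x. real m * P x + dd (x - v) P x) = 0"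
proof -
  obtain \<nu> m where \<nu>: "flat_measure (flat S) m \<nu>"
    "\<And>u::real^'n \<Rightarrow> real. u \<in> borel_measurable borel \<Longrightarrow> J S u = (\<integral>x. indicator (convex hull S) x * u x \<partial>\<nu>)"
    using meas_flat[OF S] by metis
  have "J S (\<lambda>x. real m * P x + dd (x - v) P x) = 0" 
    if v: "v \<in> S" and P: "real_polynomial_function P" and Q: "real_polynomial_function Q"
      and PQ: "\<And>x. x \<in> convex hull S \<Longrightarrow> P x = lam v x * Q x" for v P Q
  proof -
    have "real_polynomial_function (\<lambda>x. real m * P x + dd (x - v) P x)"
      by (intro real_polynomial_function.intros(3)[OF real_polynomial_function.intros(4)] rpf_dd_radial P
          real_polynomial_function.intros(2))
    then have "J S (\<lambda>x. real m * P x + dd (x - v) P x)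
       = (\<integral>x. indicator (convex hull S) x * (real m * P x + dd (x - v) P x) \<partial>\<nu>)"
      by (intro \<nu>(2) rpf_borel)
    also have "\<dots> = 0"
    proof (rule flat_measure_homothety[OF \<nu>(1) compact_face[OF S(1)] _ P Q PQ])
      show "v \<in> flat S" using v S(1) by (rule vertex_mem_flat)
      show "x \<in> convex hull S \<Longrightarrow> 0 \<le> lam v x" for x using v S by (simp add: convex_hull_eq)
      have lam_eta: "lam c (v + s *\<^sub>R (x - v)) = (1 - s) * lam c v + s * lam c x" for c s x
        by (simp add: lam_def inner_add_right inner_diff_right algebra_simps)
      show "(\<lambda>x. v + s *\<^sub>R (x - v)) ` (convex hull S) \<subseteq> convex hull S" if "0 < s" "s < 1" for s
        using that v S by (auto simp: convex_hull_eq flat_def lam_eta lam_vertex subset_eq)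
      show "lam v x \<le> 1 - s" if s: "0 < s" "s < 1" and x: "x \<in> convex hull S" "x \<notin> (\<lambda>x. v + s *\<^sub>R (x - v)) ` (convex hull S)" for s x
      proof (rule ccontr)
        assume n: "\<not> lam v x \<le> 1 - s"
        \<comment> \<open>The preimage of \<open>x\<close> under the homothety; it belongs to the
          face as soon as \<open>lam v x\<close> exceeds \<open>1 - s\<close>.\<close>
        let ?y = "v + (1 / s) *\<^sub>R (x - v)"
        have "x = v + s *\<^sub>R (?y - v)" using s by simp
        moreover have "?y \<in> convex hull S"
        proof -
          have "lam c ?y = lam c x / s" if "c \<in> C" "c \<noteq> v" for c
            using that v S by (simp add: lam_eta lam_vertex subset_eq)
          moreover have "lam v ?y = (lam v x - (1 - s)) / s"
            unfolding lam_eta using v S s lam_vertex[of v v] by (auto simp: field_simps)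
          ultimately have "lam c ?y \<ge> 0" if "c \<in> S" for c
            using that n s S x(1) by (cases "c = v") (auto simp: convex_hull_eq subset_eq)
          moreover have "lam c ?y = 0" if "c \<in> C - S" for c
            using that v S x(1) \<open>\<And>c. c \<in> C \<Longrightarrow> c \<noteq> v \<Longrightarrow> lam c ?y = lam c x / s\<close>[of c]
            by (auto simp: convex_hull_eq flat_def)
          ultimately show ?thesis using S by (simp add: convex_hull_eq flat_def)
        qed
        ultimately show False using x(2) by blast
      qed
    qed
    finally show ?thesis .
  qed
  then show thesis by (rule that)
qed

text \<open>A tangential derivative is taken along a line inside the flat, so it sees only the
  values there.\<close>

lemma dd_zero_flat:
  assumes "p differentiable (at x)" "\<And>y. y \<in> flat S \<Longrightarrow> p y = 0" "x \<in> flat S"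
    "\<And>c. c \<in> C - S \<Longrightarrow> g c \<bullet> t = 0"
  shows "dd t p x = 0"
proof -
  have "((\<lambda>s. p (x + s *\<^sub>R t)) has_real_derivative dd t p (x + 0 *\<^sub>R t)) (at 0)"
    using assms(1) by (intro dd_line) simp
  moreover have "(\<lambda>s. p (x + s *\<^sub>R t)) = (\<lambda>s. 0)"
    using assms by (auto simp: fun_eq_iff flat_def lam_add)
  ultimately have "((\<lambda>s::real. 0::real) has_real_derivative dd t p x) (at 0)" by simp
  then show ?thesis using DERIV_unique[OF _ DERIV_const] by blast
qed

text \<open>The divergence theorem on a face for fields with vanishing normal trace, the field being
  \<open>\<Sum>j\<in>S. \<beta> j *\<^sub>R j\<close>.  It is the sum over \<open>j\<close> of the homothety identities about the vertices \<open>j\<close>: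
  if \<open>\<Sum>j\<in>S. \<beta> j = 0\<close> then \<open>\<Sum>j\<in>S. \<beta> j *\<^sub>R (x - j)\<close> is minus the field.\<close>

lemma divergence_face:
  assumes S: "S \<subseteq> C" and c0: "c0 \<in> S"
    and \<beta>: "\<And>j. j \<in> S \<Longrightarrow> real_polynomial_function (\<beta> j)"
    and q: "\<And>j. j \<in> S \<Longrightarrow> real_polynomial_function (q j)" 
    and \<beta>q: "\<And>j x. j \<in> S \<Longrightarrow> x \<in> flat S \<Longrightarrow> \<beta> j x = lam j x * q j x"
    and sum0: "\<And>x. x \<in> flat S \<Longrightarrow> (\<Sum>j\<in>S. \<beta> j x) = 0"
    and u: "real_polynomial_function u"
  shows "J S (\<lambda>x. \<Sum>j\<in>S. dd (j - c0) (\<lambda>x. \<beta> j x * u x) x) = 0"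
proof -
  have ne: "S \<noteq> {}" using c0 by blast
  obtain m where m: "\<And>v P Q. v \<in> S \<Longrightarrow> real_polynomial_function P \<Longrightarrow> real_polynomial_function Q \<Longrightarrow>
    (\<And>x. x \<in> convex hull S \<Longrightarrow> P x = lam v x * Q x) \<Longrightarrow> J S (\<lambda>x. real m * P x + dd (x - v) P x) = 0"
    by (rule J_homothety[OF S ne]) blast
  let ?P = "\<lambda>j x. \<beta> j x * u x"
  have rP: "real_polynomial_function (?P j)" if "j \<in> S" for j using \<beta>[OF that] u by auto
  have z: "J S (\<lambda>x. real m * ?P j x + dd (x - j) (?P j) x) = 0" if "j \<in> S" for j
  proof (rule m[OF that rP[OF that]])
    show "real_polynomial_function (\<lambda>x. q j x * u x)" using q[OF that] u by auto
    show "?P j x = lam j x * (q j x * u x)" if "x \<in> convex hull S" for x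
      using \<beta>q[OF \<open>j \<in> S\<close>, of x] that S by (simp add: convex_hull_eq)
  qed
  have rr: "real_polynomial_function (\<lambda>x. real m * ?P j x + dd (x - j) (?P j) x)" if "j \<in> S" for j
    by (intro real_polynomial_function.intros(3)[OF real_polynomial_function.intros(4)[OF real_polynomial_function.intros(2)]] 
         rpf_dd_radial rP that)
  have rd: "real_polynomial_function (dd (j - c0) (?P j))" if "j \<in> S" for j
    by (rule rpf_dd[OF rP[OF that]])
  have "0 = (\<Sum>j\<in>S. J S (\<lambda>x. real m * ?P j x + dd (x - j) (?P j) x))" using z by simp
  also have "\<dots> = J S (\<lambda>x. \<Sum>j\<in>S. real m * ?P j x + dd (x - j) (?P j) x)"
    by (rule J_sum[OF S ne rr, symmetric])
  also have "\<dots> = J S (\<lambda>x. - (\<Sum>j\<in>S. dd (j - c0) (?P j) x))"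
  proof (rule J_cong[OF S])
    fix x assume x: "x \<in> flat S"
    have "dd (x - j) (?P j) x = dd (x - c0) (?P j) x - dd (j - c0) (?P j) x" if "j \<in> S" for j
      using linear_diff[OF dd_linear[OF rpf_differentiable[OF rP[OF that]]], where x="x - c0" and y="j - c0"] by simp
    then have "(\<Sum>j\<in>S. real m * ?P j x + dd (x - j) (?P j) x)
        = (\<Sum>j\<in>S. real m * ?P j x) + (\<Sum>j\<in>S. dd (x - c0) (?P j) x) - (\<Sum>j\<in>S. dd (j - c0) (?P j) x)"
      by (simp add: sum.distrib sum_subtractf)
    also have "(\<Sum>j\<in>S. real m * ?P j x) = real m * ((\<Sum>j\<in>S. \<beta> j x) * u x)"
      by (simp add: sum_distrib_left sum_distrib_right)
    also have "\<dots> = 0" using sum0[OF x] by simp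
    \<comment> \<open>The direction \<open>x - c0\<close> is common to all \<open>j\<close> and
      tangent to the flat, on which \<open>\<Sum>j\<in>S. ?P j x\<close> is zero.\<close>
    also have "(\<Sum>j\<in>S. dd (x - c0) (?P j) x) = dd (x - c0) (\<lambda>x. \<Sum>j\<in>S. ?P j x) x"
      using rP rpf_differentiable by (intro dd_sum[symmetric]) blast
    also have "\<dots> = 0"
    proof (rule dd_zero_flat[OF _ _ x])
      show "(\<lambda>x. \<Sum>j\<in>S. ?P j x) differentiable (at x)"
        using rP rpf_differentiable finite_subset[OF S finite_C] by (intro differentiable_sum ballI) blast+
      show "y \<in> flat S \<Longrightarrow> (\<Sum>j\<in>S. ?P j y) = 0" for y
        using sum0[of y] by (simp flip: sum_distrib_right)
      show "c \<in> C - S \<Longrightarrow> g c \<bullet> (x - c0) = 0" for c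
        using x vertex_mem_flat[OF c0 S] by (auto simp: inner_g_diff flat_def)
    qed
    finally show "(\<Sum>j\<in>S. real m * ?P j x + dd (x - j) (?P j) x) = - (\<Sum>j\<in>S. dd (j - c0) (?P j) x)" by simp
  qed
  finally show ?thesis by simp
qed

section \<open>Polynomials vanishing on subfaces\<close>

text \<open>\<open>\<pi>\<close> projects along \<open>i - l\<close> onto the plane
  \<open>lam i x = 0\<close> and, as \<open>l \<noteq> j\<close>, does not change
  \<open>lam j\<close>. Hence \<open>p \<circ> \<pi>\<close> vanishes on the whole plane
  \<open>lam j x = 0\<close>, and division on the full space applies to it.\<close>

lemma factor_on_facet:
  assumes p: "p \<in> spolys k" and ij: "i \<in> C" "j \<in> C" "i \<noteq> j"
    and zero: "\<And>x. lam i x = 0 \<Longrightarrow> lam j x = 0 \<Longrightarrow> p x = 0"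
  shows "\<exists>q\<in>spolys (k - 1). \<forall>x. lam i x = 0 \<longrightarrow> p x = lam j x * q x"
proof -
  obtain l where l: "l \<in> C" "l \<noteq> i" "l \<noteq> j" using ex_other_vertex[OF ij(1,2)] .
  define \<pi> where "\<pi> x = x - lam i x *\<^sub>R (i - l)" for x
  have pi1: "(\<lambda>x. \<pi> x $ m) \<in> spolys 1" for m
  proof -
    have "(\<lambda>x. x $ m - (i - l) $ m * lam i x) \<in> spolys 1"
      using coord_shpolys[of m] hpolys_subset_polys[of UNIV 1] lam_spolys
      by (intro spolys_pointwise(2) spolys_scale) auto
    then show ?thesis by (simp add: \<pi>_def mult.commute)
  qed
  have "\<exists>q\<in>spolys (k - 1). (\<forall>x. p (\<pi> x) = (a j + g j \<bullet> x) * q x) \<and> (k = 0 \<longrightarrow> q = (\<lambda>x. 0))"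
  proof (rule spolys_factor)
    show "(\<lambda>x. p (\<pi> x)) \<in> spolys k" by (rule spolys_compose_affine[OF p pi1])
    show "g j \<noteq> 0" using g_nonzero ij by blast
    fix x assume "a j + g j \<bullet> x = 0"
    then show "p (\<pi> x) = 0"
      using ij l by (intro zero) (auto simp: \<pi>_def lam_diff inner_g_vertex lam_def[symmetric])
  qed
  then obtain q where q: "q \<in> spolys (k - 1)" "\<And>x. p (\<pi> x) = lam j x * q x" by (auto simp: lam_def)
  have "p x = lam j x * q x" if "lam i x = 0" for x using q(2)[of x] that by (simp add: \<pi>_def)
  then show ?thesis using q(1) by blast
qed

lemma factor_two:
  assumes p: "p \<in> spolys k" and ij: "i \<in> C" "j \<in> C" "i \<noteq> j"
    and zero: "\<And>x. lam i x = 0 \<Longrightarrow> p x = 0" "\<And>x. lam j x = 0 \<Longrightarrow> p x = 0"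
  shows "\<exists>q\<in>spolys (k - 2). \<forall>x. p x = lam i x * lam j x * q x"
proof -
  have "\<exists>q\<in>spolys (k - card {i,j}). (\<forall>x. p x = (\<Prod>i\<in>{i,j}. a i + g i \<bullet> x) * q x) \<and> (k < card {i,j} \<longrightarrow> q = (\<lambda>x. 0))"
  proof (rule spolys_factor_prod[OF _ p])
    fix i' j' x assume *: "i' \<in> {i,j}" "j' \<in> {i,j}" "i' \<noteq> j'"
    obtain l where l: "l \<in> C" "l \<noteq> i" "l \<noteq> j" using ex_other_vertex[OF ij(1,2)] .
    then show "\<exists>u. g j' \<bullet> u = 0 \<and> g i' \<bullet> u \<noteq> 0"
      using * ij by (intro exI[of _ "i' - l"]) (auto simp: inner_g_vertex)
  qed (use ij zero g_nonzero in \<open>auto simp: lam_def\<close>)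
  moreover have "card {i, j} = 2" using ij by simp
  ultimately obtain q where "q \<in> spolys (k - 2)" "\<And>x. p x = (\<Prod>i\<in>{i,j}. a i + g i \<bullet> x) * q x" by auto
  then show ?thesis using ij by (intro bexI[of _ q]) (auto simp: lam_def)
qed

text \<open>Induction over the faces from the vertices upwards. On the flat of \<open>S\<close> the
  polynomial vanishes wherever one coordinate in \<open>S\<close> does, so it is the product of the
  \<open>lam c\<close>, \<open>c \<in> S\<close>, times some \<open>q\<close> of degree
  \<open>k - card S\<close>; the moment against this \<open>q\<close> removes it by positivity. For
  \<open>card S > k\<close> the quotient is zero by degree.\<close>

lemma zero_on_flat:
  assumes p: "p \<in> spolys k" and T: "T \<subseteq> C"
    and vert: "\<And>c. c \<in> T \<Longrightarrow> p c = 0"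
    and mom: "\<And>S q. S \<subseteq> T \<Longrightarrow> 2 \<le> card S \<Longrightarrow> card S \<le> k \<Longrightarrow> q \<in> spolys (k - card S) \<Longrightarrow> 
        J S (\<lambda>x. p x * q x) = 0"
    and x: "x \<in> flat T"
  shows "p x = 0"
proof -
  have "S \<subseteq> T \<Longrightarrow> x \<in> flat S \<Longrightarrow> p x = 0" for S x
  proof (induction "card S" arbitrary: S x rule: less_induct)
    case less
    have S: "S \<subseteq> C" using less.prems T by blast
    have finS: "finite S" using S finite_C finite_subset by blast
    have sumS: "(\<Sum>c\<in>S. lam c y) = 1" if "y \<in> flat S" for y
    proof -
      have "(\<Sum>c\<in>S. lam c y) = (\<Sum>c\<in>C. lam c y)"
        using that S finite_C by (intro sum.mono_neutral_left) (auto simp: flat_def)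
      then show ?thesis by (simp add: sum_lam)
    qed
    consider "card S = 0" | "card S = 1" | "card S \<ge> 2" by linarith
    then show ?case
    proof cases
      case 1
      then have "S = {}" using finS by simp
      then show ?thesis using sumS[OF less.prems(2)] by simp
    next
      case 2
      then obtain c where c: "S = {c}" by (rule card_1_singletonE)
      have "x = (\<Sum>c\<in>C. lam c x *\<^sub>R c)" by (simp add: sum_lam_vertex)
      also have "\<dots> = (\<Sum>c\<in>S. lam c x *\<^sub>R c)"
        using less.prems S finite_C by (intro sum.mono_neutral_right) (auto simp: flat_def)
      also have "\<dots> = c" using sumS[OF less.prems(2)] c by simp
      finally show ?thesis using vert[of c] less.prems c by auto
    next
      case 3
      then obtain c0 where c0: "c0 \<in> S" by fastforce
      \<comment> \<open>The projection of the space onto the flat of \<open>S\<close> that transfers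
        the coordinates outside \<open>S\<close> to \<open>c0\<close>. For \<open>c \<in> S\<close>
        the forms \<open>b c + h c \<bullet> x\<close> below are the coordinates
        \<open>lam c (\<pi> x)\<close>.\<close>
      define \<pi> where "\<pi> x = x - (\<Sum>c\<in>C-S. lam c x *\<^sub>R (c - c0))" for x
      define b h where "b c = a c + (if c = c0 then \<Sum>c\<in>C-S. a c else 0)"
        and "h c = g c + (if c = c0 then \<Sum>c\<in>C-S. g c else 0)" for c
      have bh: "b c + h c \<bullet> x = lam c x + (if c = c0 then \<Sum>c\<in>C-S. lam c x else 0)" for c x
        by (simp add: b_def h_def lam_def inner_add_left inner_sum_left sum.distrib)
      have lampi: "lam c (\<pi> x) = lam c x - (\<Sum>c'\<in>C-S. lam c' x * ((if c = c' then 1 else 0) - (if c = c0 then 1 else 0)))" 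
        if "c \<in> C" for c x
      proof -
        have "lam c (\<pi> x) = lam c x - (\<Sum>c'\<in>C-S. lam c' x * (g c \<bullet> (c' - c0)))"
          by (simp add: \<pi>_def lam_diff inner_sum_right)
        also have "(\<Sum>c'\<in>C-S. lam c' x * (g c \<bullet> (c' - c0))) = 
           (\<Sum>c'\<in>C-S. lam c' x * ((if c = c' then 1 else 0) - (if c = c0 then 1 else 0)))"
          using c0 S that by (intro sum.cong) (auto simp: inner_g_vertex)
        finally show ?thesis .
      qed
      have lampi_out: "lam c (\<pi> x) = 0" if "c \<in> C - S" for c x
      proof -
        have "c \<noteq> c0" "c \<in> C" using that c0 by auto
        then show ?thesis using lampi[of c x] that finite_C
          by (simp add: if_distrib[of "\<lambda>r. _ * r"] cong: if_cong)
      qed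
      have lampi_in: "lam c (\<pi> x) = b c + h c \<bullet> x" if "c \<in> S" for c x
      proof -
        have "(\<Sum>c'\<in>C-S. lam c' x * ((if c = c' then 1 else 0) - (if c = c0 then 1 else 0)))
            = (\<Sum>c'\<in>C-S. lam c' x * (- (if c = c0 then 1 else 0)))"
          using that by (intro sum.cong) auto
        then show ?thesis using lampi[of c x] that S by (auto simp: bh sum_negf)
      qed
      have pi1: "(\<lambda>x. \<pi> x $ m) \<in> spolys 1" for m
      proof -
        have "(\<lambda>x. x $ m - (\<Sum>c\<in>C-S. (c - c0) $ m * lam c x)) \<in> spolys 1"
          using coord_shpolys[of m] hpolys_subset_polys[of UNIV 1] lam_spolys
          by (intro spolys_pointwise(2) spolys_pointwise(6) spolys_scale) auto
        then show ?thesis by (simp add: \<pi>_def mult.commute)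
      qed
      have hdiff: "h c \<bullet> (i - j) = (if c = i then 1 else 0) - (if c = j then 1 else 0)" 
        if "c \<in> S" "i \<in> S" "j \<in> S" for c i j
      proof -
        have "(\<Sum>c\<in>C-S. g c \<bullet> (i - j)) = 0" using that S by (intro sum.neutral ballI, subst inner_g_vertex) auto
        moreover have "c \<in> C" "i \<in> C" "j \<in> C" using that S by auto
        ultimately show ?thesis unfolding h_def by (auto simp: inner_add_left inner_sum_left inner_g_vertex)
      qed
      have "\<exists>q\<in>spolys (k - card S). (\<forall>x. p (\<pi> x) = (\<Prod>c\<in>S. b c + h c \<bullet> x) * q x) \<and> (k < card S \<longrightarrow> q = (\<lambda>x. 0))"
      proof (rule spolys_factor_prod[OF finS])
        show "(\<lambda>x. p (\<pi> x)) \<in> spolys k" by (rule spolys_compose_affine[OF p pi1])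
        show "h c \<noteq> 0" if c: "c \<in> S" for c
        proof -
          have "card (S - {c}) > 0" using 3 c finS by simp
          then have "S - {c} \<noteq> {}" by (metis card.empty less_irrefl)
          then obtain c' where "c' \<in> S" "c' \<noteq> c" by auto
          then show ?thesis using hdiff[of c c c'] c by auto
        qed
        fix c y assume c: "c \<in> S" "b c + h c \<bullet> y = 0"
        show "p (\<pi> y) = 0"
        proof (rule less.hyps[of "S - {c}"])
          show "card (S - {c}) < card S" using c finS by (intro psubset_card_mono) auto
          show "S - {c} \<subseteq> T" using less.prems by auto
          show "\<pi> y \<in> flat (S - {c})" using c lampi_in lampi_out by (auto simp: flat_def)
        qed
      next
        fix i j y assume ij: "i \<in> S" "j \<in> S" "i \<noteq> j" "b i + h i \<bullet> y = 0" "b j + h j \<bullet> y = 0"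
        \<comment> \<open>On an edge the two forms add up to one and have no common zero. Otherwise
          there is a third vertex \<open>l\<close>, and the direction \<open>i - l\<close> preserves
          form \<open>j\<close> while changing form \<open>i\<close>.\<close>
        have "S \<noteq> {i, j}"
        proof
          assume "S = {i, j}"
          moreover have "\<pi> y \<in> flat S" using lampi_out by (auto simp: flat_def)
          ultimately show False using sumS[of "\<pi> y"] ij lampi_in by simp
        qed
        then obtain l where "l \<in> S" "l \<noteq> i" "l \<noteq> j" using ij by auto
        then show "\<exists>u. h j \<bullet> u = 0 \<and> h i \<bullet> u \<noteq> 0" using ij by (intro exI[of _ "i - l"]) (simp add: hdiff)
      qed
      then obtain q where q: "q \<in> spolys (k - card S)" "\<And>x. p (\<pi> x) = (\<Prod>c\<in>S. b c + h c \<bullet> x) * q x"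
        "k < card S \<longrightarrow> q = (\<lambda>x. 0)" by auto
      have pS: "p y = (\<Prod>c\<in>S. lam c y) * q y" if "y \<in> flat S" for y
      proof -
        have "\<pi> y = y" using that by (simp add: \<pi>_def flat_def)
        then show ?thesis using q(2)[of y] lampi_in[of _ y] by simp
      qed
      show ?thesis
      proof (cases "k < card S")
        case True
        then show ?thesis using q(3) pS[OF less.prems(2)] by simp
      next
        case False
        have "J S (\<lambda>x. p x * q x) = 0" using mom[OF less.prems(1) 3 _ q(1)] False by simp
        moreover have "J S (\<lambda>x. p x * q x) = J S (\<lambda>x. (\<Prod>c\<in>S. lam c x) * (q x)\<^sup>2)"
          using S by (intro J_cong) (auto simp: pS power2_eq_square)
        ultimately have z: "J S (\<lambda>x. (\<Prod>c\<in>S. lam c x) * (q x)\<^sup>2) = 0" by simp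
        have "q x = 0"
        proof (rule J_positive[OF S _ _ _ _ _ z less.prems(2)])
          show "S \<noteq> {}" using c0 by blast
          show "real_polynomial_function (\<lambda>x. \<Prod>c\<in>S. lam c x)"
            using finS by (intro real_polynomial_function_prod) auto
          show "real_polynomial_function q" using q(1) spolys_rpf by blast
          show "y \<in> convex hull S \<Longrightarrow> 0 \<le> (\<Prod>c\<in>S. lam c y)" for y
            using S by (auto simp: convex_hull_eq intro: prod_nonneg)
          show "(\<And>c. c \<in> S \<Longrightarrow> 0 < lam c y) \<Longrightarrow> (\<Prod>c\<in>S. lam c y) \<noteq> 0" for y
            using finS by (simp add: less_imp_neq[symmetric] order_less_imp_not_eq2)
        qed
        then show ?thesis using pS[OF less.prems(2)] by simp
      qed
    qed
  qed
  then show ?thesis using x by blast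
qed

end

section \<open>Vector and matrix fields\<close>

lemma linear_spolys: "p \<in> polys k X \<Longrightarrow> linear f \<Longrightarrow> (\<lambda>x. f (p x)) \<in> spolys k"
  unfolding polys_eq_mpolys by (rule mpolys_linear) auto

lemma linear_shpolys: "p \<in> hpolys k X \<Longrightarrow> linear f \<Longrightarrow> (\<lambda>x. f (p x)) \<in> shpolys k"
  unfolding hpolys_eq_mpolys by (rule mpolys_linear) auto

lemma polys_pf:
  fixes p :: "real ^ 'n \<Rightarrow> 'b::euclidean_space"
  shows "p \<in> polys k X \<Longrightarrow> polynomial_function p"
  unfolding polynomial_function_iff_Basis_inner
  by (intro ballI spolys_rpf[OF linear_spolys]) (auto simp: linear_iff inner_add_left)

lemma pf_linear:
  fixes p :: "'a::euclidean_space \<Rightarrow> 'b::euclidean_space" and f :: "'b \<Rightarrow> 'c::euclidean_space"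
  assumes "polynomial_function p" "linear f"
  shows "polynomial_function (\<lambda>x. f (p x))"
  using polynomial_function_compose[OF assms(1) polynomial_function_bounded_linear[of f]] assms(2)
  by (simp add: linear_linear comp_def)

lemma rpf_inner:
  fixes p q :: "'a::euclidean_space \<Rightarrow> 'b::euclidean_space"
  shows "polynomial_function p \<Longrightarrow> polynomial_function q \<Longrightarrow> real_polynomial_function (\<lambda>x. p x \<bullet> q x)"
  unfolding polynomial_function_iff_Basis_inner
  by (subst euclidean_inner) (auto intro!: real_polynomial_function_sum real_polynomial_function.intros(4))

lemma linear_nth: "linear (\<lambda>v::real^'n. v $ i)"
  by (simp add: linear_iff)

lemma linear_nth2: "linear (\<lambda>A::real^'n^'m. A $ i $ j)"
  by (simp add: linear_iff)

lemma linear_matrix_vector: "linear (\<lambda>A::real^'n^'m. A *v v)"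
  by (simp add: linear_iff matrix_vector_mult_add_rdistrib scaleR_matrix_vector_assoc)

lemma linear_inner_matrix_vector: "linear (\<lambda>A::real^'n^'m. w \<bullet> (A *v v))"
  by (simp add: linear_iff matrix_vector_mult_add_rdistrib inner_add_right flip: scaleR_matrix_vector_assoc)

lemma subspace_sym_mats: "subspace sym_mats"
  by (auto simp: subspace_def sym_mats_def transpose_def vec_eq_iff)

lemma subspace_skew_mats: "subspace (skew_mats :: (real ^ 'n ^ 'n) set)"
proof -
  have "transpose (A + B) = transpose A + transpose B" "transpose (r *\<^sub>R A) = r *\<^sub>R transpose A" "transpose 0 = 0"
    for A B :: "real ^ 'n ^ 'n" and r
    by (simp_all add: transpose_def vec_eq_iff)
  then show ?thesis by (auto simp: subspace_def skew_mats_def)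
qed

lemma sym_mats_nth: "A \<in> sym_mats \<Longrightarrow> A $ i $ j = A $ j $ i"
  by (auto simp: sym_mats_def transpose_def vec_eq_iff)

lemma skew_mats_nth: 
  fixes B :: "real ^ 'n ^ 'n"
  assumes "B \<in> skew_mats" 
  shows "B $ i $ j = - B $ j $ i"
proof -
  have "transpose B = - B" using assms by (simp add: skew_mats_def)
  then have "transpose B $ j $ i = (- B) $ j $ i" by simp
  then show ?thesis by (simp add: transpose_def)
qed

lemma sym_mats_inner: "A \<in> sym_mats \<Longrightarrow> v \<bullet> (A *v w) = w \<bullet> (A *v v)"
proof -
  assume "A \<in> sym_mats"
  have "v \<bullet> (A *v w) = (transpose A *v v) \<bullet> w" by (simp add: dot_lmul_matrix)
  also have "transpose A = A" using \<open>A \<in> sym_mats\<close> by (simp add: sym_mats_def)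
  finally show ?thesis by (simp add: inner_commute)
qed

lemma skew_mats_inner: "A \<in> skew_mats \<Longrightarrow> v \<bullet> (A *v v) = 0"
proof -
  assume A: "A \<in> skew_mats"
  have "v \<bullet> (A *v v) = (transpose A *v v) \<bullet> v" by (simp add: dot_lmul_matrix)
  also have "transpose A = - A" using A by (simp add: skew_mats_def)
  also have "(- A) *v v = - (A *v v)" using matrix_vector_mult_diff_rdistrib[of 0 A v] by simp
  finally show ?thesis by (simp add: inner_commute)
qed

lemma inner_mat: "(A::real^'n^'m) \<bullet> B = (\<Sum>i\<in>UNIV. \<Sum>j\<in>UNIV. A $ i $ j * B $ i $ j)"
  by (simp add: inner_vec_def)

section \<open>Symmetric products, symmetric gradient and row-wise divergence\<close>

definition outer :: "real ^ 'n \<Rightarrow> real ^ 'n \<Rightarrow> real ^ 'n ^ 'n" where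
  "outer v w = (\<chi> i j. v $ i * w $ j)"

text \<open>Twice the symmetric part of \<open>outer v w\<close>; this is the origin of the factors
  2 in later pairings.\<close>

definition sprod :: "real ^ 'n \<Rightarrow> real ^ 'n \<Rightarrow> real ^ 'n ^ 'n" where
  "sprod v w = outer v w + outer w v"

lemma outer_mult: "outer v w *v x = (w \<bullet> x) *\<^sub>R v"
  by (simp add: outer_def matrix_vector_mult_def vec_eq_iff inner_vec_def sum_distrib_left sum_distrib_right mult_ac)

lemma sprod_mult: "sprod v w *v x = (w \<bullet> x) *\<^sub>R v + (v \<bullet> x) *\<^sub>R w"
  by (simp add: sprod_def matrix_vector_mult_add_rdistrib outer_mult)

lemma sprod_sym: "sprod v w \<in> sym_mats"
  by (simp add: sym_mats_def sprod_def outer_def transpose_def vec_eq_iff)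

lemma inner_outer: "A \<bullet> outer v w = v \<bullet> (A *v w)"
  by (simp add: inner_mat outer_def inner_vec_def[of v] matrix_vector_mult_def sum_distrib_left mult_ac)

lemma inner_sprod: "A \<in> sym_mats \<Longrightarrow> A \<bullet> sprod v w = 2 * (v \<bullet> (A *v w))"
  using sym_mats_inner[of A v w] by (simp add: sprod_def inner_add_right inner_outer)

definition jac :: "(real ^ 'n \<Rightarrow> real ^ 'n) \<Rightarrow> real ^ 'n \<Rightarrow> real ^ 'n ^ 'n" where
  "jac v x = (\<chi> i j. dd (axis j 1) (\<lambda>x. v x $ i) x)"

text \<open>Up to sign the formal adjoint of \<open>row_div\<close> on symmetric fields.\<close>

definition symgrad :: "(real ^ 'n \<Rightarrow> real ^ 'n) \<Rightarrow> real ^ 'n \<Rightarrow> real ^ 'n ^ 'n" where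
  "symgrad v x = (1 / 2) *\<^sub>R (jac v x + transpose (jac v x))"

lemma symgrad_nth: "symgrad v x $ i $ j = (dd (axis j 1) (\<lambda>x. v x $ i) x + dd (axis i 1) (\<lambda>x. v x $ j) x) / 2"
  by (simp add: symgrad_def jac_def transpose_def)

lemma symgrad_sym: "symgrad v x \<in> sym_mats"
  by (simp add: sym_mats_def transpose_def vec_eq_iff symgrad_nth)

lemma inner_symgrad: "A \<in> sym_mats \<Longrightarrow> A \<bullet> symgrad v x = A \<bullet> jac v x"
proof -
  assume A: "A \<in> sym_mats"
  have "A \<bullet> transpose (jac v x) = (\<Sum>j\<in>UNIV. \<Sum>i\<in>UNIV. A $ i $ j * jac v x $ j $ i)"
    unfolding inner_mat by (subst sum.swap) (simp add: transpose_def)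
  also have "\<dots> = A \<bullet> jac v x" unfolding inner_mat by (intro sum.cong refl arg_cong2[where f="(*)"] sym_mats_nth[OF A])
  finally show ?thesis by (simp add: symgrad_def inner_add_right)
qed

lemma dd_axis_sum:
  fixes p :: "real ^ 'n \<Rightarrow> real"
  assumes "p differentiable (at x)"
  shows "dd t p x = (\<Sum>i\<in>UNIV. t $ i * dd (axis i 1) p x)"
proof -
  note l = dd_linear[OF assms]
  have "dd (\<Sum>i\<in>UNIV. t $ i *\<^sub>R axis i 1) p x = (\<Sum>i\<in>UNIV. t $ i * dd (axis i 1) p x)"
    by (simp add: linear_sum[OF l] linear_scale[OF l])
  then show ?thesis using basis_expansion[of t] by (simp add: scalar_mult_eq_scaleR)
qed

lemma frechet_derivative_nth2:
  fixes \<tau> :: "real ^ 'n \<Rightarrow> real ^ 'm ^ 'l"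
  assumes "\<tau> differentiable (at x)"
  shows "frechet_derivative \<tau> (at x) t $ i $ j = dd t (\<lambda>x. \<tau> x $ i $ j) x"
proof -
  have "(\<tau> has_derivative frechet_derivative \<tau> (at x)) (at x)"
    using assms frechet_derivative_works by blast
  then have "((\<lambda>x. \<tau> x $ i $ j) has_derivative (\<lambda>t. frechet_derivative \<tau> (at x) t $ i $ j)) (at x)"
    by (intro bounded_linear.has_derivative[OF bounded_linear_vec_nth])
  then show ?thesis by (simp add: dd_eqI)
qed

lemma pf_differentiable:
  fixes p :: "'a::euclidean_space \<Rightarrow> 'b::euclidean_space"
  shows "polynomial_function p \<Longrightarrow> p differentiable (at x)"
  by (rule differentiable_at_polynomial_function)

lemma row_div_nth:
  assumes "polynomial_function (\<tau>::real^'n \<Rightarrow> real^'n^'n)"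
  shows "row_div \<tau> x $ i = (\<Sum>j\<in>UNIV. dd (axis j 1) (\<lambda>x. \<tau> x $ i $ j) x)"
  by (simp add: row_div_def frechet_derivative_nth2[OF pf_differentiable[OF assms]])

lemma row_div_polys:
  assumes "(\<tau>::real^'n \<Rightarrow> real^'n^'n) \<in> polys k X"
  shows "row_div \<tau> \<in> polys (k - 1) UNIV"
  unfolding polys_eq_mpolys
proof (rule vec_mpolysI)
  fix i
  have "dd t (\<lambda>x. \<tau> x $ i $ j) \<in> spolys (k - 1)" for t j
    using dd_spolys[OF linear_spolys[OF assms linear_nth2]] by blast
  then have "(\<lambda>x. \<Sum>j\<in>UNIV. dd (axis j 1) (\<lambda>x. \<tau> x $ i $ j) x) \<in> spolys (k - 1)"
    by (rule spolys_pointwise(6))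
  then show "(\<lambda>x. row_div \<tau> x $ i) \<in> mpolys {\<alpha>. sum \<alpha> UNIV \<le> k - 1} UNIV"
    by (simp add: row_div_nth[OF polys_pf[OF assms]] polys_eq_mpolys)
qed simp

lemma symgrad_polys:
  assumes "v \<in> polys k X"
  shows "symgrad v \<in> polys (k - 1) sym_mats"
  unfolding polys_eq_mpolys
proof (rule mpolys_valued[OF subspace_sym_mats mat_mpolysI symgrad_sym])
  fix i j
  have "dd t (\<lambda>x. v x $ i) \<in> spolys (k - 1)" for t i
    using dd_spolys[OF linear_spolys[OF assms linear_nth]] by blast
  then have "(\<lambda>x. (1 / 2) * (dd (axis j 1) (\<lambda>x. v x $ i) x + dd (axis i 1) (\<lambda>x. v x $ j) x)) \<in> spolys (k - 1)"
    by (intro spolys_scale spolys_pointwise(1))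
  then show "(\<lambda>x. symgrad v x $ i $ j) \<in> mpolys {\<alpha>. sum \<alpha> UNIV \<le> k - 1} UNIV"
    by (simp add: symgrad_nth polys_eq_mpolys)
qed simp

lemma symgrad_hpolys:
  assumes "v \<in> hpolys k X"
  shows "symgrad v \<in> hpolys (k - 1) sym_mats"
  unfolding hpolys_eq_mpolys
proof (rule mpolys_valued[OF subspace_sym_mats mat_mpolysI symgrad_sym])
  fix i j
  have "dd t (\<lambda>x. v x $ i) \<in> shpolys (k - 1)" for t i
    using dd_shpolys[OF linear_shpolys[OF assms linear_nth]] by blast
  then have "(\<lambda>x. (1 / 2) * (dd (axis j 1) (\<lambda>x. v x $ i) x + dd (axis i 1) (\<lambda>x. v x $ j) x)) \<in> shpolys (k - 1)"
    by (intro shpolys_scale shpolys_pointwise(1))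
  then show "(\<lambda>x. symgrad v x $ i $ j) \<in> mpolys {\<alpha>. sum \<alpha> UNIV = k - 1} UNIV"
    by (simp add: symgrad_nth hpolys_eq_mpolys)
qed simp

lemma inner_x_shpolys:
  assumes "(w::real^'n \<Rightarrow> real^'n) \<in> hpolys k X"
  shows "(\<lambda>x. w x \<bullet> x) \<in> shpolys (Suc k)"
proof -
  have "(\<lambda>x. w x $ i * x $ i) \<in> shpolys (k + 1)" for i
    by (intro shpolys_mult linear_shpolys[OF assms linear_nth] coord_shpolys)
  then have "(\<lambda>x. \<Sum>i\<in>UNIV. w x $ i * x $ i) \<in> shpolys (k + 1)"
    by (rule shpolys_pointwise(6))
  then show ?thesis by (simp add: inner_vec_def)
qed

lemma dd_inner_x:
  fixes w :: "real ^ 'n \<Rightarrow> real ^ 'n"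
  assumes "polynomial_function w"
  shows "dd t (\<lambda>x. w x \<bullet> x) x = (\<Sum>j\<in>UNIV. dd t (\<lambda>x. w x $ j) x * x $ j) + w x \<bullet> t"
proof -
  have d: "(\<lambda>x. w x $ j) differentiable (at x)" for j
    using pf_linear[OF assms linear_nth[of j]] pf_differentiable by blast
  have "dd t (\<lambda>x. w x \<bullet> x) x = dd t (\<lambda>x. \<Sum>j\<in>UNIV. w x $ j * x $ j) x"
    by (simp add: inner_vec_def)
  also have "\<dots> = (\<Sum>j\<in>UNIV. dd t (\<lambda>x. w x $ j * x $ j) x)"
    using d by (intro dd_sum differentiable_mult) auto
  also have "\<dots> = (\<Sum>j\<in>UNIV. w x $ j * t $ j + dd t (\<lambda>x. w x $ j) x * x $ j)"
    using d by (simp add: dd_mult dd_coord)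
  finally show ?thesis by (simp add: sum.distrib inner_vec_def)
qed

text \<open>The Jacobian applied to \<open>x\<close> is the radial derivative; its transpose applied
  to \<open>x\<close> is, by the product rule, the gradient of \<open>v \<bullet> x\<close> minus
  \<open>v\<close>.\<close>

lemma symgrad_mult_x:
  fixes v :: "real ^ 'n \<Rightarrow> real ^ 'n"
  assumes "polynomial_function v"
  shows "(symgrad v x *v x) $ i = (dd x (\<lambda>x. v x $ i) x + dd (axis i 1) (\<lambda>x. v x \<bullet> x) x - v x $ i) / 2"
proof -
  have d: "(\<lambda>x. v x $ j) differentiable (at x)" for j
    using pf_linear[OF assms linear_nth[of j]] pf_differentiable by blast
  have "(symgrad v x *v x) $ i = (\<Sum>j\<in>UNIV. (x $ j * dd (axis j 1) (\<lambda>x. v x $ i) x + dd (axis i 1) (\<lambda>x. v x $ j) x * x $ j) / 2)"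
    by (simp add: matrix_vector_mult_def symgrad_nth algebra_simps)
  also have "\<dots> = (dd x (\<lambda>x. v x $ i) x + (\<Sum>j\<in>UNIV. dd (axis i 1) (\<lambda>x. v x $ j) x * x $ j)) / 2"
    by (simp add: dd_axis_sum[OF d, of x] sum.distrib add_divide_distrib flip: sum_divide_distrib)
  finally show ?thesis by (simp add: dd_inner_x[OF assms] inner_axis)
qed

text \<open>On homogeneous fields of degree \<open>k + 1\<close> the map \<open>v \<mapsto> 2 (symgrad v) x\<close> equals
  \<open>k v + \<nabla>(v \<bullet> x)\<close>, which is inverted explicitly.\<close>

lemma hpolys_sym_decompose:
  fixes q :: "real ^ 'n \<Rightarrow> real ^ 'n ^ 'n"
  assumes q: "q \<in> hpolys k sym_mats"
  shows "\<exists>v\<in>hpolys (Suc k) UNIV. \<exists>s\<in>hpolys k sym_mats. (\<forall>x. s x *v x = 0) \<and> (\<forall>x. q x = symgrad v x + s x)"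
proof -
  have qs: "q x \<in> sym_mats" for x
    using q mpolys_value[OF _ subspace_sym_mats] unfolding hpolys_eq_mpolys by blast
  define w where "w x = q x *v x" for x
  have w: "w \<in> hpolys (Suc k) UNIV"
    unfolding hpolys_eq_mpolys
  proof (rule vec_mpolysI)
    fix i
    have "(\<lambda>x. \<Sum>j\<in>UNIV. q x $ i $ j * x $ j) \<in> shpolys (k + 1)"
      by (intro shpolys_pointwise(6) shpolys_mult linear_shpolys[OF q linear_nth2] coord_shpolys)
    then show "(\<lambda>x. w x $ i) \<in> mpolys {\<alpha>. sum \<alpha> UNIV = Suc k} UNIV"
      by (simp add: w_def matrix_vector_mult_def hpolys_eq_mpolys)
  qed simp
  show ?thesis
  proof (cases "k = 0")
    \<comment> \<open>For \<open>k = 0\<close> the map to be inverted loses the term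
      \<open>k v\<close>; here the linear field \<open>w x = A *v x\<close> itself has symmetric
      gradient \<open>A\<close>.\<close>
    case True
    then obtain A where A: "A \<in> sym_mats" "q = (\<lambda>x. A)" using polys_0[of q sym_mats] q hpolys_0 by blast
    have "(\<lambda>x. w x $ i) = (\<lambda>x. (A $ i) \<bullet> x)" for i
      by (simp add: w_def A matrix_vector_mult_def inner_vec_def fun_eq_iff)
    then have "q x = symgrad w x" for x
      using sym_mats_nth[OF A(1)] by (simp add: vec_eq_iff symgrad_nth dd_inner inner_axis A(2))
    then show ?thesis using w subspace_hpolys[OF subspace_sym_mats]
      by (intro bexI[of _ w] bexI[of _ "\<lambda>x. 0"]) (auto intro: subspace_pointwise(5))
  next
    case False
    define \<phi> where "\<phi> x = w x \<bullet> x" for x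
    have phi: "\<phi> \<in> shpolys (Suc (Suc k))"
      using inner_x_shpolys[OF w] by (simp add: \<phi>_def[abs_def])
    \<comment> \<open>Taking the inner product of \<open>2 w = k v + \<nabla>(v \<bullet> x)\<close>
      with \<open>x\<close> gives \<open>v \<bullet> x = \<phi> / (k + 1)\<close> by Euler's
      identity. Substituting this and solving for \<open>v\<close> yields the constants.\<close>
    define v where "v x = (2 / k) *\<^sub>R (w x - (1 / (2 * k + 2)) *\<^sub>R (\<chi> i. dd (axis i 1) \<phi> x))" for x
    have vi: "(\<lambda>x. v x $ i) = (\<lambda>x. (2 / k) * (w x $ i - (1 / (2 * k + 2)) * dd (axis i 1) \<phi> x))" for i
      by (simp add: v_def)
    have dphi: "dd t \<phi> \<in> shpolys (Suc k)" for t using dd_shpolys[OF phi, of t] by simp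
    have v: "v \<in> hpolys (Suc k) UNIV"
      unfolding hpolys_eq_mpolys
    proof (rule vec_mpolysI)
      show "(\<lambda>x. v x $ i) \<in> mpolys {\<alpha>. sum \<alpha> UNIV = Suc k} UNIV" for i
        unfolding vi hpolys_eq_mpolys[symmetric]
        by (intro shpolys_scale shpolys_pointwise(2) dphi linear_shpolys[OF w linear_nth])
    qed simp
    have pv: "polynomial_function v"
      using v hpolys_subset_polys[of UNIV "Suc k"] polys_pf by blast
    have vx: "v x \<bullet> x = (1 / (k + 1)) * \<phi> x" for x
    proof -
      have "(\<chi> i. dd (axis i 1) \<phi> x) \<bullet> x = dd x \<phi> x"
        using dd_axis_sum[of \<phi> x x] dd_shpolys[OF phi] by (simp add: inner_vec_def mult.commute)
      also have "\<dots> = (real k + 2) * \<phi> x" using euler_shpolys[OF phi, of x] by simp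
      finally have "v x \<bullet> x = (2 / k) * (\<phi> x - (1 / (2 * k + 2)) * ((real k + 2) * \<phi> x))"
        by (simp add: v_def inner_diff_left \<phi>_def[symmetric])
      then show ?thesis using False by (simp add: field_simps)
    qed
    have sx: "(symgrad v x *v x) = w x" for x
    proof -
      have "(symgrad v x *v x) $ i = w x $ i" for i
      proof -
        have "dd (axis i 1) (\<lambda>x. v x \<bullet> x) x = (1 / (k + 1)) * dd (axis i 1) \<phi> x"
          unfolding vx using dd_shpolys[OF phi] by (intro dd_scale) blast
        moreover have "dd x (\<lambda>x. v x $ i) x = (real k + 1) * v x $ i"
          using euler_shpolys[OF linear_shpolys[OF v linear_nth]] by simp
        ultimately have "(symgrad v x *v x) $ i = (real k * v x $ i + (1 / (k + 1)) * dd (axis i 1) \<phi> x) / 2"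
          by (simp add: symgrad_mult_x[OF pv] algebra_simps)
        also have "real k * v x $ i = 2 * (w x $ i - (1 / (2 * k + 2)) * dd (axis i 1) \<phi> x)"
          using False by (simp add: v_def)
        also have "1 / real (k + 1) = 2 * (1 / real (2 * k + 2))" by (simp add: field_simps)
        finally show ?thesis by simp
      qed
      then show ?thesis by (simp add: vec_eq_iff)
    qed
    have "symgrad v \<in> hpolys k sym_mats" using symgrad_hpolys[OF v] by simp
    then have "(\<lambda>x. q x - symgrad v x) \<in> hpolys k sym_mats"
      using q subspace_pointwise(2)[OF subspace_hpolys[OF subspace_sym_mats]] by blast
    then show ?thesis using v sx
      by (intro bexI[of _ v] bexI[of _ "\<lambda>x. q x - symgrad v x"]) (auto simp: matrix_vector_mult_diff_rdistrib w_def)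
  qed
qed

lemma symgrad_add:
  assumes "polynomial_function v" "polynomial_function w"
  shows "symgrad (\<lambda>x. v x + w x) x = symgrad v x + symgrad w x"
proof -
  have d: "(\<lambda>x. v x $ j) differentiable (at x)" "(\<lambda>x. w x $ j) differentiable (at x)" for j
    using pf_linear[OF assms(1) linear_nth[of j]] pf_linear[OF assms(2) linear_nth[of j]] pf_differentiable by blast+
  show ?thesis by (simp add: vec_eq_iff symgrad_nth dd_add d add_divide_distrib)
qed

text \<open>Each homogeneous part is decomposed separately. This is how the two kinds of interior
  conditions on bubbles, on the divergence and against fields annihilating \<open>x\<close>,
  together control all interior moments.\<close>

lemma polys_sym_decompose:
  fixes q :: "real ^ 'n \<Rightarrow> real ^ 'n ^ 'n"
  assumes "q \<in> polys k sym_mats"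
  shows "\<exists>v\<in>polys (Suc k) UNIV. \<exists>s\<in>polys k sym_mats. (\<forall>x. s x *v x = 0) \<and> (\<forall>x. q x = symgrad v x + s x)"
  using assms
proof (induction k arbitrary: q)
  have sub: "hpolys j sym_mats \<subseteq> polys j (sym_mats :: (real^'n^'n) set)" "hpolys j UNIV \<subseteq> polys j (UNIV :: (real^'n) set)" for j
    using subspace_0[OF subspace_sym_mats] by (auto intro!: hpolys_subset_polys)
  case 0
  then show ?case using hpolys_sym_decompose[of q 0] sub by (simp add: hpolys_0) blast
next
  case (Suc k)
  have sub: "hpolys j sym_mats \<subseteq> polys j (sym_mats :: (real^'n^'n) set)" "hpolys j UNIV \<subseteq> polys j (UNIV :: (real^'n) set)" for j
    using subspace_0[OF subspace_sym_mats] by (auto intro!: hpolys_subset_polys)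
  obtain q1 q2 where q: "q1 \<in> polys k sym_mats" "q2 \<in> hpolys (Suc k) sym_mats" "q = (\<lambda>x. q1 x + q2 x)"
    using polys_hpolys_decompose[OF Suc.prems] by blast
  obtain v1 s1 where 1: "v1 \<in> polys (Suc k) UNIV" "s1 \<in> polys k sym_mats" "\<And>x. s1 x *v x = 0"
    "\<And>x. q1 x = symgrad v1 x + s1 x" using Suc.IH[OF q(1)] by blast
  obtain v2 s2 where 2: "v2 \<in> hpolys (Suc (Suc k)) UNIV" "s2 \<in> hpolys (Suc k) sym_mats" "\<And>x. s2 x *v x = 0"
    "\<And>x. q2 x = symgrad v2 x + s2 x" using hpolys_sym_decompose[OF q(2)] by blast
  have v2: "v2 \<in> polys (Suc (Suc k)) UNIV" and s2: "s2 \<in> polys (Suc k) sym_mats" 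
    using 2 sub hpolys_subset_polys[of UNIV "Suc (Suc k)"] by auto
  have v1: "v1 \<in> polys (Suc (Suc k)) UNIV" using 1 polys_mono[of "Suc k" "Suc (Suc k)" UNIV UNIV] by auto
  have s1: "s1 \<in> polys (Suc k) sym_mats" 
    using 1 polys_mono[of k "Suc k" sym_mats sym_mats] subspace_0[OF subspace_sym_mats] by auto
  show ?case
  proof (intro bexI[of _ "\<lambda>x. v1 x + v2 x"] bexI[of _ "\<lambda>x. s1 x + s2 x"] conjI allI)
    show "(\<lambda>x. v1 x + v2 x) \<in> polys (Suc (Suc k)) UNIV"
      using v1 v2 by (intro subspace_pointwise(1)[OF subspace_polys]) auto
    show "(\<lambda>x. s1 x + s2 x) \<in> polys (Suc k) sym_mats"
      using s1 s2 by (intro subspace_pointwise(1)[OF subspace_polys[OF subspace_sym_mats]])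
    show "(s1 x + s2 x) *v x = 0" for x by (simp add: matrix_vector_mult_add_rdistrib 1 2)
    show "q x = symgrad (\<lambda>x. v1 x + v2 x) x + (s1 x + s2 x)" for x
      by (simp add: q(3) 1(4) 2(4) symgrad_add[OF polys_pf[OF v1] polys_pf[OF v2]])
  qed
qed

section \<open>Fields with vanishing normal trace\<close>

context barycentric
begin

lemma vec_zeroI: "(\<And>c. c \<in> C \<Longrightarrow> g c \<bullet> v = 0) \<Longrightarrow> v = 0"
  using sum_inner_g[of v] by simp

lemma mat_zeroI:
  assumes "\<And>i j. i \<in> C \<Longrightarrow> j \<in> C \<Longrightarrow> g i \<bullet> (A *v g j) = 0"
  shows "A = 0"
proof -
  have *: "A *v g j = 0" if "j \<in> C" for j using vec_zeroI assms that by blast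
  have "A *v w = 0" for w
  proof -
    have "A *v w = A *v (\<Sum>c\<in>C. (w \<bullet> (c - 0)) *\<^sub>R g c)" by (simp only: sum_vertex_g)
    also have "\<dots> = (\<Sum>c\<in>C. (w \<bullet> (c - 0)) *\<^sub>R (A *v g c))"
      by (simp add: linear_sum[OF matrix_vector_mul_linear] matrix_vector_mult_scaleR)
    finally show ?thesis using * by simp
  qed
  then show ?thesis by (simp add: matrix_eq)
qed

text \<open>Polarization at a common vertex \<open>c0\<close> recovers the bilinear form on the edge
  vectors \<open>i - c0\<close>, which span the space. The number of edges equals the dimension of
  the symmetric matrices, so no edge is redundant.\<close>

lemma sym_mat_zeroI:
  assumes A: "A \<in> sym_mats" and z: "\<And>i j. i \<in> C \<Longrightarrow> j \<in> C \<Longrightarrow> i \<noteq> j \<Longrightarrow> (i - j) \<bullet> (A *v (i - j)) = 0"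
  shows "A = 0"
proof -
  obtain c0 where c0: "c0 \<in> C" using card_C by fastforce
  have z': "(i - j) \<bullet> (A *v (i - j)) = 0" if "i \<in> C" "j \<in> C" for i j
    using z that by (cases "i = j") auto
  have "(i - c0) \<bullet> (A *v (j - c0)) = 0" if "i \<in> C" "j \<in> C" for i j
  proof -
    have "i - j = (i - c0) - (j - c0)" by simp
    then have "(i - j) \<bullet> (A *v (i - j)) = (i - c0) \<bullet> (A *v (i - c0)) - (i - c0) \<bullet> (A *v (j - c0)) - (j - c0) \<bullet> (A *v (i - c0)) + (j - c0) \<bullet> (A *v (j - c0))"
      by (simp only: matrix_vector_mult_diff_distrib inner_diff_left inner_diff_right)
    then show ?thesis using z' that c0 sym_mats_inner[OF A, of "j - c0" "i - c0"] by simp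
  qed
  then have *: "t \<bullet> (A *v (j - c0)) = 0" if "j \<in> C" for j t
  proof -
    have "t \<bullet> (A *v (j - c0)) = (\<Sum>c\<in>C. (g c \<bullet> t) *\<^sub>R (c - c0)) \<bullet> (A *v (j - c0))" by (simp only: sum_inner_g_diff)
    then show ?thesis using \<open>\<And>j i. i \<in> C \<Longrightarrow> j \<in> C \<Longrightarrow> (i - c0) \<bullet> (A *v (j - c0)) = 0\<close> that by (simp add: inner_sum_left)
  qed
  have "A *v t = 0" for t
  proof -
    have "w \<bullet> (A *v t) = 0" for w
    proof -
      have "w \<bullet> (A *v t) = t \<bullet> (A *v w)" by (rule sym_mats_inner[OF A])
      also have "\<dots> = t \<bullet> (A *v (\<Sum>c\<in>C. (g c \<bullet> w) *\<^sub>R (c - c0)))" by (simp only: sum_inner_g_diff)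
      also have "\<dots> = 0" using * by (simp add: linear_sum[OF matrix_vector_mul_linear] matrix_vector_mult_scaleR inner_sum_right)
      finally show ?thesis .
    qed
    then show ?thesis by (metis inner_eq_zero_iff)
  qed
  then show ?thesis by (simp add: matrix_eq)
qed

lemma J_norm_zero:
  fixes q :: "real ^ 'n \<Rightarrow> 'b::euclidean_space"
  assumes S: "S \<subseteq> C" "S \<noteq> {}" and "polynomial_function q" "J S (\<lambda>x. q x \<bullet> q x) = 0" "x \<in> flat S"
  shows "q x = 0"
proof -
  have r: "real_polynomial_function (\<lambda>x. q x \<bullet> q x)" using assms by (intro rpf_inner)
  have "q x \<bullet> q x = 0"
    by (rule rpf_zero_flat[OF S r J_positive_point[OF S r _ assms(4)] assms(5)]) auto
  then show ?thesis by simp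
qed

lemma C_nonempty: "C \<noteq> {}" using card_C by auto

text \<open>On the facet opposite to \<open>i\<close> or \<open>j\<close> one of the two gradients
  is the normal there; by symmetry of the matrix it does not matter on which side it stands.\<close>

lemma bubble_factor:
  assumes \<tau>: "\<tau> \<in> polys k sym_mats" and ij: "i \<in> C" "j \<in> C" "i \<noteq> j"
    and nz: "\<And>c x. c \<in> C \<Longrightarrow> lam c x = 0 \<Longrightarrow> \<tau> x *v g c = 0"
  shows "\<exists>q\<in>spolys (k - 2). \<forall>x. g i \<bullet> (\<tau> x *v g j) = lam i x * lam j x * q x"
proof (rule factor_two[OF _ ij])
  have sym: "\<tau> x \<in> sym_mats" for x
    using \<tau> mpolys_value[OF _ subspace_sym_mats] unfolding polys_eq_mpolys by blast
  show "(\<lambda>x. g i \<bullet> (\<tau> x *v g j)) \<in> spolys k"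
    by (rule linear_spolys[OF \<tau> linear_inner_matrix_vector])
  show "lam i x = 0 \<Longrightarrow> g i \<bullet> (\<tau> x *v g j) = 0" for x
    using nz[of i x] ij sym_mats_inner[OF sym, of "g i" x "g j"] by simp
  show "lam j x = 0 \<Longrightarrow> g i \<bullet> (\<tau> x *v g j) = 0" for x
    using nz[of j x] ij by simp
qed

text \<open>An off-diagonal barycentric component is \<open>lam i * lam j\<close> times some
  \<open>q\<close>, and the test field is \<open>q\<close> times \<open>sprod (g i) (g j)\<close>.
  The diagonal components follow because the gradients sum to zero.\<close>

lemma interior_unisolvent:
  assumes \<tau>: "\<tau> \<in> polys k sym_mats"
    and nz: "\<And>c x. c \<in> C \<Longrightarrow> lam c x = 0 \<Longrightarrow> \<tau> x *v g c = 0"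
    and mom: "\<And>q. q \<in> polys (k - 2) sym_mats \<Longrightarrow> J C (\<lambda>x. \<tau> x \<bullet> q x) = 0"
  shows "\<tau> x = 0"
proof (rule mat_zeroI)
  have sym: "\<tau> x \<in> sym_mats" for x
    using \<tau> mpolys_value[OF _ subspace_sym_mats] unfolding polys_eq_mpolys by blast
  have off: "g i \<bullet> (\<tau> x *v g j) = 0" if ij: "i \<in> C" "j \<in> C" "i \<noteq> j" for i j
  proof -
    obtain q where q: "q \<in> spolys (k - 2)" "\<And>x. g i \<bullet> (\<tau> x *v g j) = lam i x * lam j x * q x"
      using bubble_factor[OF \<tau> ij nz] by blast
    have "(\<lambda>x. q x *\<^sub>R sprod (g i) (g j)) \<in> polys (k - 2) sym_mats"
      using q(1) unfolding polys_eq_mpolys by (intro mpolys_scalar_times sprod_sym subspace_sym_mats) auto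
    then have "J C (\<lambda>x. \<tau> x \<bullet> (q x *\<^sub>R sprod (g i) (g j))) = 0" by (rule mom)
    moreover have "(\<lambda>x. \<tau> x \<bullet> (q x *\<^sub>R sprod (g i) (g j))) = (\<lambda>x. 2 * (lam i x * lam j x) * (q x)\<^sup>2)"
      by (simp add: inner_sprod[OF sym] q(2) power2_eq_square fun_eq_iff)
    ultimately have z: "J C (\<lambda>x. (2 * (lam i x * lam j x)) * (q x)\<^sup>2) = 0" by simp
    have "q x = 0"
    proof (rule J_positive[OF subset_refl C_nonempty _ spolys_rpf[OF q(1)] _ _ z])
      show "real_polynomial_function (\<lambda>x. 2 * (lam i x * lam j x))"
        by (intro real_polynomial_function.intros(2,4) lam_rpf)
      show "x \<in> convex hull C \<Longrightarrow> 0 \<le> 2 * (lam i x * lam j x)" for x using ij by (simp add: convex_hull_eq)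
      show "(\<And>c. c \<in> C \<Longrightarrow> 0 < lam c x) \<Longrightarrow> 2 * (lam i x * lam j x) \<noteq> 0" for x using ij by (metis less_irrefl mult_eq_0_iff zero_neq_numeral)
    qed (simp add: flat_UNIV)
    then show ?thesis by (simp add: q(2))
  qed
  fix i j assume ij: "i \<in> C" "j \<in> C"
  show "g i \<bullet> (\<tau> x *v g j) = 0"
  proof (cases "i = j")
    case True
    have "0 = (\<Sum>c\<in>C. g c) \<bullet> (\<tau> x *v g j)" by (simp add: sum_g)
    also have "\<dots> = (\<Sum>c\<in>C. g c \<bullet> (\<tau> x *v g j))" by (simp add: inner_sum_left)
    also have "\<dots> = g j \<bullet> (\<tau> x *v g j)" using off ij finite_C by (subst sum.remove[of C j]) auto
    finally show ?thesis using True by simp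
  qed (use off ij in auto)
qed

text \<open>The divergence theorem is applied to each row multiplied by the matching component of
  \<open>v\<close>. The barycentric components \<open>(\<tau> x *v g c) $ i\<close> of the row are
  divisible by \<open>lam c\<close> because the normal trace vanishes, and they sum to zero because
  the gradients do.\<close>

lemma div_parts_interior:
  assumes \<tau>: "\<tau> \<in> polys k sym_mats"
    and nz: "\<And>c x. c \<in> C \<Longrightarrow> lam c x = 0 \<Longrightarrow> \<tau> x *v g c = 0"
    and v: "polynomial_function v"
  shows "J C (\<lambda>x. row_div \<tau> x \<bullet> v x) = - J C (\<lambda>x. \<tau> x \<bullet> symgrad v x)"
proof -
  have sym: "\<tau> x \<in> sym_mats" for x
    using \<tau> mpolys_value[OF _ subspace_sym_mats] unfolding polys_eq_mpolys by blast
  obtain c0 where c0: "c0 \<in> C" using C_nonempty by blast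
  have rt: "real_polynomial_function (\<lambda>x. \<tau> x $ i $ j)" for i j
    using linear_spolys[OF \<tau> linear_nth2] spolys_rpf by blast
  have rv: "real_polynomial_function (\<lambda>x. v x $ i)" for i
    using pf_linear[OF v linear_nth] by (simp add: real_polynomial_function_eq)
  have rtv: "real_polynomial_function (\<lambda>x. \<tau> x $ i $ j * v x $ i)" for i j using rt rv by auto
  have row: "J C (\<lambda>x. \<Sum>j\<in>UNIV. dd (axis j 1) (\<lambda>x. \<tau> x $ i $ j * v x $ i) x) = 0" for i
  proof -
    let ?\<beta> = "\<lambda>c x. (\<tau> x *v g c) $ i"
    have b: "?\<beta> c \<in> spolys k" for c
      by (rule linear_spolys[OF \<tau>, of "\<lambda>A. (A *v g c) $ i"])
         (simp add: linear_iff matrix_vector_mult_add_rdistrib flip: scaleR_matrix_vector_assoc)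
    have "\<forall>c\<in>C. \<exists>q. real_polynomial_function q \<and> (\<forall>x. ?\<beta> c x = lam c x * q x)"
    proof
      fix c assume c: "c \<in> C"
      have "\<exists>q\<in>spolys (k - 1). (\<forall>x. ?\<beta> c x = (a c + g c \<bullet> x) * q x) \<and> (k = 0 \<longrightarrow> q = (\<lambda>x. 0))"
        using nz[OF c] by (intro spolys_factor b g_nonzero[OF c]) (simp add: lam_def)
      then show "\<exists>q. real_polynomial_function q \<and> (\<forall>x. ?\<beta> c x = lam c x * q x)"
        using spolys_rpf by (auto simp: lam_def)
    qed
    then obtain q where q: "\<And>c. c \<in> C \<Longrightarrow> real_polynomial_function (q c)"
      "\<And>c x. c \<in> C \<Longrightarrow> ?\<beta> c x = lam c x * q c x" by metis
    have "J C (\<lambda>x. \<Sum>c\<in>C. dd (c - c0) (\<lambda>x. ?\<beta> c x * v x $ i) x) = 0"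
    proof (rule divergence_face[OF subset_refl c0 _ q(1)])
      show "(\<Sum>c\<in>C. ?\<beta> c x) = 0" for x
      proof -
        have "(\<Sum>c\<in>C. ?\<beta> c x) = (\<tau> x *v (\<Sum>c\<in>C. g c)) $ i"
          by (simp add: linear_sum[OF matrix_vector_mul_linear])
        then show ?thesis by (simp add: sum_g)
      qed
    qed (use b spolys_rpf q rv in auto)
    moreover have "(\<Sum>c\<in>C. dd (c - c0) (\<lambda>x. ?\<beta> c x * v x $ i) x) = (\<Sum>j\<in>UNIV. dd (axis j 1) (\<lambda>x. \<tau> x $ i $ j * v x $ i) x)" for x
    proof -
      have d: "(\<lambda>x. \<tau> x $ i $ j * v x $ i) differentiable (at x)" for j using rtv rpf_differentiable by blast
      \<comment> \<open>Derivatives are linear in the direction; expanding \<open>axis j 1\<close>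
        in the vectors \<open>c - c0\<close> will turn barycentric derivatives into coordinate
        derivatives.\<close>
      have "dd (c - c0) (\<lambda>x. ?\<beta> c x * v x $ i) x = (\<Sum>j\<in>UNIV. dd ((g c \<bullet> axis j 1) *\<^sub>R (c - c0)) (\<lambda>x. \<tau> x $ i $ j * v x $ i) x)" for c
      proof -
        have "(\<lambda>x. ?\<beta> c x * v x $ i) = (\<lambda>x. \<Sum>j\<in>UNIV. g c $ j * (\<tau> x $ i $ j * v x $ i))"
          by (simp add: matrix_vector_mult_def sum_distrib_left sum_distrib_right mult_ac fun_eq_iff)
        then show ?thesis using d by (simp add: dd_sum dd_scale differentiable_cmult_left_iff linear_scale[OF dd_linear[OF d]] inner_axis
              differentiable_mult)
      qed
      then have "(\<Sum>c\<in>C. dd (c - c0) (\<lambda>x. ?\<beta> c x * v x $ i) x) = 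
         (\<Sum>c\<in>C. \<Sum>j\<in>UNIV. dd ((g c \<bullet> axis j 1) *\<^sub>R (c - c0)) (\<lambda>x. \<tau> x $ i $ j * v x $ i) x)" by simp
      also have "\<dots> = (\<Sum>j\<in>UNIV. \<Sum>c\<in>C. dd ((g c \<bullet> axis j 1) *\<^sub>R (c - c0)) (\<lambda>x. \<tau> x $ i $ j * v x $ i) x)"
        by (rule sum.swap)
      also have "\<dots> = (\<Sum>j\<in>UNIV. dd (\<Sum>c\<in>C. (g c \<bullet> axis j 1) *\<^sub>R (c - c0)) (\<lambda>x. \<tau> x $ i $ j * v x $ i) x)"
        by (simp only: linear_sum[OF dd_linear[OF d]])
      finally show ?thesis by (simp only: sum_inner_g_diff)
    qed
    ultimately show ?thesis by simp
  qed
  have "0 = (\<Sum>i\<in>UNIV. J C (\<lambda>x. \<Sum>j\<in>UNIV. dd (axis j 1) (\<lambda>x. \<tau> x $ i $ j * v x $ i) x))"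
    using row by simp
  also have "\<dots> = J C (\<lambda>x. \<Sum>i\<in>UNIV. \<Sum>j\<in>UNIV. dd (axis j 1) (\<lambda>x. \<tau> x $ i $ j * v x $ i) x)"
    by (intro J_sum[OF subset_refl C_nonempty, symmetric] real_polynomial_function_sum rpf_dd rtv) simp
  also have "\<dots> = J C (\<lambda>x. row_div \<tau> x \<bullet> v x + \<tau> x \<bullet> symgrad v x)"
  proof -
    have "(\<Sum>i\<in>UNIV. \<Sum>j\<in>UNIV. dd (axis j 1) (\<lambda>x. \<tau> x $ i $ j * v x $ i) x) = row_div \<tau> x \<bullet> v x + \<tau> x \<bullet> symgrad v x" for x
    proof -
      have "(\<Sum>i\<in>UNIV. \<Sum>j\<in>UNIV. dd (axis j 1) (\<lambda>x. \<tau> x $ i $ j * v x $ i) x) = row_div \<tau> x \<bullet> v x + \<tau> x \<bullet> jac v x"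
        by (simp add: dd_mult rpf_differentiable[OF rt] rpf_differentiable[OF rv] sum.distrib inner_vec_def[of "row_div \<tau> x"]
          row_div_nth[OF polys_pf[OF \<tau>]] sum_distrib_right inner_mat jac_def)
      then show ?thesis using inner_symgrad[OF sym] by simp
    qed
    then show ?thesis by simp
  qed
  also have "\<dots> = J C (\<lambda>x. row_div \<tau> x \<bullet> v x) + J C (\<lambda>x. \<tau> x \<bullet> symgrad v x)"
  proof (rule J_add[OF subset_refl C_nonempty])
    show "real_polynomial_function (\<lambda>x. row_div \<tau> x \<bullet> v x)"
      using polys_pf[OF row_div_polys[OF \<tau>]] v by (rule rpf_inner)
    have "real_polynomial_function (\<lambda>x. (dd (axis j 1) (\<lambda>x. v x $ i) x + dd (axis i 1) (\<lambda>x. v x $ j) x) / 2)" for i j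
      by (intro real_polynomial_function_divide real_polynomial_function.intros(3) rpf_dd rv)
    then have "real_polynomial_function (\<lambda>x. \<Sum>i\<in>UNIV. \<Sum>j\<in>UNIV. \<tau> x $ i $ j * ((dd (axis j 1) (\<lambda>x. v x $ i) x + dd (axis i 1) (\<lambda>x. v x $ j) x) / 2))"
      by (intro real_polynomial_function_sum real_polynomial_function.intros(4) rt) auto
    then show "real_polynomial_function (\<lambda>x. \<tau> x \<bullet> symgrad v x)" by (simp add: inner_mat symgrad_nth)
  qed
  finally show ?thesis by simp
qed

lemma rigid_motion_pf: "w \<in> rigid_motions \<Longrightarrow> polynomial_function w"
  by (auto simp: rigid_motions_def intro!: polynomial_function_add polynomial_function_const 
      polynomial_function_bounded_linear[OF matrix_vector_mul_bounded_linear])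

lemma symgrad_rigid_motion: "w \<in> rigid_motions \<Longrightarrow> symgrad w x = 0"
proof -
  assume "w \<in> rigid_motions"
  then obtain b B where w: "w = (\<lambda>x. b + B *v x)" "B \<in> skew_mats" by (auto simp: rigid_motions_def)
  have "dd t (\<lambda>x. w x $ i) x = B $ i \<bullet> t" for t i
  proof -
    have "(\<lambda>x. w x $ i) = (\<lambda>x. b $ i + B $ i \<bullet> x)" by (simp add: w matrix_vector_mult_def inner_vec_def fun_eq_iff)
    then show ?thesis by (simp add: dd_affine)
  qed
  moreover have "B $ i $ j + B $ j $ i = 0" for i j using skew_mats_nth[OF w(2), of i j] by simp
  ultimately show ?thesis by (simp add: vec_eq_iff symgrad_nth inner_axis)
qed

text \<open>By parts, \<open>row_div \<tau>\<close> is orthogonal to the rigid motions, so it is one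
  of its own tests and vanishes. Then \<open>\<tau>\<close> is orthogonal to all symmetric gradients
  of polynomial fields, and together with the fields annihilating \<open>x\<close> these make up all
  tests.\<close>

lemma div_moments_interior:
  assumes \<tau>: "\<tau> \<in> polys k sym_mats"
    and nz: "\<And>c x. c \<in> C \<Longrightarrow> lam c x = 0 \<Longrightarrow> \<tau> x *v g c = 0"
    and k: "k \<ge> 2"
    and divmom: "\<And>q. q \<in> polys_mod_RM (k - 1) (convex hull C) \<Longrightarrow> J C (\<lambda>x. row_div \<tau> x \<bullet> q x) = 0"
    and mom: "\<And>s. s \<in> polys (k - 2) sym_mats \<Longrightarrow> (\<And>x. s x *v x = 0) \<Longrightarrow> J C (\<lambda>x. \<tau> x \<bullet> s x) = 0"
    and q: "q \<in> polys (k - 2) sym_mats"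
  shows "J C (\<lambda>x. \<tau> x \<bullet> q x) = 0"
proof -
  have d: "row_div \<tau> \<in> polys (k - 1) UNIV" by (rule row_div_polys[OF \<tau>])
  have "J C (\<lambda>x. row_div \<tau> x \<bullet> w x) = 0" if "w \<in> rigid_motions" for w
    using div_parts_interior[OF \<tau> nz rigid_motion_pf[OF that]] symgrad_rigid_motion[OF that] by simp
  then have "row_div \<tau> \<in> polys_mod_RM (k - 1) (convex hull C)"
    using d by (simp add: polys_mod_RM_def L2_inner_def meas_def)
  then have "J C (\<lambda>x. row_div \<tau> x \<bullet> row_div \<tau> x) = 0" by (rule divmom)
  then have div0: "row_div \<tau> x = 0" for x
    using J_norm_zero[OF subset_refl C_nonempty polys_pf[OF d], of x] by (simp add: flat_UNIV)
  obtain v s where vs: "v \<in> polys (Suc (k - 2)) UNIV" "s \<in> polys (k - 2) sym_mats" "\<And>x. s x *v x = 0"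
    "\<And>x. q x = symgrad v x + s x" using polys_sym_decompose[OF q] by blast
  have "J C (\<lambda>x. \<tau> x \<bullet> q x) = J C (\<lambda>x. \<tau> x \<bullet> symgrad v x) + J C (\<lambda>x. \<tau> x \<bullet> s x)"
    unfolding vs(4) inner_add_right
    by (intro J_add[OF subset_refl C_nonempty] rpf_inner polys_pf[OF \<tau>] polys_pf[OF symgrad_polys[OF vs(1)]] polys_pf[OF vs(2)])
  then show ?thesis using div_parts_interior[OF \<tau> nz polys_pf[OF vs(1)]] div0 mom[OF vs(2,3)] by simp
qed

end

section \<open>Tangential traces on facets\<close>

lemma linear_proj_normal: "linear (proj_normal n)"
  by (simp add: linear_iff proj_normal_def algebra_simps inner_add_right)

lemma proj_normal_idem: "n \<bullet> n = 1 \<Longrightarrow> proj_normal n (proj_normal n x) = proj_normal n x"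
  by (simp add: proj_normal_def inner_diff_right)

lemma inner_proj_normal: "n \<bullet> n = 1 \<Longrightarrow> n \<bullet> proj_normal n x = 0"
  by (simp add: proj_normal_def inner_diff_right)

lemma subspace_skew_on_tangent: "subspace (skew_on_tangent F)"
proof -
  have "skew_on_tangent F = skew_mats \<inter> (\<Inter>v\<in>(tangent_space F)\<^sup>\<bottom>. {A. A *v v = 0})"
    by (auto simp: skew_on_tangent_def)
  moreover have "subspace {A. A *v v = 0}" for v :: "real ^ 'a"
    by (auto simp: subspace_def matrix_vector_mult_add_rdistrib simp flip: scaleR_matrix_vector_assoc)
  ultimately show ?thesis by (auto intro!: subspace_inter subspace_skew_mats subspace_Inter)
qed

lemma dd_compose_linear:
  fixes p :: "'b::euclidean_space \<Rightarrow> real" and L :: "'a::euclidean_space \<Rightarrow> 'b"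
  assumes "p differentiable (at (L x))" "linear L"
  shows "dd t (\<lambda>x. p (L x)) x = dd (L t) p (L x)"
proof -
  have "(L has_derivative L) (at x)"
    using assms(2) by (simp add: linear_linear bounded_linear_imp_has_derivative)
  from has_derivative_compose[OF this dd_works[OF assms(1)]] show ?thesis by (rule dd_eqI)
qed

lemma skew_mats_inner2:
  fixes A :: "real ^ 'n ^ 'n"
  assumes "A \<in> skew_mats" shows "v \<bullet> (A *v w) = - (w \<bullet> (A *v v))"
proof -
  have "(v + w) \<bullet> (A *v (v + w)) = 0" by (rule skew_mats_inner[OF assms])
  then show ?thesis using skew_mats_inner[OF assms, of v] skew_mats_inner[OF assms, of w]
    by (simp add: matrix_vector_right_distrib inner_add_left inner_add_right)
qed

text \<open>The homotopy formula. The Jacobian applied to \<open>x\<close> is \<open>k w\<close> by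
  Euler's identity, and its transpose applied to \<open>x\<close> is the gradient of
  \<open>w \<bullet> x\<close> minus \<open>w\<close> by the product rule.\<close>

lemma koszul:
  fixes w :: "real ^ 'n \<Rightarrow> real ^ 'n"
  assumes w: "w \<in> hpolys k X"
  shows "(real k + 1) *\<^sub>R w x = (\<chi> i. dd (axis i 1) (\<lambda>x. w x \<bullet> x) x) + (jac w x - transpose (jac w x)) *v x"
proof -
  have sub: "w \<in> hpolys k UNIV" using w mpolys_mono[of "{\<alpha>. sum \<alpha> UNIV = k}" "{\<alpha>. sum \<alpha> UNIV = k}" UNIV X] 
    by (auto simp: hpolys_eq_mpolys)
  have pw: "polynomial_function w"
    using sub hpolys_subset_polys[of UNIV k] polys_pf by blast
  have d: "(\<lambda>x. w x $ j) differentiable (at x)" for j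
    using pf_linear[OF pw linear_nth[of j]] pf_differentiable by blast
  have "(real k + 1) * w x $ i = dd (axis i 1) (\<lambda>x. w x \<bullet> x) x + ((jac w x - transpose (jac w x)) *v x) $ i" for i
  proof -
    have "((jac w x - transpose (jac w x)) *v x) $ i
        = (\<Sum>j\<in>UNIV. x $ j * dd (axis j 1) (\<lambda>x. w x $ i) x) - (\<Sum>j\<in>UNIV. dd (axis i 1) (\<lambda>x. w x $ j) x * x $ j)"
      by (simp add: matrix_vector_mult_def jac_def transpose_def algebra_simps sum_subtractf)
    also have "(\<Sum>j\<in>UNIV. x $ j * dd (axis j 1) (\<lambda>x. w x $ i) x) = real k * w x $ i"
      using dd_axis_sum[OF d, of x i] euler_shpolys[OF linear_shpolys[OF w linear_nth]] by simp
    finally show ?thesis by (simp add: dd_inner_x[OF pw] inner_axis algebra_simps)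
  qed
  then show ?thesis by (simp add: vec_eq_iff)
qed

context barycentric
begin

text \<open>Used with \<open>k = d + 1\<close> for bubbles and with \<open>k = 2\<close> for the
  quadratic part. The space \<open>ND (k - 2)\<close> fits because it contains the tangential
  polynomials of degree \<open>k - 2\<close> and the skew part, which complements the gradients in
  degree \<open>k - 1\<close>. The hypothesis \<open>diag\<close> makes the trace tangential,
  \<open>off\<close> makes its barycentric components divisible by \<open>lam j\<close> on the
  facet.\<close>

lemma facet_unisolvent:
  assumes \<tau>: "\<tau> \<in> polys k sym_mats" and k: "k \<ge> 2" and c: "c \<in> C"
    and off: "\<And>j x. j \<in> C \<Longrightarrow> j \<noteq> c \<Longrightarrow> lam c x = 0 \<Longrightarrow> lam j x = 0 \<Longrightarrow> g j \<bullet> (\<tau> x *v g c) = 0"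
    and diag: "\<And>x. lam c x = 0 \<Longrightarrow> g c \<bullet> (\<tau> x *v g c) = 0"
    and n: "n \<bullet> n = 1" "g c = r *\<^sub>R n"
    and mom: "\<And>w. w \<in> ND (k - 2) (convex hull (C - {c})) n \<Longrightarrow>
       J (C - {c}) (\<lambda>x. proj_normal n (\<tau> x *v n) \<bullet> w x) = 0"
    and x: "lam c x = 0"
  shows "\<tau> x *v g c = 0"
proof -
  define S where "S = C - {c}"
  define F where "F = convex hull S"
  define T where "T = {t. g c \<bullet> t = 0}"
  define h where "h x = \<tau> x *v g c" for x
  let ?\<Pi> = "proj_normal n"
  have S: "S \<subseteq> C" "S \<noteq> {}" "finite S" "c \<notin> S" "C = insert c S"
    using finite_C c ex_other_vertex[OF c c] unfolding S_def by blast+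
  obtain c0 where c0: "c0 \<in> S" using S by blast
  have r0: "r \<noteq> 0" using g_nonzero[OF c] n by auto
  have fS: "x \<in> flat S \<longleftrightarrow> lam c x = 0" for x using c by (simp add: S_def flat_facet)
  have FS: "x \<in> F \<Longrightarrow> x \<in> flat S" for x using S by (simp add: F_def convex_hull_eq)
  have CS: "C - S = {c}" using c by (auto simp: S_def)
  have T: "tangent_space F = T" "t \<in> T \<longleftrightarrow> n \<bullet> t = 0" for t
    using r0 unfolding F_def tangent_space_face[OF S(1,2)] CS by (auto simp: T_def n(2))
  have subT: "subspace T" unfolding T(1)[symmetric] tangent_space_def by (rule subspace_span)
  have hn: "n \<bullet> h x = 0" if "lam c x = 0" for x
  proof -
    have "g c \<bullet> h x = 0" using diag[OF that] by (simp add: h_def)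
    then show ?thesis using r0 by (simp add: n(2))
  qed
  have hpoly: "(\<lambda>x. v \<bullet> h x) \<in> spolys k" for v
    unfolding h_def by (rule linear_spolys[OF \<tau> linear_inner_matrix_vector])
  have pfh: "polynomial_function h"
    unfolding h_def by (rule pf_linear[OF polys_pf[OF \<tau>] linear_matrix_vector])
  \<comment> \<open>For a tangential test the projection in the functional has no effect; the factor
    \<open>r\<close> converts the unit normal into \<open>g c\<close>.\<close>
  have mom': "J S (\<lambda>x. h x \<bullet> p x) = 0"
    if p: "restrict0 F p \<in> ND (k - 2) F n" and pn: "\<And>x. lam c x = 0 \<Longrightarrow> n \<bullet> p x = 0" for p
  proof -
    have "J S (\<lambda>x. h x \<bullet> p x) = J S (\<lambda>x. r * (proj_normal n (\<tau> x *v n) \<bullet> restrict0 F p x))"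
    proof (rule J_cong'[OF S(1)])
      fix x assume x: "x \<in> convex hull S"
      then have "n \<bullet> p x = 0" using FS fS pn by (simp add: F_def)
      then show "h x \<bullet> p x = r * (proj_normal n (\<tau> x *v n) \<bullet> restrict0 F p x)"
        using x by (simp add: h_def n(2) proj_normal_def restrict0_def F_def inner_diff_left matrix_vector_mult_scaleR)
    qed
    also have "\<dots> = r * J S (\<lambda>x. proj_normal n (\<tau> x *v n) \<bullet> restrict0 F p x)" by simp
    also have "\<dots> = 0" using mom p by (simp add: S_def F_def)
    finally show ?thesis .
  qed
  have tang: "J S (\<lambda>x. h x \<bullet> p x) = 0" if p: "p \<in> polys (k - 2) T" for p
  proof (rule mom')
    show "restrict0 F p \<in> ND (k - 2) F n"
      unfolding ND_def using p T(1) subspace_pointwise(5)[OF subspace_hpolys[OF subspace_skew_on_tangent[of F]], of "k - 2"]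
      by (intro CollectI exI[of _ p] exI[of _ "\<lambda>x. 0"]) auto
    show "n \<bullet> p x = 0" for x
      using mpolys_value[OF _ subT] p T(2) unfolding polys_eq_mpolys by blast
  qed
  have orth: "v \<in> T\<^sup>\<bottom> \<Longrightarrow> v = (n \<bullet> v) *\<^sub>R n" for v
  proof -
    assume v: "v \<in> T\<^sup>\<bottom>"
    have p: "proj_normal n v \<in> T" by (simp add: T(2) inner_proj_normal n)
    then have "proj_normal n v \<bullet> v = 0" using v by (auto simp: orthogonal_comp_def orthogonal_def)
    moreover have "proj_normal n v \<bullet> n = 0" using p T(2) by (simp add: inner_commute)
    ultimately have "proj_normal n v \<bullet> proj_normal n v = 0"
      by (subst (2) proj_normal_def) (simp add: inner_diff_right)
    then show ?thesis by (simp add: proj_normal_def)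
  qed
  have nT: "n \<in> T\<^sup>\<bottom>" using T(2) by (auto simp: orthogonal_comp_def orthogonal_def inner_commute)
  have skew: "J S (\<lambda>x. h x \<bullet> (A (?\<Pi> x) *v ?\<Pi> x)) = 0" if A: "A \<in> hpolys (k - 2) (skew_on_tangent F)" for A
  proof (rule mom')
    show "restrict0 F (\<lambda>x. A (?\<Pi> x) *v ?\<Pi> x) \<in> ND (k - 2) F n"
      unfolding ND_def using A T(1) subspace_pointwise(5)[OF subspace_polys[OF subT], of "k - 2"]
      by (intro CollectI exI[of _ "\<lambda>x. 0"] exI[of _ A]) auto
    have "A y \<in> skew_on_tangent F" for y
      using mpolys_value[OF _ subspace_skew_on_tangent] A unfolding hpolys_eq_mpolys by blast
    then have "A y \<in> skew_mats" "A y *v n = 0" for y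
      using nT T(1) by (auto simp: skew_on_tangent_def)
    then show "n \<bullet> (A (?\<Pi> x) *v ?\<Pi> x) = 0" for x
      using skew_mats_inner2[of "A (?\<Pi> x)" n] by simp
  qed
  let ?\<beta> = "\<lambda>j x. g j \<bullet> h x"
  have "\<forall>j\<in>S. \<exists>q\<in>spolys (k - 1). \<forall>x. lam c x = 0 \<longrightarrow> ?\<beta> j x = lam j x * q x"
  proof
    fix j assume j: "j \<in> S"
    then have "j \<in> C" "j \<noteq> c" by (auto simp: S_def)
    then show "\<exists>q\<in>spolys (k - 1). \<forall>x. lam c x = 0 \<longrightarrow> ?\<beta> j x = lam j x * q x"
      using off[of j] c by (intro factor_on_facet hpoly) (auto simp: h_def)
  qed
  then obtain q where q: "\<And>j. j \<in> S \<Longrightarrow> q j \<in> spolys (k - 1)"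
    "\<And>j x. j \<in> S \<Longrightarrow> lam c x = 0 \<Longrightarrow> ?\<beta> j x = lam j x * q j x" by metis
  have sum_\<beta>: "(\<Sum>j\<in>S. ?\<beta> j x *\<^sub>R (j - c0)) = h x" if "lam c x = 0" for x
  proof -
    have "g c \<bullet> h x = 0" using hn[OF that] n(2) by simp
    then have "(\<Sum>j\<in>S. ?\<beta> j x *\<^sub>R (j - c0)) = (\<Sum>j\<in>C. ?\<beta> j x *\<^sub>R (j - c0))"
      using S by simp
    then show ?thesis by (simp only: sum_inner_g_diff)
  qed
  have sum0: "(\<Sum>j\<in>S. ?\<beta> j x) = 0" if "lam c x = 0" for x
  proof -
    have "g c \<bullet> h x = 0" using hn[OF that] n(2) by simp
    then have "(\<Sum>j\<in>S. ?\<beta> j x) = (\<Sum>j\<in>C. g j) \<bullet> h x" using S by (simp add: inner_sum_left inner_add_left)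
    then show ?thesis by (simp add: sum_g)
  qed
  define \<delta> where "\<delta> x = (\<Sum>j\<in>S. dd (j - c0) (?\<beta> j) x)" for x
  have \<delta>: "\<delta> \<in> spolys (k - 1)"
    unfolding \<delta>_def[abs_def] using dd_spolys[OF hpoly] by (intro spolys_pointwise(6)) blast
  \<comment> \<open>Integration by parts on the facet; \<open>\<delta>\<close> is the divergence of
    the tangential field \<open>h\<close>.\<close>
  have parts: "J S (\<lambda>x. dd (h x) u x + u x * \<delta> x) = 0" if u: "real_polynomial_function u" for u
  proof -
    have "J S (\<lambda>x. \<Sum>j\<in>S. dd (j - c0) (\<lambda>x. ?\<beta> j x * u x) x) = 0"
    proof (rule divergence_face[OF S(1) c0 _ _ _ _ u, of _ q])
      show "real_polynomial_function (?\<beta> j)" for j by (rule spolys_rpf[OF hpoly])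
      show "j \<in> S \<Longrightarrow> real_polynomial_function (q j)" for j by (rule spolys_rpf[OF q(1)])
    qed (use q sum0 in \<open>auto simp: fS\<close>)
    also have "J S (\<lambda>x. \<Sum>j\<in>S. dd (j - c0) (\<lambda>x. ?\<beta> j x * u x) x) = J S (\<lambda>x. dd (h x) u x + u x * \<delta> x)"
    proof (rule J_cong[OF S(1)])
      fix x assume x: "x \<in> flat S"
      note du = rpf_differentiable[OF u, of x]
      have "(\<Sum>j\<in>S. dd (j - c0) (\<lambda>x. ?\<beta> j x * u x) x) = (\<Sum>j\<in>S. ?\<beta> j x * dd (j - c0) u x + dd (j - c0) (?\<beta> j) x * u x)"
        using spolys_differentiable[OF hpoly] du by (simp add: dd_mult)
      also have "\<dots> = dd (\<Sum>j\<in>S. ?\<beta> j x *\<^sub>R (j - c0)) u x + u x * \<delta> x"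
        by (simp add: sum.distrib \<delta>_def sum_distrib_left mult.commute linear_sum[OF dd_linear[OF du]] linear_scale[OF dd_linear[OF du]])
      finally show "(\<Sum>j\<in>S. dd (j - c0) (\<lambda>x. ?\<beta> j x * u x) x) = dd (h x) u x + u x * \<delta> x"
        using sum_\<beta> x by (simp add: fS)
    qed
    finally show ?thesis by simp
  qed
  have grad_pf: "polynomial_function (\<lambda>x. \<chi> i. dd (axis i 1) u x)" if "real_polynomial_function u" for u :: "real ^ 'n \<Rightarrow> real"
    unfolding polynomial_function_iff_Basis_inner using that by (auto simp: Basis_vec_def inner_axis intro: rpf_dd)
  have dd_grad: "dd t u x = t \<bullet> (\<chi> i. dd (axis i 1) u x)" if "real_polynomial_function u" for t u and x :: "real ^ 'n"
    using dd_axis_sum[OF rpf_differentiable[OF that], of t x] by (simp add: inner_vec_def)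
  have rpf_ddh: "real_polynomial_function (\<lambda>x. dd (h x) u x)" if "real_polynomial_function u" for u
  proof -
    have "(\<lambda>x. dd (h x) u x) = (\<lambda>x. h x \<bullet> (\<chi> i. dd (axis i 1) u x))" by (intro ext dd_grad that)
    then show ?thesis by (simp only: rpf_inner[OF pfh grad_pf[OF that]])
  qed
  have div0: "\<delta> x = 0" if "lam c x = 0" for x
  proof -
    note r\<delta> = spolys_rpf[OF \<delta>]
    \<comment> \<open>The tangential gradient of \<open>\<delta>\<close> has degree
      \<open>k - 2\<close> and is thus an admissible test; by parts, the integral of
      \<open>\<delta>\<^sup>2\<close> over the facet is zero.\<close>
    define p where "p x = ?\<Pi> (\<chi> i. dd (axis i 1) \<delta> x)" for x
    have "(\<lambda>x. \<chi> i. dd (axis i 1) \<delta> x) \<in> polys (k - 2) UNIV"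
      unfolding polys_eq_mpolys
      by (rule vec_mpolysI) (use dd_spolys[OF \<delta>] in \<open>auto simp: polys_eq_mpolys numeral_2_eq_2\<close>)
    then have "p \<in> polys (k - 2) T"
      unfolding p_def polys_eq_mpolys
      by (rule mpolys_linear[OF _ linear_proj_normal]) (auto simp: T(2) inner_proj_normal n)
    then have "J S (\<lambda>x. h x \<bullet> p x) = 0" by (rule tang)
    also have "J S (\<lambda>x. h x \<bullet> p x) = J S (\<lambda>x. dd (h x) \<delta> x)"
    proof (rule J_cong[OF S(1)])
      fix x assume "x \<in> flat S"
      then have "h x \<bullet> n = 0" using hn by (simp add: fS inner_commute)
      then have "h x \<bullet> p x = h x \<bullet> (\<chi> i. dd (axis i 1) \<delta> x)"
        by (simp add: p_def proj_normal_def inner_diff_right)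
      also have "\<dots> = dd (h x) \<delta> x" by (rule dd_grad[OF r\<delta>, symmetric])
      finally show "h x \<bullet> p x = dd (h x) \<delta> x" .
    qed
    finally have "J S (\<lambda>x. \<delta> x \<bullet> \<delta> x) = 0"
      using parts[OF r\<delta>] J_add[OF S(1,2) rpf_ddh[OF r\<delta>] rpf_inner[of \<delta> \<delta>]] r\<delta>
      by (simp add: real_polynomial_function_eq)
    then show ?thesis using J_norm_zero[OF S(1,2), of \<delta> x] r\<delta> that fS by (simp add: real_polynomial_function_eq)
  qed
  \<comment> \<open>From here on, gradients of polynomials of any degree are orthogonal to
    \<open>h\<close>.\<close>
  have grad0: "J S (\<lambda>x. dd (h x) u x) = 0" if "real_polynomial_function u" for u
  proof -
    have "J S (\<lambda>x. dd (h x) u x) = J S (\<lambda>x. dd (h x) u x + u x * \<delta> x)"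
      using div0 by (intro J_cong[OF S(1)]) (simp add: fS)
    then show ?thesis using parts[OF that] by simp
  qed
  \<comment> \<open>On the facet \<open>h x \<bullet> v x\<close> is the sum of the
    \<open>lam j x * (q j x)\<^sup>2\<close>. The degree of \<open>v\<close> is one too high for the
    tangential polynomials, so its top part needs the Koszul formula.\<close>
  define v where "v x = (\<Sum>j\<in>S. q j x *\<^sub>R ?\<Pi> (g j))" for x
  have v: "v \<in> polys (k - 1) T"
    unfolding v_def[abs_def] polys_eq_mpolys
    using q(1) by (intro mpolys_sum subT mpolys_scalar_times) (auto simp: polys_eq_mpolys T(2) inner_proj_normal n)
  \<comment> \<open>On the plane of the facet \<open>n \<bullet> x = s\<close>. Writing
    \<open>x\<close> there as \<open>?\<Pi> x + s *\<^sub>R n\<close> makes \<open>v\<close> a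
    polynomial in the coordinate \<open>?\<Pi> x\<close>, with respect to which the homogeneous top
    part is taken.\<close>
  define s where "s = - a c / r"
  define v' where "v' x = v (?\<Pi> x + s *\<^sub>R n)" for x
  have \<Pi>x: "?\<Pi> x + s *\<^sub>R n = x" if "lam c x = 0" for x
  proof -
    have "n \<bullet> x = s" using that r0 by (simp add: lam_def n(2) s_def field_simps add_eq_0_iff)
    then show ?thesis by (simp add: proj_normal_def)
  qed
  have \<Pi>1: "(\<lambda>x. ?\<Pi> x $ i) \<in> shpolys 1" for i
  proof -
    have "(\<lambda>x. x $ i - n $ i * (n \<bullet> x)) \<in> shpolys 1"
      by (intro shpolys_pointwise(2) shpolys_scale coord_shpolys inner_shpolys)
    then show ?thesis by (simp add: proj_normal_def mult.commute)
  qed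
  have v': "v' \<in> polys (k - 1) T"
    unfolding polys_eq_mpolys
  proof (rule mpolys_valued[OF subT vec_mpolysI])
    fix i
    have "(\<lambda>x. (?\<Pi> x + s *\<^sub>R n) $ i) \<in> spolys 1" for i
      using \<Pi>1[of i] hpolys_subset_polys[of UNIV 1] const_polys[of UNIV "s * n $ i" 1]
      by (auto intro!: spolys_pointwise(1))
    then have "(\<lambda>x. v (?\<Pi> x + s *\<^sub>R n) $ i) \<in> spolys (k - 1)"
      by (rule spolys_compose_affine[OF linear_spolys[OF v linear_nth]])
    then show "(\<lambda>x. v' x $ i) \<in> mpolys {\<alpha>. sum \<alpha> UNIV \<le> k - 1} UNIV"
      by (simp add: v'_def polys_eq_mpolys)
    show "v' x \<in> T" for x
      using mpolys_value[OF _ subT] v unfolding v'_def polys_eq_mpolys by blast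
  qed simp
  have "k - 1 = Suc (k - 2)" using k by simp
  then obtain lo hi where lohi: "lo \<in> polys (k - 2) T" "hi \<in> hpolys (k - 1) T" "v' = (\<lambda>x. lo x + hi x)"
    using polys_hpolys_decompose[of v' "k - 2" T] v' by auto
  define lo' hi' where "lo' x = lo (?\<Pi> x)" and "hi' x = hi (?\<Pi> x)" for x
  have lo': "lo' \<in> polys (k - 2) T"
    unfolding polys_eq_mpolys
  proof (rule mpolys_valued[OF subT vec_mpolysI])
    have "(\<lambda>x. ?\<Pi> x $ i) \<in> spolys 1" for i using \<Pi>1[of i] hpolys_subset_polys[of UNIV 1] by auto
    then have "(\<lambda>x. lo (?\<Pi> x) $ i) \<in> spolys (k - 2)" for i
      by (rule spolys_compose_affine[OF linear_spolys[OF lohi(1) linear_nth]])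
    then show "(\<lambda>x. lo' x $ i) \<in> mpolys {\<alpha>. sum \<alpha> UNIV \<le> k - 2} UNIV" for i
      by (simp add: lo'_def polys_eq_mpolys)
    show "lo' x \<in> T" for x
      using mpolys_value[OF _ subT] lohi(1) unfolding lo'_def polys_eq_mpolys by blast
  qed simp
  have hi': "hi' \<in> hpolys (k - 1) T"
    unfolding hpolys_eq_mpolys
  proof (rule mpolys_valued[OF subT vec_mpolysI])
    show "(\<lambda>x. hi' x $ i) \<in> mpolys {\<alpha>. sum \<alpha> UNIV = k - 1} UNIV" for i
      using shpolys_compose_linear[OF linear_shpolys[OF lohi(2) linear_nth] \<Pi>1] by (simp add: hi'_def hpolys_eq_mpolys)
    show "hi' x \<in> T" for x
      using mpolys_value[OF _ subT] lohi(2) unfolding hi'_def hpolys_eq_mpolys by blast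
  qed simp
  have pfhi: "polynomial_function hi'"
    using hi' hpolys_subset_polys[of T "k - 1"] subspace_0[OF subT] polys_pf by blast
  have hiT: "n \<bullet> hi' x = 0" for x
    using mpolys_value[OF _ subT] hi' T(2) unfolding hpolys_eq_mpolys by blast
  define \<phi> where "\<phi> x = hi' x \<bullet> x" for x
  have r\<phi>: "real_polynomial_function \<phi>" unfolding \<phi>_def by (rule rpf_inner[OF pfhi polynomial_function_id])
  \<comment> \<open>The exterior derivative of the top part. It annihilates \<open>n\<close> because
    \<open>hi'\<close> is tangential and depends on \<open>?\<Pi> x\<close> only.\<close>
  define A where "A x = jac hi' x - transpose (jac hi' x)" for x
  have dhi: "(\<lambda>x. hi' x $ j) differentiable (at x)" for j x
    using pf_linear[OF pfhi linear_nth[of j]] pf_differentiable by blast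
  have A: "A \<in> hpolys (k - 2) (skew_on_tangent F)"
    unfolding hpolys_eq_mpolys
  proof (rule mpolys_valued[OF subspace_skew_on_tangent mat_mpolysI])
    fix i j
    have "dd t (\<lambda>x. hi' x $ i) \<in> shpolys (k - 2)" for i t
      using dd_shpolys[OF linear_shpolys[OF hi' linear_nth], of t i] by (simp add: numeral_2_eq_2)
    then have "(\<lambda>x. dd (axis j 1) (\<lambda>x. hi' x $ i) x - dd (axis i 1) (\<lambda>x. hi' x $ j) x) \<in> shpolys (k - 2)"
      by (intro shpolys_pointwise(2))
    then show "(\<lambda>x. A x $ i $ j) \<in> mpolys {\<alpha>. sum \<alpha> UNIV = k - 2} UNIV"
      by (simp add: A_def jac_def transpose_def hpolys_eq_mpolys)
  next
    fix x
    have "A x *v n = 0"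
    proof -
      have "(A x *v n) $ i = 0" for i
      proof -
        have "(A x *v n) $ i = (\<Sum>j\<in>UNIV. n $ j * dd (axis j 1) (\<lambda>x. hi' x $ i) x) - (\<Sum>j\<in>UNIV. n $ j * dd (axis i 1) (\<lambda>x. hi' x $ j) x)"
          by (simp add: matrix_vector_mult_def A_def jac_def transpose_def algebra_simps sum_subtractf)
        also have "(\<Sum>j\<in>UNIV. n $ j * dd (axis j 1) (\<lambda>x. hi' x $ i) x) = dd n (\<lambda>x. hi' x $ i) x"
          by (simp add: dd_axis_sum[OF dhi, of n])
        also have "\<dots> = 0"
        proof -
          have "(\<lambda>x. hi' x $ i) = (\<lambda>x. (\<lambda>y. hi' y $ i) (?\<Pi> x))" by (simp add: hi'_def proj_normal_idem[OF n(1)])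
          then have "dd n (\<lambda>x. hi' x $ i) x = dd n (\<lambda>x. (\<lambda>y. hi' y $ i) (?\<Pi> x)) x" by simp
          also have "\<dots> = dd (?\<Pi> n) (\<lambda>x. hi' x $ i) (?\<Pi> x)"
            by (rule dd_compose_linear[OF dhi linear_proj_normal])
          also have "?\<Pi> n = 0" using n by (simp add: proj_normal_def)
          also have "dd 0 (\<lambda>x. hi' x $ i) (?\<Pi> x) = 0" by (rule linear_0[OF dd_linear[OF dhi]])
          finally show ?thesis .
        qed
        also have "(\<Sum>j\<in>UNIV. n $ j * dd (axis i 1) (\<lambda>x. hi' x $ j) x) = dd (axis i 1) (\<lambda>x. \<Sum>j\<in>UNIV. n $ j * hi' x $ j) x"
          using dhi by (simp add: dd_sum dd_scale differentiable_mult)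
        also have "(\<lambda>x. \<Sum>j\<in>UNIV. n $ j * hi' x $ j) = (\<lambda>x. 0)" using hiT by (simp add: inner_vec_def fun_eq_iff)
        finally show ?thesis by (simp add: dd_const)
      qed
      then show ?thesis by (simp add: vec_eq_iff)
    qed
    moreover have "A x \<in> skew_mats" by (simp add: A_def skew_mats_def transpose_def vec_eq_iff)
    ultimately show "A x \<in> skew_on_tangent F"
      unfolding skew_on_tangent_def T(1) using orth
      by (auto simp: matrix_vector_mult_scaleR) (metis matrix_vector_mult_scaleR scaleR_zero_right)
  qed simp
  have "J S (\<lambda>x. h x \<bullet> v x) = J S (\<lambda>x. h x \<bullet> lo' x + h x \<bullet> hi' x)"
  proof (rule J_cong[OF S(1)])
    fix x assume "x \<in> flat S"
    then have e: "?\<Pi> x + s *\<^sub>R n = x" using \<Pi>x fS by blast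
    have "v x = v' (?\<Pi> x)" unfolding v'_def using proj_normal_idem[of n x] n e by simp
    also have "\<dots> = lo' x + hi' x" using lohi(3) by (simp add: lo'_def hi'_def)
    finally show "h x \<bullet> v x = h x \<bullet> lo' x + h x \<bullet> hi' x" by (simp add: inner_add_right)
  qed
  also have "\<dots> = J S (\<lambda>x. h x \<bullet> lo' x) + J S (\<lambda>x. h x \<bullet> hi' x)"
    by (intro J_add S rpf_inner pfh pfhi polys_pf[OF lo'])
  also have "J S (\<lambda>x. h x \<bullet> lo' x) = 0" by (rule tang[OF lo'])
  also have "J S (\<lambda>x. h x \<bullet> hi' x) = 0"
  proof -
    \<comment> \<open>The Koszul formula in degree \<open>k - 1\<close>, whence the factor
      \<open>k\<close>. The gradient of \<open>\<phi> \<circ> ?\<Pi>\<close> is removed by the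
      vanishing divergence, the skew part by the functionals.\<close>
    have "J S (\<lambda>x. real k * (h x \<bullet> hi' x)) = J S (\<lambda>x. dd (h x) (\<lambda>x. \<phi> (?\<Pi> x)) x + h x \<bullet> (A (?\<Pi> x) *v ?\<Pi> x))"
    proof (rule J_cong[OF S(1)])
      fix x assume x: "x \<in> flat S"
      have "hi' x = hi' (?\<Pi> x)" by (simp add: hi'_def proj_normal_idem[OF n(1)])
      then have "real k *\<^sub>R hi' x = (real (k - 1) + 1) *\<^sub>R hi' (?\<Pi> x)" using k by (simp add: of_nat_diff)
      also have "\<dots> = (\<chi> i. dd (axis i 1) \<phi> (?\<Pi> x)) + A (?\<Pi> x) *v ?\<Pi> x"
        unfolding A_def \<phi>_def by (rule koszul[OF hi'])
      finally have "real k * (h x \<bullet> hi' x) = h x \<bullet> (\<chi> i. dd (axis i 1) \<phi> (?\<Pi> x)) + h x \<bullet> (A (?\<Pi> x) *v ?\<Pi> x)"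
        by (metis inner_add_right inner_scaleR_right)
      also have "h x \<bullet> (\<chi> i. dd (axis i 1) \<phi> (?\<Pi> x)) = dd (h x) \<phi> (?\<Pi> x)" by (rule dd_grad[OF r\<phi>, symmetric])
      also have "h x = ?\<Pi> (h x)" using hn x fS by (simp add: proj_normal_def)
      also have "dd (?\<Pi> (h x)) \<phi> (?\<Pi> x) = dd (h x) (\<lambda>x. \<phi> (?\<Pi> x)) x"
        by (rule dd_compose_linear[OF rpf_differentiable[OF r\<phi>] linear_proj_normal, symmetric])
      finally show "real k * (h x \<bullet> hi' x) = dd (h x) (\<lambda>x. \<phi> (?\<Pi> x)) x + h x \<bullet> (A (?\<Pi> x) *v ?\<Pi> x)"
        using \<open>h x = ?\<Pi> (h x)\<close> by simp
    qed
    also have "\<dots> = J S (\<lambda>x. dd (h x) (\<lambda>x. \<phi> (?\<Pi> x)) x) + J S (\<lambda>x. h x \<bullet> (A (?\<Pi> x) *v ?\<Pi> x))"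
    proof (intro J_add S rpf_ddh rpf_inner pfh)
      have "(\<lambda>x. \<phi> (?\<Pi> x)) = \<phi> \<circ> ?\<Pi>" by (simp add: comp_def)
      then show "real_polynomial_function (\<lambda>x. \<phi> (?\<Pi> x))"
        using real_polynomial_function_compose[OF pf_linear[OF polynomial_function_id linear_proj_normal] r\<phi>] by simp
      have rA: "real_polynomial_function (\<lambda>x. A (?\<Pi> x) $ i $ j)" for i j
        by (rule spolys_rpf[of _ "k - 2"])
           (use shpolys_compose_linear[OF linear_shpolys[OF A linear_nth2] \<Pi>1] hpolys_subset_polys[of UNIV "k - 2"] in auto)
      have r\<Pi>: "real_polynomial_function (\<lambda>x. ?\<Pi> x $ j)" for j
        by (rule spolys_rpf[of _ 1]) (use \<Pi>1[of j] hpolys_subset_polys[of UNIV 1] in auto)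
      have "real_polynomial_function (\<lambda>x. \<Sum>j\<in>UNIV. A (?\<Pi> x) $ i $ j * ?\<Pi> x $ j)" for i
        by (intro real_polynomial_function_sum real_polynomial_function.intros(4) rA r\<Pi>) simp
      then show "polynomial_function (\<lambda>x. A (?\<Pi> x) *v ?\<Pi> x)"
        unfolding polynomial_function_iff_Basis_inner by (auto simp: Basis_vec_def inner_axis matrix_vector_mult_def)
    qed
    also have "J S (\<lambda>x. dd (h x) (\<lambda>x. \<phi> (?\<Pi> x)) x) = 0"
    proof (rule grad0)
      have "(\<lambda>x. \<phi> (?\<Pi> x)) = \<phi> \<circ> ?\<Pi>" by (simp add: comp_def)
      then show "real_polynomial_function (\<lambda>x. \<phi> (?\<Pi> x))"
        using real_polynomial_function_compose[OF pf_linear[OF polynomial_function_id linear_proj_normal] r\<phi>] by simp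
    qed
    also have "J S (\<lambda>x. h x \<bullet> (A (?\<Pi> x) *v ?\<Pi> x)) = 0" by (rule skew[OF A])
    finally show ?thesis using k by simp
  qed
  also have "J S (\<lambda>x. h x \<bullet> v x) = J S (\<lambda>x. \<Sum>j\<in>S. lam j x * (q j x)\<^sup>2)"
  proof (rule J_cong[OF S(1)])
    fix x assume x: "x \<in> flat S"
    have "h x \<bullet> n = 0" using hn x by (simp add: fS inner_commute)
    then have "h x \<bullet> ?\<Pi> (g j) = ?\<beta> j x" for j
      by (simp add: proj_normal_def inner_diff_right inner_commute)
    then show "h x \<bullet> v x = (\<Sum>j\<in>S. lam j x * (q j x)\<^sup>2)"
      using q(2) x by (simp add: v_def inner_sum_right fS power2_eq_square mult_ac)
  qed
  finally have z: "J S (\<lambda>x. \<Sum>j\<in>S. lam j x * (q j x)\<^sup>2) = 0" by simp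
  have q0: "q j x = 0" if j: "j \<in> S" and x: "x \<in> flat S" for j x
  proof (rule rpf_zero_flat[OF S(1,2) spolys_rpf[OF q(1)[OF j]] _ x])
    fix x assume x: "x \<in> flat S" "\<And>c. c \<in> S \<Longrightarrow> 0 < lam c x"
    have "real_polynomial_function (\<lambda>x. \<Sum>j\<in>S. lam j x * (q j x)\<^sup>2)"
      using S(3) spolys_rpf[OF q(1)]
      by (intro real_polynomial_function_sum real_polynomial_function.intros(4) lam_rpf real_polynomial_function_power)
    then have "(\<Sum>j\<in>S. lam j x * (q j x)\<^sup>2) = 0"
      by (rule J_positive_point[OF S(1,2) _ _ z x]) (use S(1) in \<open>auto simp: convex_hull_eq intro!: sum_nonneg mult_nonneg_nonneg\<close>)
    moreover have "0 \<le> lam i x * (q i x)\<^sup>2" if "i \<in> S" for i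
      using x(2)[OF that] by (simp add: less_imp_le)
    ultimately have "lam j x * (q j x)\<^sup>2 = 0"
      using S(3) j by (subst (asm) sum_nonneg_eq_0_iff) blast+
    then show "q j x = 0" using x(2)[OF j] by auto
  qed
  have "h x = (\<Sum>j\<in>S. ?\<beta> j x *\<^sub>R (j - c0))" using sum_\<beta>[OF x] by simp
  also have "\<dots> = 0" using q0 q(2) x by (simp add: fS)
  finally show ?thesis by (simp add: h_def)
qed

end

section \<open>Unisolvence as nondegeneracy on both sides\<close>

lemma functional_sum:
  fixes L :: "'a::real_vector \<Rightarrow> real"
  assumes V: "subspace V"
    and add: "\<And>x y. x \<in> V \<Longrightarrow> y \<in> V \<Longrightarrow> L (x + y) = L x + L y"
    and scale: "\<And>x r. x \<in> V \<Longrightarrow> L (r *\<^sub>R x) = r * L x"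
    and "finite A" "\<And>i. i \<in> A \<Longrightarrow> X i \<in> V"
  shows "L (\<Sum>i\<in>A. c i *\<^sub>R X i) = (\<Sum>i\<in>A. c i * L (X i))"
  using assms(4,5)
proof (induction A rule: finite_induct)
  case empty
  show ?case using scale[OF subspace_0[OF V], of 0] by simp
next
  case (insert b A)
  then have "(\<Sum>i\<in>A. c i *\<^sub>R X i) \<in> V" "X b \<in> V" using V by (auto intro!: subspace_sum subspace_scale)
  then show ?case using insert add scale subspace_scale[OF V] by simp
qed

text \<open>Induction on the number of functionals. For a new index \<open>k\<close> some
  \<open>x\<close> has \<open>L k x\<close> different from the value predicted by its old
  components, since otherwise \<open>L k\<close> would be a combination of the others; subtracting
  these components leaves a vector seen by \<open>L k\<close> alone.\<close>

lemma dual_family: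
  fixes L :: "'i \<Rightarrow> 'a::real_vector \<Rightarrow> real"
  assumes "finite I" "subspace V"
    and "\<And>i x y. i \<in> I \<Longrightarrow> x \<in> V \<Longrightarrow> y \<in> V \<Longrightarrow> L i (x + y) = L i x + L i y"
    and "\<And>i x r. i \<in> I \<Longrightarrow> x \<in> V \<Longrightarrow> L i (r *\<^sub>R x) = r * L i x"
    and "\<And>u. (\<And>x. x \<in> V \<Longrightarrow> (\<Sum>i\<in>I. u i * L i x) = 0) \<Longrightarrow> (\<And>i. i \<in> I \<Longrightarrow> u i = 0)"
  shows "\<exists>X. (\<forall>i\<in>I. X i \<in> V) \<and> (\<forall>i\<in>I. \<forall>j\<in>I. L j (X i) = (if i = j then 1 else 0))"
  using assms
proof (induction I rule: finite_induct)
  case empty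
  then show ?case by simp
next
  case (insert k I)
  note V = insert.prems(1) and add = insert.prems(2) and scale = insert.prems(3) and nd = insert.prems(4)
  have ik: "i \<in> I \<Longrightarrow> i \<noteq> k" for i using insert.hyps by auto
  have "\<exists>X. (\<forall>i\<in>I. X i \<in> V) \<and> (\<forall>i\<in>I. \<forall>j\<in>I. L j (X i) = (if i = j then 1 else 0))"
  proof (rule insert.IH[OF V])
    show "u i = 0" if u: "\<And>x. x \<in> V \<Longrightarrow> (\<Sum>i\<in>I. u i * L i x) = 0" and i: "i \<in> I" for u i
    proof -
      have "(\<Sum>j\<in>insert k I. (u(k := 0)) j * L j x) = 0" if "x \<in> V" for x
      proof -
        have "(\<Sum>j\<in>I. (u(k := 0)) j * L j x) = (\<Sum>j\<in>I. u j * L j x)"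
          using ik by (intro sum.cong) auto
        then show ?thesis using u[OF that] insert.hyps by simp
      qed
      then have "(u(k := 0)) i = 0" using nd[of "u(k := 0)" i] i by blast
      then show ?thesis using ik[OF i] by simp
    qed
  qed (use add scale in auto)
  then obtain X where X: "\<And>i. i \<in> I \<Longrightarrow> X i \<in> V" 
    "\<And>i j. i \<in> I \<Longrightarrow> j \<in> I \<Longrightarrow> L j (X i) = (if i = j then 1 else 0)" by blast
  have sumL: "L j (\<Sum>i\<in>I. c i *\<^sub>R X i) = (\<Sum>i\<in>I. c i * L j (X i))" if "j \<in> insert k I" for j c
    using X(1) by (intro functional_sum[OF V add[OF that] scale[OF that] insert.hyps(1)])
  have "\<exists>x\<in>V. L k x \<noteq> (\<Sum>i\<in>I. L k (X i) * L i x)"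
  proof (rule ccontr)
    assume "\<not> ?thesis"
    then have *: "L k x = (\<Sum>i\<in>I. L k (X i) * L i x)" if "x \<in> V" for x using that by blast
    let ?u = "\<lambda>i. if i = k then 1 else - L k (X i)"
    have "(\<Sum>i\<in>insert k I. ?u i * L i x) = 0" if "x \<in> V" for x
    proof -
      have "(\<Sum>i\<in>I. ?u i * L i x) = (\<Sum>i\<in>I. - (L k (X i) * L i x))"
        using ik by (intro sum.cong) auto
      then show ?thesis using *[OF that] insert.hyps by (simp add: sum_negf)
    qed
    then have "?u k = 0" using nd[of ?u k] by blast
    then show False by simp
  qed
  then obtain x where x: "x \<in> V" "L k x \<noteq> (\<Sum>i\<in>I. L k (X i) * L i x)" by blast
  define y where "y = x + (\<Sum>i\<in>I. (- L i x) *\<^sub>R X i)"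
  have sV: "(\<Sum>i\<in>I. c i *\<^sub>R X i) \<in> V" for c using X V by (auto intro!: subspace_sum subspace_scale)
  have y: "y \<in> V" unfolding y_def by (rule subspace_add[OF V x(1) sV])
  have Ly: "L j y = L j x + (\<Sum>i\<in>I. - L i x * L j (X i))" if "j \<in> insert k I" for j
    unfolding y_def by (subst add[OF that x(1) sV]) (simp only: sumL[OF that])
  have Lj: "L j y = 0" if "j \<in> I" for j
  proof -
    have "(\<Sum>i\<in>I. - L i x * L j (X i)) = (\<Sum>i\<in>I. if i = j then - L i x else 0)"
      using X(2) that by (intro sum.cong) auto
    then show ?thesis using Ly[of j] that insert.hyps by simp
  qed
  have Lk: "L k y \<noteq> 0"
    using x(2) Ly[of k] by (simp add: sum_negf mult.commute)
  define z where "z = (1 / L k y) *\<^sub>R y"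
  have z: "z \<in> V" "L k z = 1" "\<And>j. j \<in> I \<Longrightarrow> L j z = 0"
    using y V Lk Lj scale by (auto simp: z_def subspace_scale)
  \<comment> \<open>The old vectors are corrected by multiples of \<open>z\<close> so that
    \<open>L k\<close> vanishes on them; the other functionals do not see the correction.\<close>
  define X' where "X' i = (if i = k then z else X i + (- L k (X i)) *\<^sub>R z)" for i
  have szV: "r *\<^sub>R z \<in> V" for r using z(1) V by (rule subspace_scale[rotated])
  have 1: "\<forall>i\<in>insert k I. X' i \<in> V"
    using X(1) z(1) szV V by (auto simp: X'_def intro!: subspace_add simp del: scaleR_minus_left)
  have 2: "L j (X' i) = (if i = j then 1 else 0)" if "i \<in> insert k I" "j \<in> insert k I" for i j
  proof (cases "i = k")
    case True
    then show ?thesis using that z by (auto simp: X'_def)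
  next
    case False
    then have i: "i \<in> I" using that by auto
    have "L j (X' i) = L j (X i) - L k (X i) * L j z"
      using False add[OF that(2) X(1)[OF i] szV] scale[OF that(2) z(1)] by (simp add: X'_def del: scaleR_minus_left)
    then show ?thesis using that(2) i False X(2)[of i j] z ik by (auto split: if_splits)
  qed
  show ?case using 1 2 by blast
qed

lemma subspace_dual_space: "subspace (dual_space V)"
  by (auto simp: subspace_def dual_space_def scaleR_fun_def algebra_simps)

text \<open>The family biorthogonal to the functionals spans \<open>V\<close> because of
  \<open>left\<close>. It is therefore a basis, so the number of functionals is the dimension, and
  an arbitrary dual element is expanded with its values on this basis.\<close>

lemma unisolventI:
  fixes L :: "'i \<Rightarrow> 'a::real_vector \<Rightarrow> real"
  assumes I: "finite I" and V: "subspace V"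
    and add: "\<And>i x y. i \<in> I \<Longrightarrow> x \<in> V \<Longrightarrow> y \<in> V \<Longrightarrow> L i (x + y) = L i x + L i y"
    and scale: "\<And>i x r. i \<in> I \<Longrightarrow> x \<in> V \<Longrightarrow> L i (r *\<^sub>R x) = r * L i x"
    and left: "\<And>x. x \<in> V \<Longrightarrow> (\<And>i. i \<in> I \<Longrightarrow> L i x = 0) \<Longrightarrow> x = 0"
    and right: "\<And>u. (\<And>x. x \<in> V \<Longrightarrow> (\<Sum>i\<in>I. u i * L i x) = 0) \<Longrightarrow> (\<And>i. i \<in> I \<Longrightarrow> u i = 0)"
  shows "unisolvent I L V"
proof -
  have "\<exists>X. (\<forall>i\<in>I. X i \<in> V) \<and> (\<forall>i\<in>I. \<forall>j\<in>I. L j (X i) = (if i = j then 1 else 0))"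
  proof (rule dual_family[OF I V])
    show "u i = 0" if "\<And>x. x \<in> V \<Longrightarrow> (\<Sum>i\<in>I. u i * L i x) = 0" "i \<in> I" for u i
      by (rule right[of u, OF that])
  qed (use add scale in auto)
  then obtain X where X: "\<And>i. i \<in> I \<Longrightarrow> X i \<in> V" 
    "\<And>i j. i \<in> I \<Longrightarrow> j \<in> I \<Longrightarrow> L j (X i) = (if i = j then 1 else 0)" by blast
  have sumL: "L j (\<Sum>i\<in>I. c i *\<^sub>R X i) = (\<Sum>i\<in>I. c i * L j (X i))" if "j \<in> I" for j c
    using X(1) by (intro functional_sum[OF V add[OF that] scale[OF that] I])
  have sV: "(\<Sum>i\<in>I. c i *\<^sub>R X i) \<in> V" for c using X V by (auto intro!: subspace_sum subspace_scale)
  have Lsum: "L j (\<Sum>i\<in>I. c i *\<^sub>R X i) = c j" if "j \<in> I" for c j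
  proof -
    have "L j (\<Sum>i\<in>I. c i *\<^sub>R X i) = (\<Sum>i\<in>I. if i = j then c i else 0)"
      using sumL[OF that] X(2) that by (auto intro!: sum.cong)
    then show ?thesis using that I by simp
  qed
  have repr: "x = (\<Sum>i\<in>I. L i x *\<^sub>R X i)" if x: "x \<in> V" for x
  proof -
    have "x + (-1) *\<^sub>R (\<Sum>i\<in>I. L i x *\<^sub>R X i) = 0"
    proof (rule left)
      show "x + (-1) *\<^sub>R (\<Sum>i\<in>I. L i x *\<^sub>R X i) \<in> V" by (intro subspace_add subspace_scale V x sV)
      fix j assume j: "j \<in> I"
      have "L j (x + (-1) *\<^sub>R (\<Sum>i\<in>I. L i x *\<^sub>R X i)) = L j x + (-1) * L j (\<Sum>i\<in>I. L i x *\<^sub>R X i)"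
        by (simp only: add[OF j x subspace_scale[OF V sV]] scale[OF j sV])
      then show "L j (x + (-1) *\<^sub>R (\<Sum>i\<in>I. L i x *\<^sub>R X i)) = 0" using Lsum[OF j] by simp
    qed
    then show ?thesis by simp
  qed
  let ?\<Phi> = "\<lambda>i. restrict0 V (L i)"
  have inj: "inj_on ?\<Phi> I"
  proof (rule inj_onI)
    fix i j assume ij: "i \<in> I" "j \<in> I" "?\<Phi> i = ?\<Phi> j"
    have "?\<Phi> i (X i) = ?\<Phi> j (X i)" by (rule fun_cong[OF ij(3)])
    then have "L i (X i) = L j (X i)" using X(1)[OF ij(1)] by (simp add: restrict0_def)
    then show "i = j" using X(2) ij by (auto split: if_splits)
  qed
  have dual: "?\<Phi> i \<in> dual_space V" if "i \<in> I" for i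
    unfolding dual_space_def restrict0_def using add[OF that] scale[OF that] subspace_add[OF V] subspace_scale[OF V] by simp
  have "independent (?\<Phi> ` I)"
  proof
    assume "dependent (?\<Phi> ` I)"
    then obtain u where u: "\<exists>v\<in>?\<Phi> ` I. u v \<noteq> 0" "(\<Sum>v\<in>?\<Phi> ` I. u v *\<^sub>R v) = 0"
      unfolding dependent_finite[OF finite_imageI[OF I]] by blast
    have "(\<Sum>i\<in>I. u (?\<Phi> i) *\<^sub>R ?\<Phi> i) = 0"
      using u(2) by (simp add: sum.reindex[OF inj])
    then have *: "(\<Sum>i\<in>I. u (?\<Phi> i) *\<^sub>R ?\<Phi> i) (X j) = 0" for j by simp
    have "u (?\<Phi> j) = 0" if "j \<in> I" for j
    proof -
      have "(\<Sum>i\<in>I. u (?\<Phi> i) *\<^sub>R ?\<Phi> i) (X j) = (\<Sum>i\<in>I. u (?\<Phi> i) * L i (X j))"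
        using X(1)[OF that] by (simp add: sum_fun_apply scaleR_fun_def restrict0_def)
      also have "\<dots> = (\<Sum>i\<in>I. if i = j then u (?\<Phi> i) else 0)"
        using X(2) that by (auto intro!: sum.cong)
      finally show ?thesis using * that I by simp
    qed
    then show False using u(1) by auto
  qed
  moreover have "span (?\<Phi> ` I) = dual_space V"
  proof
    show "span (?\<Phi> ` I) \<subseteq> dual_space V"
      using dual by (intro span_minimal subspace_dual_space) auto
    show "dual_space V \<subseteq> span (?\<Phi> ` I)"
    proof
      fix \<phi> assume \<phi>: "\<phi> \<in> dual_space V"
      have padd: "\<phi> (x + y) = \<phi> x + \<phi> y" if "x \<in> V" "y \<in> V" for x y using \<phi> that by (simp add: dual_space_def)
      have pscale: "\<phi> (r *\<^sub>R x) = r * \<phi> x" if "x \<in> V" for x r using \<phi> that by (simp add: dual_space_def)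
      have psum: "\<phi> (\<Sum>i\<in>I. c i *\<^sub>R X i) = (\<Sum>i\<in>I. c i * \<phi> (X i))" for c
        using X(1) by (intro functional_sum[OF V padd pscale I])
      have "\<phi> = (\<Sum>i\<in>I. \<phi> (X i) *\<^sub>R ?\<Phi> i)"
      proof
        fix x show "\<phi> x = (\<Sum>i\<in>I. \<phi> (X i) *\<^sub>R ?\<Phi> i) x"
        proof (cases "x \<in> V")
          case True
          have "\<phi> x = \<phi> (\<Sum>i\<in>I. L i x *\<^sub>R X i)" using repr[OF True] by simp
          also have "\<dots> = (\<Sum>i\<in>I. L i x * \<phi> (X i))" by (rule psum)
          finally show ?thesis using True
            by (simp add: sum_fun_apply scaleR_fun_def restrict0_def mult.commute)
        next
          case False
          then show ?thesis using \<phi> by (simp add: sum_fun_apply scaleR_fun_def restrict0_def dual_space_def)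
        qed
      qed
      also have "\<dots> \<in> span (?\<Phi> ` I)" by (intro span_sum span_scale span_base) auto
      finally show "\<phi> \<in> span (?\<Phi> ` I)" .
    qed
  qed
  moreover have "card I = dim V"
  proof -
    have injX: "inj_on X I"
    proof (rule inj_onI)
      fix i j assume "i \<in> I" "j \<in> I" "X i = X j"
      then have "L i (X i) = L i (X j)" by simp
      then show "i = j" using X(2)[of i i] X(2)[of j i] \<open>i \<in> I\<close> \<open>j \<in> I\<close> by (simp split: if_splits)
    qed
    have "independent (X ` I)"
    proof
      assume "dependent (X ` I)"
      then obtain u where u: "\<exists>v\<in>X ` I. u v \<noteq> 0" "(\<Sum>v\<in>X ` I. u v *\<^sub>R v) = 0"
        unfolding dependent_finite[OF finite_imageI[OF I]] by blast
      have "(\<Sum>i\<in>I. u (X i) *\<^sub>R X i) = 0" using u(2) by (simp add: sum.reindex[OF injX])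
      then have "u (X j) = 0" if "j \<in> I" for j
        using Lsum[OF that, of "\<lambda>i. u (X i)"] scale[OF that subspace_0[OF V], of 0] by simp
      then show False using u(1) by auto
    qed
    moreover have "span (X ` I) = span V"
    proof
      show "span (X ` I) \<subseteq> span V" using X(1) by (intro span_mono) auto
      have "V \<subseteq> span (X ` I)"
      proof
        fix x assume "x \<in> V"
        then have "x = (\<Sum>i\<in>I. L i x *\<^sub>R X i)" by (rule repr)
        also have "\<dots> \<in> span (X ` I)" by (intro span_sum span_scale span_base) auto
        finally show "x \<in> span (X ` I)" .
      qed
      then show "span V \<subseteq> span (X ` I)" by (simp add: span_minimal)
    qed
    ultimately show ?thesis using dim_eq_card[of "X ` I" V] card_image[OF injX] by simp
  qed
  ultimately show ?thesis using inj I left by (auto simp: unisolvent_def basis_of_def)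
qed

section \<open>Degrees of freedom on the simplex\<close>

locale framed_simplex = barycentric C a g for C :: "(real ^ 'n::finite) set" and a g +
  fixes nv :: "(real ^ 'n) set \<Rightarrow> nat \<Rightarrow> real ^ 'n"
  assumes frames: "normal_frames (convex hull C) nv"
begin

abbreviation "K \<equiv> convex hull C"

text \<open>Evaluating \<open>lam c\<close> on an affine dependence isolates the coefficient of
  \<open>c\<close>.\<close>

lemma affine_independent: "\<not> affine_dependent C"
proof
  assume "affine_dependent C"
  then obtain U where U: "sum U C = 0" "\<exists>v\<in>C. U v \<noteq> 0" "(\<Sum>v\<in>C. U v *\<^sub>R v) = 0"
    using affine_dependent_explicit_finite[OF finite_C] by blast
  have "U c = 0" if "c \<in> C" for c
  proof -
    have "(\<Sum>v\<in>C. U v * lam c v) = a c * sum U C + g c \<bullet> (\<Sum>v\<in>C. U v *\<^sub>R v)"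
      by (simp add: lam_def distrib_left sum.distrib sum_distrib_left inner_sum_right mult.commute)
    also have "\<dots> = 0" using U by simp
    also have "(\<Sum>v\<in>C. U v * lam c v) = (\<Sum>v\<in>C. if v = c then U v else 0)"
      using that by (intro sum.cong) (auto simp: lam_vertex)
    finally show ?thesis using that finite_C by simp
  qed
  then show False using U(2) by blast
qed

text \<open>From here on faces are indexed by their vertex sets, with one vertex more than the
  dimension.\<close>

lemma subsimplices_iff: "f \<in> subsimplices r K \<longleftrightarrow> (\<exists>S\<subseteq>C. card S = Suc r \<and> f = convex hull S)"
proof -
  have *: "int r simplex convex hull S \<longleftrightarrow> card S = Suc r" if "S \<subseteq> C" for S
  proof -
    have i: "\<not> affine_dependent S" using affine_independent affine_independent_subset that by blast
    show ?thesis
    proof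
      assume "int r simplex convex hull S"
      then have "aff_dim (convex hull S) = int r" by (rule aff_dim_simplex)
      then show "card S = Suc r" using aff_dim_affine_independent[OF i] by (simp add: aff_dim_convex_hull)
    next
      assume "card S = Suc r"
      then show "int r simplex convex hull S" using i by (intro simplex_convex_hull) auto
    qed
  qed
  have fc: "f face_of K \<longleftrightarrow> (\<exists>S\<subseteq>C. f = convex hull S)"
    by (rule face_of_convex_hull_affine_independent[OF affine_independent])
  show ?thesis
  proof
    assume "f \<in> subsimplices r K"
    then have "f face_of K" "int r simplex f" by (auto simp: subsimplices_def)
    then show "\<exists>S\<subseteq>C. card S = Suc r \<and> f = convex hull S" using fc * by auto
  next
    assume "\<exists>S\<subseteq>C. card S = Suc r \<and> f = convex hull S"
    then obtain S where "S \<subseteq> C" "card S = Suc r" "f = convex hull S" by blast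
    then show "f \<in> subsimplices r K" using fc *[of S] unfolding subsimplices_def by auto
  qed
qed

lemma vertex_subsimplices: "{v} \<in> subsimplices 0 K \<longleftrightarrow> v \<in> C"
proof
  assume "{v} \<in> subsimplices 0 K"
  then obtain S where S: "S \<subseteq> C" "card S = Suc 0" "{v} = convex hull S" by (auto simp: subsimplices_iff)
  then obtain c where "S = {c}" by (metis One_nat_def card_1_singletonE)
  then show "v \<in> C" using S by auto
next
  assume "v \<in> C"
  then show "{v} \<in> subsimplices 0 K" unfolding subsimplices_iff by (intro exI[of _ "{v}"]) auto
qed

lemma facet_subsimplices: "f \<in> subsimplices (CARD('n) - 1) K \<longleftrightarrow> (\<exists>c\<in>C. f = convex hull (C - {c}))"
proof -
  have "S \<subseteq> C \<and> card S = Suc (CARD('n) - 1) \<longleftrightarrow> (\<exists>c\<in>C. S = C - {c})" for S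
  proof
    assume S: "S \<subseteq> C \<and> card S = Suc (CARD('n) - 1)"
    then have "finite S" using finite_C finite_subset by blast
    then have "card (C - S) = 1" using S card_C dim_ge card_Diff_subset[of S C] by simp
    then obtain c where "C - S = {c}" by (rule card_1_singletonE)
    then show "\<exists>c\<in>C. S = C - {c}" using S by blast
  next
    assume "\<exists>c\<in>C. S = C - {c}"
    then show "S \<subseteq> C \<and> card S = Suc (CARD('n) - 1)" using card_C dim_ge finite_C by auto
  qed
  then show ?thesis unfolding subsimplices_iff by (simp only: conj_assoc[symmetric] Bex_def) metis
qed

lemma card_facet: "c \<in> C \<Longrightarrow> card (C - {c}) = CARD('n)"
  using card_C finite_C by simp

lemma meas_face: "S \<subseteq> C \<Longrightarrow> S \<noteq> C \<Longrightarrow> face_measure (convex hull S) = meas S"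
  by (simp add: meas_def)

lemma dof_normal:
  assumes "S \<subseteq> C" "S \<noteq> C"
  shows "dof_value K nv (Normal_Dof (convex hull S) i j (restrict0 (convex hull S) p)) \<tau> =
    J S (\<lambda>x. (nv (convex hull S) i \<bullet> (\<tau> x *v nv (convex hull S) j)) * p x)"
  using assms by (auto simp: L2_inner_def meas_face restrict0_def intro!: J_cong')

lemma dof_tangential:
  assumes "S \<subseteq> C" "S \<noteq> C"
  shows "dof_value K nv (Tangential_Dof (convex hull S) (restrict0 (convex hull S) p)) \<tau> =
    J S (\<lambda>x. proj_normal (nv (convex hull S) 1) (\<tau> x *v nv (convex hull S) 1) \<bullet> p x)"
  using assms by (auto simp: L2_inner_def meas_face restrict0_def intro!: J_cong')

lemma dof_interior: "dof_value K nv (Interior_Dof q) \<tau> = J C (\<lambda>x. \<tau> x \<bullet> q x)"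
  by (simp add: L2_inner_def meas_def)

text \<open>The vectors \<open>nv f i\<close>, \<open>i \<in> N\<close>, and the gradients
  \<open>g c\<close>, \<open>c \<in> C - S\<close>, are two bases of the normal space of
  \<open>f\<close>; the last two claims are the changes of basis. The upper end of \<open>N\<close>
  is \<open>d - r\<close> for the dimension \<open>r = card S - 1\<close>.\<close>

lemma frame:
  assumes "S \<subseteq> C" "S \<noteq> {}"
  defines "f \<equiv> convex hull S" and "N \<equiv> {1..Suc CARD('n) - card S}"
  shows "i \<in> N \<Longrightarrow> j \<in> N \<Longrightarrow> nv f i \<bullet> nv f j = (if i = j then 1 else 0)"
    and "i \<in> N \<Longrightarrow> k \<in> S \<Longrightarrow> l \<in> S \<Longrightarrow> nv f i \<bullet> (k - l) = 0"
    and "c \<in> C - S \<Longrightarrow> \<exists>\<gamma>. g c = (\<Sum>i\<in>N. \<gamma> i *\<^sub>R nv f i)"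
    and "i \<in> N \<Longrightarrow> \<exists>\<gamma>. nv f i = (\<Sum>c\<in>C-S. \<gamma> c *\<^sub>R g c)"
proof -
  have finS: "finite S" using assms(1) finite_C finite_subset by blast
  then have cS: "card S > 0" using assms(2) by (simp add: card_gt_0_iff)
  define r where "r = card S - 1"
  have f: "f \<in> subsimplices r K" unfolding subsimplices_iff f_def r_def using assms(1) cS by auto
  have N: "N = {1..CARD('n) - r}" using cS by (simp add: N_def r_def)
  have fr: "\<And>i j. i \<in> N \<Longrightarrow> j \<in> N \<Longrightarrow> nv f i \<bullet> nv f j = (if i = j then 1 else 0)"
    "span (nv f ` N) = (tangent_space f)\<^sup>\<bottom>"
    using frames f unfolding normal_frames_def N by (simp_all only: DIM_cart DIM_real mult_1_right)
  show "i \<in> N \<Longrightarrow> j \<in> N \<Longrightarrow> nv f i \<bullet> nv f j = (if i = j then 1 else 0)" by (rule fr(1))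
  have T: "tangent_space f = {t. \<forall>c\<in>C-S. g c \<bullet> t = 0}" unfolding f_def by (rule tangent_space_face[OF assms(1,2)])
  have orth: "nv f i \<bullet> (k - l) = 0" if "i \<in> N" "k \<in> S" "l \<in> S" for i k l
  proof -
    have "nv f i \<in> (tangent_space f)\<^sup>\<bottom>" using fr(2) that by (metis span_base image_eqI)
    moreover have "k - l \<in> tangent_space f"
      unfolding tangent_space_def f_def using that by (intro span_base) (auto intro: hull_inc)
    ultimately show ?thesis by (auto simp: orthogonal_comp_def orthogonal_def inner_commute)
  qed
  show "i \<in> N \<Longrightarrow> k \<in> S \<Longrightarrow> l \<in> S \<Longrightarrow> nv f i \<bullet> (k - l) = 0" by (rule orth)
  show "\<exists>\<gamma>. g c = (\<Sum>i\<in>N. \<gamma> i *\<^sub>R nv f i)" if "c \<in> C - S"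
  proof -
    have "g c \<in> span (nv f ` N)"
      unfolding fr(2) T using that by (auto simp: orthogonal_comp_def orthogonal_def inner_commute)
    then obtain u where u: "g c = (\<Sum>v\<in>nv f ` N. u v *\<^sub>R v)"
      using span_finite[of "nv f ` N"] by (auto simp: N_def)
    have "inj_on (nv f) N" by (rule inj_onI) (metis fr(1) zero_neq_one)
    then have "g c = (\<Sum>i\<in>N. u (nv f i) *\<^sub>R nv f i)" unfolding u by (simp add: sum.reindex)
    then show ?thesis by (intro exI)
  qed
  show "\<exists>\<gamma>. nv f i = (\<Sum>c\<in>C-S. \<gamma> c *\<^sub>R g c)" if i: "i \<in> N"
  proof -
    obtain c0 where c0: "c0 \<in> S" using assms(2) by blast
    have "nv f i = (\<Sum>c\<in>C. (nv f i \<bullet> (c - c0)) *\<^sub>R g c)" by (simp only: sum_vertex_g)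
    also have "\<dots> = (\<Sum>c\<in>C-S. (nv f i \<bullet> (c - c0)) *\<^sub>R g c)"
      using orth[OF i _ c0] finite_C assms(1) by (intro sum.mono_neutral_right) auto
    finally show ?thesis by (intro exI)
  qed
qed

text \<open>The sign of \<open>r\<close> stays open, since \<open>nv\<close> may point to either
  side of the facet.\<close>

lemma facet_normal:
  assumes "c \<in> C"
  obtains r where "r \<noteq> 0" "g c = r *\<^sub>R nv (convex hull (C - {c})) 1" 
    "nv (convex hull (C - {c})) 1 \<bullet> nv (convex hull (C - {c})) 1 = 1"
proof -
  have ne: "C - {c} \<noteq> {}" using ex_other_vertex[OF assms assms] by blast
  have N: "{1..Suc CARD('n) - card (C - {c})} = {1}" using card_facet[OF assms] by auto
  note fr = frame[OF Diff_subset ne, unfolded N]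
  have "c \<in> C - (C - {c})" using assms by auto
  then obtain \<gamma> where "g c = (\<Sum>i\<in>{1}. \<gamma> i *\<^sub>R nv (convex hull (C - {c})) i)" using fr(3)[of c] by blast
  then have "g c = \<gamma> 1 *\<^sub>R nv (convex hull (C - {c})) 1" by simp
  moreover have "\<gamma> 1 \<noteq> 0" using g_nonzero[OF assms] calculation by auto
  ultimately show thesis using that fr(1)[of 1 1] by simp
qed

section \<open>Normal components on faces\<close>

lemma bilinear_sum:
  fixes A :: "real ^ 'm ^ 'm"
  shows "(\<Sum>i\<in>I. s i *\<^sub>R v i) \<bullet> (A *v (\<Sum>j\<in>L. t j *\<^sub>R w j)) = (\<Sum>i\<in>I. \<Sum>j\<in>L. s i * t j * (v i \<bullet> (A *v w j)))"
proof -
  have "A *v (\<Sum>j\<in>L. t j *\<^sub>R w j) = (\<Sum>j\<in>L. t j *\<^sub>R (A *v w j))"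
    by (simp add: linear_sum[OF matrix_vector_mul_linear] matrix_vector_mult_scaleR)
  then show ?thesis
    by (simp only: inner_sum_left inner_scaleR_left) (simp add: inner_sum_right sum_distrib_left mult.assoc)
qed

text \<open>The gradients are expanded in the frame, and symmetry supplies the frame moments with
  \<open>i > j\<close>. Unlike frame vectors, a gradient \<open>g c\<close> is normal to all faces
  that avoid \<open>c\<close> at once, as the induction over faces requires.\<close>

lemma normal_moments:
  assumes S: "S \<subseteq> C" "S \<noteq> {}" "S \<noteq> C" and \<tau>: "\<tau> \<in> polys k sym_mats" and q: "q \<in> spolys l"
    and mom: "\<And>i j. 1 \<le> i \<Longrightarrow> i \<le> j \<Longrightarrow> j \<le> Suc CARD('n) - card S \<Longrightarrow>
      dof_value K nv (Normal_Dof (convex hull S) i j (restrict0 (convex hull S) q)) \<tau> = 0"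
    and c: "c \<in> C - S" "c' \<in> C - S"
  shows "J S (\<lambda>x. (g c \<bullet> (\<tau> x *v g c')) * q x) = 0"
proof -
  let ?f = "convex hull S" and ?N = "{1..Suc CARD('n) - card S}"
  have sym: "\<tau> x \<in> sym_mats" for x
    using \<tau> mpolys_value[OF _ subspace_sym_mats] unfolding polys_eq_mpolys by blast
  obtain u v where u: "g c = (\<Sum>i\<in>?N. u i *\<^sub>R nv ?f i)" and v: "g c' = (\<Sum>i\<in>?N. v i *\<^sub>R nv ?f i)"
    using frame(3)[OF S(1,2)] c by blast
  have z: "J S (\<lambda>x. (nv ?f i \<bullet> (\<tau> x *v nv ?f j)) * q x) = 0" if "i \<in> ?N" "j \<in> ?N" for i j
  proof (cases "i \<le> j")
    case True
    then show ?thesis using mom[of i j] that by (simp only: dof_normal[OF S(1,3)]) simp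
  next
    case False
    then have "J S (\<lambda>x. (nv ?f j \<bullet> (\<tau> x *v nv ?f i)) * q x) = 0"
      using mom[of j i] that by (simp only: dof_normal[OF S(1,3)]) simp
    then show ?thesis using sym_mats_inner[OF sym, of "nv ?f j" _ "nv ?f i"] by simp
  qed
  have r: "real_polynomial_function (\<lambda>x. (nv ?f i \<bullet> (\<tau> x *v nv ?f j)) * q x)" for i j
    using linear_spolys[OF \<tau> linear_inner_matrix_vector] spolys_rpf q
    by (intro real_polynomial_function.intros(4)) blast+
  have "(g c \<bullet> (\<tau> x *v g c')) * q x = (\<Sum>i\<in>?N. \<Sum>j\<in>?N. (u i * v j) * ((nv ?f i \<bullet> (\<tau> x *v nv ?f j)) * q x))" for x
    unfolding u v bilinear_sum by (simp only: sum_distrib_right mult.assoc)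
  then have "J S (\<lambda>x. (g c \<bullet> (\<tau> x *v g c')) * q x) = 
    J S (\<lambda>x. \<Sum>i\<in>?N. \<Sum>j\<in>?N. (u i * v j) * ((nv ?f i \<bullet> (\<tau> x *v nv ?f j)) * q x))" by simp
  also have "\<dots> = (\<Sum>i\<in>?N. \<Sum>j\<in>?N. J S (\<lambda>x. (u i * v j) * ((nv ?f i \<bullet> (\<tau> x *v nv ?f j)) * q x)))"
    using r by (subst J_sum[OF S(1,2)] | (intro sum.cong refl J_sum[OF S(1,2)])
        | (intro real_polynomial_function_sum real_polynomial_function.intros(4)[OF real_polynomial_function.intros(2)]) | simp)+
  also have "\<dots> = 0" using z by simp
  finally show ?thesis .
qed

text \<open>Both \<open>g i\<close> and \<open>g j\<close> are normal to every face avoiding the two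
  vertices. Such faces have dimension at most d - 2, hence the bound
  \<open>card S < CARD('n)\<close> in the moments.\<close>

lemma off_diagonal_zero:
  assumes \<tau>: "\<tau> \<in> polys k sym_mats" and vert: "\<And>c. c \<in> C \<Longrightarrow> \<tau> c = 0"
    and mom: "\<And>S i j q. S \<subseteq> C \<Longrightarrow> 2 \<le> card S \<Longrightarrow> card S < CARD('n) \<Longrightarrow> card S \<le> k \<Longrightarrow> q \<in> spolys (k - card S) \<Longrightarrow>
       1 \<le> i \<Longrightarrow> i \<le> j \<Longrightarrow> j \<le> Suc CARD('n) - card S \<Longrightarrow>
       dof_value K nv (Normal_Dof (convex hull S) i j (restrict0 (convex hull S) q)) \<tau> = 0"
    and ij: "i \<in> C" "j \<in> C" "i \<noteq> j" and x: "lam i x = 0" "lam j x = 0"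
  shows "g i \<bullet> (\<tau> x *v g j) = 0"
proof (rule zero_on_flat[where T="C - {i, j}" and k=k and p="\<lambda>x. g i \<bullet> (\<tau> x *v g j)"])
  show "(\<lambda>x. g i \<bullet> (\<tau> x *v g j)) \<in> spolys k"
    by (rule linear_spolys[OF \<tau> linear_inner_matrix_vector])
  show "x \<in> flat (C - {i, j})" using x by (auto simp: flat_def)
  show "g i \<bullet> (\<tau> c *v g j) = 0" if "c \<in> C - {i, j}" for c using vert that by simp
  fix S and q :: "real ^ 'n \<Rightarrow> real" assume S: "S \<subseteq> C - {i, j}" "2 \<le> card S" "card S \<le> k" "q \<in> spolys (k - card S)"
  have "card S \<le> card (C - {i, j})" using S(1) finite_C by (intro card_mono) auto
  also have "\<dots> = CARD('n) - 1" using ij finite_C card_C by (simp add: card_Diff_subset)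
  finally have "card S < CARD('n)" using dim_ge by simp
  then show "J S (\<lambda>x. g i \<bullet> (\<tau> x *v g j) * q x) = 0"
    using S ij by (intro normal_moments[OF _ _ _ \<tau> S(4)] mom) auto
qed auto

text \<open>The faces avoiding the single vertex \<open>i\<close> include a facet, so in contrast to
  the off-diagonal case its normal-normal moments enter.\<close>

lemma diagonal_zero:
  assumes \<tau>: "\<tau> \<in> polys k sym_mats" and vert: "\<And>c. c \<in> C \<Longrightarrow> \<tau> c = 0"
    and mom: "\<And>S i j q. S \<subseteq> C \<Longrightarrow> 2 \<le> card S \<Longrightarrow> card S \<le> CARD('n) \<Longrightarrow> card S \<le> k \<Longrightarrow> q \<in> spolys (k - card S) \<Longrightarrow>
       1 \<le> i \<Longrightarrow> i \<le> j \<Longrightarrow> j \<le> Suc CARD('n) - card S \<Longrightarrow>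
       dof_value K nv (Normal_Dof (convex hull S) i j (restrict0 (convex hull S) q)) \<tau> = 0"
    and i: "i \<in> C" and x: "lam i x = 0"
  shows "g i \<bullet> (\<tau> x *v g i) = 0"
proof (rule zero_on_flat[where T="C - {i}" and k=k and p="\<lambda>x. g i \<bullet> (\<tau> x *v g i)"])
  show "(\<lambda>x. g i \<bullet> (\<tau> x *v g i)) \<in> spolys k"
    by (rule linear_spolys[OF \<tau> linear_inner_matrix_vector])
  show "x \<in> flat (C - {i})" using x by (auto simp: flat_def)
  show "g i \<bullet> (\<tau> c *v g i) = 0" if "c \<in> C - {i}" for c using vert that by simp
  fix S and q :: "real ^ 'n \<Rightarrow> real" assume S: "S \<subseteq> C - {i}" "2 \<le> card S" "card S \<le> k" "q \<in> spolys (k - card S)"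
  have "card S \<le> card (C - {i})" using S(1) finite_C by (intro card_mono) auto
  then have "card S \<le> CARD('n)" using card_facet[OF i] by simp
  then show "J S (\<lambda>x. g i \<bullet> (\<tau> x *v g i) * q x) = 0"
    using S i by (intro normal_moments[OF _ _ _ \<tau> S(4)] mom) auto
qed auto

lemma facet_tangent_space:
  assumes "c \<in> C" 
  shows "tangent_space (convex hull (C - {c})) = {t. nv (convex hull (C - {c})) 1 \<bullet> t = 0}"
proof -
  obtain r where r: "r \<noteq> 0" "g c = r *\<^sub>R nv (convex hull (C - {c})) 1" by (rule facet_normal[OF assms])
  have ne: "C - {c} \<noteq> {}" using ex_other_vertex[OF assms assms] by blast
  have CS: "C - (C - {c}) = {c}" using assms by auto
  show ?thesis unfolding tangent_space_face[OF Diff_subset ne] CS using r by auto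
qed

text \<open>In degree zero the skew part is a tangential polynomial field of degree one, which lies
  in the polynomial part as soon as \<open>k \<ge> 1\<close>. So the functionals (d) are among those
  that vanish on bubbles.\<close>

lemma ND_0_subset:
  assumes c: "c \<in> C" and k: "k \<ge> 1"
  defines "F \<equiv> convex hull (C - {c})"
  shows "ND 0 F (nv F 1) \<subseteq> ND k F (nv F 1)"
proof
  let ?n = "nv F 1"
  let ?T = "tangent_space F"
  have T: "?T = {t. ?n \<bullet> t = 0}" unfolding F_def by (rule facet_tangent_space[OF c])
  have sT: "subspace ?T" by (simp add: tangent_space_def)
  fix w assume "w \<in> ND 0 F ?n"
  then obtain p A where w: "w = restrict0 F (\<lambda>x. p x + A (proj_normal ?n x) *v proj_normal ?n x)"
    "p \<in> polys 0 ?T" "A \<in> hpolys 0 (skew_on_tangent F)" unfolding ND_def by blast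
  obtain t where t: "p = (\<lambda>x. t)" "t \<in> ?T" using polys_0[OF w(2)] by blast
  obtain B where B: "A = (\<lambda>x. B)" "B \<in> skew_on_tangent F" using polys_0[of A] w(3) hpolys_0 by blast
  have nT: "?n \<in> ?T\<^sup>\<bottom>" by (auto simp: T orthogonal_comp_def orthogonal_def inner_commute)
  have Bn: "B \<in> skew_mats" "B *v ?n = 0" using B(2) nT by (auto simp: skew_on_tangent_def)
  define p' where "p' x = t + B *v proj_normal ?n x" for x
  have "p' \<in> polys 1 ?T"
    unfolding polys_eq_mpolys
  proof (rule mpolys_valued[OF sT vec_mpolysI])
    fix i
    have "B *v proj_normal ?n x = B *v x" for x
      using Bn(2) by (simp add: proj_normal_def matrix_vector_mult_diff_distrib matrix_vector_mult_scaleR)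
    then have "(\<lambda>x. (B *v proj_normal ?n x) $ i) = (\<lambda>x. B $ i \<bullet> x)"
      by (simp add: matrix_vector_mult_def inner_vec_def fun_eq_iff)
    then have "(\<lambda>x. (B *v proj_normal ?n x) $ i) \<in> spolys 1"
      using inner_shpolys[of "B $ i"] hpolys_subset_polys[of UNIV 1] by auto
    then have "(\<lambda>x. t $ i + (B *v proj_normal ?n x) $ i) \<in> spolys 1"
      by (intro spolys_pointwise(1) const_polys) auto
    then show "(\<lambda>x. p' x $ i) \<in> mpolys {\<alpha>. sum \<alpha> UNIV \<le> 1} UNIV"
      by (simp add: p'_def polys_eq_mpolys)
    show "p' x \<in> ?T" for x
      using t(2) Bn skew_mats_inner2[of B ?n "proj_normal ?n x"] by (simp add: p'_def T inner_add_right)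
  qed simp
  then have "p' \<in> polys k ?T" using polys_mono[OF k subspace_0[OF sT] subset_refl] by blast
  moreover have "(\<lambda>x. 0) \<in> hpolys k (skew_on_tangent F)"
    by (rule subspace_pointwise(5)[OF subspace_hpolys[OF subspace_skew_on_tangent]])
  moreover have "w = restrict0 F (\<lambda>x. p' x + 0 *v proj_normal ?n x)"
    by (simp add: w(1) p'_def t(1) B(1))
  ultimately show "w \<in> ND k F ?n" unfolding ND_def by (intro CollectI exI[of _ p'] exI[of _ "\<lambda>x. 0"]) simp
qed

end

lemma pf_mat_vec:
  fixes A :: "'a::euclidean_space \<Rightarrow> real ^ 'n ^ 'm"
  assumes "polynomial_function A" "polynomial_function v"
  shows "polynomial_function (\<lambda>x. A x *v v x)"
proof -
  have "real_polynomial_function (\<lambda>x. \<Sum>j\<in>UNIV. A x $ i $ j * v x $ j)" for i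
    using pf_linear[OF assms(1) linear_nth2] pf_linear[OF assms(2) linear_nth]
    by (intro real_polynomial_function_sum real_polynomial_function.intros(4)) (auto simp: real_polynomial_function_eq)
  then show ?thesis
    unfolding polynomial_function_iff_Basis_inner by (auto simp: Basis_vec_def inner_axis matrix_vector_mult_def)
qed

lemma hpolys_pf:
  fixes p :: "real ^ 'n \<Rightarrow> 'b::euclidean_space"
  assumes "p \<in> hpolys k X"
  shows "polynomial_function p"
proof -
  have "p \<in> polys k UNIV"
    using assms mpolys_mono[of "{\<alpha>. sum \<alpha> UNIV = k}" "{\<alpha>. sum \<alpha> UNIV \<le> k}" UNIV X]
    by (auto simp: hpolys_eq_mpolys polys_eq_mpolys)
  then show ?thesis by (rule polys_pf)
qed

lemma ND_pf:
  assumes "w \<in> ND k F n"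
  obtains p where "polynomial_function p" "w = restrict0 F p"
proof -
  obtain p A where w: "w = restrict0 F (\<lambda>x. p x + A (proj_normal n x) *v proj_normal n x)"
    "p \<in> polys k (tangent_space F)" "A \<in> hpolys k (skew_on_tangent F)"
    using assms unfolding ND_def by blast
  have "polynomial_function (proj_normal n)"
    using pf_linear[OF polynomial_function_id linear_proj_normal[of n]] by simp
  moreover from this have "polynomial_function (\<lambda>x. A (proj_normal n x))"
    using polynomial_function_compose[OF _ hpolys_pf[OF w(3)]] by (simp add: comp_def)
  ultimately have "polynomial_function (\<lambda>x. p x + A (proj_normal n x) *v proj_normal n x)"
    using polys_pf[OF w(2)] by (intro polynomial_function_add pf_mat_vec)
  then show thesis using that w(1) by blast
qed

text \<open>The ray argument: \<open>(symgrad v x) x = 0\<close> forces \<open>v \<bullet> x\<close> and then \<open>v - v 0\<close> to be homogeneous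
  of degree one along every ray.\<close>

lemma rigid_motion_if_symgrad_mult_x:
  fixes v :: "real ^ 'n \<Rightarrow> real ^ 'n"
  assumes v: "polynomial_function v" and z: "\<And>x. symgrad v x *v x = 0"
  shows "v \<in> rigid_motions"
proof -
  have rv: "real_polynomial_function (\<lambda>x. v x $ j)" for j
    using pf_linear[OF v linear_nth] by (simp add: real_polynomial_function_eq)
  have d: "(\<lambda>x. v x $ j) differentiable (at x)" for j x
    by (rule rpf_differentiable[OF rv])
  have sym: "x \<bullet> (symgrad v x *v x) = (\<Sum>i\<in>UNIV. x $ i * dd x (\<lambda>x. v x $ i) x)" for x
  proof -
    have "x \<bullet> (symgrad v x *v x) = (1 / 2) * (x \<bullet> (jac v x *v x) + x \<bullet> (transpose (jac v x) *v x))"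
      by (simp add: symgrad_def matrix_vector_mult_add_rdistrib inner_add_right flip: scaleR_matrix_vector_assoc)
    also have "x \<bullet> (transpose (jac v x) *v x) = x \<bullet> (jac v x *v x)"
      by (subst inner_commute) (simp add: dot_lmul_matrix)
    also have "x \<bullet> (jac v x *v x) = (\<Sum>i\<in>UNIV. x $ i * dd x (\<lambda>x. v x $ i) x)"
      by (simp add: inner_vec_def matrix_vector_mult_def jac_def dd_axis_sum[OF d, of x] mult.commute)
    finally show ?thesis by simp
  qed
  have vx: "v y \<bullet> y = v 0 \<bullet> y" for y
  proof -
    have der: "((\<lambda>s. v (0 + s *\<^sub>R y) \<bullet> y) has_real_derivative (\<Sum>i\<in>UNIV. dd y (\<lambda>x. v x $ i) (0 + s *\<^sub>R y) * y $ i)) (at s)" for s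
    proof -
      have "((\<lambda>s. \<Sum>i\<in>UNIV. v (0 + s *\<^sub>R y) $ i * y $ i) has_real_derivative (\<Sum>i\<in>UNIV. dd y (\<lambda>x. v x $ i) (0 + s *\<^sub>R y) * y $ i)) (at s)"
        by (intro DERIV_sum DERIV_cmult_right dd_line d)
      then show ?thesis by (simp add: inner_vec_def)
    qed
    have "\<exists>c. \<forall>s\<in>{0<..}. v (0 + s *\<^sub>R y) \<bullet> y = c"
    proof (rule has_field_derivative_zero_constant)
      fix s :: real assume "s \<in> {0<..}"
      have "0 = (s *\<^sub>R y) \<bullet> (symgrad v (s *\<^sub>R y) *v (s *\<^sub>R y))" by (simp only: z inner_zero_right)
      also have "\<dots> = (\<Sum>i\<in>UNIV. (s *\<^sub>R y) $ i * dd (s *\<^sub>R y) (\<lambda>x. v x $ i) (s *\<^sub>R y))" by (rule sym)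
      also have "\<dots> = s\<^sup>2 * (\<Sum>i\<in>UNIV. dd y (\<lambda>x. v x $ i) (0 + s *\<^sub>R y) * y $ i)"
        by (simp add: linear_scale[OF dd_linear[OF d]] sum_distrib_left power2_eq_square mult_ac)
      finally have "(\<Sum>i\<in>UNIV. dd y (\<lambda>x. v x $ i) (0 + s *\<^sub>R y) * y $ i) = 0"
        using \<open>s \<in> {0<..}\<close> by simp
      then show "((\<lambda>s. v (0 + s *\<^sub>R y) \<bullet> y) has_real_derivative 0) (at s within {0<..})"
        using der[of s] by (simp add: has_field_derivative_at_within)
    qed simp
    then obtain c where c: "\<And>s. s > 0 \<Longrightarrow> v (0 + s *\<^sub>R y) \<bullet> y = c" by auto
    \<comment> \<open>Constancy along the ray is known for \<open>s > 0\<close>; as a polynomial in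
      \<open>s\<close> the expression has the same value at \<open>s = 0\<close>, which is
      \<open>v 0 \<bullet> y\<close>.\<close>
    have "real_polynomial_function (\<lambda>x. v x \<bullet> y - c)"
      by (intro real_polynomial_function_diff rpf_inner v polynomial_function_const real_polynomial_function.intros(2))
    then have "v (0 + s *\<^sub>R y) \<bullet> y - c = 0" for s
      by (rule rpf_zero_on_line[of _ 1]) (use c in auto)
    from this[of 1] this[of 0] show ?thesis by simp
  qed
  have euler: "dd x (\<lambda>x. v x $ i) x = v x $ i - v 0 $ i" for x i
  proof -
    have "0 = (dd x (\<lambda>x. v x $ i) x + dd (axis i 1) (\<lambda>x. v x \<bullet> x) x - v x $ i) / 2"
      using symgrad_mult_x[OF v, of x i] z by simp
    moreover have "dd (axis i 1) (\<lambda>x. v x \<bullet> x) x = v 0 $ i"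
      unfolding vx by (simp add: dd_inner inner_axis)
    ultimately show ?thesis by simp
  qed
  have lin: "v y $ i = v 0 $ i + dd y (\<lambda>x. v x $ i) 0" for y i
  proof -
    let ?f = "\<lambda>s. v (0 + s *\<^sub>R y) $ i"
    have der: "(?f has_real_derivative dd y (\<lambda>x. v x $ i) (0 + s *\<^sub>R y)) (at s)" for s
      by (rule dd_line[OF d])
    \<comment> \<open>By the Euler relation the difference quotient along the ray has derivative
      zero.\<close>
    have "\<exists>c. \<forall>s\<in>{0<..}. (?f s - v 0 $ i) / s = c"
    proof (rule has_field_derivative_zero_constant)
      fix s :: real assume s: "s \<in> {0<..}"
      have "s * dd y (\<lambda>x. v x $ i) (s *\<^sub>R y) = ?f s - v 0 $ i"
        using euler[of "s *\<^sub>R y" i] by (simp add: linear_scale[OF dd_linear[OF d]])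
      moreover have "((\<lambda>s. (?f s - v 0 $ i) / s) has_real_derivative
          (dd y (\<lambda>x. v x $ i) (0 + s *\<^sub>R y) * s - (?f s - v 0 $ i) * 1) / (s * s)) (at s)"
        using s by (auto intro!: derivative_eq_intros der[simplified])
      ultimately show "((\<lambda>s. (?f s - v 0 $ i) / s) has_real_derivative 0) (at s within {0<..})"
        by (simp add: has_field_derivative_at_within mult.commute)
    qed simp
    then obtain c where c: "\<And>s. s > 0 \<Longrightarrow> ?f s - v 0 $ i = c * s" by (auto simp: field_simps)
    have "real_polynomial_function (\<lambda>s::real. ?f s - v 0 $ i - c * s)"
    proof -
      have "polynomial_function (\<lambda>s::real. 0 + s *\<^sub>R y)"
        by (intro polynomial_function_add polynomial_function_const polynomial_function_bounded_linear bounded_linear_scaleR_left)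
      from real_polynomial_function_compose[OF this rv[of i]]
      have "real_polynomial_function ?f" by (simp add: comp_def)
      moreover have "real_polynomial_function (\<lambda>s::real. c * s)" 
        by (intro real_polynomial_function.intros(1) bounded_linear_mult_right)
      ultimately show ?thesis by (intro real_polynomial_function_diff real_polynomial_function.intros(2))
    qed
    then have "?f (0 + s *\<^sub>R 1) - v 0 $ i - c * (0 + s *\<^sub>R 1) = 0" for s
      by (rule rpf_zero_on_line[of _ 1 "0::real" "1::real"]) (use c in auto)
    then have f: "?f = (\<lambda>s. v 0 $ i + c * s)" by (auto simp: fun_eq_iff algebra_simps)
    have "(?f has_real_derivative c) (at 0)" unfolding f by (auto intro!: derivative_eq_intros)
    moreover have "(?f has_real_derivative dd y (\<lambda>x. v x $ i) 0) (at 0)" using der[of 0] by simp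
    ultimately have "c = dd y (\<lambda>x. v x $ i) 0" by (rule DERIV_unique)
    moreover have "?f 1 = v 0 $ i + c * 1" by (rule fun_cong[OF f])
    ultimately show ?thesis by simp
  qed
  define B where "B = jac v 0"
  have vB: "v y = v 0 + B *v y" for y
    by (simp add: vec_eq_iff lin[of y] B_def jac_def matrix_vector_mult_def dd_axis_sum[OF d, of y] mult.commute)
  \<comment> \<open>The identity \<open>v y \<bullet> y = v 0 \<bullet> y\<close> leaves no
    quadratic term, which is skewness of the linear part.\<close>
  have quad: "y \<bullet> (B *v y) = 0" for y
  proof -
    have "v y \<bullet> y = v 0 \<bullet> y + (B *v y) \<bullet> y" by (subst vB) (rule inner_add_left)
    then show ?thesis using vx[of y] by (simp add: inner_commute)
  qed
  have skew: "B $ i $ j = - B $ j $ i" for i j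
  proof -
    have e: "axis k 1 \<bullet> (B *v axis l 1) = B $ k $ l" for k l
      by (simp add: inner_axis' matrix_vector_mult_basis column_def)
    have "(axis i 1 + axis j 1) \<bullet> (B *v (axis i 1 + axis j 1)) = 0" by (rule quad)
    then show ?thesis
      using quad[of "axis i 1"] quad[of "axis j 1"] 
      by (simp add: matrix_vector_right_distrib inner_add_left inner_add_right e)
  qed
  have "transpose B $ i $ j = (- B) $ i $ j" for i j
    using skew[of j i] by (simp add: transpose_def)
  then have "B \<in> skew_mats" unfolding skew_mats_def by (simp only: mem_Collect_eq vec_eq_iff) blast
  moreover have "v = (\<lambda>x. v 0 + B *v x)" by (rule ext) (rule vB)
  ultimately show ?thesis unfolding rigid_motions_def by blast
qed

lemma finite_basis:
  fixes V :: "(real ^ 'n \<Rightarrow> 'b::euclidean_space) set"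
  assumes "subspace V" "V \<subseteq> polys k UNIV"
  obtains B where "finite B" "independent B" "span B = V" 
proof -
  obtain B where B: "B \<subseteq> V" "independent B" "V \<subseteq> span B" using maximal_independent_subset by blast
  obtain D where D: "finite D" "polys k UNIV \<subseteq> span (D :: (real ^ 'n \<Rightarrow> 'b) set)"
    using mpolys_finite_span[OF finite_degree_le[of k], where 'b='b] by (auto simp: polys_eq_mpolys)
  have "B \<subseteq> span D" using B assms D by blast
  then have "finite B" using independent_span_bound[OF D(1) B(2)] by blast
  moreover have "span B = V" using B span_minimal[OF B(1) assms(1)] by blast
  ultimately show thesis using that B by blast
qed

section \<open>Functionals as moments, and vanishing of fields annihilated by them\<close>

context framed_simplex
begin

text \<open>Apart from point evaluations, every functional is the integral over one face against a
  polynomial matrix field; linearity is read off from this form.\<close>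

definition test_dof :: "'n dof \<Rightarrow> bool" where
  "test_dof d \<longleftrightarrow> (\<exists>v M. d = Vertex_Dof v M) \<or>
     (\<exists>S \<Phi>. S \<subseteq> C \<and> S \<noteq> {} \<and> polynomial_function \<Phi> \<and>
        (\<forall>\<tau>. dof_value K nv d \<tau> = J S (\<lambda>x. \<tau> x \<bullet> \<Phi> x)))"

lemma dof_add:
  assumes "test_dof d" "polynomial_function \<tau>" "polynomial_function \<sigma>"
  shows "dof_value K nv d (\<tau> + \<sigma>) = dof_value K nv d \<tau> + dof_value K nv d \<sigma>"
  using assms(1) unfolding test_dof_def
proof (elim disjE exE conjE)
  fix S \<Phi> assume *: "S \<subseteq> C" "S \<noteq> {}" "polynomial_function \<Phi>" "\<forall>\<tau>. dof_value K nv d \<tau> = J S (\<lambda>x. \<tau> x \<bullet> \<Phi> x)"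
  have "J S (\<lambda>x. \<tau> x \<bullet> \<Phi> x + \<sigma> x \<bullet> \<Phi> x) = J S (\<lambda>x. \<tau> x \<bullet> \<Phi> x) + J S (\<lambda>x. \<sigma> x \<bullet> \<Phi> x)"
    using * assms by (intro J_add rpf_inner)
  then show ?thesis using *(4) by (simp add: inner_add_left)
qed (simp add: inner_add_left)

lemma dof_scale:
  assumes "test_dof d" 
  shows "dof_value K nv d (r *\<^sub>R \<tau>) = r * dof_value K nv d \<tau>"
  using assms(1) unfolding test_dof_def
  by (elim disjE exE conjE) (simp_all add: scaleR_fun_def)

lemma proj_normal_inner: "proj_normal n v \<bullet> w = proj_normal n w \<bullet> v"
  by (simp add: proj_normal_def inner_diff_left inner_diff_right inner_commute algebra_simps)

lemma test_dof_normal: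
  assumes S: "S \<subseteq> C" "S \<noteq> {}" "S \<noteq> C" and q: "real_polynomial_function q"
  shows "test_dof (Normal_Dof (convex hull S) i j (restrict0 (convex hull S) q))"
  unfolding test_dof_def
proof (intro disjI2 exI conjI allI)
  let ?f = "convex hull S"
  show "polynomial_function (\<lambda>x. q x *\<^sub>R outer (nv ?f i) (nv ?f j))"
    using q by (intro polynomial_function_mult polynomial_function_const) (simp add: real_polynomial_function_eq)
  show "dof_value K nv (Normal_Dof ?f i j (restrict0 ?f q)) \<tau> = J S (\<lambda>x. \<tau> x \<bullet> q x *\<^sub>R outer (nv ?f i) (nv ?f j))" for \<tau>
    unfolding dof_normal[OF S(1,3)] by (simp add: inner_outer mult.commute)
qed (use S in auto)

lemma test_dof_tangential:
  assumes S: "S \<subseteq> C" "S \<noteq> {}" "S \<noteq> C" and p: "polynomial_function p"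
  shows "test_dof (Tangential_Dof (convex hull S) (restrict0 (convex hull S) p))"
  unfolding test_dof_def
proof (intro disjI2 exI conjI allI)
  let ?f = "convex hull S"
  let ?n = "nv ?f 1"
  have "linear (\<lambda>v. outer (proj_normal ?n v) ?n)"
    by (simp add: linear_iff proj_normal_def outer_def vec_eq_iff algebra_simps inner_add_right)
  then show "polynomial_function (\<lambda>x. outer (proj_normal ?n (p x)) ?n)"
    by (rule pf_linear[OF p])
  show "dof_value K nv (Tangential_Dof ?f (restrict0 ?f p)) \<tau> = J S (\<lambda>x. \<tau> x \<bullet> outer (proj_normal ?n (p x)) ?n)" for \<tau>
    unfolding dof_tangential[OF S(1,3)] by (simp add: inner_outer proj_normal_inner[of _ _ "p _"])
qed (use S in auto)

lemma test_dof_interior: "polynomial_function q \<Longrightarrow> test_dof (Interior_Dof q)"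
  unfolding test_dof_def using C_nonempty
  by (intro disjI2 exI[of _ C] exI[of _ q]) (simp only: dof_interior, simp)

lemma facet_nonempty: "c \<in> C \<Longrightarrow> C - {c} \<noteq> {}"
  using ex_other_vertex[of c c] by blast

lemma test_dof_facet_tangential:
  assumes "c \<in> C" "w \<in> ND k (convex hull (C - {c})) n"
  shows "test_dof (Tangential_Dof (convex hull (C - {c})) w)"
  using ND_pf[OF assms(2)] test_dof_tangential[OF Diff_subset facet_nonempty[OF assms(1)]] assms(1) by blast

lemma sym_polys_value: "\<tau> \<in> polys k sym_mats \<Longrightarrow> \<tau> x \<in> sym_mats"
  using mpolys_value[OF _ subspace_sym_mats] unfolding polys_eq_mpolys by blast

lemma nn_bubblesD:
  assumes b: "b \<in> nn_bubbles K nv"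
  shows "b \<in> polys (CARD('n) + 1) sym_mats"
    and "c \<in> C \<Longrightarrow> b c = 0"
    and "S \<subseteq> C \<Longrightarrow> 2 \<le> card S \<Longrightarrow> card S < CARD('n) \<Longrightarrow> q \<in> spolys (CARD('n) + 1 - card S) \<Longrightarrow>
       1 \<le> i \<Longrightarrow> i \<le> j \<Longrightarrow> j \<le> Suc CARD('n) - card S \<Longrightarrow>
       dof_value K nv (Normal_Dof (convex hull S) i j (restrict0 (convex hull S) q)) b = 0"
    and "c \<in> C \<Longrightarrow> w \<in> ND (CARD('n) - 1) (convex hull (C - {c})) (nv (convex hull (C - {c})) 1) \<Longrightarrow>
       dof_value K nv (Tangential_Dof (convex hull (C - {c})) w) b = 0"
    and "v \<in> polys_mod_RM (CARD('n)) K \<Longrightarrow> J C (\<lambda>x. row_div b x \<bullet> v x) = 0"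
    and "s \<in> polys (CARD('n) - 1) sym_mats \<Longrightarrow> (\<And>x. s x *v x = 0) \<Longrightarrow> J C (\<lambda>x. b x \<bullet> s x) = 0"
proof -
  note B = b[unfolded nn_bubbles_def mem_Collect_eq]
  show "b \<in> polys (CARD('n) + 1) sym_mats" using B by blast
  show "c \<in> C \<Longrightarrow> b c = 0" using B vertex_subsimplices by blast
  show "dof_value K nv (Normal_Dof (convex hull S) i j (restrict0 (convex hull S) q)) b = 0"
    if S: "S \<subseteq> C" "2 \<le> card S" "card S < CARD('n)" "q \<in> spolys (CARD('n) + 1 - card S)" "1 \<le> i" "i \<le> j" "j \<le> Suc CARD('n) - card S"
  proof -
    let ?r = "card S - 1"
    have e: "CARD('n) + 1 - card S = CARD('n) - ?r" using S by simp
    have "?r \<in> {1..CARD('n) - 2}" using S by auto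
    moreover have "convex hull S \<in> subsimplices ?r K" unfolding subsimplices_iff using S by (intro exI[of _ S]) auto
    moreover have "j \<le> CARD('n) - ?r" using S by simp
    moreover have "restrict0 (convex hull S) q \<in> polys_on (CARD('n) - ?r) (convex hull S) UNIV"
      using S(4) unfolding e polys_on_def by blast
    ultimately show ?thesis using B S(5,6) by blast
  qed
  show "dof_value K nv (Tangential_Dof (convex hull (C - {c})) w) b = 0"
    if "c \<in> C" "w \<in> ND (CARD('n) - 1) (convex hull (C - {c})) (nv (convex hull (C - {c})) 1)"
    using B that facet_subsimplices by blast
  show "J C (\<lambda>x. row_div b x \<bullet> v x) = 0" if "v \<in> polys_mod_RM (CARD('n)) K"
    using B that by (simp add: L2_inner_def meas_def)
  show "J C (\<lambda>x. b x \<bullet> s x) = 0" if "s \<in> polys (CARD('n) - 1) sym_mats" "\<And>x. s x *v x = 0"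
    using B that by (simp only: dof_interior[symmetric]) blast
qed

lemma left_nondegenerate:
  assumes p: "p \<in> polys 2 sym_mats" and b: "b \<in> nn_bubbles K nv"
    and va: "\<And>c. c \<in> C \<Longrightarrow> (p + b) c = 0"
    and vb: "\<And>S i j q. S \<subseteq> C \<Longrightarrow> card S = 2 \<Longrightarrow> 1 \<le> i \<Longrightarrow> i \<le> j \<Longrightarrow> j \<le> CARD('n) - 1 \<Longrightarrow> q \<in> spolys 0 \<Longrightarrow>
       dof_value K nv (Normal_Dof (convex hull S) i j (restrict0 (convex hull S) q)) (p + b) = 0"
    and vc: "\<And>c q. c \<in> C \<Longrightarrow> q \<in> spolys 1 \<Longrightarrow> 
       dof_value K nv (Normal_Dof (convex hull (C - {c})) 1 1 (restrict0 (convex hull (C - {c})) q)) (p + b) = 0"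
    and vd: "\<And>c w. c \<in> C \<Longrightarrow> w \<in> ND 0 (convex hull (C - {c})) (nv (convex hull (C - {c})) 1) \<Longrightarrow>
       dof_value K nv (Tangential_Dof (convex hull (C - {c})) w) (p + b) = 0"
    and ve: "\<And>q. q \<in> polys 0 sym_mats \<Longrightarrow> dof_value K nv (Interior_Dof q) (p + b) = 0"
  shows "p + b = 0"
proof -
  note B = nn_bubblesD[OF b]
  have pp: "polynomial_function p" "polynomial_function b" using polys_pf p B(1) by blast+
  have split: "dof_value K nv d p = 0" if "test_dof d" "dof_value K nv d (p + b) = 0" "dof_value K nv d b = 0" for d
    using dof_add[OF that(1) pp] that by simp
  have pv: "p c = 0" if "c \<in> C" for c using va[OF that] B(2)[OF that] by simp
  have nS: "S \<noteq> C" "S \<noteq> {}" if "S \<subseteq> C" "2 \<le> card S" "card S \<le> CARD('n)" for S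
    using that card_C by auto
  \<comment> \<open>For a quadratic field only edges carry moments. There the functional of
    \<open>p + b\<close> is zero by assumption, and that of \<open>b\<close> because
    \<open>2 < d\<close> and constants are among the tests of bubbles.\<close>
  have pe: "dof_value K nv (Normal_Dof (convex hull S) i j (restrict0 (convex hull S) q)) p = 0"
    if S: "S \<subseteq> C" "2 \<le> card S" "card S \<le> CARD('n)" "card S \<le> 2" "q \<in> spolys (2 - card S)" "1 \<le> i" "i \<le> j" "j \<le> Suc CARD('n) - card S"
    for S i j q
  proof (rule split)
    have c2: "card S = 2" using S by simp
    have q0: "q \<in> spolys 0" using S c2 by simp
    show "test_dof (Normal_Dof (convex hull S) i j (restrict0 (convex hull S) q))"
      using S nS[of S] spolys_rpf by (intro test_dof_normal) auto
    show "dof_value K nv (Normal_Dof (convex hull S) i j (restrict0 (convex hull S) q)) (p + b) = 0"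
      using S c2 q0 by (intro vb) auto
    show "dof_value K nv (Normal_Dof (convex hull S) i j (restrict0 (convex hull S) q)) b = 0"
      using S c2 q0 dim_ge spolys_mono[of q 0] by (intro B(3)) auto
  qed
  have pdiag: "g i \<bullet> (p x *v g i) = 0" if "i \<in> C" "lam i x = 0" for i x
    using pe by (intro diagonal_zero[OF p pv _ that])
  have poff: "g i \<bullet> (p x *v g j) = 0" if "i \<in> C" "j \<in> C" "i \<noteq> j" "lam i x = 0" "lam j x = 0" for i j x
    using pe by (intro off_diagonal_zero[OF p pv _ that]) auto
  \<comment> \<open>Below the facets this is part of being a bubble. On a facet the normal-normal
    trace of \<open>p\<close> is zero, so the functional of \<open>p + b\<close> is that of
    \<open>b\<close>.\<close>
  have bn: "dof_value K nv (Normal_Dof (convex hull S) i j (restrict0 (convex hull S) q)) b = 0"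
    if S: "S \<subseteq> C" "2 \<le> card S" "card S \<le> CARD('n)" "q \<in> spolys (CARD('n) + 1 - card S)" "1 \<le> i" "i \<le> j" "j \<le> Suc CARD('n) - card S"
    for S i j q
  proof (cases "card S < CARD('n)")
    case True
    then show ?thesis using S by (intro B(3))
  next
    case False
    then have cS: "card S = CARD('n)" using S by simp
    then have "\<exists>c\<in>C. convex hull S = convex hull (C - {c})"
      using S dim_ge by (subst facet_subsimplices[symmetric]) (auto simp: subsimplices_iff)
    then obtain c where c: "c \<in> C" "convex hull S = convex hull (C - {c})" by blast
    then have Sc: "S = C - {c}" using convex_hull_inj[OF S(1), of "C - {c}"] by blast
    have ij: "i = 1" "j = 1" using S cS by auto
    have q1: "q \<in> spolys 1" using S cS by simp
    let ?F = "convex hull (C - {c})"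
    let ?d = "Normal_Dof ?F 1 1 (restrict0 ?F q)"
    have td: "test_dof ?d" using facet_nonempty[OF c(1)] c(1) spolys_rpf[OF q1] by (intro test_dof_normal) auto
    obtain r where r: "r \<noteq> 0" "g c = r *\<^sub>R nv ?F 1" by (rule facet_normal[OF c(1)])
    have "dof_value K nv ?d p = J (C - {c}) (\<lambda>x. (nv ?F 1 \<bullet> (p x *v nv ?F 1)) * q x)"
      using c(1) by (intro dof_normal) auto
    also have "\<dots> = 0"
    proof (rule J_zero)
      fix x assume "x \<in> flat (C - {c})"
      then have "g c \<bullet> (p x *v g c) = 0" using pdiag c(1) flat_facet by blast
      then show "(nv ?F 1 \<bullet> (p x *v nv ?F 1)) * q x = 0" using r by (simp add: matrix_vector_mult_scaleR)
    qed auto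
    finally have "dof_value K nv ?d p = 0" .
    then have "dof_value K nv ?d b = 0" using dof_add[OF td pp] vc[OF c(1) q1] by simp
    then show ?thesis using Sc ij by simp
  qed
  have bdiag: "g i \<bullet> (b x *v g i) = 0" if "i \<in> C" "lam i x = 0" for i x
    using bn by (intro diagonal_zero[OF B(1,2) _ that])
  have boff: "g i \<bullet> (b x *v g j) = 0" if "i \<in> C" "j \<in> C" "i \<noteq> j" "lam i x = 0" "lam j x = 0" for i j x
    using bn by (intro off_diagonal_zero[OF B(1,2) _ that]) auto
  have tang: "J (C - {c}) (\<lambda>x. proj_normal (nv (convex hull (C - {c})) 1) (\<tau> x *v nv (convex hull (C - {c})) 1) \<bullet> w x) = 0"
    if "c \<in> C" "dof_value K nv (Tangential_Dof (convex hull (C - {c})) w) \<tau> = 0" for c \<tau> w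
  proof -
    have "face_measure (convex hull (C - {c})) = meas (C - {c})" using that(1) by (intro meas_face) auto
    then show ?thesis using that(2) by (simp add: L2_inner_def)
  qed
  have btr: "b x *v g c = 0" if cx: "c \<in> C" "lam c x = 0" for c x
  proof -
    let ?F = "convex hull (C - {c})"
    obtain r where r: "r \<noteq> 0" "g c = r *\<^sub>R nv ?F 1" "nv ?F 1 \<bullet> nv ?F 1 = 1" by (rule facet_normal[OF cx(1)])
    show ?thesis
    proof (rule facet_unisolvent[OF B(1) _ cx(1) _ _ r(3,2) _ cx(2)])
      show "2 \<le> CARD('n) + 1" using dim_ge by simp
      show "g j \<bullet> (b x *v g c) = 0" if "j \<in> C" "j \<noteq> c" "lam c x = 0" "lam j x = 0" for j x
        using boff that \<open>c \<in> C\<close> by blast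
      show "g c \<bullet> (b x *v g c) = 0" if "lam c x = 0" for x using bdiag that \<open>c \<in> C\<close> by blast
      show "J (C - {c}) (\<lambda>x. proj_normal (nv ?F 1) (b x *v nv ?F 1) \<bullet> w x) = 0"
        if "w \<in> ND (CARD('n) + 1 - 2) ?F (nv ?F 1)" for w
        using that \<open>c \<in> C\<close> by (intro tang B(4)) auto
    qed
  qed
  have b0: "b x = 0" for x
  proof (rule interior_unisolvent[OF B(1) btr])
    show "J C (\<lambda>x. b x \<bullet> q x) = 0" if "q \<in> polys (CARD('n) + 1 - 2) sym_mats" for q
      by (rule div_moments_interior[OF B(1) btr _ _ _ that]) (use B(5,6) dim_ge in auto)
  qed
  have b0': "b = 0" using b0 by (simp add: fun_eq_iff)
  have ptr: "p x *v g c = 0" if cx: "c \<in> C" "lam c x = 0" for c x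
  proof -
    let ?F = "convex hull (C - {c})"
    obtain r where r: "r \<noteq> 0" "g c = r *\<^sub>R nv ?F 1" "nv ?F 1 \<bullet> nv ?F 1 = 1" by (rule facet_normal[OF cx(1)])
    show ?thesis
    proof (rule facet_unisolvent[OF p _ cx(1) _ _ r(3,2) _ cx(2)])
      show "g j \<bullet> (p x *v g c) = 0" if "j \<in> C" "j \<noteq> c" "lam c x = 0" "lam j x = 0" for j x
        using poff that \<open>c \<in> C\<close> by blast
      show "g c \<bullet> (p x *v g c) = 0" if "lam c x = 0" for x using pdiag that \<open>c \<in> C\<close> by blast
      show "J (C - {c}) (\<lambda>x. proj_normal (nv ?F 1) (p x *v nv ?F 1) \<bullet> w x) = 0"
        if "w \<in> ND (2 - 2) ?F (nv ?F 1)" for w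
        using that \<open>c \<in> C\<close> vd[of c w] b0' by (intro tang) auto
    qed simp
  qed
  have "p x = 0" for x
  proof (rule interior_unisolvent[OF p ptr])
    show "J C (\<lambda>x. p x \<bullet> q x) = 0" if "q \<in> polys (2 - 2) sym_mats" for q
      using ve[of q] that b0' unfolding dof_interior by simp
  qed
  then show ?thesis using b0 by (simp add: fun_eq_iff)
qed

section \<open>Interior bubbles and their moments\<close>

text \<open>The conditions on traces are pointwise, so all polynomial tests are covered at once. On
  a facet only the tangential part has to vanish, hence the multiple \<open>\<kappa>\<close> of
  \<open>g c\<close>; the normal-normal trace remains free.\<close>

lemma nn_bubblesI:
  assumes \<tau>: "\<tau> \<in> polys (CARD('n) + 1) sym_mats"
    and vert: "\<And>c. c \<in> C \<Longrightarrow> \<tau> c = 0"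
    and nn: "\<And>S c c' x. S \<subseteq> C \<Longrightarrow> 2 \<le> card S \<Longrightarrow> card S < CARD('n) \<Longrightarrow> c \<in> C - S \<Longrightarrow> c' \<in> C - S \<Longrightarrow> x \<in> flat S \<Longrightarrow>
       g c \<bullet> (\<tau> x *v g c') = 0"
    and tang: "\<And>c x. c \<in> C \<Longrightarrow> lam c x = 0 \<Longrightarrow> \<exists>\<kappa>. \<tau> x *v g c = \<kappa> *\<^sub>R g c"
    and divm: "\<And>v. v \<in> polys_mod_RM (CARD('n)) K \<Longrightarrow> J C (\<lambda>x. row_div \<tau> x \<bullet> v x) = 0"
    and intm: "\<And>s. s \<in> polys (CARD('n) - 1) sym_mats \<Longrightarrow> (\<And>x. x \<in> K \<Longrightarrow> s x *v x = 0) \<Longrightarrow> J C (\<lambda>x. \<tau> x \<bullet> s x) = 0"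
  shows "\<tau> \<in> nn_bubbles K nv"
  unfolding nn_bubbles_def mem_Collect_eq
proof (intro conjI ballI allI impI \<tau>)
  show "{v} \<in> subsimplices 0 K \<Longrightarrow> \<tau> v = 0" for v using vert vertex_subsimplices by blast
next
  fix r f i j and q :: "real ^ 'n \<Rightarrow> real"
  assume r: "r \<in> {1..CARD('n) - 2}" and f: "f \<in> subsimplices r K" and ij: "1 \<le> i \<and> i \<le> j \<and> j \<le> CARD('n) - r"
    and q: "q \<in> polys_on (CARD('n) - r) f UNIV"
  obtain S where S: "S \<subseteq> C" "card S = Suc r" "f = convex hull S" using f by (auto simp: subsimplices_iff)
  have ne: "S \<noteq> {}" "S \<noteq> C" using S(2) r card_C by auto
  obtain p where p: "q = restrict0 f p" using q unfolding polys_on_def by blast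
  obtain u where u: "nv f i = (\<Sum>c\<in>C-S. u c *\<^sub>R g c)"
    using frame(4)[OF S(1) ne(1), of i] ij S(2,3) by auto
  obtain v where v: "nv f j = (\<Sum>c\<in>C-S. v c *\<^sub>R g c)"
    using frame(4)[OF S(1) ne(1), of j] ij S(2,3) by auto
  have "dof_value K nv (Normal_Dof f i j q) \<tau> = J S (\<lambda>x. (nv f i \<bullet> (\<tau> x *v nv f j)) * p x)"
    unfolding p S(3) by (rule dof_normal[OF S(1) ne(2)])
  also have "\<dots> = 0"
  proof (rule J_zero[OF S(1)])
    fix x assume x: "x \<in> flat S"
    have "nv f i \<bullet> (\<tau> x *v nv f j) = 0"
      unfolding u v bilinear_sum using S r x by (intro sum.neutral ballI) (auto simp: nn[OF S(1)])
    then show "(nv f i \<bullet> (\<tau> x *v nv f j)) * p x = 0" by simp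
  qed
  finally show "dof_value K nv (Normal_Dof f i j q) \<tau> = 0" .
next
  fix F w assume F: "F \<in> subsimplices (CARD('n) - 1) K" and w: "w \<in> ND (CARD('n) - 1) F (nv F 1)"
  obtain c where c: "c \<in> C" "F = convex hull (C - {c})" using F facet_subsimplices by blast
  obtain r where r: "r \<noteq> 0" "g c = r *\<^sub>R nv F 1" "nv F 1 \<bullet> nv F 1 = 1"
    using facet_normal[OF c(1)] c(2) by blast
  obtain p where p: "w = restrict0 F p" using ND_pf[OF w] by blast
  have "dof_value K nv (Tangential_Dof F w) \<tau> = J (C - {c}) (\<lambda>x. proj_normal (nv F 1) (\<tau> x *v nv F 1) \<bullet> p x)"
    unfolding p c(2) using c(1) by (intro dof_tangential) auto
  also have "\<dots> = 0"
  proof (rule J_zero)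
    fix x assume "x \<in> flat (C - {c})"
    then obtain \<kappa> where "\<tau> x *v g c = \<kappa> *\<^sub>R g c" using tang c(1) flat_facet by blast
    then have "r *\<^sub>R (\<tau> x *v nv F 1) = r *\<^sub>R (\<kappa> *\<^sub>R nv F 1)" by (simp add: r(2) matrix_vector_mult_scaleR mult.commute)
    then have "\<tau> x *v nv F 1 = \<kappa> *\<^sub>R nv F 1" using r(1) by (simp only: scaleR_cancel_left) simp
    then show "proj_normal (nv F 1) (\<tau> x *v nv F 1) \<bullet> p x = 0" using r(3) by (simp add: proj_normal_def)
  qed auto
  finally show "dof_value K nv (Tangential_Dof F w) \<tau> = 0" .
next
  show "q \<in> polys_mod_RM CARD('n) K \<Longrightarrow> L2_inner (lebesgue_on K) (row_div \<tau>) q = 0" for q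
    using divm by (simp add: L2_inner_def meas_def)
  show "q \<in> polys (CARD('n) - 1) sym_mats \<Longrightarrow> \<forall>x\<in>K. q x *v x = 0 \<Longrightarrow> dof_value K nv (Interior_Dof q) \<tau> = 0" for q
    unfolding dof_interior by (rule intm) auto
qed

text \<open>Fields that can be added without changing normal traces on the facets; they serve to
  correct the divergence and interior moments.\<close>

definition interior_bubbles :: "(real ^ 'n \<Rightarrow> real ^ 'n ^ 'n) set" where
  "interior_bubbles = {\<tau> \<in> polys (CARD('n) + 1) sym_mats. \<forall>c\<in>C. \<forall>x. lam c x = 0 \<longrightarrow> \<tau> x *v g c = 0}"

lemma subspace_interior_bubbles: "subspace interior_bubbles"
  unfolding interior_bubbles_def subspace_def
  using subspace_polys[OF subspace_sym_mats, of "CARD('n) + 1"]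
  by (auto simp: subspace_def matrix_vector_mult_add_rdistrib scaleR_fun_def simp flip: scaleR_matrix_vector_assoc)

lemma outer_self_sym: "outer t t \<in> sym_mats"
  by (simp add: sym_mats_def outer_def transpose_def vec_eq_iff)

text \<open>The vector \<open>i - j\<close> is tangent to every facet except those opposite to
  \<open>i\<close> and \<open>j\<close>, and there the product of the two coordinates
  vanishes.\<close>

lemma edge_bubble:
  assumes ij: "i \<in> C" "j \<in> C" "i \<noteq> j" and q: "q \<in> spolys (CARD('n) - 1)"
  shows "(\<lambda>x. (lam i x * lam j x * q x) *\<^sub>R outer (i - j) (i - j)) \<in> interior_bubbles"
proof -
  have "(\<lambda>x. lam i x * lam j x * q x) \<in> spolys (1 + 1 + (CARD('n) - 1))"
    by (intro spolys_mult lam_spolys q)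
  moreover have "1 + 1 + (CARD('n) - 1) = CARD('n) + 1" using dim_ge by simp
  ultimately have "(\<lambda>x. (lam i x * lam j x * q x) *\<^sub>R outer (i - j) (i - j)) \<in> polys (CARD('n) + 1) sym_mats"
    unfolding polys_eq_mpolys by (intro mpolys_scalar_times outer_self_sym subspace_sym_mats) (simp_all add: polys_eq_mpolys)
  moreover have "((lam i x * lam j x * q x) *\<^sub>R outer (i - j) (i - j)) *v g c = 0" if "c \<in> C" "lam c x = 0" for c x
  proof -
    have "((lam i x * lam j x * q x) *\<^sub>R outer (i - j) (i - j)) *v g c = (lam i x * lam j x * q x * (g c \<bullet> (i - j))) *\<^sub>R (i - j)"
      by (simp add: outer_mult inner_commute flip: scaleR_matrix_vector_assoc)
    then show ?thesis using that ij by (auto simp: inner_g_vertex)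
  qed
  ultimately show ?thesis by (simp add: interior_bubbles_def)
qed

lemma rpf_zero_everywhere:
  assumes "real_polynomial_function u" "\<And>x. x \<in> K \<Longrightarrow> u x = 0"
  shows "u x = 0"
proof (rule rpf_zero_flat[OF subset_refl C_nonempty assms(1)])
  show "x \<in> flat C" by (simp add: flat_UNIV)
  show "u x = 0" if "x \<in> flat C" "\<And>c. c \<in> C \<Longrightarrow> 0 < lam c x" for x
    using that by (intro assms(2)) (auto simp: convex_hull_eq less_imp_le)
qed

text \<open>The divergence and interior moments in the definition of bubbles are linearly
  independent on the interior bubbles, so prescribed values, here those of \<open>b\<close>, are
  attained.\<close>

lemma interior_bubble_moments:
  fixes b :: "real ^ 'n \<Rightarrow> real ^ 'n ^ 'n"
  assumes b: "polynomial_function b"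
  shows "\<exists>\<tau>\<in>interior_bubbles. 
    (\<forall>v\<in>polys_mod_RM (CARD('n)) K. J C (\<lambda>x. row_div \<tau> x \<bullet> v x) = J C (\<lambda>x. row_div b x \<bullet> v x)) \<and>
    (\<forall>s\<in>polys (CARD('n) - 1) sym_mats. (\<forall>x\<in>K. s x *v x = 0) \<longrightarrow> J C (\<lambda>x. \<tau> x \<bullet> s x) = J C (\<lambda>x. b x \<bullet> s x))"
proof -
  define d where "d = CARD('n)"
  have d1: "d \<ge> 1" using dim_ge by (simp add: d_def)
  define Z where "Z = {s \<in> polys (d - 1) (sym_mats :: (real ^ 'n ^ 'n) set). \<forall>x\<in>K. s x *v x = 0}"
  have rdb: "polynomial_function (row_div b)"
  proof -
    have "real_polynomial_function (\<lambda>x. b x $ i $ j)" for i j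
      using pf_linear[OF b linear_nth2] by (simp add: real_polynomial_function_eq)
    then have "real_polynomial_function (\<lambda>x. \<Sum>j\<in>UNIV. dd (axis j 1) (\<lambda>x. b x $ i $ j) x)" for i
      by (intro real_polynomial_function_sum rpf_dd) auto
    then show ?thesis unfolding polynomial_function_iff_Basis_inner by (auto simp: Basis_vec_def inner_axis row_div_nth[OF b])
  qed
  have J_add_C: "J C (\<lambda>x. u x + w x) = J C u + J C w" if "real_polynomial_function u" "real_polynomial_function w" for u w
    using that by (intro J_add C_nonempty subset_refl)
  have sR: "subspace (polys_mod_RM d K)"
    unfolding subspace_def
  proof (intro conjI ballI allI)
    show "0 \<in> polys_mod_RM d K"
      using subspace_0[OF subspace_polys[OF subspace_UNIV]] by (auto simp: polys_mod_RM_def L2_inner_def)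
    show "v + w \<in> polys_mod_RM d K" if v: "v \<in> polys_mod_RM d K" and w: "w \<in> polys_mod_RM d K" for v w
    proof -
      have P: "v \<in> polys d UNIV" "w \<in> polys d UNIV" using v w by (auto simp: polys_mod_RM_def)
      have "J C (\<lambda>x. v x \<bullet> z x + w x \<bullet> z x) = J C (\<lambda>x. v x \<bullet> z x) + J C (\<lambda>x. w x \<bullet> z x)" if "z \<in> rigid_motions" for z
        by (intro J_add_C rpf_inner polys_pf[OF P(1)] polys_pf[OF P(2)] rigid_motion_pf that)
      then show ?thesis using v w subspace_add[OF subspace_polys[OF subspace_UNIV] P]
        by (simp add: polys_mod_RM_def L2_inner_def meas_def inner_add_left)
    qed
    show "r *\<^sub>R v \<in> polys_mod_RM d K" if v: "v \<in> polys_mod_RM d K" for r v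
      using v subspace_scale[OF subspace_polys[OF subspace_UNIV], of v d r]
      by (simp add: polys_mod_RM_def L2_inner_def scaleR_fun_def)
  qed
  have sZ: "subspace Z"
    unfolding Z_def using subspace_polys[OF subspace_sym_mats, of "d - 1"]
    by (auto simp: subspace_def matrix_vector_mult_add_rdistrib scaleR_fun_def simp flip: scaleR_matrix_vector_assoc)
  obtain Q where Q: "finite Q" "independent Q" "span Q = polys_mod_RM d K"
    by (rule finite_basis[OF sR, of d]) (auto simp: polys_mod_RM_def)
  have Zsub: "Z \<subseteq> polys (d - 1) UNIV"
    using polys_mono[of "d - 1" "d - 1" UNIV sym_mats] by (auto simp: Z_def)
  obtain Y where Y: "finite Y" "independent Y" "span Y = Z"
    by (rule finite_basis[OF sZ Zsub])
  have QR: "q \<in> Q \<Longrightarrow> q \<in> polys d UNIV" for q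
    using Q(3) span_base[of q Q] by (auto simp: polys_mod_RM_def)
  have YZ: "s \<in> Y \<Longrightarrow> s \<in> Z" for s using Y(3) span_base[of s Y] by auto
  have pfQ: "polynomial_function q" if "q \<in> Q" for q using QR[OF that] by (rule polys_pf)
  have pfY: "polynomial_function s" if "s \<in> Y" for s using YZ[OF that] unfolding Z_def by (auto intro: polys_pf)
  \<comment> \<open>The two kinds of moments are treated as one family, indexed by the disjoint sum
    of the two bases.\<close>
  define L where "L i \<tau> = (case i of Inl q \<Rightarrow> J C (\<lambda>x. row_div \<tau> x \<bullet> q x) | Inr s \<Rightarrow> J C (\<lambda>x. \<tau> x \<bullet> s x))"
    for i :: "(real ^ 'n \<Rightarrow> real ^ 'n) + (real ^ 'n \<Rightarrow> real ^ 'n ^ 'n)" and \<tau>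
  let ?I = "Inl ` Q \<union> Inr ` Y"
  have sumI: "(\<Sum>i\<in>?I. h i) = (\<Sum>q\<in>Q. h (Inl q)) + (\<Sum>s\<in>Y. h (Inr s))" for h :: "_ \<Rightarrow> real"
    using Q(1) Y(1) by (subst sum.union_disjoint) (auto simp: sum.reindex)
  have pfB: "polynomial_function \<tau>" "polynomial_function (row_div \<tau>)" if "\<tau> \<in> interior_bubbles" for \<tau>
    using that polys_pf[of \<tau> "CARD('n) + 1" sym_mats] polys_pf[OF row_div_polys[of \<tau> "CARD('n) + 1" sym_mats]] by (auto simp: interior_bubbles_def)
  have dcomp: "(\<lambda>x. \<tau> x $ i $ j) differentiable (at x)" if "polynomial_function \<tau>" for \<tau> :: "real ^ 'n \<Rightarrow> real ^ 'n ^ 'n" and i j x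
    by (rule pf_differentiable[OF pf_linear[OF that linear_nth2]])
  have rd_add: "row_div (\<tau> + \<sigma>) x = row_div \<tau> x + row_div \<sigma> x" if "polynomial_function \<tau>" "polynomial_function \<sigma>" for \<tau> \<sigma> :: "real ^ 'n \<Rightarrow> real ^ 'n ^ 'n" and x
    unfolding plus_fun_def
    by (simp add: vec_eq_iff row_div_nth[OF polynomial_function_add[OF that]] row_div_nth[OF that(1)] row_div_nth[OF that(2)]
        dd_add dcomp[OF that(1)] dcomp[OF that(2)] sum.distrib)
  have rd_scale: "row_div (r *\<^sub>R \<tau>) x = r *\<^sub>R row_div \<tau> x" if "polynomial_function \<tau>" for \<tau> :: "real ^ 'n \<Rightarrow> real ^ 'n ^ 'n" and r x
    unfolding scaleR_fun_def
    by (simp add: vec_eq_iff row_div_nth[OF polynomial_function_cmul[OF that]] row_div_nth[OF that]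
        dd_scale dcomp[OF that] sum_distrib_left)
  have "\<exists>X. (\<forall>i\<in>?I. X i \<in> interior_bubbles) \<and> (\<forall>i\<in>?I. \<forall>j\<in>?I. L j (X i) = (if i = j then 1 else 0))"
  proof (rule dual_family)
    show "finite ?I" using Q(1) Y(1) by simp
    show "subspace interior_bubbles" by (rule subspace_interior_bubbles)
    fix i x y and r :: real assume i: "i \<in> ?I" and x: "x \<in> interior_bubbles"
    show "L i (r *\<^sub>R x) = r * L i x"
      using i by (auto simp: L_def rd_scale[OF pfB(1)[OF x]]) (simp add: scaleR_fun_def)
    assume y: "y \<in> interior_bubbles"
    show "L i (x + y) = L i x + L i y"
      using i
    proof (elim UnE imageE)
      fix q assume q: "i = Inl q" "q \<in> Q"
      show ?thesis using J_add_C[OF rpf_inner[OF pfB(2)[OF x] pfQ[OF q(2)]] rpf_inner[OF pfB(2)[OF y] pfQ[OF q(2)]]]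
        by (simp add: q(1) L_def rd_add[OF pfB(1)[OF x] pfB(1)[OF y]] inner_add_left)
    next
      fix s assume s: "i = Inr s" "s \<in> Y"
      show ?thesis using J_add_C[OF rpf_inner[OF pfB(1)[OF x] pfY[OF s(2)]] rpf_inner[OF pfB(1)[OF y] pfY[OF s(2)]]]
        by (simp add: s(1) L_def inner_add_left)
    qed
  next
    fix u i assume u: "\<And>\<tau>. \<tau> \<in> interior_bubbles \<Longrightarrow> (\<Sum>i\<in>?I. u i * L i \<tau>) = 0" and i: "i \<in> ?I"
    define q where "q = (\<Sum>q\<in>Q. u (Inl q) *\<^sub>R q)"
    define s where "s = (\<Sum>s\<in>Y. u (Inr s) *\<^sub>R s)"
    have qR: "q \<in> polys_mod_RM d K" unfolding q_def Q(3)[symmetric] by (intro span_sum span_scale span_base)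
    have sZ': "s \<in> Z" unfolding s_def Y(3)[symmetric] by (intro span_sum span_scale span_base)
    have qd: "q \<in> polys d UNIV" using qR by (simp add: polys_mod_RM_def)
    have sd: "s \<in> polys (d - 1) sym_mats" using sZ' by (simp add: Z_def)
    note pq = polys_pf[OF qd] and ps = polys_pf[OF sd]
    \<comment> \<open>By parts, the whole linear combination is the single moment against
      \<open>s - symgrad q\<close>.\<close>
    define z where "z x = s x - symgrad q x" for x
    have zd: "z \<in> polys (d - 1) sym_mats"
      unfolding z_def[abs_def] by (rule subspace_pointwise(2)[OF subspace_polys[OF subspace_sym_mats] sd symgrad_polys[OF qd]])
    have test: "J C (\<lambda>x. \<tau> x \<bullet> z x) = 0" if \<tau>: "\<tau> \<in> interior_bubbles" for \<tau>
    proof -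
      have \<tau>': "\<tau> \<in> polys (CARD('n) + 1) sym_mats" "\<And>c x. c \<in> C \<Longrightarrow> lam c x = 0 \<Longrightarrow> \<tau> x *v g c = 0"
        using \<tau> by (auto simp: interior_bubbles_def)
      have "0 = (\<Sum>q\<in>Q. u (Inl q) * J C (\<lambda>x. row_div \<tau> x \<bullet> q x)) + (\<Sum>s\<in>Y. u (Inr s) * J C (\<lambda>x. \<tau> x \<bullet> s x))"
        using u[OF \<tau>] unfolding sumI by (simp add: L_def)
      also have "(\<Sum>q\<in>Q. u (Inl q) * J C (\<lambda>x. row_div \<tau> x \<bullet> q x)) = (\<Sum>q\<in>Q. J C (\<lambda>x. u (Inl q) * (row_div \<tau> x \<bullet> q x)))" by simp
      also have "\<dots> = J C (\<lambda>x. \<Sum>q\<in>Q. u (Inl q) * (row_div \<tau> x \<bullet> q x))"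
        using pfB(2)[OF \<tau>] pfQ
        by (intro J_sum[OF subset_refl C_nonempty, symmetric] real_polynomial_function.intros(4)[OF real_polynomial_function.intros(2)] rpf_inner) auto
      also have "\<dots> = J C (\<lambda>x. row_div \<tau> x \<bullet> q x)"
        by (simp add: q_def sum_fun_apply scaleR_fun_def inner_sum_right)
      also have "\<dots> = - J C (\<lambda>x. \<tau> x \<bullet> symgrad q x)" by (rule div_parts_interior[OF \<tau>' pq])
      also have "(\<Sum>s\<in>Y. u (Inr s) * J C (\<lambda>x. \<tau> x \<bullet> s x)) = (\<Sum>s\<in>Y. J C (\<lambda>x. u (Inr s) * (\<tau> x \<bullet> s x)))" by simp
      also have "\<dots> = J C (\<lambda>x. \<Sum>s\<in>Y. u (Inr s) * (\<tau> x \<bullet> s x))"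
        using pfB(1)[OF \<tau>] pfY
        by (intro J_sum[OF subset_refl C_nonempty, symmetric] real_polynomial_function.intros(4)[OF real_polynomial_function.intros(2)] rpf_inner) auto
      also have "\<dots> = J C (\<lambda>x. \<tau> x \<bullet> s x)"
        by (simp add: s_def sum_fun_apply scaleR_fun_def inner_sum_right)
      also have "- J C (\<lambda>x. \<tau> x \<bullet> symgrad q x) + J C (\<lambda>x. \<tau> x \<bullet> s x) = J C (\<lambda>x. \<tau> x \<bullet> s x - \<tau> x \<bullet> symgrad q x)"
        using J_diff[OF subset_refl C_nonempty rpf_inner[OF pfB(1)[OF \<tau>] ps] rpf_inner[OF pfB(1)[OF \<tau>] polys_pf[OF symgrad_polys[OF qd]]]] by simp
      finally show ?thesis by (simp add: z_def inner_diff_right)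
    qed
    \<comment> \<open>Each edge component of \<open>z\<close> is tested with the edge bubble
      weighted by this component itself.\<close>
    have z0: "z x = 0" for x
    proof (rule sym_mat_zeroI)
      show "z x \<in> sym_mats" by (rule sym_polys_value[OF zd])
      fix i j assume ij: "i \<in> C" "j \<in> C" "i \<noteq> j"
      let ?w = "\<lambda>x. (i - j) \<bullet> (z x *v (i - j))"
      have w: "?w \<in> spolys (d - 1)" by (rule linear_spolys[OF zd linear_inner_matrix_vector])
      have "J C (\<lambda>x. ((lam i x * lam j x * ?w x) *\<^sub>R outer (i - j) (i - j)) \<bullet> z x) = 0"
        using edge_bubble[OF ij] w by (intro test) (simp add: d_def)
      then have zz: "J C (\<lambda>x. (lam i x * lam j x) * (?w x)\<^sup>2) = 0"
        by (simp add: inner_commute[of "outer _ _"] inner_outer power2_eq_square mult.assoc)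
      show "?w x = 0"
      proof (rule J_positive[OF subset_refl C_nonempty _ spolys_rpf[OF w] _ _ zz])
        show "real_polynomial_function (\<lambda>x. lam i x * lam j x)" by (intro real_polynomial_function.intros(4) lam_rpf)
        show "x \<in> convex hull C \<Longrightarrow> 0 \<le> lam i x * lam j x" for x using ij by (simp add: convex_hull_eq)
        show "(\<And>c. c \<in> C \<Longrightarrow> 0 < lam c x) \<Longrightarrow> lam i x * lam j x \<noteq> 0" for x using ij by (metis less_irrefl mult_eq_0_iff)
      qed (simp add: flat_UNIV)
    qed
    have sq: "s x = symgrad q x" for x using z0[of x] by (simp add: z_def)
    \<comment> \<open>The identity holds on the simplex, hence everywhere. Since
      \<open>s = symgrad q\<close>, the field \<open>q\<close> is a rigid motion, and it is
      orthogonal to all rigid motions, hence to itself.\<close>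
    have "s x *v x = 0" for x
    proof -
      have r: "real_polynomial_function (\<lambda>x. (s x *v x) $ i)" for i
        using pf_linear[OF pf_mat_vec[OF ps polynomial_function_id] linear_nth] by (simp add: real_polynomial_function_eq)
      have "(s x *v x) $ i = 0" for i
        by (rule rpf_zero_everywhere[OF r]) (use sZ' in \<open>simp add: Z_def\<close>)
      then show ?thesis by (simp add: vec_eq_iff)
    qed
    then have "q \<in> rigid_motions" by (intro rigid_motion_if_symgrad_mult_x[OF pq]) (simp add: sq)
    then have "J C (\<lambda>x. q x \<bullet> q x) = 0" using qR by (simp add: polys_mod_RM_def L2_inner_def meas_def)
    then have "q x = 0" for x using J_norm_zero[OF subset_refl C_nonempty pq, of x] by (simp add: flat_UNIV)
    then have q0: "q = 0" by (simp add: fun_eq_iff)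
    then have "symgrad q x = 0" for x by (simp add: vec_eq_iff symgrad_nth dd_const)
    then have s0: "s = 0" using sq by (simp add: fun_eq_iff)
    have uQ: "u (Inl q') = 0" if "q' \<in> Q" for q'
      using Q(2) q0[unfolded q_def] dependent_finite[OF Q(1)] that by (auto dest!: spec[of _ "\<lambda>q. u (Inl q)"])
    have uY: "u (Inr s') = 0" if "s' \<in> Y" for s'
      using Y(2) s0[unfolded s_def] dependent_finite[OF Y(1)] that by (auto dest!: spec[of _ "\<lambda>q. u (Inr q)"])
    show "u i = 0" using i uQ uY by auto
  qed
  then obtain X where X': "(\<forall>i\<in>?I. X i \<in> interior_bubbles) \<and> (\<forall>i\<in>?I. \<forall>j\<in>?I. L j (X i) = (if i = j then 1 else 0))"
    by (rule exE)
  have X: "\<And>i. i \<in> ?I \<Longrightarrow> X i \<in> interior_bubbles"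
    by (rule bspec[OF conjunct1[OF X']])
  have LX: "\<And>i j. i \<in> ?I \<Longrightarrow> j \<in> ?I \<Longrightarrow> L j (X i) = (if i = j then 1 else 0)"
    by (rule bspec[OF bspec[OF conjunct2[OF X']]])
  \<comment> \<open>The biorthogonal fields combined with the values of \<open>b\<close> as
    coefficients.\<close>
  define \<tau> where "\<tau> = (\<Sum>i\<in>?I. L i b *\<^sub>R X i)"
  have fI: "finite ?I" using Q(1) Y(1) by simp
  have Ladd: "L i (x + y) = L i x + L i y" if "i \<in> ?I" "x \<in> interior_bubbles" "y \<in> interior_bubbles" for i x y
    using that(1)
  proof (elim UnE imageE)
    fix q assume q: "i = Inl q" "q \<in> Q"
    show ?thesis using J_add_C[OF rpf_inner[OF pfB(2)[OF that(2)] pfQ[OF q(2)]] rpf_inner[OF pfB(2)[OF that(3)] pfQ[OF q(2)]]]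
      by (simp add: q(1) L_def rd_add[OF pfB(1)[OF that(2)] pfB(1)[OF that(3)]] inner_add_left)
  next
    fix s assume s: "i = Inr s" "s \<in> Y"
    show ?thesis using J_add_C[OF rpf_inner[OF pfB(1)[OF that(2)] pfY[OF s(2)]] rpf_inner[OF pfB(1)[OF that(3)] pfY[OF s(2)]]]
      by (simp add: s(1) L_def inner_add_left)
  qed
  have Lscale: "L i (r *\<^sub>R x) = r * L i x" if "i \<in> ?I" "x \<in> interior_bubbles" for i x r
    using that by (auto simp: L_def rd_scale[OF pfB(1)[OF that(2)]]) (simp add: scaleR_fun_def)
  have \<tau>: "\<tau> \<in> interior_bubbles"
    unfolding \<tau>_def by (intro subspace_sum subspace_scale subspace_interior_bubbles X)
  have L\<tau>: "L j \<tau> = L j b" if j: "j \<in> ?I" for j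
  proof -
    have "L j (\<Sum>i\<in>?I. L i b *\<^sub>R X i) = (\<Sum>i\<in>?I. L i b * L j (X i))"
    proof (rule functional_sum[OF subspace_interior_bubbles _ _ fI])
      show "L j (x + y) = L j x + L j y" if "x \<in> interior_bubbles" "y \<in> interior_bubbles" for x y by (rule Ladd[OF j that])
      show "L j (r *\<^sub>R x) = r * L j x" if "x \<in> interior_bubbles" for x r by (rule Lscale[OF j that])
      show "X i \<in> interior_bubbles" if "i \<in> ?I" for i by (rule X[OF that])
    qed
    then have "L j \<tau> = (\<Sum>i\<in>?I. L i b * L j (X i))" unfolding \<tau>_def by blast
    also have "\<dots> = (\<Sum>i\<in>?I. if i = j then L i b else 0)" using LX[OF _ j] by (intro sum.cong refl) simp
    finally show ?thesis using fI j by simp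
  qed
  show ?thesis
  proof (intro bexI[of _ \<tau>] conjI ballI impI \<tau>)
    fix v assume "v \<in> polys_mod_RM (CARD('n)) K"
    then have "v \<in> span Q" using Q(3) by (simp add: d_def)
    then obtain c where c: "v = (\<Sum>q\<in>Q. c q *\<^sub>R q)" using span_finite[OF Q(1)] by auto
    have "J C (\<lambda>x. w x \<bullet> v x) = (\<Sum>q\<in>Q. c q * J C (\<lambda>x. w x \<bullet> q x))" if "polynomial_function w" for w
    proof -
      have "J C (\<lambda>x. w x \<bullet> v x) = J C (\<lambda>x. \<Sum>q\<in>Q. c q * (w x \<bullet> q x))"
        by (simp add: c sum_fun_apply scaleR_fun_def inner_sum_right)
      also have "\<dots> = (\<Sum>q\<in>Q. J C (\<lambda>x. c q * (w x \<bullet> q x)))"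
        using that pfQ by (intro J_sum[OF subset_refl C_nonempty] real_polynomial_function.intros(4)[OF real_polynomial_function.intros(2)] rpf_inner) auto
      finally show ?thesis by simp
    qed
    moreover have "J C (\<lambda>x. row_div \<tau> x \<bullet> q x) = J C (\<lambda>x. row_div b x \<bullet> q x)" if "q \<in> Q" for q
      using L\<tau>[of "Inl q"] that by (simp add: L_def)
    ultimately show "J C (\<lambda>x. row_div \<tau> x \<bullet> v x) = J C (\<lambda>x. row_div b x \<bullet> v x)"
      using pfB(2)[OF \<tau>] rdb by simp
  next
    fix s :: "real ^ 'n \<Rightarrow> real ^ 'n ^ 'n" assume "s \<in> polys (CARD('n) - 1) sym_mats" "\<forall>x\<in>K. s x *v x = 0"
    then have "s \<in> span Y" using Y(3) by (simp add: d_def Z_def)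
    then obtain c where c: "s = (\<Sum>q\<in>Y. c q *\<^sub>R q)" using span_finite[OF Y(1)] by auto
    have "J C (\<lambda>x. w x \<bullet> s x) = (\<Sum>q\<in>Y. c q * J C (\<lambda>x. w x \<bullet> q x))" if "polynomial_function w" for w
    proof -
      have "J C (\<lambda>x. w x \<bullet> s x) = J C (\<lambda>x. \<Sum>q\<in>Y. c q * (w x \<bullet> q x))"
        by (simp add: c sum_fun_apply scaleR_fun_def inner_sum_right)
      also have "\<dots> = (\<Sum>q\<in>Y. J C (\<lambda>x. c q * (w x \<bullet> q x)))"
        using that pfY by (intro J_sum[OF subset_refl C_nonempty] real_polynomial_function.intros(4)[OF real_polynomial_function.intros(2)] rpf_inner) auto
      finally show ?thesis by simp
    qed
    moreover have "J C (\<lambda>x. \<tau> x \<bullet> q x) = J C (\<lambda>x. b x \<bullet> q x)" if "q \<in> Y" for q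
      using L\<tau>[of "Inr q"] that by (simp add: L_def)
    ultimately show "J C (\<lambda>x. \<tau> x \<bullet> s x) = J C (\<lambda>x. b x \<bullet> s x)"
      using pfB(1)[OF \<tau>] b by simp
  qed
qed

end

section \<open>Elimination of one block of functionals\<close>

text \<open>The block consists of the functionals \<open>mk q\<close>, \<open>q \<in> B\<close>. On
  the fields in \<open>T\<close> all other terms of the relation drop out, and linearity in the test
  merges the block into the single functional \<open>mk z\<close>, which in general is not in
  \<open>I\<close>. Nondegeneracy gives \<open>z = 0\<close>, and independence of \<open>B\<close>
  gives the coefficients.\<close>

lemma block_zero:
  fixes L :: "'i \<Rightarrow> 'a \<Rightarrow> real" and mk :: "'b::real_vector \<Rightarrow> 'i"
  assumes I: "finite I" and B: "finite B" "independent B" and mk: "inj mk" "mk ` B \<subseteq> I"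
    and lin: "\<And>\<tau> w. \<tau> \<in> T \<Longrightarrow> (\<Sum>q\<in>B. w q * L (mk q) \<tau>) = L (mk (\<Sum>q\<in>B. w q *\<^sub>R q)) \<tau>"
    and others: "\<And>\<tau> i. \<tau> \<in> T \<Longrightarrow> i \<in> I \<Longrightarrow> i \<notin> mk ` B \<Longrightarrow> u i = 0 \<or> L i \<tau> = 0"
    and sum0: "\<And>\<tau>. \<tau> \<in> T \<Longrightarrow> (\<Sum>i\<in>I. u i * L i \<tau>) = 0"
    and nd: "\<And>z. z \<in> span B \<Longrightarrow> (\<And>\<tau>. \<tau> \<in> T \<Longrightarrow> L (mk z) \<tau> = 0) \<Longrightarrow> z = 0"
    and q: "q \<in> B"
  shows "u (mk q) = 0"
proof -
  define z where "z = (\<Sum>q\<in>B. u (mk q) *\<^sub>R q)"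
  have "z = 0"
  proof (rule nd)
    show "z \<in> span B" unfolding z_def by (intro span_sum span_scale span_base)
    fix \<tau> assume \<tau>: "\<tau> \<in> T"
    have "0 = (\<Sum>i\<in>I. u i * L i \<tau>)" using sum0[OF \<tau>] by simp
    also have "\<dots> = (\<Sum>i\<in>mk ` B. u i * L i \<tau>)"
      using I mk(2) others[OF \<tau>] by (intro sum.mono_neutral_right) auto
    also have "\<dots> = (\<Sum>q\<in>B. u (mk q) * L (mk q) \<tau>)"
      using mk(1) by (subst sum.reindex) (auto intro: inj_on_subset)
    also have "\<dots> = L (mk z) \<tau>" unfolding z_def by (rule lin[OF \<tau>])
    finally show "L (mk z) \<tau> = 0" by simp
  qed
  then have "(\<Sum>q\<in>B. u (mk q) *\<^sub>R q) = 0" by (simp add: z_def)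
  then show ?thesis by (rule independentD[OF B(2) B(1) subset_refl _ q])
qed

lemma linear_restrict0: "linear (restrict0 D :: ('a \<Rightarrow> 'b::real_vector) \<Rightarrow> 'a \<Rightarrow> 'b)"
  by (rule linearI) (auto simp: restrict0_def fun_eq_iff scaleR_fun_def)

text \<open>Restriction is linear, so it maps a finite spanning set of the polynomials to one of
  their restrictions.\<close>

lemma finite_restrict_basis:
  fixes B :: "(real ^ 'n \<Rightarrow> 'b::euclidean_space) set"
  assumes "independent B" "span B \<subseteq> restrict0 D ` polys k UNIV"
  shows "finite B"
proof -
  obtain E where E: "finite E" "polys k UNIV \<subseteq> span (E :: (real ^ 'n \<Rightarrow> 'b) set)"
    using mpolys_finite_span[OF finite_degree_le[of k], where 'b='b] by (auto simp: polys_eq_mpolys)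
  have "B \<subseteq> restrict0 D ` span E" using assms(2) E(2) span_superset[of B] by blast
  also have "\<dots> = span (restrict0 D ` E)" by (rule linear_span_image[OF linear_restrict0, symmetric])
  finally show ?thesis using independent_span_bound[OF finite_imageI[OF E(1)] assms(1)] by blast
qed

lemma ND_subset_restrict: "ND k F n \<subseteq> restrict0 F ` polys (k + 1) UNIV"
proof
  fix w assume "w \<in> ND k F n"
  then obtain p A where w: "w = restrict0 F (\<lambda>x. p x + A (proj_normal n x) *v proj_normal n x)"
    "p \<in> polys k (tangent_space F)" "A \<in> hpolys k (skew_on_tangent F)"
    unfolding ND_def by blast
  have \<Pi>1: "(\<lambda>x. proj_normal n x $ i) \<in> shpolys 1" for i
  proof -
    have "(\<lambda>x. x $ i - n $ i * (n \<bullet> x)) \<in> shpolys 1"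
      by (intro shpolys_pointwise(2) shpolys_scale coord_shpolys inner_shpolys)
    then show ?thesis by (simp add: proj_normal_def mult.commute)
  qed
  have "(\<lambda>x. p x + A (proj_normal n x) *v proj_normal n x) \<in> polys (k + 1) UNIV"
    unfolding polys_eq_mpolys
  proof (rule vec_mpolysI)
    fix i
    have "(\<lambda>x. A (proj_normal n x) $ i $ j) \<in> shpolys k" for j
      by (rule shpolys_compose_linear[OF linear_shpolys[OF w(3) linear_nth2] \<Pi>1])
    then have "(\<lambda>x. \<Sum>j\<in>UNIV. A (proj_normal n x) $ i $ j * proj_normal n x $ j) \<in> shpolys (k + 1)"
      by (intro shpolys_pointwise(6) shpolys_mult \<Pi>1)
    then have "(\<lambda>x. \<Sum>j\<in>UNIV. A (proj_normal n x) $ i $ j * proj_normal n x $ j) \<in> spolys (k + 1)"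
      using hpolys_subset_polys[of UNIV "k + 1"] by auto
    moreover have "(\<lambda>x. p x $ i) \<in> spolys (k + 1)"
      by (rule spolys_mono[OF linear_spolys[OF w(2) linear_nth]]) simp
    ultimately show "(\<lambda>x. (p x + A (proj_normal n x) *v proj_normal n x) $ i) \<in> mpolys {\<alpha>. sum \<alpha> UNIV \<le> k + 1} UNIV"
      using spolys_pointwise(1) by (simp add: polys_eq_mpolys matrix_vector_mult_def)
  qed simp
  then show "w \<in> restrict0 F ` polys (k + 1) UNIV" unfolding w(1) by (rule imageI)
qed

lemma row_div_diff:
  fixes \<tau> \<sigma> :: "real ^ 'n \<Rightarrow> real ^ 'n ^ 'n"
  assumes "polynomial_function \<tau>" "polynomial_function \<sigma>"
  shows "row_div (\<lambda>x. \<tau> x - \<sigma> x) x = row_div \<tau> x - row_div \<sigma> x"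
  by (simp add: vec_eq_iff row_div_nth[OF polynomial_function_diff[OF assms]] row_div_nth[OF assms(1)] row_div_nth[OF assms(2)]
      dd_diff pf_differentiable[OF pf_linear[OF assms(1) linear_nth2]] pf_differentiable[OF pf_linear[OF assms(2) linear_nth2]] sum_subtractf)

lemma spolys_prod:
  assumes "finite A" "\<And>i. i \<in> A \<Longrightarrow> f i \<in> spolys 1"
  shows "(\<lambda>x. \<Prod>i\<in>A. f i x) \<in> spolys (card A)"
  using assms
proof (induction A rule: finite_induct)
  case empty
  then show ?case by (simp add: const_polys)
next
  case (insert i A)
  then have "(\<lambda>x. f i x * (\<Prod>i\<in>A. f i x)) \<in> spolys (1 + card A)" by (intro spolys_mult) auto
  then show ?case using insert.hyps by simp
qed

section \<open>Test fields for the elimination\<close>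

context framed_simplex
begin

text \<open>The field \<open>b0\<close> is \<open>outer (g c) (g c)\<close> times \<open>r\<close>
  and the coordinates that vanish on the other facets: it has degree d + 1, and its normal trace on
  the facet opposite to \<open>c\<close> is purely normal. Its divergence and interior moments are
  in general nonzero; they are cancelled by an interior bubble with the same moments, which leaves
  the traces unchanged.\<close>

lemma ex_bubble:
  assumes c: "c \<in> C" and r: "r \<in> spolys 1"
  shows "\<exists>b\<in>nn_bubbles K nv. 
    (\<forall>x. lam c x = 0 \<longrightarrow> g c \<bullet> (b x *v g c) = (g c \<bullet> g c)\<^sup>2 * ((\<Prod>k\<in>C-{c}. lam k x) * r x)) \<and>
    (\<forall>c'\<in>C-{c}. \<forall>x. lam c' x = 0 \<longrightarrow> g c' \<bullet> (b x *v g c') = 0)"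
proof -
  define \<beta> where "\<beta> x = (\<Prod>k\<in>C-{c}. lam k x) * r x" for x
  have \<beta>: "\<beta> \<in> spolys (CARD('n) + 1)"
    unfolding \<beta>_def[abs_def] card_facet[OF c, symmetric]
    using finite_C lam_spolys r by (intro spolys_mult spolys_prod) auto
  have \<beta>0: "\<beta> x = 0" if "k \<in> C" "k \<noteq> c" "lam k x = 0" for k x
    using that finite_C by (auto simp: \<beta>_def)
  define b0 where "b0 x = \<beta> x *\<^sub>R outer (g c) (g c)" for x
  have b0: "b0 \<in> polys (CARD('n) + 1) sym_mats"
    unfolding b0_def polys_eq_mpolys
    using \<beta> by (intro mpolys_scalar_times outer_self_sym subspace_sym_mats) (simp_all add: polys_eq_mpolys)
  have b0_mult: "b0 x *v v = (\<beta> x * (g c \<bullet> v)) *\<^sub>R g c" for x v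
    by (simp add: b0_def outer_mult flip: scaleR_matrix_vector_assoc)
  obtain \<tau> where \<tau>: "\<tau> \<in> interior_bubbles"
    and \<tau>div: "\<And>v. v \<in> polys_mod_RM (CARD('n)) K \<Longrightarrow> J C (\<lambda>x. row_div \<tau> x \<bullet> v x) = J C (\<lambda>x. row_div b0 x \<bullet> v x)"
    and \<tau>int: "\<And>s. s \<in> polys (CARD('n) - 1) sym_mats \<Longrightarrow> (\<And>x. x \<in> K \<Longrightarrow> s x *v x = 0) \<Longrightarrow> J C (\<lambda>x. \<tau> x \<bullet> s x) = J C (\<lambda>x. b0 x \<bullet> s x)"
    using interior_bubble_moments[OF polys_pf[OF b0]] by blast
  have \<tau>p: "\<tau> \<in> polys (CARD('n) + 1) sym_mats" and \<tau>z: "\<And>c x. c \<in> C \<Longrightarrow> lam c x = 0 \<Longrightarrow> \<tau> x *v g c = 0"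
    using \<tau> by (auto simp: interior_bubbles_def)
  note pf = polys_pf[OF b0] polys_pf[OF \<tau>p]
  define b where "b x = b0 x - \<tau> x" for x
  have bz: "b x *v g k = b0 x *v g k" if "k \<in> C" "lam k x = 0" for k x
    using \<tau>z[OF that] by (simp add: b_def matrix_vector_mult_diff_rdistrib)
  have "b \<in> nn_bubbles K nv"
  proof (rule nn_bubblesI)
    show "b \<in> polys (CARD('n) + 1) sym_mats"
      unfolding b_def[abs_def] by (rule subspace_pointwise(2)[OF subspace_polys[OF subspace_sym_mats] b0 \<tau>p])
    show "b c0 = 0" if c0: "c0 \<in> C" for c0
    proof -
      obtain k where k: "k \<in> C" "k \<noteq> c" "k \<noteq> c0" using ex_other_vertex[OF c c0] .
      have "b0 c0 = 0" using \<beta>0[OF k(1,2), of c0] k c0 by (simp add: b0_def lam_vertex)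
      \<comment> \<open>A vertex lies on all facets but the one opposite to it, so
        \<open>\<tau> c0\<close> annihilates all gradients except possibly \<open>g c0\<close>, and
        that one too because the gradients sum to zero.\<close>
      moreover have "\<tau> c0 = 0"
      proof (rule mat_zeroI)
        have z: "\<tau> c0 *v g j = 0" if "j \<in> C" "j \<noteq> c0" for j using that c0 by (intro \<tau>z) (auto simp: lam_vertex)
        have "0 = \<tau> c0 *v (\<Sum>j\<in>C. g j)" by (simp add: sum_g)
        also have "\<dots> = (\<Sum>j\<in>C. \<tau> c0 *v g j)" by (simp add: linear_sum[OF matrix_vector_mul_linear])
        also have "\<dots> = \<tau> c0 *v g c0" using z c0 finite_C by (subst sum.remove[of C c0]) auto
        finally show "g i \<bullet> (\<tau> c0 *v g j) = 0" if "j \<in> C" for i j using z that by (cases "j = c0") auto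
      qed
      ultimately show ?thesis by (simp add: b_def)
    qed
    show "g c1 \<bullet> (b x *v g c2) = 0" if S: "S \<subseteq> C" "card S < CARD('n)" "c1 \<in> C - S" "c2 \<in> C - S" "x \<in> flat S" for S c1 c2 x
    proof -
      \<comment> \<open>With fewer than d vertices in \<open>S\<close>, some vertex other than
        \<open>c\<close> lies outside \<open>S\<close>; its coordinate vanishes on the flat and is a
        factor of \<open>\<beta>\<close>.\<close>
      have "card (insert c S) < card C" using S(2) card_C card_insert_le_m1[of "card S + 1" S c]
        by (simp add: card_insert_if finite_subset[OF S(1) finite_C])
      then have "\<not> C \<subseteq> insert c S" using card_mono[of "insert c S" C] finite_subset[OF S(1) finite_C] by auto
      then obtain k where "k \<in> C" "k \<noteq> c" "k \<notin> S" by blast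
      then have "\<beta> x = 0" using S(5) by (intro \<beta>0[of k]) (auto simp: flat_def)
      moreover have "lam c2 x = 0" using S by (auto simp: flat_def)
      ultimately show ?thesis using bz[of c2 x] S(4) by (simp add: b0_mult)
    qed
    show "\<exists>\<kappa>. b x *v g c' = \<kappa> *\<^sub>R g c'" if "c' \<in> C" "lam c' x = 0" for c' x
    proof (cases "c' = c")
      case True
      then show ?thesis using bz[OF that] by (auto simp: b0_mult)
    next
      case False
      then show ?thesis using bz[OF that] \<beta>0[OF that(1) False that(2)] by (intro exI[of _ 0]) (simp add: b0_mult)
    qed
    show "J C (\<lambda>x. row_div b x \<bullet> v x) = 0" if v: "v \<in> polys_mod_RM CARD('n) K" for v
    proof -
      have pv: "polynomial_function v" using v polys_pf by (auto simp: polys_mod_RM_def)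
      have "J C (\<lambda>x. row_div b x \<bullet> v x) = J C (\<lambda>x. row_div b0 x \<bullet> v x) - J C (\<lambda>x. row_div \<tau> x \<bullet> v x)"
        unfolding b_def[abs_def] row_div_diff[OF pf] inner_diff_left
        by (intro J_diff[OF subset_refl C_nonempty] rpf_inner polys_pf[OF row_div_polys[OF b0]] polys_pf[OF row_div_polys[OF \<tau>p]] pv)
      then show ?thesis using \<tau>div[OF v] by simp
    qed
    show "J C (\<lambda>x. b x \<bullet> s x) = 0" if s: "s \<in> polys (CARD('n) - 1) sym_mats" "\<And>x. x \<in> K \<Longrightarrow> s x *v x = 0" for s
    proof -
      have "J C (\<lambda>x. b x \<bullet> s x) = J C (\<lambda>x. b0 x \<bullet> s x) - J C (\<lambda>x. \<tau> x \<bullet> s x)"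
        unfolding b_def inner_diff_left
        by (intro J_diff[OF subset_refl C_nonempty] rpf_inner pf polys_pf[OF s(1)])
      then show ?thesis using \<tau>int[OF s] by simp
    qed
  qed
  moreover have "g c \<bullet> (b x *v g c) = (g c \<bullet> g c)\<^sup>2 * ((\<Prod>k\<in>C-{c}. lam k x) * r x)" if "lam c x = 0" for x
    using bz[OF c that] by (simp add: b0_mult \<beta>_def power2_eq_square)
  moreover have "g c' \<bullet> (b x *v g c') = 0" if "c' \<in> C - {c}" "lam c' x = 0" for c' x
    using bz[of c' x] \<beta>0[of c' x] that by (simp add: b0_mult)
  ultimately show ?thesis by blast
qed

text \<open>Basis elements are restrictions extended by zero and agree with polynomials only on the
  face; integrability is taken from those polynomials.\<close>

lemma J_test_linear:
  fixes U :: "real ^ 'n \<Rightarrow> 'b::euclidean_space"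
  assumes S: "S \<subseteq> C" "S \<noteq> {}" and U: "polynomial_function U" 
    and B: "\<And>q. q \<in> B \<Longrightarrow> \<exists>p. polynomial_function p \<and> (\<forall>x\<in>convex hull S. q x = p x)"
  shows "(\<Sum>q\<in>B. w q * J S (\<lambda>x. U x \<bullet> q x)) = J S (\<lambda>x. U x \<bullet> (\<Sum>q\<in>B. w q *\<^sub>R q) x)"
proof -
  obtain p where p: "\<And>q. q \<in> B \<Longrightarrow> polynomial_function (p q)" 
    and qp: "\<And>q x. q \<in> B \<Longrightarrow> x \<in> convex hull S \<Longrightarrow> q x = p q x"
    using B by metis
  have "(\<Sum>q\<in>B. w q * J S (\<lambda>x. U x \<bullet> q x)) = (\<Sum>q\<in>B. J S (\<lambda>x. w q * (U x \<bullet> p q x)))"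
  proof (rule sum.cong[OF refl])
    fix q assume q: "q \<in> B"
    have "J S (\<lambda>x. U x \<bullet> q x) = J S (\<lambda>x. U x \<bullet> p q x)" using qp[OF q] by (intro J_cong'[OF S(1)]) simp
    then show "w q * J S (\<lambda>x. U x \<bullet> q x) = J S (\<lambda>x. w q * (U x \<bullet> p q x))" by simp
  qed
  also have "\<dots> = J S (\<lambda>x. \<Sum>q\<in>B. w q * (U x \<bullet> p q x))"
    using U p by (intro J_sum[OF S, symmetric] real_polynomial_function.intros(4)[OF real_polynomial_function.intros(2)] rpf_inner) auto
  also have "\<dots> = J S (\<lambda>x. U x \<bullet> (\<Sum>q\<in>B. w q *\<^sub>R q) x)"
    using qp by (intro J_cong'[OF S(1)]) (simp add: sum_fun_apply scaleR_fun_def inner_sum_right)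
  finally show ?thesis .
qed

lemma dof_normal':
  assumes "S \<subseteq> C" "S \<noteq> C"
  shows "dof_value K nv (Normal_Dof (convex hull S) i j q) \<tau> =
    J S (\<lambda>x. (nv (convex hull S) i \<bullet> (\<tau> x *v nv (convex hull S) j)) \<bullet> q x)"
  using assms by (simp add: L2_inner_def meas_face)

lemma dof_tangential':
  assumes "S \<subseteq> C" "S \<noteq> C"
  shows "dof_value K nv (Tangential_Dof (convex hull S) q) \<tau> =
    J S (\<lambda>x. proj_normal (nv (convex hull S) 1) (\<tau> x *v nv (convex hull S) 1) \<bullet> q x)"
  using assms by (simp add: L2_inner_def meas_face)

text \<open>Positivity for the weight \<open>lam i * lam j\<close> and the constant
  \<open>q = 1\<close>.\<close>

lemma J_lam_lam:
  assumes S: "S \<subseteq> C" and ij: "i \<in> S" "j \<in> S"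
  shows "J S (\<lambda>x. lam i x * lam j x) \<noteq> 0"
proof
  assume "J S (\<lambda>x. lam i x * lam j x) = 0"
  then have z: "J S (\<lambda>x. (lam i x * lam j x) * (1::real)\<^sup>2) = 0" by simp
  have "(1::real) = 0"
  proof (rule J_positive[OF S _ _ _ _ _ z vertex_mem_flat[OF ij(1) S]])
    show "real_polynomial_function (\<lambda>x. lam i x * lam j x)" by (intro real_polynomial_function.intros(4) lam_rpf)
    show "x \<in> convex hull S \<Longrightarrow> 0 \<le> lam i x * lam j x" for x using ij S by (simp add: convex_hull_eq)
    show "(\<And>c. c \<in> S \<Longrightarrow> 0 < lam c x) \<Longrightarrow> lam i x * lam j x \<noteq> 0" for x using ij by (metis less_irrefl mult_eq_0_iff)
  qed (use ij in auto)
  then show False by simp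
qed

text \<open>The homothety identity about \<open>l\<close>, applied to the product of the three
  coordinates. The derivative of \<open>lam k\<close> along \<open>x - l\<close> is
  \<open>lam k\<close>, minus one if \<open>k = l\<close>: the three factors contribute 3 on the
  left, and every factor equal to \<open>lam l\<close> contributes one copy of
  \<open>lam i * lam j\<close> on the right.\<close>

lemma J_lam_lam_lam:
  assumes S: "S \<subseteq> C" "S \<noteq> {}"
  obtains m :: nat where "\<And>i j l. i \<in> S \<Longrightarrow> j \<in> S \<Longrightarrow> i \<noteq> j \<Longrightarrow> l \<in> S \<Longrightarrow>
    (real m + 3) * J S (\<lambda>x. lam i x * lam j x * lam l x) =
    (1 + (if l = i then 1 else 0) + (if l = j then 1 else 0)) * J S (\<lambda>x. lam i x * lam j x)"
proof -
  obtain m where m: "\<And>v P Q. v \<in> S \<Longrightarrow> real_polynomial_function P \<Longrightarrow> real_polynomial_function Q \<Longrightarrow>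
    (\<And>x. x \<in> convex hull S \<Longrightarrow> P x = lam v x * Q x) \<Longrightarrow> J S (\<lambda>x. real m * P x + dd (x - v) P x) = 0"
    by (rule J_homothety[OF S]) blast
  have "(real m + 3) * J S (\<lambda>x. lam i x * lam j x * lam l x) =
    (1 + (if l = i then 1 else 0) + (if l = j then 1 else 0)) * J S (\<lambda>x. lam i x * lam j x)"
    if ij: "i \<in> S" "j \<in> S" "i \<noteq> j" and l: "l \<in> S" for i j l
  proof -
    have ijl: "i \<in> C" "j \<in> C" "l \<in> C" using ij l S by auto
    let ?\<delta> = "1 + (if l = i then 1 else 0) + (if l = j then 1 else (0::real))"
    have r2: "real_polynomial_function (\<lambda>x. lam i x * lam j x)" by (intro real_polynomial_function.intros(4) lam_rpf)
    have r3: "real_polynomial_function (\<lambda>x. lam i x * lam j x * lam l x)" by (intro real_polynomial_function.intros(4) lam_rpf)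
    have d: "lam k differentiable (at x)" for k x by (rule rpf_differentiable[OF lam_rpf])
    have "0 = J S (\<lambda>x. real m * (lam i x * lam j x * lam l x) + dd (x - l) (\<lambda>x. lam i x * lam j x * lam l x) x)"
      by (rule m[OF l r3 r2, symmetric]) simp
    also have "\<dots> = J S (\<lambda>x. (real m + 3) * (lam i x * lam j x * lam l x) - ?\<delta> * (lam i x * lam j x))"
    proof (rule J_cong[OF S(1)])
      fix x
      have dl: "dd (x - l) (lam k) x = lam k x - (if k = l then 1 else 0)" if "k \<in> C" for k
        using that ijl by (simp add: dd_lam inner_g_diff lam_vertex)
      have "dd (x - l) (\<lambda>x. lam i x * lam j x * lam l x) x
         = lam i x * lam j x * dd (x - l) (lam l) x + (lam i x * dd (x - l) (lam j) x + dd (x - l) (lam i) x * lam j x) * lam l x"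
        using d by (simp add: dd_mult differentiable_mult)
      also have "\<dots> = 3 * (lam i x * lam j x * lam l x) - ?\<delta> * (lam i x * lam j x)"
        using ijl ij(3) by (auto simp: dl algebra_simps)
      finally show "real m * (lam i x * lam j x * lam l x) + dd (x - l) (\<lambda>x. lam i x * lam j x * lam l x) x
         = (real m + 3) * (lam i x * lam j x * lam l x) - ?\<delta> * (lam i x * lam j x)" by (simp add: algebra_simps)
    qed
    also have "\<dots> = J S (\<lambda>x. (real m + 3) * (lam i x * lam j x * lam l x)) - J S (\<lambda>x. ?\<delta> * (lam i x * lam j x))"
      by (intro J_diff S real_polynomial_function.intros(4)[OF real_polynomial_function.intros(2)] r2 r3)
    finally show ?thesis by simp
  qed
  then show thesis by (rule that)
qed

text \<open>With \<open>s j = \<Sum>k\<in>S. (k - j) \<bullet> W k\<close> the moments of the tangential edge fields give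
  \<open>s j - s i + 2 (i - j) \<bullet> W i = 0\<close>; summation over \<open>i\<close> and then over \<open>j\<close> yields \<open>s = 0\<close>.\<close>

lemma facet_rigid_motion_zero:
  assumes S: "S \<subseteq> C" "S \<noteq> {}"
    and aff: "\<And>x. x \<in> flat S \<Longrightarrow> W x = (\<Sum>k\<in>S. lam k x *\<^sub>R W k)"
    and rigid: "\<And>i j. i \<in> S \<Longrightarrow> j \<in> S \<Longrightarrow> (W i - W j) \<bullet> (i - j) = 0"
    and tang: "\<And>i c. i \<in> S \<Longrightarrow> c \<in> C - S \<Longrightarrow> g c \<bullet> W i = 0"
    and mom: "\<And>i j. i \<in> S \<Longrightarrow> j \<in> S \<Longrightarrow> i \<noteq> j \<Longrightarrow> J S (\<lambda>x. lam i x * lam j x * ((i - j) \<bullet> W x)) = 0"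
    and x: "x \<in> flat S"
  shows "W x = 0"
proof -
  have finS: "finite S" using S finite_C finite_subset by blast
  obtain m :: nat where m: "\<And>i j l. i \<in> S \<Longrightarrow> j \<in> S \<Longrightarrow> i \<noteq> j \<Longrightarrow> l \<in> S \<Longrightarrow>
    (real m + 3) * J S (\<lambda>x. lam i x * lam j x * lam l x) =
    (1 + (if l = i then 1 else 0) + (if l = j then 1 else 0)) * J S (\<lambda>x. lam i x * lam j x)"
    by (rule J_lam_lam_lam[OF S]) blast
  define s where "s j = (\<Sum>k\<in>S. (k - j) \<bullet> W k)" for j
  have rel: "s j - s i + 2 * ((i - j) \<bullet> W i) = 0" if ij: "i \<in> S" "j \<in> S" for i j
  proof (cases "i = j")
    case False
    let ?E = "J S (\<lambda>x. lam i x * lam j x)"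
    have r3: "real_polynomial_function (\<lambda>x. lam i x * lam j x * lam l x)" for l by (intro real_polynomial_function.intros(4) lam_rpf)
    have "0 = J S (\<lambda>x. lam i x * lam j x * ((i - j) \<bullet> W x))" using mom[OF ij False] by simp
    also have "\<dots> = J S (\<lambda>x. \<Sum>l\<in>S. ((i - j) \<bullet> W l) * (lam i x * lam j x * lam l x))"
      by (rule J_cong[OF S(1)]) (simp add: aff[of _] inner_sum_right sum_distrib_left mult_ac)
    also have "\<dots> = (\<Sum>l\<in>S. J S (\<lambda>x. ((i - j) \<bullet> W l) * (lam i x * lam j x * lam l x)))"
      by (intro J_sum S real_polynomial_function.intros(4)[OF real_polynomial_function.intros(2)] r3)
    also have "\<dots> = (\<Sum>l\<in>S. ((i - j) \<bullet> W l) * J S (\<lambda>x. lam i x * lam j x * lam l x))" by simp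
    finally have "0 = (real m + 3) * (\<Sum>l\<in>S. ((i - j) \<bullet> W l) * J S (\<lambda>x. lam i x * lam j x * lam l x))" by simp
    also have "\<dots> = (\<Sum>l\<in>S. ((i - j) \<bullet> W l) * ((real m + 3) * J S (\<lambda>x. lam i x * lam j x * lam l x)))"
      by (simp only: sum_distrib_left mult.left_commute)
    also have "\<dots> = (\<Sum>l\<in>S. ((i - j) \<bullet> W l) * ((1 + (if l = i then 1 else 0) + (if l = j then 1 else 0)) * ?E))"
      by (intro sum.cong refl) (simp only: m[OF ij False])
    also have "\<dots> = (\<Sum>l\<in>S. ((i - j) \<bullet> W l) + (if l = i then (i - j) \<bullet> W l else 0) + (if l = j then (i - j) \<bullet> W l else 0)) * ?E"
      unfolding sum_distrib_right by (intro sum.cong refl) (simp add: algebra_simps)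
    also have "\<dots> = ((\<Sum>l\<in>S. (i - j) \<bullet> W l) + (i - j) \<bullet> W i + (i - j) \<bullet> W j) * ?E"
      using ij finS by (simp add: sum.distrib)
    finally have "(\<Sum>l\<in>S. (i - j) \<bullet> W l) + (i - j) \<bullet> W i + (i - j) \<bullet> W j = 0"
      using J_lam_lam[OF S(1) ij] by simp
    moreover have "(i - j) \<bullet> W j = (i - j) \<bullet> W i"
      using rigid[OF ij] by (simp add: inner_diff_left inner_diff_right inner_commute)
    moreover have "(\<Sum>l\<in>S. (i - j) \<bullet> W l) = s j - s i"
      by (simp add: s_def inner_diff_left flip: sum_subtractf)
    ultimately show ?thesis by simp
  qed simp
  have s1: "(real (card S) + 2) * s j = sum s S" if j: "j \<in> S" for j
  proof -
    have "0 = (\<Sum>i\<in>S. s j - s i + 2 * ((i - j) \<bullet> W i))" using rel j by simp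
    also have "\<dots> = real (card S) * s j - sum s S + 2 * (\<Sum>i\<in>S. (i - j) \<bullet> W i)"
      by (simp add: sum.distrib sum_subtractf sum_distrib_left)
    also have "(\<Sum>i\<in>S. (i - j) \<bullet> W i) = s j" by (simp add: s_def)
    finally show ?thesis by (simp add: algebra_simps)
  qed
  have "(\<Sum>j\<in>S. (real (card S) + 2) * s j) = (\<Sum>j\<in>S. sum s S)" using s1 by (rule sum.cong[OF refl])
  then have "(real (card S) + 2) * sum s S = real (card S) * sum s S" by (simp add: sum_distrib_left)
  then have "sum s S = 0" by (simp add: algebra_simps)
  then have s0: "s j = 0" if "j \<in> S" for j
    using s1[OF that] by (auto simp: add_nonneg_eq_0_iff)
  have W0: "W i = 0" if i: "i \<in> S" for i
  proof -
    have z: "(j - i) \<bullet> W i = 0" if "j \<in> S" for j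
      using rel[OF i that] s0[OF i] s0[OF that] by (simp add: inner_diff_left)
    \<comment> \<open>As \<open>W i\<close> is tangential, only edges within \<open>S\<close> enter
      its expansion, and along these its component is zero.\<close>
    have "W i \<bullet> W i = (\<Sum>c\<in>C. (g c \<bullet> W i) *\<^sub>R (c - i)) \<bullet> W i" by (simp only: sum_inner_g_diff)
    also have "\<dots> = (\<Sum>c\<in>C. (g c \<bullet> W i) * ((c - i) \<bullet> W i))" by (simp add: inner_sum_left)
    also have "\<dots> = 0"
    proof (rule sum.neutral, rule ballI)
      fix c assume "c \<in> C"
      then show "(g c \<bullet> W i) * ((c - i) \<bullet> W i) = 0" using z tang[OF i] by (cases "c \<in> S") auto
    qed
    finally show ?thesis by simp
  qed
  show ?thesis using aff[OF x] W0 by simp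
qed

text \<open>The factor \<open>lam i * lam j\<close> vanishes at the vertices, on the facets opposite
  to \<open>i\<close> and \<open>j\<close> and on all other edges; the normals of the remaining edge
  and facets are orthogonal to \<open>i - j\<close>, so no normal-normal functional sees the field.
  The vector \<open>w\<close> selects the facets that see it tangentially: none for
  \<open>w = i - j\<close>, only the one opposite to \<open>c\<close> for
  \<open>w = i - c\<close>.\<close>

lemma edge_field:
  assumes ij: "i \<in> C" "j \<in> C" "i \<noteq> j"
  defines "\<tau> \<equiv> \<lambda>w x. (lam i x * lam j x) *\<^sub>R sprod (i - j) w"
  shows "\<tau> w \<in> polys 2 sym_mats"
    and "c \<in> C \<Longrightarrow> \<tau> w c = 0"
    and "S \<subseteq> C \<Longrightarrow> card S = 2 \<Longrightarrow> k \<in> {1..CARD('n) - 1} \<Longrightarrow> l \<in> {1..CARD('n) - 1} \<Longrightarrow>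
       dof_value K nv (Normal_Dof (convex hull S) k l q) (\<tau> w) = 0"
    and "c \<in> C \<Longrightarrow> dof_value K nv (Normal_Dof (convex hull (C - {c})) 1 1 q) (\<tau> w) = 0"
    and "c \<in> C \<Longrightarrow> c = i \<or> c = j \<or> g c \<bullet> w = 0 \<Longrightarrow> 
      dof_value K nv (Tangential_Dof (convex hull (C - {c})) v) (\<tau> w) = 0"
proof -
  have "(\<lambda>x. lam i x * lam j x) \<in> spolys (1 + 1)" by (intro spolys_mult lam_spolys)
  then have "(\<lambda>x. lam i x * lam j x) \<in> spolys 2" by (simp only: one_add_one)
  then show "\<tau> w \<in> polys 2 sym_mats"
    unfolding \<tau>_def polys_eq_mpolys
    by (intro mpolys_scalar_times sprod_sym subspace_sym_mats) (simp_all add: polys_eq_mpolys)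
  show "\<tau> w c = 0" if "c \<in> C" using that ij by (auto simp: \<tau>_def lam_vertex)
  have \<tau>_mult: "\<tau> w x *v y = (lam i x * lam j x) *\<^sub>R ((w \<bullet> y) *\<^sub>R (i - j) + ((i - j) \<bullet> y) *\<^sub>R w)" for x y
    by (simp add: \<tau>_def sprod_mult flip: scaleR_matrix_vector_assoc)
  show "dof_value K nv (Normal_Dof (convex hull S) k l q) (\<tau> w) = 0"
    if S: "S \<subseteq> C" "card S = 2" "k \<in> {1..CARD('n) - 1}" "l \<in> {1..CARD('n) - 1}"
  proof -
    have ne: "S \<noteq> {}" "S \<noteq> C" using S card_C dim_ge by auto
    have kl: "k \<in> {1..Suc CARD('n) - card S}" "l \<in> {1..Suc CARD('n) - card S}" using S by auto
    show ?thesis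
      unfolding dof_normal'[OF S(1) ne(2)]
    proof (rule J_zero[OF S(1)])
      fix x assume x: "x \<in> flat S"
      show "(nv (convex hull S) k \<bullet> (\<tau> w x *v nv (convex hull S) l)) \<bullet> q x = 0"
      proof (cases "i \<in> S \<and> j \<in> S")
        case True
        then have "nv (convex hull S) k \<bullet> (i - j) = 0" "(i - j) \<bullet> nv (convex hull S) l = 0"
          using frame(2)[OF S(1) ne(1)] kl by (simp_all add: inner_commute)
        then show ?thesis by (simp add: \<tau>_mult inner_add_right)
      next
        case False
        then have "lam i x * lam j x = 0" using x ij by (auto simp: flat_def)
        then show ?thesis by (simp add: \<tau>_mult)
      qed
    qed
  qed
  show "dof_value K nv (Normal_Dof (convex hull (C - {c})) 1 1 q) (\<tau> w) = 0" if c: "c \<in> C"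
  proof -
    obtain r where r: "r \<noteq> 0" "g c = r *\<^sub>R nv (convex hull (C - {c})) 1" by (rule facet_normal[OF c])
    have ne: "C - {c} \<noteq> C" using c by blast
    show ?thesis
      unfolding dof_normal'[OF Diff_subset ne]
    proof (rule J_zero[OF Diff_subset])
      fix x assume x: "x \<in> flat (C - {c})"
      show "(nv (convex hull (C - {c})) 1 \<bullet> (\<tau> w x *v nv (convex hull (C - {c})) 1)) \<bullet> q x = 0"
      proof (cases "c = i \<or> c = j")
        case True
        then have "lam i x * lam j x = 0" using x flat_facet[OF c] by auto
        then show ?thesis by (simp add: \<tau>_mult)
      next
        case False
        then have "g c \<bullet> (i - j) = 0" using c ij by (simp add: inner_g_vertex)
        then have "nv (convex hull (C - {c})) 1 \<bullet> (i - j) = 0" using r by simp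
        then show ?thesis by (simp add: \<tau>_mult inner_add_right inner_commute)
      qed
    qed
  qed
  show "dof_value K nv (Tangential_Dof (convex hull (C - {c})) v) (\<tau> w) = 0" if c: "c \<in> C" and w: "c = i \<or> c = j \<or> g c \<bullet> w = 0"
  proof -
    obtain r where r: "r \<noteq> 0" "g c = r *\<^sub>R nv (convex hull (C - {c})) 1" by (rule facet_normal[OF c])
    have ne: "C - {c} \<noteq> C" using c by blast
    show ?thesis
      unfolding dof_tangential'[OF Diff_subset ne]
    proof (rule J_zero[OF Diff_subset])
      fix x assume x: "x \<in> flat (C - {c})"
      have "\<tau> w x *v nv (convex hull (C - {c})) 1 = 0"
      proof (cases "c = i \<or> c = j")
        case True
        then have "lam i x * lam j x = 0" using x flat_facet[OF c] by auto
        then show ?thesis by (simp add: \<tau>_mult)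
      next
        case False
        then have "g c \<bullet> (i - j) = 0" "g c \<bullet> w = 0" using c ij w by (auto simp: inner_g_vertex)
        then show ?thesis using r by (simp add: \<tau>_mult inner_commute)
      qed
      then show "proj_normal (nv (convex hull (C - {c})) 1) (\<tau> w x *v nv (convex hull (C - {c})) 1) \<bullet> v x = 0"
        by (simp add: proj_normal_def)
    qed
  qed
qed

section \<open>The shape function space is a space of polynomials\<close>

lemma subspace_nn_bubbles: "subspace (nn_bubbles K nv)"
proof -
  have add: "\<tau> + \<sigma> \<in> nn_bubbles K nv" if \<tau>: "\<tau> \<in> nn_bubbles K nv" and \<sigma>: "\<sigma> \<in> nn_bubbles K nv" for \<tau> \<sigma>
  proof -
    note T = \<tau>[unfolded nn_bubbles_def mem_Collect_eq] and S = \<sigma>[unfolded nn_bubbles_def mem_Collect_eq]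
    note pf = polys_pf[OF nn_bubblesD(1)[OF \<tau>]] polys_pf[OF nn_bubblesD(1)[OF \<sigma>]]
    show ?thesis
      unfolding nn_bubbles_def mem_Collect_eq
    proof (intro conjI ballI allI impI)
      show "\<tau> + \<sigma> \<in> polys (CARD('n) + 1) sym_mats"
        using nn_bubblesD(1)[OF \<tau>] nn_bubblesD(1)[OF \<sigma>] by (intro subspace_add subspace_polys subspace_sym_mats)
      show "{v} \<in> subsimplices 0 K \<Longrightarrow> (\<tau> + \<sigma>) v = 0" for v using T S by simp
    next
      fix r f i j and q :: "real ^ 'n \<Rightarrow> real"
      assume *: "r \<in> {1..CARD('n) - 2}" "f \<in> subsimplices r K" "1 \<le> i \<and> i \<le> j \<and> j \<le> CARD('n) - r" "q \<in> polys_on (CARD('n) - r) f UNIV"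
      obtain S' where S': "S' \<subseteq> C" "card S' = Suc r" "f = convex hull S'" using *(2) by (auto simp: subsimplices_iff)
      obtain p where p: "p \<in> spolys (CARD('n) - r)" "q = restrict0 f p" using *(4) unfolding polys_on_def by blast
      have "test_dof (Normal_Dof f i j q)"
        unfolding p(2) S'(3) using S' *(1) card_C spolys_rpf[OF p(1)] by (intro test_dof_normal) auto
      then show "dof_value K nv (Normal_Dof f i j q) (\<tau> + \<sigma>) = 0" 
        using T S * by (simp only: dof_add[OF _ pf])
    next
      fix F w assume *: "F \<in> subsimplices (CARD('n) - 1) K" "w \<in> ND (CARD('n) - 1) F (nv F 1)"
      obtain c where c: "c \<in> C" "F = convex hull (C - {c})" using *(1) unfolding facet_subsimplices by blast
      have "test_dof (Tangential_Dof F w)"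
        using *(2) unfolding c(2) by (rule test_dof_facet_tangential[OF c(1)])
      then show "dof_value K nv (Tangential_Dof F w) (\<tau> + \<sigma>) = 0"
        using T S * by (simp only: dof_add[OF _ pf])
    next
      fix q assume q: "q \<in> polys_mod_RM CARD('n) K"
      have pq: "polynomial_function q" using q polys_pf by (auto simp: polys_mod_RM_def)
      have \<sigma>': "polynomial_function (\<lambda>x. - \<sigma> x)" using pf(2) by (rule polynomial_function_minus)
      \<comment> \<open>The sum is treated as the difference with \<open>- \<sigma>\<close>; among
        the instances is the vanishing divergence of the zero field.\<close>
      have m: "row_div (\<lambda>x. - \<sigma> x) x = - row_div \<sigma> x" for x
        using row_div_diff[OF polynomial_function_const[of 0] pf(2), of x] row_div_diff[OF pf(2) pf(2), of x] 
          row_div_diff[OF polynomial_function_const[of "0::real^'n^'n"] polynomial_function_const[of 0], of x] by simp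
      have "row_div (\<tau> + \<sigma>) x = row_div \<tau> x + row_div \<sigma> x" for x
        using row_div_diff[OF pf(1) \<sigma>', of x] by (simp add: m plus_fun_def)
      then have "J C (\<lambda>x. row_div (\<tau> + \<sigma>) x \<bullet> q x) = J C (\<lambda>x. row_div \<tau> x \<bullet> q x + row_div \<sigma> x \<bullet> q x)"
        by (simp only: inner_add_left)
      also have "\<dots> = J C (\<lambda>x. row_div \<tau> x \<bullet> q x) + J C (\<lambda>x. row_div \<sigma> x \<bullet> q x)"
        by (intro J_add[OF subset_refl C_nonempty] rpf_inner pq polys_pf[OF row_div_polys[OF nn_bubblesD(1)[OF \<tau>]]]
            polys_pf[OF row_div_polys[OF nn_bubblesD(1)[OF \<sigma>]]])
      also have "\<dots> = 0" using nn_bubblesD(5)[OF \<tau> q] nn_bubblesD(5)[OF \<sigma> q] by simp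
      finally show "L2_inner (lebesgue_on K) (row_div (\<tau> + \<sigma>)) q = 0" by (simp add: L2_inner_def meas_def)
    next
      fix q :: "real ^ 'n \<Rightarrow> real ^ 'n ^ 'n"
      assume *: "q \<in> polys (CARD('n) - 1) sym_mats" "\<forall>x\<in>K. q x *v x = 0"
      have "test_dof (Interior_Dof q)" using polys_pf[OF *(1)] by (rule test_dof_interior)
      then show "dof_value K nv (Interior_Dof q) (\<tau> + \<sigma>) = 0"
        using T S * by (simp only: dof_add[OF _ pf])
    qed
  qed
  have scale: "r *\<^sub>R \<tau> \<in> nn_bubbles K nv" if \<tau>: "\<tau> \<in> nn_bubbles K nv" for \<tau> r
  proof -
    note T = \<tau>[unfolded nn_bubbles_def mem_Collect_eq]
    note pf = polys_pf[OF nn_bubblesD(1)[OF \<tau>]]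
    show ?thesis
      unfolding nn_bubbles_def mem_Collect_eq
    proof (intro conjI ballI allI impI)
      show "r *\<^sub>R \<tau> \<in> polys (CARD('n) + 1) sym_mats"
        using nn_bubblesD(1)[OF \<tau>] by (intro subspace_scale subspace_polys subspace_sym_mats)
      show "{v} \<in> subsimplices 0 K \<Longrightarrow> (r *\<^sub>R \<tau>) v = 0" for v using T by (simp add: scaleR_fun_def)
    next
      fix r' f i j and q :: "real ^ 'n \<Rightarrow> real"
      assume *: "r' \<in> {1..CARD('n) - 2}" "f \<in> subsimplices r' K" "1 \<le> i \<and> i \<le> j \<and> j \<le> CARD('n) - r'" "q \<in> polys_on (CARD('n) - r') f UNIV"
      obtain S' where S': "S' \<subseteq> C" "card S' = Suc r'" "f = convex hull S'" using *(2) by (auto simp: subsimplices_iff)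
      obtain p where p: "p \<in> spolys (CARD('n) - r')" "q = restrict0 f p" using *(4) unfolding polys_on_def by blast
      have "test_dof (Normal_Dof f i j q)"
        unfolding p(2) S'(3) using S' *(1) card_C spolys_rpf[OF p(1)] by (intro test_dof_normal) auto
      then show "dof_value K nv (Normal_Dof f i j q) (r *\<^sub>R \<tau>) = 0" 
        using T * by (simp only: dof_scale)
    next
      fix F w assume *: "F \<in> subsimplices (CARD('n) - 1) K" "w \<in> ND (CARD('n) - 1) F (nv F 1)"
      obtain c where c: "c \<in> C" "F = convex hull (C - {c})" using *(1) unfolding facet_subsimplices by blast
      have "test_dof (Tangential_Dof F w)"
        using *(2) unfolding c(2) by (rule test_dof_facet_tangential[OF c(1)])
      then show "dof_value K nv (Tangential_Dof F w) (r *\<^sub>R \<tau>) = 0"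
        using T * by (simp only: dof_scale)
    next
      fix q assume q: "q \<in> polys_mod_RM CARD('n) K"
      have "row_div (r *\<^sub>R \<tau>) x = r *\<^sub>R row_div \<tau> x" for x
        unfolding scaleR_fun_def
        by (simp add: vec_eq_iff row_div_nth[OF polynomial_function_cmul[OF pf]] row_div_nth[OF pf]
          dd_scale pf_differentiable[OF pf_linear[OF pf linear_nth2]] sum_distrib_left)
      then show "L2_inner (lebesgue_on K) (row_div (r *\<^sub>R \<tau>)) q = 0"
        using nn_bubblesD(5)[OF \<tau> q] by (simp add: L2_inner_def meas_def)
    next
      fix q :: "real ^ 'n \<Rightarrow> real ^ 'n ^ 'n"
      assume *: "q \<in> polys (CARD('n) - 1) sym_mats" "\<forall>x\<in>K. q x *v x = 0"
      have "test_dof (Interior_Dof q)" using polys_pf[OF *(1)] by (rule test_dof_interior)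
      then show "dof_value K nv (Interior_Dof q) (r *\<^sub>R \<tau>) = 0"
        using T * by (simp only: dof_scale)
    qed
  qed
  \<comment> \<open>Any existing bubble, scaled by zero.\<close>
  have zero_poly: "(0::real^'n \<Rightarrow> real^'n^'n) \<in> nn_bubbles K nv"
  proof -
    obtain c where c: "c \<in> C" using C_nonempty by blast
    obtain b where "b \<in> nn_bubbles K nv" using ex_bubble[OF c spolys_pointwise(5)] by blast
    from scale[OF this, of 0] show ?thesis by simp
  qed
  show ?thesis unfolding subspace_def using add scale zero_poly by blast
qed

lemma subspace_shape_space: "subspace (shape_space K nv)"
proof -
  have "shape_space K nv = {x + y |x y. x \<in> polys 2 sym_mats \<and> y \<in> nn_bubbles K nv}"
    by (simp add: shape_space_def)
  then show ?thesis using subspace_sums[OF subspace_polys[OF subspace_sym_mats] subspace_nn_bubbles] by simp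
qed

lemma polys_subset_shape_space: "\<tau> \<in> polys 2 sym_mats \<Longrightarrow> \<tau> \<in> shape_space K nv"
  unfolding shape_space_def using subspace_0[OF subspace_nn_bubbles] by (intro CollectI exI[of _ \<tau>] exI[of _ 0]) auto

lemma bubbles_subset_shape_space: "\<tau> \<in> nn_bubbles K nv \<Longrightarrow> \<tau> \<in> shape_space K nv"
  unfolding shape_space_def using subspace_0[OF subspace_polys[OF subspace_sym_mats]] by (intro CollectI exI[of _ 0] exI[of _ \<tau>]) auto

lemma shape_space_pf: "\<tau> \<in> shape_space K nv \<Longrightarrow> polynomial_function \<tau>"
proof -
  assume "\<tau> \<in> shape_space K nv"
  then obtain p b where pb: "\<tau> = p + b" "p \<in> polys 2 sym_mats" "b \<in> nn_bubbles K nv" by (auto simp: shape_space_def)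
  then show ?thesis
    using polynomial_function_add[OF polys_pf[OF pb(2)] polys_pf[OF nn_bubblesD(1)[OF pb(3)]]] by (simp add: plus_fun_def)
qed

end

section \<open>The functionals indexed by bases of the test spaces\<close>

locale dof_bases = framed_simplex C a g nv for C :: "(real ^ 'n::finite) set" and a g nv +
  fixes Ba :: "real ^ 'n \<Rightarrow> (real ^ 'n ^ 'n) set"
    and Bb :: "(real ^ 'n) set \<Rightarrow> nat \<Rightarrow> nat \<Rightarrow> (real ^ 'n \<Rightarrow> real) set"
    and Bc :: "(real ^ 'n) set \<Rightarrow> (real ^ 'n \<Rightarrow> real) set"
    and Bd :: "(real ^ 'n) set \<Rightarrow> (real ^ 'n \<Rightarrow> real ^ 'n) set"
    and Be :: "(real ^ 'n \<Rightarrow> real ^ 'n ^ 'n) set"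
  assumes Ba: "\<And>v. {v} \<in> subsimplices 0 K \<Longrightarrow> basis_of (Ba v) sym_mats"
    and Bb: "\<And>e i j. e \<in> subsimplices 1 K \<Longrightarrow> 1 \<le> i \<Longrightarrow> i \<le> j \<Longrightarrow> j \<le> CARD('n) - 1 \<Longrightarrow>
           basis_of (Bb e i j) (polys_on 0 e UNIV)"
    and Bc: "\<And>F. F \<in> subsimplices (CARD('n) - 1) K \<Longrightarrow> basis_of (Bc F) (polys_on 1 F UNIV)"
    and Bd: "\<And>F. F \<in> subsimplices (CARD('n) - 1) K \<Longrightarrow> basis_of (Bd F) (ND 0 F (nv F 1))"
    and Be: "basis_of Be (polys 0 sym_mats)"
begin

definition dofs :: "'n dof set" where
  "dofs = {Vertex_Dof v M | v M. {v} \<in> subsimplices 0 K \<and> M \<in> Ba v} \<union>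
      {Normal_Dof e i j q | e i j q. e \<in> subsimplices 1 K \<and> 1 \<le> i \<and> i \<le> j \<and>
                                      j \<le> CARD('n) - 1 \<and> q \<in> Bb e i j} \<union>
      {Normal_Dof F 1 1 q | F q. F \<in> subsimplices (CARD('n) - 1) K \<and> q \<in> Bc F} \<union>
      {Tangential_Dof F q | F q. F \<in> subsimplices (CARD('n) - 1) K \<and> q \<in> Bd F} \<union>
      {Interior_Dof q | q. q \<in> Be}"

lemma dofs_cases [consumes 1, case_names vertex edge facet tangential interior]:
  assumes "d \<in> dofs"
  obtains v M where "d = Vertex_Dof v M" "v \<in> C" "M \<in> Ba v"
  | S k l q where "d = Normal_Dof (convex hull S) k l q" "S \<subseteq> C" "card S = 2" "1 \<le> k" "k \<le> l" "l \<le> CARD('n) - 1" 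
      "q \<in> Bb (convex hull S) k l"
  | c q where "d = Normal_Dof (convex hull (C - {c})) 1 1 q" "c \<in> C" "q \<in> Bc (convex hull (C - {c}))"
  | c w where "d = Tangential_Dof (convex hull (C - {c})) w" "c \<in> C" "w \<in> Bd (convex hull (C - {c}))"
  | q where "d = Interior_Dof q" "q \<in> Be"
proof -
  consider (1) v M where "d = Vertex_Dof v M" "{v} \<in> subsimplices 0 K" "M \<in> Ba v"
    | (2) e k l q where "d = Normal_Dof e k l q" "e \<in> subsimplices 1 K" "1 \<le> k" "k \<le> l" "l \<le> CARD('n) - 1" "q \<in> Bb e k l"
    | (3) F q where "d = Normal_Dof F 1 1 q" "F \<in> subsimplices (CARD('n) - 1) K" "q \<in> Bc F"
    | (4) F w where "d = Tangential_Dof F w" "F \<in> subsimplices (CARD('n) - 1) K" "w \<in> Bd F"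
    | (5) q where "d = Interior_Dof q" "q \<in> Be"
    using assms unfolding dofs_def by blast
  then show thesis
  proof cases
    case 1 then show thesis using that(1) vertex_subsimplices by blast
  next
    case 2
    then obtain S where "S \<subseteq> C" "card S = 2" "e = convex hull S" by (auto simp: subsimplices_iff numeral_2_eq_2)
    then show thesis using that(2) 2 by blast
  next
    case 3
    then obtain c where "c \<in> C" "F = convex hull (C - {c})" by (auto simp only: facet_subsimplices)
    then show thesis using that(3) 3 by blast
  next
    case 4
    then obtain c where "c \<in> C" "F = convex hull (C - {c})" by (auto simp only: facet_subsimplices)
    then show thesis using that(4) 4 by blast
  next
    case 5 then show thesis using that(5) by blast
  qed
qed

lemma edge_subsimplices: "S \<subseteq> C \<Longrightarrow> card S = 2 \<Longrightarrow> convex hull S \<in> subsimplices 1 K"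
  by (auto simp: subsimplices_iff numeral_2_eq_2)

lemma facetI: "c \<in> C \<Longrightarrow> convex hull (C - {c}) \<in> subsimplices (CARD('n) - 1) K"
  using facet_subsimplices by blast

lemma finite_subsimplices: "finite (subsimplices r K)"
proof (rule finite_subset)
  show "subsimplices r K \<subseteq> (\<lambda>S. convex hull S) ` Pow C" by (auto simp: subsimplices_iff)
qed (use finite_C in simp)

lemma basis_vertex: "v \<in> C \<Longrightarrow> finite (Ba v) \<and> independent (Ba v) \<and> span (Ba v) = sym_mats"
  using Ba vertex_subsimplices independent_imp_finite by (auto simp: basis_of_def)

lemma basis_edge:
  assumes "e \<in> subsimplices 1 K" "1 \<le> i" "i \<le> j" "j \<le> CARD('n) - 1"
  shows "finite (Bb e i j) \<and> independent (Bb e i j) \<and> span (Bb e i j) = polys_on 0 e UNIV"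
  using Bb[OF assms] finite_restrict_basis[of "Bb e i j" e 0] by (auto simp: basis_of_def polys_on_def)

lemma basis_facet:
  assumes "F \<in> subsimplices (CARD('n) - 1) K"
  shows "finite (Bc F) \<and> independent (Bc F) \<and> span (Bc F) = polys_on 1 F UNIV"
  using Bc[OF assms] finite_restrict_basis[of "Bc F" F 1] by (auto simp: basis_of_def polys_on_def)

lemma basis_tangential:
  assumes "F \<in> subsimplices (CARD('n) - 1) K"
  shows "finite (Bd F) \<and> independent (Bd F) \<and> span (Bd F) = ND 0 F (nv F 1)"
  using Bd[OF assms] finite_restrict_basis[of "Bd F" F "0 + 1"] ND_subset_restrict[of 0 F "nv F 1"] by (auto simp: basis_of_def)

lemma basis_interior: "finite Be \<and> independent Be \<and> span Be = polys 0 sym_mats"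
proof -
  \<comment> \<open>Restriction to the whole space is the identity; in this form the finiteness
    lemma for restrictions covers the interior basis as well.\<close>
  have "polys 0 sym_mats \<subseteq> restrict0 UNIV ` polys 0 (UNIV :: (real ^ 'n ^ 'n) set)"
    using polys_mono[of 0 0 "UNIV :: (real ^ 'n ^ 'n) set" sym_mats] by (auto simp: restrict0_def)
  then show ?thesis using Be finite_restrict_basis[of Be UNIV 0] by (auto simp: basis_of_def)
qed

lemma finite_dofs: "finite dofs"
proof -
  have "dofs \<subseteq> (\<Union>v\<in>C. Vertex_Dof v ` Ba v) \<union>
     (\<Union>e\<in>subsimplices 1 K. \<Union>i\<in>{1..CARD('n) - 1}. \<Union>j\<in>{i..CARD('n) - 1}. Normal_Dof e i j ` Bb e i j) \<union>
     (\<Union>F\<in>subsimplices (CARD('n) - 1) K. Normal_Dof F 1 1 ` Bc F) \<union>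
     (\<Union>F\<in>subsimplices (CARD('n) - 1) K. Tangential_Dof F ` Bd F) \<union> Interior_Dof ` Be"
    unfolding dofs_def vertex_subsimplices by (intro Un_mono) force+
  moreover have "finite \<dots>"
    using finite_C finite_subsimplices basis_vertex basis_edge basis_facet basis_tangential basis_interior
    by (intro finite_UnI finite_UN_I finite_imageI) auto
  ultimately show ?thesis by (rule finite_subset)
qed

lemma edge_ne: "S \<subseteq> C \<Longrightarrow> card S = 2 \<Longrightarrow> S \<noteq> {} \<and> S \<noteq> C"
  using card_C dim_ge by auto

lemma edge_basis_mem:
  assumes "S \<subseteq> C" "card S = 2" "1 \<le> k" "k \<le> l" "l \<le> CARD('n) - 1" "q \<in> Bb (convex hull S) k l"
  obtains p where "p \<in> spolys 0" "q = restrict0 (convex hull S) p"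
  using basis_edge[OF edge_subsimplices[OF assms(1,2)] assms(3-5)] span_base[OF assms(6)] by (auto simp: polys_on_def)

lemma facet_basis_mem:
  assumes "c \<in> C" "q \<in> Bc (convex hull (C - {c}))"
  obtains p where "p \<in> spolys 1" "q = restrict0 (convex hull (C - {c})) p"
  using basis_facet[OF facetI[OF assms(1)]] span_base[OF assms(2)] by (auto simp: polys_on_def)

lemma tangential_basis_mem:
  assumes "c \<in> C" "w \<in> Bd (convex hull (C - {c}))"
  shows "w \<in> ND 0 (convex hull (C - {c})) (nv (convex hull (C - {c})) 1)"
  using basis_tangential[OF facetI[OF assms(1)]] span_base[OF assms(2)] by simp

lemma interior_basis_mem: "q \<in> Be \<Longrightarrow> q \<in> polys 0 sym_mats"
  using basis_interior span_base[of q Be] by simp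

lemma test_dof_dofs: 
  assumes "d \<in> dofs" shows "test_dof d"
  using assms
proof (cases rule: dofs_cases)
  case (vertex v M) then show ?thesis by (simp add: test_dof_def)
next
  case (edge S k l q)
  then obtain p where p: "p \<in> spolys 0" "q = restrict0 (convex hull S) p" using edge_basis_mem by metis
  then show ?thesis using edge edge_ne[of S] spolys_rpf[OF p(1)] by (simp add: test_dof_normal)
next
  case (facet c q)
  then obtain p where p: "p \<in> spolys 1" "q = restrict0 (convex hull (C - {c})) p" using facet_basis_mem by metis
  have "C - {c} \<noteq> C" using facet by blast
  then show ?thesis unfolding facet(1) p(2)
    by (intro test_dof_normal[OF Diff_subset facet_nonempty[OF facet(2)]] spolys_rpf[OF p(1)])
next
  case (tangential c w)
  then show ?thesis using test_dof_facet_tangential[OF tangential(2) tangential_basis_mem[OF tangential(2,3)]] by simp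
next
  case (interior q)
  then show ?thesis using test_dof_interior polys_pf interior_basis_mem by blast
qed

lemma dof_value_zero_span:
  fixes mk :: "(real ^ 'n \<Rightarrow> 'b::euclidean_space) \<Rightarrow> 'n dof"
  assumes S: "S \<subseteq> C" "S \<noteq> {}" and U: "polynomial_function U"
    and L: "\<And>q. dof_value K nv (mk q) \<tau> = J S (\<lambda>x. U x \<bullet> q x)"
    and B: "finite B" "\<And>q. q \<in> B \<Longrightarrow> \<exists>p. polynomial_function p \<and> (\<forall>x\<in>convex hull S. q x = p x)"
    and z: "\<And>q. q \<in> B \<Longrightarrow> dof_value K nv (mk q) \<tau> = 0" and q: "q \<in> span B"
  shows "dof_value K nv (mk q) \<tau> = 0"
proof -
  obtain w where w: "q = (\<Sum>q\<in>B. w q *\<^sub>R q)" using q span_finite[OF B(1)] by auto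
  have "J S (\<lambda>x. U x \<bullet> q x) = (\<Sum>q\<in>B. w q * J S (\<lambda>x. U x \<bullet> q x))"
    unfolding w by (rule J_test_linear[OF S U B(2), symmetric])
  also have "\<dots> = 0" using z by (simp add: L)
  finally show ?thesis by (simp add: L)
qed

lemma restrict0_agrees: "polynomial_function p \<Longrightarrow> \<exists>p'. polynomial_function p' \<and> (\<forall>x\<in>D. restrict0 D p x = p' x)"
  by (intro exI[of _ p]) (simp add: restrict0_def)

lemma normal_component_pf: 
  fixes \<tau> :: "real ^ 'n \<Rightarrow> real ^ 'n ^ 'n"
  shows "polynomial_function \<tau> \<Longrightarrow> polynomial_function (\<lambda>x. v \<bullet> (\<tau> x *v w))"
  by (rule pf_linear[OF _ linear_inner_matrix_vector])

lemma tangential_component_pf: 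
  fixes \<tau> :: "real ^ 'n \<Rightarrow> real ^ 'n ^ 'n"
  shows "polynomial_function \<tau> \<Longrightarrow> polynomial_function (\<lambda>x. proj_normal n (\<tau> x *v w))"
  by (rule pf_linear[OF pf_linear[OF _ linear_matrix_vector] linear_proj_normal])

lemma edge_test:
  assumes "S \<subseteq> C" "card S = 2" "1 \<le> k" "k \<le> l" "l \<le> CARD('n) - 1" "q \<in> Bb (convex hull S) k l"
  shows "\<exists>p. polynomial_function p \<and> (\<forall>x\<in>convex hull S. q x = p x)"
proof -
  obtain p where "p \<in> spolys 0" "q = restrict0 (convex hull S) p" by (rule edge_basis_mem[OF assms])
  then show ?thesis using restrict0_agrees[OF polys_pf] by blast
qed

lemma facet_test:
  assumes "c \<in> C" "q \<in> Bc (convex hull (C - {c}))"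
  shows "\<exists>p. polynomial_function p \<and> (\<forall>x\<in>convex hull (C - {c}). q x = p x)"
proof -
  obtain p where "p \<in> spolys 1" "q = restrict0 (convex hull (C - {c})) p" by (rule facet_basis_mem[OF assms])
  then show ?thesis using restrict0_agrees[OF polys_pf] by blast
qed

lemma tangential_test:
  assumes "c \<in> C" "w \<in> Bd (convex hull (C - {c}))"
  shows "\<exists>p. polynomial_function p \<and> (\<forall>x\<in>convex hull (C - {c}). w x = p x)"
proof -
  obtain p where "polynomial_function p" "w = restrict0 (convex hull (C - {c})) p"
    by (rule ND_pf[OF tangential_basis_mem[OF assms]])
  then show ?thesis using restrict0_agrees by blast
qed

lemma interior_test: "q \<in> Be \<Longrightarrow> \<exists>p. polynomial_function p \<and> (\<forall>x\<in>convex hull C. q x = p x)"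
  using polys_pf[OF interior_basis_mem] by blast

lemma zero_if_dofs_zero:
  assumes \<tau>: "\<tau> \<in> shape_space K nv" and z: "\<And>d. d \<in> dofs \<Longrightarrow> dof_value K nv d \<tau> = 0"
  shows "\<tau> = 0"
proof -
  obtain p b where pb: "\<tau> = p + b" "p \<in> polys 2 sym_mats" "b \<in> nn_bubbles K nv"
    using \<tau> by (auto simp: shape_space_def)
  note pf = shape_space_pf[OF \<tau>]
  have fne: "C - {c} \<noteq> C" "C - {c} \<noteq> {}" if "c \<in> C" for c using that facet_nonempty[OF that] by auto
  show ?thesis
    unfolding pb(1)
  proof (rule left_nondegenerate[OF pb(2,3)], fold pb(1))
    fix c assume c: "c \<in> C"
    note bv = basis_vertex[OF c]
    have "\<tau> c \<bullet> M = 0" if "M \<in> Ba c" for M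
      using z[of "Vertex_Dof c M"] that c vertex_subsimplices by (auto simp: dofs_def)
    then have orth: "\<tau> c \<bullet> M = 0" if "M \<in> span (Ba c)" for M
      using orthogonal_to_span[of M "Ba c" "\<tau> c"] that by (auto simp: orthogonal_def)
    \<comment> \<open>Being symmetric, the value lies in the span of the basis to which it is
      orthogonal.\<close>
    have "\<tau> c \<in> sym_mats"
      using subspace_add[OF subspace_sym_mats sym_polys_value[OF pb(2), of c] sym_polys_value[OF nn_bubblesD(1)[OF pb(3)], of c]]
      by (simp add: pb(1))
    then have "\<tau> c \<bullet> \<tau> c = 0" using orth bv by simp
    then show "\<tau> c = 0" by simp
  next
    fix S i j and q :: "real ^ 'n \<Rightarrow> real"
    assume S: "S \<subseteq> C" "card S = 2" "1 \<le> i" "i \<le> j" "j \<le> CARD('n) - 1" "q \<in> spolys 0"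
    note be = basis_edge[OF edge_subsimplices[OF S(1,2)] S(3-5)]
    have ne: "S \<noteq> {}" "S \<noteq> C" using edge_ne[OF S(1,2)] by auto
    show "dof_value K nv (Normal_Dof (convex hull S) i j (restrict0 (convex hull S) q)) \<tau> = 0"
    proof (rule dof_value_zero_span[OF S(1) ne(1) normal_component_pf[OF pf] dof_normal'[OF S(1) ne(2)]])
      show "finite (Bb (convex hull S) i j)" using be by blast
      show "restrict0 (convex hull S) q \<in> span (Bb (convex hull S) i j)" using be S(6) by (simp add: polys_on_def)
      fix q assume q: "q \<in> Bb (convex hull S) i j"
      show "\<exists>p. polynomial_function p \<and> (\<forall>x\<in>convex hull S. q x = p x)" by (rule edge_test[OF S(1-5) q])
      show "dof_value K nv (Normal_Dof (convex hull S) i j q) \<tau> = 0"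
        using q S edge_subsimplices[OF S(1,2)] by (intro z) (auto simp: dofs_def)
    qed
  next
    fix c and q :: "real ^ 'n \<Rightarrow> real" assume c: "c \<in> C" "q \<in> spolys 1"
    note bf = basis_facet[OF facetI[OF c(1)]]
    show "dof_value K nv (Normal_Dof (convex hull (C - {c})) 1 1 (restrict0 (convex hull (C - {c})) q)) \<tau> = 0"
    proof (rule dof_value_zero_span[OF Diff_subset fne(2)[OF c(1)] normal_component_pf[OF pf] dof_normal'[OF Diff_subset fne(1)[OF c(1)]]])
      show "finite (Bc (convex hull (C - {c})))" using bf by blast
      show "restrict0 (convex hull (C - {c})) q \<in> span (Bc (convex hull (C - {c})))" using bf c(2) by (simp add: polys_on_def)
      fix q assume q: "q \<in> Bc (convex hull (C - {c}))"
      show "\<exists>p. polynomial_function p \<and> (\<forall>x\<in>convex hull (C - {c}). q x = p x)" by (rule facet_test[OF c(1) q])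
      show "dof_value K nv (Normal_Dof (convex hull (C - {c})) 1 1 q) \<tau> = 0"
        using q facetI[OF c(1)] by (intro z) (auto simp: dofs_def)
    qed
  next
    fix c w assume c: "c \<in> C" and w: "w \<in> ND 0 (convex hull (C - {c})) (nv (convex hull (C - {c})) 1)"
    note bt = basis_tangential[OF facetI[OF c]]
    show "dof_value K nv (Tangential_Dof (convex hull (C - {c})) w) \<tau> = 0"
    proof (rule dof_value_zero_span[OF Diff_subset fne(2)[OF c] tangential_component_pf[OF pf] dof_tangential'[OF Diff_subset fne(1)[OF c]]])
      show "finite (Bd (convex hull (C - {c})))" using bt by blast
      show "w \<in> span (Bd (convex hull (C - {c})))" using bt w by simp
      fix w assume w: "w \<in> Bd (convex hull (C - {c}))"
      show "\<exists>p. polynomial_function p \<and> (\<forall>x\<in>convex hull (C - {c}). w x = p x)" by (rule tangential_test[OF c w])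
      show "dof_value K nv (Tangential_Dof (convex hull (C - {c})) w) \<tau> = 0"
        using w facetI[OF c] by (intro z) (auto simp: dofs_def)
    qed
  next
    fix q :: "real ^ 'n \<Rightarrow> real ^ 'n ^ 'n" assume q: "q \<in> polys 0 sym_mats"
    show "dof_value K nv (Interior_Dof q) \<tau> = 0"
    proof (rule dof_value_zero_span[OF subset_refl C_nonempty pf dof_interior])
      show "finite Be" "q \<in> span Be" using basis_interior q by auto
      fix q assume q: "q \<in> Be"
      show "\<exists>p. polynomial_function p \<and> (\<forall>x\<in>convex hull C. q x = p x)" by (rule interior_test[OF q])
      show "dof_value K nv (Interior_Dof q) \<tau> = 0" using q by (intro z) (auto simp: dofs_def)
    qed
  qed
qed

text \<open>Since \<open>B *v n = 0\<close>, the coordinate in the facet may be replaced by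
  \<open>x\<close>. The test is then the restriction of a rigid motion of the whole space whose
  values are tangent to the facet.\<close>

lemma ND_0_repr:
  assumes c: "c \<in> C" and w: "w \<in> ND 0 (convex hull (C - {c})) n" and n: "n = nv (convex hull (C - {c})) 1"
  obtains t B where "n \<bullet> t = 0" "B \<in> skew_mats" "B *v n = 0" "w = restrict0 (convex hull (C - {c})) (\<lambda>x. t + B *v x)"
proof -
  let ?F = "convex hull (C - {c})"
  let ?T = "tangent_space ?F"
  have T: "?T = {t. n \<bullet> t = 0}" unfolding n by (rule facet_tangent_space[OF c])
  obtain p A where w: "w = restrict0 ?F (\<lambda>x. p x + A (proj_normal n x) *v proj_normal n x)"
    "p \<in> polys 0 ?T" "A \<in> hpolys 0 (skew_on_tangent ?F)" using w unfolding ND_def by blast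
  obtain t where t: "p = (\<lambda>x. t)" "t \<in> ?T" using polys_0[OF w(2)] by blast
  obtain B where B: "A = (\<lambda>x. B)" "B \<in> skew_on_tangent ?F" using polys_0[of A] w(3) hpolys_0 by blast
  have nT: "n \<in> ?T\<^sup>\<bottom>" by (auto simp: T orthogonal_comp_def orthogonal_def inner_commute)
  have Bn: "B \<in> skew_mats" "B *v n = 0" using B(2) nT by (auto simp: skew_on_tangent_def)
  have "B *v proj_normal n x = B *v x" for x
    using Bn(2) by (simp add: proj_normal_def matrix_vector_mult_diff_distrib matrix_vector_mult_scaleR)
  then have "w = restrict0 ?F (\<lambda>x. t + B *v x)" by (simp add: w(1) t(1) B(1))
  then show thesis using that t(2) Bn T by blast
qed

text \<open>The order of the blocks, interior, facet normal, tangential, edge, vertex, follows from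
  the test fields: those of a block vanish under the functionals of the blocks still to come, but
  may be seen by the blocks already removed. Bubbles have uncontrolled moments against constants,
  edge normals leave traces on facets, and \<open>lam v *\<^sub>R N\<close> is in general seen by
  every kind of functional.\<close>

lemma dof_relation_trivial:
  assumes u: "\<And>\<tau>. \<tau> \<in> shape_space K nv \<Longrightarrow> (\<Sum>d\<in>dofs. u d * dof_value K nv d \<tau>) = 0"
    and d: "d \<in> dofs"
  shows "u d = 0"
proof -
  have fne: "C - {c} \<noteq> C" "C - {c} \<noteq> {}" if "c \<in> C" for c using that facet_nonempty[OF that] by auto
  have pf2: "polynomial_function \<tau>" if "\<tau> \<in> polys 2 sym_mats" for \<tau> :: "real ^ 'n \<Rightarrow> real ^ 'n ^ 'n"
    using that by (rule polys_pf)
  let ?ef = "\<lambda>i j w x. (lam i x * lam j x) *\<^sub>R sprod (i - j) w"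
  have u_int: "u (Interior_Dof q) = 0" if q: "q \<in> Be" for q
  proof (rule block_zero[where mk=Interior_Dof and T="{?ef i j (i - j) |i j. i \<in> C \<and> j \<in> C \<and> i \<noteq> j}" and L="dof_value K nv", 
        OF finite_dofs _ _ _ _ _ _ _ _ q])
    show "finite Be" "independent Be" using basis_interior by auto
    show "inj Interior_Dof" by (rule injI) simp
    show "Interior_Dof ` Be \<subseteq> dofs" by (auto simp: dofs_def)
    fix \<tau> assume "\<tau> \<in> {?ef i j (i - j) |i j. i \<in> C \<and> j \<in> C \<and> i \<noteq> j}"
    then obtain i j where ij: "i \<in> C" "j \<in> C" "i \<noteq> j" and \<tau>: "\<tau> = ?ef i j (i - j)" by blast
    note ef = edge_field[OF ij, where w="i - j", folded \<tau>]
    show "(\<Sum>d\<in>dofs. u d * dof_value K nv d \<tau>) = 0" by (rule u[OF polys_subset_shape_space[OF ef(1)]])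
    show "(\<Sum>q\<in>Be. w q * dof_value K nv (Interior_Dof q) \<tau>) = dof_value K nv (Interior_Dof (\<Sum>q\<in>Be. w q *\<^sub>R q)) \<tau>" for w
      unfolding dof_interior by (rule J_test_linear[OF subset_refl C_nonempty pf2[OF ef(1)] interior_test])
    fix d assume d: "d \<in> dofs" "d \<notin> Interior_Dof ` Be"
    from d(1) have "dof_value K nv d \<tau> = 0"
    proof (cases rule: dofs_cases)
      case (vertex v M)
      have "\<tau> v = 0" using ef(2)[OF vertex(2)] unfolding \<tau> .
      then show ?thesis by (simp add: vertex(1))
    next
      case (edge S k l q)
      then have "k \<in> {1..CARD('n) - 1}" "l \<in> {1..CARD('n) - 1}" by simp_all
      from ef(3)[OF edge(2,3) this] show ?thesis by (simp only: edge(1))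
    next
      case (facet c q) show ?thesis unfolding facet(1) by (rule ef(4)[OF facet(2)])
    next
      case (tangential c w)
      have "c = i \<or> c = j \<or> g c \<bullet> (i - j) = 0" using ij tangential(2) by (auto simp: inner_g_vertex)
      from ef(5)[OF tangential(2) this] show ?thesis by (simp only: tangential(1))
    next
      case (interior q) then show ?thesis using d(2) by blast
    qed
    then show "u d = 0 \<or> dof_value K nv d \<tau> = 0" ..
  next
    fix z assume "z \<in> span Be"
    then have z: "z \<in> polys 0 sym_mats" using basis_interior by simp
    then obtain M where M: "z = (\<lambda>x. M)" "M \<in> sym_mats" using polys_0 by blast
    assume mom: "\<And>\<tau>. \<tau> \<in> {?ef i j (i - j) |i j. i \<in> C \<and> j \<in> C \<and> i \<noteq> j} \<Longrightarrow> dof_value K nv (Interior_Dof z) \<tau> = 0"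
    have "M = 0"
    proof (rule sym_mat_zeroI[OF M(2)])
      fix i j assume ij: "i \<in> C" "j \<in> C" "i \<noteq> j"
      have "J C (\<lambda>x. ?ef i j (i - j) x \<bullet> M) = 0" using mom[of "?ef i j (i - j)"] ij unfolding dof_interior M(1) by blast
      then have "J C (\<lambda>x. (2 * ((i - j) \<bullet> (M *v (i - j)))) * (lam i x * lam j x)) = 0"
        by (simp add: inner_commute[of "sprod _ _"] inner_sprod[OF M(2)] mult_ac)
      then show "(i - j) \<bullet> (M *v (i - j)) = 0" using J_lam_lam[OF subset_refl ij(1,2)] by simp
    qed
    then show "z = 0" by (simp add: M(1) zero_fun_def)
  qed
  have u_facet: "u (Normal_Dof (convex hull (C - {c})) 1 1 q) = 0" if c: "c \<in> C" and q: "q \<in> Bc (convex hull (C - {c}))" for c q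
  proof -
    let ?F = "convex hull (C - {c})"
    let ?mk = "Normal_Dof ?F 1 1"
    let ?T = "{b \<in> nn_bubbles K nv. \<forall>c'\<in>C-{c}. \<forall>x. lam c' x = 0 \<longrightarrow> g c' \<bullet> (b x *v g c') = 0}"
    note bf = basis_facet[OF facetI[OF c]]
    show ?thesis
    proof (rule block_zero[where mk="?mk" and T="?T" and L="dof_value K nv", OF finite_dofs _ _ _ _ _ _ _ _ q])
      show "finite (Bc ?F)" "independent (Bc ?F)" using bf by auto
      show "inj ?mk" by (rule injI) simp
      show "?mk ` Bc ?F \<subseteq> dofs" using facetI[OF c] by (auto simp: dofs_def)
      fix \<tau> assume \<tau>: "\<tau> \<in> ?T"
      then have b: "\<tau> \<in> nn_bubbles K nv" by blast
      note B = nn_bubblesD[OF b]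
      show "(\<Sum>d\<in>dofs. u d * dof_value K nv d \<tau>) = 0" by (rule u[OF bubbles_subset_shape_space[OF b]])
      show "(\<Sum>q\<in>Bc ?F. w q * dof_value K nv (?mk q) \<tau>) = dof_value K nv (?mk (\<Sum>q\<in>Bc ?F. w q *\<^sub>R q)) \<tau>" for w
        unfolding dof_normal'[OF Diff_subset fne(1)[OF c]]
        by (rule J_test_linear[OF Diff_subset fne(2)[OF c] normal_component_pf[OF polys_pf[OF B(1)]] facet_test[OF c]])
      fix d assume d: "d \<in> dofs" "d \<notin> ?mk ` Bc ?F"
      from d(1) show "u d = 0 \<or> dof_value K nv d \<tau> = 0"
      proof (cases rule: dofs_cases)
        case (vertex v M) then show ?thesis using B(2) by simp
      next
        case (edge S k l q)
        then obtain p where p: "p \<in> spolys 0" "q = restrict0 (convex hull S) p" using edge_basis_mem by metis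
        have "dof_value K nv d \<tau> = 0" unfolding edge(1) p(2)
          using edge dim_ge spolys_mono[OF p(1)] by (intro B(3)) auto
        then show ?thesis ..
      next
        case (facet c' q)
        then have c': "c' \<in> C - {c}" using d(2) by auto
        obtain r where r: "r \<noteq> 0" "g c' = r *\<^sub>R nv (convex hull (C - {c'})) 1" by (rule facet_normal[OF facet(2)])
        have "dof_value K nv d \<tau> = 0"
          unfolding facet(1) dof_normal'[OF Diff_subset fne(1)[OF facet(2)]]
        proof (rule J_zero[OF Diff_subset])
          fix x assume "x \<in> flat (C - {c'})"
          then have "lam c' x = 0" using flat_facet[OF facet(2)] by auto
          then have "g c' \<bullet> (\<tau> x *v g c') = 0" using \<tau> c' by blast
          then show "(nv (convex hull (C - {c'})) 1 \<bullet> (\<tau> x *v nv (convex hull (C - {c'})) 1)) \<bullet> q x = 0"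
            using r by (simp add: matrix_vector_mult_scaleR)
        qed
        then show ?thesis ..
      next
        case (tangential c' w)
        have "1 \<le> CARD('n) - 1" using dim_ge by simp
        then have "w \<in> ND (CARD('n) - 1) (convex hull (C - {c'})) (nv (convex hull (C - {c'})) 1)"
          using subsetD[OF ND_0_subset[OF tangential(2)] tangential_basis_mem[OF tangential(2,3)]] by simp
        then show ?thesis using B(4) tangential by simp
      next
        case (interior q) then show ?thesis using u_int by simp
      qed
    next
      fix z assume "z \<in> span (Bc ?F)"
      then obtain p where p: "p \<in> spolys 1" "z = restrict0 ?F p" using bf by (auto simp: polys_on_def)
      assume mom: "\<And>\<tau>. \<tau> \<in> ?T \<Longrightarrow> dof_value K nv (?mk z) \<tau> = 0"
      \<comment> \<open>The test polynomial \<open>p\<close> itself is put into the trace of the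
        bubble, so that the functional becomes a weighted integral of its square.\<close>
      obtain b where b: "b \<in> ?T" 
        and tr: "\<And>x. lam c x = 0 \<Longrightarrow> g c \<bullet> (b x *v g c) = (g c \<bullet> g c)\<^sup>2 * ((\<Prod>k\<in>C-{c}. lam k x) * p x)"
        using ex_bubble[OF c p(1)] by blast
      obtain r where r: "r \<noteq> 0" "g c = r *\<^sub>R nv ?F 1" by (rule facet_normal[OF c])
      \<comment> \<open>The numerator comes from \<open>outer (g c) (g c)\<close> between two copies
        of \<open>g c\<close>, the denominator from passing to the unit normal on both
        sides.\<close>
      let ?\<kappa> = "(g c \<bullet> g c)\<^sup>2 / r\<^sup>2"
      have "0 = J (C - {c}) (\<lambda>x. (nv ?F 1 \<bullet> (b x *v nv ?F 1)) * p x)"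
        using mom[OF b] unfolding p(2) dof_normal[OF Diff_subset fne(1)[OF c]] by simp
      also have "\<dots> = J (C - {c}) (\<lambda>x. ?\<kappa> * ((\<Prod>k\<in>C-{c}. lam k x) * (p x)\<^sup>2))"
      proof (rule J_cong[OF Diff_subset])
        fix x assume "x \<in> flat (C - {c})"
        then have "g c \<bullet> (b x *v g c) = (g c \<bullet> g c)\<^sup>2 * ((\<Prod>k\<in>C-{c}. lam k x) * p x)" using tr flat_facet[OF c] by auto
        moreover have "g c \<bullet> (b x *v g c) = r\<^sup>2 * (nv ?F 1 \<bullet> (b x *v nv ?F 1))"
          unfolding r(2) by (simp add: matrix_vector_mult_scaleR power2_eq_square)
        ultimately have "nv ?F 1 \<bullet> (b x *v nv ?F 1) = ?\<kappa> * ((\<Prod>k\<in>C-{c}. lam k x) * p x)"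
          using r(1) by (simp add: field_simps)
        then show "(nv ?F 1 \<bullet> (b x *v nv ?F 1)) * p x = ?\<kappa> * ((\<Prod>k\<in>C-{c}. lam k x) * (p x)\<^sup>2)"
          by (simp add: power2_eq_square)
      qed
      finally have zz: "J (C - {c}) (\<lambda>x. (\<Prod>k\<in>C-{c}. lam k x) * (p x)\<^sup>2) = 0"
        using r(1) g_nonzero[OF c] by simp
      have "p x = 0" if "x \<in> flat (C - {c})" for x
      proof (rule J_positive[OF Diff_subset fne(2)[OF c] _ spolys_rpf[OF p(1)] _ _ zz that])
        show "real_polynomial_function (\<lambda>x. \<Prod>k\<in>C-{c}. lam k x)"
          using finite_C by (intro real_polynomial_function_prod lam_rpf) auto
        show "x \<in> ?F \<Longrightarrow> 0 \<le> (\<Prod>k\<in>C-{c}. lam k x)" for x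
          by (auto simp: convex_hull_eq[OF Diff_subset] intro!: prod_nonneg)
        show "(\<And>k. k \<in> C - {c} \<Longrightarrow> 0 < lam k x) \<Longrightarrow> (\<Prod>k\<in>C-{c}. lam k x) \<noteq> 0" for x
          by (metis less_irrefl prod_pos)
      qed
      then have "x \<in> ?F \<Longrightarrow> p x = 0" for x using convex_hull_eq[OF Diff_subset, of "{c}"] by blast
      then show "z = 0" by (auto simp: p(2) restrict0_def fun_eq_iff)
    qed
  qed
  have u_tang: "u (Tangential_Dof (convex hull (C - {c})) q) = 0" if c: "c \<in> C" and q: "q \<in> Bd (convex hull (C - {c}))" for c q
  proof -
    let ?F = "convex hull (C - {c})"
    let ?mk = "Tangential_Dof ?F"
    \<comment> \<open>The vector \<open>i - c\<close> is transversal to the facet opposite to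
      \<open>c\<close> and tangent to the others, apart from the one opposite to \<open>i\<close>,
      where the field vanishes.\<close>
    let ?T = "{?ef i j (i - c) |i j. i \<in> C - {c} \<and> j \<in> C - {c} \<and> i \<noteq> j}"
    let ?n = "nv ?F 1"
    note bt = basis_tangential[OF facetI[OF c]]
    show ?thesis
    proof (rule block_zero[where mk="?mk" and T="?T" and L="dof_value K nv", OF finite_dofs _ _ _ _ _ _ _ _ q])
      show "finite (Bd ?F)" "independent (Bd ?F)" using bt by auto
      show "inj ?mk" by (rule injI) simp
      show "?mk ` Bd ?F \<subseteq> dofs" using facetI[OF c] by (auto simp: dofs_def)
      fix \<tau> assume "\<tau> \<in> ?T"
      then obtain i j where ijc: "i \<in> C - {c}" "j \<in> C - {c}" "i \<noteq> j" and \<tau>: "\<tau> = ?ef i j (i - c)" by blast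
      then have ij: "i \<in> C" "j \<in> C" "i \<noteq> j" by auto
      note ef = edge_field[OF ij, where w="i - c", folded \<tau>]
      show "(\<Sum>d\<in>dofs. u d * dof_value K nv d \<tau>) = 0" by (rule u[OF polys_subset_shape_space[OF ef(1)]])
      show "(\<Sum>q\<in>Bd ?F. w q * dof_value K nv (?mk q) \<tau>) = dof_value K nv (?mk (\<Sum>q\<in>Bd ?F. w q *\<^sub>R q)) \<tau>" for w
        unfolding dof_tangential'[OF Diff_subset fne(1)[OF c]]
        by (rule J_test_linear[OF Diff_subset fne(2)[OF c] tangential_component_pf[OF pf2[OF ef(1)]] tangential_test[OF c]])
      fix d assume d: "d \<in> dofs" "d \<notin> ?mk ` Bd ?F"
      from d(1) show "u d = 0 \<or> dof_value K nv d \<tau> = 0"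
      proof (cases rule: dofs_cases)
        case (vertex v M)
        have "\<tau> v = 0" using ef(2)[OF vertex(2)] unfolding \<tau> .
        then show ?thesis by (simp add: vertex(1))
      next
        case (edge S k l q)
        then have "k \<in> {1..CARD('n) - 1}" "l \<in> {1..CARD('n) - 1}" by simp_all
        from ef(3)[OF edge(2,3) this] show ?thesis by (simp add: edge(1))
      next
        case (facet c' q) show ?thesis using ef(4)[OF facet(2)] by (simp add: facet(1))
      next
        case (tangential c' w)
        then have "c' \<noteq> c" using d(2) by auto
        then have "c' = i \<or> c' = j \<or> g c' \<bullet> (i - c) = 0" using tangential(2) c ij by (auto simp: inner_g_vertex)
        from ef(5)[OF tangential(2) this] show ?thesis by (simp add: tangential(1))
      next
        case (interior q) then show ?thesis using u_int by simp
      qed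
    next
      fix z assume "z \<in> span (Bd ?F)"
      then have zN: "z \<in> ND 0 ?F ?n" using bt by simp
      obtain t B where tB: "?n \<bullet> t = 0" "B \<in> skew_mats" "B *v ?n = 0" "z = restrict0 ?F (\<lambda>x. t + B *v x)"
        by (rule ND_0_repr[OF c zN refl])
      assume mom: "\<And>\<tau>. \<tau> \<in> ?T \<Longrightarrow> dof_value K nv (?mk z) \<tau> = 0"
      obtain r where r: "r \<noteq> 0" "g c = r *\<^sub>R ?n" "?n \<bullet> ?n = 1" by (rule facet_normal[OF c])
      define W where "W x = t + B *v x" for x
      have "W x = 0" if x: "x \<in> flat (C - {c})" for x
      proof (rule facet_rigid_motion_zero[OF Diff_subset fne(2)[OF c] _ _ _ _ x])
        fix x assume x: "x \<in> flat (C - {c})"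
        have lc: "lam c x = 0" using x flat_facet[OF c] by auto
        have s: "(\<Sum>k\<in>C-{c}. lam k x) = 1" "(\<Sum>k\<in>C-{c}. lam k x *\<^sub>R k) = x"
          using sum_lam[of x] sum_lam_vertex[of x] lc sum.remove[OF finite_C c, of "\<lambda>k. lam k x"] sum.remove[OF finite_C c, of "\<lambda>k. lam k x *\<^sub>R k"]
          by auto
        have "(\<Sum>k\<in>C-{c}. lam k x *\<^sub>R W k) = (\<Sum>k\<in>C-{c}. lam k x) *\<^sub>R t + B *v (\<Sum>k\<in>C-{c}. lam k x *\<^sub>R k)"
          by (simp add: W_def scaleR_add_right sum.distrib scaleR_sum_left linear_sum[OF matrix_vector_mul_linear] matrix_vector_mult_scaleR)
        then show "W x = (\<Sum>k\<in>C-{c}. lam k x *\<^sub>R W k)" by (simp add: s W_def)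
      next
        fix i j
        have "W i - W j = B *v (i - j)" by (simp add: W_def matrix_vector_mult_diff_distrib)
        then show "(W i - W j) \<bullet> (i - j) = 0" using skew_mats_inner[OF tB(2), of "i - j"] by (simp add: inner_commute)
      next
        fix i c' assume "c' \<in> C - (C - {c})"
        then have "c' = c" by blast
        moreover have "?n \<bullet> W i = 0" using tB skew_mats_inner2[OF tB(2), of ?n i] by (simp add: W_def inner_add_right)
        ultimately show "g c' \<bullet> W i = 0" by (simp add: r(2))
      next
        fix i j assume ij: "i \<in> C - {c}" "j \<in> C - {c}" "i \<noteq> j"
        \<comment> \<open>Nonzero because \<open>g c \<bullet> (i - c) = -1\<close>; the functional
          of the field is \<open>?\<kappa>\<close> times the moment of \<open>W\<close> along the
          edge vector \<open>i - j\<close>.\<close>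
        let ?\<kappa> = "(i - c) \<bullet> ?n"
        have "g c \<bullet> (i - c) = -1" "g c \<bullet> (i - j) = 0" using ij c by (auto simp: inner_g_vertex)
        then have nn: "?\<kappa> \<noteq> 0" "?n \<bullet> (i - j) = 0" using r(1) by (auto simp: r(2) inner_commute)
        have "?ef i j (i - c) \<in> ?T" using ij by blast
        from mom[OF this] have "0 = J (C - {c}) (\<lambda>x. proj_normal ?n (?ef i j (i - c) x *v ?n) \<bullet> W x)"
          unfolding tB(4) W_def dof_tangential[OF Diff_subset fne(1)[OF c]] by (rule sym)
        also have "\<dots> = J (C - {c}) (\<lambda>x. ?\<kappa> * (lam i x * lam j x * ((i - j) \<bullet> W x)))"
        proof -
          have "?ef i j (i - c) x *v ?n = (?\<kappa> * (lam i x * lam j x)) *\<^sub>R (i - j)" for x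
            using nn(2) by (simp add: sprod_mult inner_commute flip: scaleR_matrix_vector_assoc)
          moreover have "proj_normal ?n (s *\<^sub>R (i - j)) = s *\<^sub>R (i - j)" for s
            using nn(2) by (simp add: proj_normal_def)
          ultimately show ?thesis by (simp add: mult.assoc)
        qed
        finally show "J (C - {c}) (\<lambda>x. lam i x * lam j x * ((i - j) \<bullet> W x)) = 0" using nn(1) by simp
      qed
      then have "x \<in> ?F \<Longrightarrow> W x = 0" for x using convex_hull_eq[OF Diff_subset, of "{c}"] by blast
      then show "z = 0" by (auto simp: tB(4) W_def restrict0_def fun_eq_iff)
    qed
  qed
  have u_edge: "u (Normal_Dof (convex hull S) k l q) = 0" 
    if S: "S \<subseteq> C" "card S = 2" and kl: "1 \<le> k" "k \<le> l" "l \<le> CARD('n) - 1" and q: "q \<in> Bb (convex hull S) k l" for S k l q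
  proof -
    let ?e = "convex hull S"
    let ?mk = "Normal_Dof ?e k l"
    obtain i j where ij: "S = {i, j}" "i \<noteq> j" using S(2) by (auto simp: card_2_iff)
    then have ijC: "i \<in> C" "j \<in> C" using S by auto
    \<comment> \<open>By orthonormality of the frame, the only component seen by the functionals of
      this edge is that of the pair \<open>k\<close>, \<open>l\<close>.\<close>
    define \<tau> where "\<tau> x = (lam i x * lam j x) *\<^sub>R sprod (nv ?e k) (nv ?e l)" for x
    have \<tau>_mult: "\<tau> x *v y = (lam i x * lam j x) *\<^sub>R ((nv ?e l \<bullet> y) *\<^sub>R nv ?e k + (nv ?e k \<bullet> y) *\<^sub>R nv ?e l)" for x y
      by (simp add: \<tau>_def sprod_mult flip: scaleR_matrix_vector_assoc)
    have ne: "S \<noteq> {}" "S \<noteq> C" using edge_ne[OF S] by auto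
    have orth: "nv ?e a \<bullet> nv ?e b = (if a = b then 1 else 0)" if "1 \<le> a" "a \<le> CARD('n) - 1" "1 \<le> b" "b \<le> CARD('n) - 1" for a b
      using frame(1)[OF S(1) ne(1), of a b] that S(2) by simp
    have "(\<lambda>x. lam i x * lam j x) \<in> spolys (1 + 1)" by (intro spolys_mult lam_spolys)
    then have "(\<lambda>x. lam i x * lam j x) \<in> spolys 2" by (simp only: one_add_one)
    then have \<tau>2: "\<tau> \<in> polys 2 sym_mats"
      unfolding \<tau>_def polys_eq_mpolys
      by (intro mpolys_scalar_times sprod_sym subspace_sym_mats) (simp_all add: polys_eq_mpolys)
    note be = basis_edge[OF edge_subsimplices[OF S] kl]
    show ?thesis
    proof (rule block_zero[where mk="?mk" and T="{\<tau>}" and L="dof_value K nv", OF finite_dofs _ _ _ _ _ _ _ _ q])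
      show "finite (Bb ?e k l)" "independent (Bb ?e k l)" using be by auto
      show "inj ?mk" by (rule injI) simp
      show "?mk ` Bb ?e k l \<subseteq> dofs" using edge_subsimplices[OF S] kl by (auto simp: dofs_def)
      fix \<sigma> assume "\<sigma> \<in> {\<tau>}"
      then have \<sigma>: "\<sigma> = \<tau>" by simp
      show "(\<Sum>d\<in>dofs. u d * dof_value K nv d \<sigma>) = 0" unfolding \<sigma> by (rule u[OF polys_subset_shape_space[OF \<tau>2]])
      show "(\<Sum>q\<in>Bb ?e k l. w q * dof_value K nv (?mk q) \<sigma>) = dof_value K nv (?mk (\<Sum>q\<in>Bb ?e k l. w q *\<^sub>R q)) \<sigma>" for w
        unfolding dof_normal'[OF S(1) ne(2)] \<sigma>
        by (rule J_test_linear[OF S(1) ne(1) normal_component_pf[OF pf2[OF \<tau>2]] edge_test[OF S kl]])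
      fix d assume d: "d \<in> dofs" "d \<notin> ?mk ` Bb ?e k l"
      from d(1) show "u d = 0 \<or> dof_value K nv d \<sigma> = 0"
      proof (cases rule: dofs_cases)
        case (vertex v M)
        then have "lam i v * lam j v = 0" using ijC ij(2) by (auto simp: lam_vertex)
        then show ?thesis using vertex by (simp add: \<sigma> \<tau>_def)
      next
        case (edge S' a b q)
        have ne': "S' \<noteq> {}" "S' \<noteq> C" using edge_ne[OF edge(2,3)] by auto
        have "dof_value K nv d \<tau> = 0"
          unfolding edge(1) dof_normal'[OF edge(2) ne'(2)]
        proof (rule J_zero[OF edge(2)])
          fix x assume x: "x \<in> flat S'"
          show "(nv (convex hull S') a \<bullet> (\<tau> x *v nv (convex hull S') b)) \<bullet> q x = 0"
          proof (cases "S' = S")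
            case True
            \<comment> \<open>As \<open>a \<le> b\<close> and \<open>k \<le> l\<close>, different
              ordered pairs are different unordered pairs, so both products of inner products
              vanish.\<close>
            then have "a \<noteq> k \<or> b \<noteq> l" using d(2) edge by auto
            then have "(nv ?e l \<bullet> nv ?e b) * (nv ?e a \<bullet> nv ?e k) + (nv ?e k \<bullet> nv ?e b) * (nv ?e a \<bullet> nv ?e l) = 0"
              using orth kl edge(4-6) by auto
            then show ?thesis unfolding True \<tau>_mult by (simp add: inner_add_right)
          next
            case False
            have "\<not> S \<subseteq> S'" using False edge(3) S(2) card_subset_eq[of S' S] finite_subset[OF edge(2) finite_C] by auto
            then have "lam i x * lam j x = 0" using x ijC unfolding ij(1) by (auto simp: flat_def)
            then show ?thesis by (simp add: \<tau>_mult)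
          qed
        qed
        then show ?thesis by (simp add: \<sigma>)
      next
        case (facet c q) then show ?thesis using u_facet by simp
      next
        case (tangential c w) then show ?thesis using u_tang by simp
      next
        case (interior q) then show ?thesis using u_int by simp
      qed
    next
      fix z assume "z \<in> span (Bb ?e k l)"
      then obtain p where p: "p \<in> spolys 0" "z = restrict0 ?e p" using be by (auto simp: polys_on_def)
      obtain \<rho> where \<rho>: "p = (\<lambda>x. \<rho>)" using polys_0[OF p(1)] by blast
      assume mom: "\<And>\<sigma>. \<sigma> \<in> {\<tau>} \<Longrightarrow> dof_value K nv (?mk z) \<sigma> = 0"
      \<comment> \<open>\<open>sprod\<close> counts a diagonal component twice.\<close>
      let ?\<delta> = "if k = l then 2 else (1::real)"
      have "0 = J S (\<lambda>x. (nv ?e k \<bullet> (\<tau> x *v nv ?e l)) * \<rho>)"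
        using mom[of \<tau>] unfolding p(2) dof_normal[OF S(1) ne(2)] \<rho> by simp
      also have "\<dots> = J S (\<lambda>x. (\<rho> * ?\<delta>) * (lam i x * lam j x))"
        using orth kl by (intro Bochner_Integration.integral_cong refl) (simp add: \<tau>_mult inner_add_right)
      finally have "\<rho> = 0" using J_lam_lam[OF S(1), of i j] ij by (auto split: if_splits)
      then show "z = 0" by (simp add: p(2) \<rho> restrict0_def fun_eq_iff)
    qed
  qed
  have u_vertex: "u (Vertex_Dof v M) = 0" if v: "v \<in> C" and M: "M \<in> Ba v" for v M
  proof -
    let ?T = "{\<lambda>x :: real ^ 'n. lam v x *\<^sub>R N |N. N \<in> (sym_mats :: (real ^ 'n ^ 'n) set)}"
    note bv = basis_vertex[OF v]
    show ?thesis
    proof (rule block_zero[where mk="Vertex_Dof v" and T="?T" and L="dof_value K nv", OF finite_dofs _ _ _ _ _ _ _ _ M])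
      show "finite (Ba v)" "independent (Ba v)" using bv by auto
      show "inj (Vertex_Dof v)" by (rule injI) simp
      show "Vertex_Dof v ` Ba v \<subseteq> dofs" using v vertex_subsimplices by (auto simp: dofs_def)
      fix \<tau> assume "\<tau> \<in> ?T"
      then obtain N where N: "\<tau> = (\<lambda>x. lam v x *\<^sub>R N)" "N \<in> sym_mats" by blast
      have "\<tau> \<in> polys 1 sym_mats"
        unfolding N(1) polys_eq_mpolys using lam_spolys N(2) 
        by (intro mpolys_scalar_times subspace_sym_mats) (simp_all add: polys_eq_mpolys)
      then have "\<tau> \<in> polys 2 sym_mats" using polys_mono[of 1 2 sym_mats sym_mats] subspace_0[OF subspace_sym_mats] by auto
      then show "(\<Sum>d\<in>dofs. u d * dof_value K nv d \<tau>) = 0" by (intro u polys_subset_shape_space)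
      show "(\<Sum>q\<in>Ba v. w q * dof_value K nv (Vertex_Dof v q) \<tau>) = dof_value K nv (Vertex_Dof v (\<Sum>q\<in>Ba v. w q *\<^sub>R q)) \<tau>" for w
        by (simp add: inner_sum_right)
      fix d assume d: "d \<in> dofs" "d \<notin> Vertex_Dof v ` Ba v"
      from d(1) show "u d = 0 \<or> dof_value K nv d \<tau> = 0"
      proof (cases rule: dofs_cases)
        case (vertex v' M')
        then have "v \<noteq> v'" using d(2) by auto
        then have "lam v v' = 0" using v vertex(2) by (simp add: lam_vertex)
        then show ?thesis by (simp add: vertex(1) N(1))
      next
        case (edge S k l q) then show ?thesis using u_edge by simp
      next
        case (facet c q) then show ?thesis using u_facet by simp
      next
        case (tangential c w) then show ?thesis using u_tang by simp
      next
        case (interior q) then show ?thesis using u_int by simp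
      qed
    next
      fix z assume "z \<in> span (Ba v)"
      then have z: "z \<in> sym_mats" using bv by simp
      assume "\<And>\<tau>. \<tau> \<in> ?T \<Longrightarrow> dof_value K nv (Vertex_Dof v z) \<tau> = 0"
      then have "dof_value K nv (Vertex_Dof v z) (\<lambda>x. lam v x *\<^sub>R z) = 0" using z by blast
      then show "z = 0" using v by (simp add: lam_vertex)
    qed
  qed
  from d show ?thesis
  proof (cases rule: dofs_cases)
    case (vertex v M) then show ?thesis using u_vertex by simp
  next
    case (edge S k l q) then show ?thesis using u_edge by simp
  next
    case (facet c q) then show ?thesis using u_facet by simp
  next
    case (tangential c w) then show ?thesis using u_tang by simp
  next
    case (interior q) then show ?thesis using u_int by simp
  qed
qed

lemma unisolvent_dofs: "unisolvent dofs (dof_value K nv) (shape_space K nv)"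
proof (rule unisolventI[OF finite_dofs subspace_shape_space])
  show "dof_value K nv d (x + y) = dof_value K nv d x + dof_value K nv d y"
    if "d \<in> dofs" "x \<in> shape_space K nv" "y \<in> shape_space K nv" for d x y
    by (rule dof_add[OF test_dof_dofs[OF that(1)] shape_space_pf[OF that(2)] shape_space_pf[OF that(3)]])
  show "dof_value K nv d (r *\<^sub>R x) = r * dof_value K nv d x" if "d \<in> dofs" for d x r
    by (rule dof_scale[OF test_dof_dofs[OF that]])
  show "x = 0" if "x \<in> shape_space K nv" "\<And>d. d \<in> dofs \<Longrightarrow> dof_value K nv d x = 0" for x
    by (rule zero_if_dofs_zero[OF that])
  show "u d = 0" if "\<And>x. x \<in> shape_space K nv \<Longrightarrow> (\<Sum>d\<in>dofs. u d * dof_value K nv d x) = 0" "d \<in> dofs" for u d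
    by (rule dof_relation_trivial[of u, OF that])
qed

end

section \<open>Barycentric coordinates of a simplex\<close>

text \<open>With \<open>f\<close> a linear form that is one on all differences
  \<open>c' - c\<close>, the function \<open>1 - f (x - c)\<close> is one at \<open>c\<close> and
  zero at the other vertices; its gradient is minus the vector that represents \<open>f\<close>.
  Partition of unity and reproduction hold because d + 1 affinely independent points have the whole
  space as affine hull.\<close>

lemma barycentric_exists:
  fixes C :: "(real ^ 'n::finite) set"
  assumes "CARD('n) \<ge> 3" "\<not> affine_dependent C" "card C = CARD('n) + 1"
  shows "\<exists>a g. barycentric C a g"
proof -
  have finC: "finite C" using assms(3) by (metis card.infinite add_is_0 one_neq_zero)
  have "\<exists>a g. \<forall>c'\<in>C. a + g \<bullet> c' = (if c = c' then 1 else 0)" if c: "c \<in> C" for c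
  proof -
    let ?B = "(\<lambda>x. - c + x) ` (C - {c})"
    have "independent ?B" using assms(2) affine_dependent_iff_dependent2[OF c] by blast
    then obtain f where f: "linear f" "\<forall>x\<in>?B. f x = (1::real)"
      using linear_independent_extend[of ?B "\<lambda>_. 1"] by blast
    have fe: "f x = adjoint f 1 \<bullet> x" for x
      using adjoint_works[OF f(1), of x 1] by (simp add: inner_commute)
    have "(1 + adjoint f 1 \<bullet> c) + (- adjoint f 1) \<bullet> c' = (if c = c' then 1 else 0)" if "c' \<in> C" for c'
    proof -
      have "(1 + adjoint f 1 \<bullet> c) + (- adjoint f 1) \<bullet> c' = 1 - f (- c + c')"
        by (simp add: fe inner_diff_right)
      also have "\<dots> = (if c = c' then 1 else 0)"
        using f that linear_0[OF f(1)] by auto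
      finally show ?thesis .
    qed
    then show ?thesis by blast
  qed
  then obtain a g where ag: "\<And>c c'. c \<in> C \<Longrightarrow> c' \<in> C \<Longrightarrow> a c + g c \<bullet> c' = (if c = c' then 1 else 0)" by metis
  have "x \<in> affine hull C" for x :: "real ^ 'n"
    using affine_independent_span_eq[OF assms(2)] assms(3) by simp
  then have repr: "\<exists>u. sum u C = 1 \<and> (\<Sum>v\<in>C. u v *\<^sub>R v) = x" for x :: "real ^ 'n"
    by (auto simp: affine_hull_finite[OF finC])
  have lam: "a c + g c \<bullet> (\<Sum>v\<in>C. u v *\<^sub>R v) = u c" if "sum u C = 1" "c \<in> C" for u c
  proof -
    have "a c + g c \<bullet> (\<Sum>v\<in>C. u v *\<^sub>R v) = (\<Sum>v\<in>C. u v) * a c + (\<Sum>v\<in>C. u v * (g c \<bullet> v))"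
      using that by (simp add: inner_sum_right)
    also have "\<dots> = (\<Sum>v\<in>C. u v * (a c + g c \<bullet> v))"
      by (simp add: sum_distrib_right distrib_left sum.distrib)
    also have "\<dots> = (\<Sum>v\<in>C. if c = v then u v else 0)"
      using ag[OF that(2)] by (intro sum.cong) auto
    finally show ?thesis using that(2) finC by simp
  qed
  have "barycentric C a g"
  proof
    fix x :: "real ^ 'n"
    obtain u where u: "sum u C = 1" "(\<Sum>v\<in>C. u v *\<^sub>R v) = x" using repr by blast
    have "a c + g c \<bullet> x = u c" if "c \<in> C" for c using lam[OF u(1) that] u(2) by simp
    then show "(\<Sum>c\<in>C. a c + g c \<bullet> x) = 1" "(\<Sum>c\<in>C. (a c + g c \<bullet> x) *\<^sub>R c) = x" using u by auto
  qed (use finC assms ag in auto)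
  then show ?thesis by blast
qed

theorem lemma3p4:
  fixes K :: "(real ^ 'n) set"
    and nv :: "(real ^ 'n) set \<Rightarrow> nat \<Rightarrow> real ^ 'n"
    and Ba :: "real ^ 'n \<Rightarrow> (real ^ 'n ^ 'n) set"
    and Bb :: "(real ^ 'n) set \<Rightarrow> nat \<Rightarrow> nat \<Rightarrow> (real ^ 'n \<Rightarrow> real) set"
    and Bc :: "(real ^ 'n) set \<Rightarrow> (real ^ 'n \<Rightarrow> real) set"
    and Bd :: "(real ^ 'n) set \<Rightarrow> (real ^ 'n \<Rightarrow> real ^ 'n) set"
    and Be :: "(real ^ 'n \<Rightarrow> real ^ 'n ^ 'n) set"
  assumes "CARD('n) \<ge> 3"
    and "int (CARD('n)) simplex K"
    and "normal_frames K nv"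
    and "\<And>v. {v} \<in> subsimplices 0 K \<Longrightarrow> basis_of (Ba v) sym_mats"
    and "\<And>e i j. e \<in> subsimplices 1 K \<Longrightarrow> 1 \<le> i \<Longrightarrow> i \<le> j \<Longrightarrow> j \<le> CARD('n) - 1 \<Longrightarrow>
           basis_of (Bb e i j) (polys_on 0 e UNIV)"
    and "\<And>F. F \<in> subsimplices (CARD('n) - 1) K \<Longrightarrow> basis_of (Bc F) (polys_on 1 F UNIV)"
    and "\<And>F. F \<in> subsimplices (CARD('n) - 1) K \<Longrightarrow> basis_of (Bd F) (ND 0 F (nv F 1))"
    and "basis_of Be (polys 0 sym_mats)"
  shows "unisolvent
     ({Vertex_Dof v M | v M. {v} \<in> subsimplices 0 K \<and> M \<in> Ba v} \<union>
      {Normal_Dof e i j q | e i j q. e \<in> subsimplices 1 K \<and> 1 \<le> i \<and> i \<le> j \<and>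
                                      j \<le> CARD('n) - 1 \<and> q \<in> Bb e i j} \<union>
      {Normal_Dof F 1 1 q | F q. F \<in> subsimplices (CARD('n) - 1) K \<and> q \<in> Bc F} \<union>
      {Tangential_Dof F q | F q. F \<in> subsimplices (CARD('n) - 1) K \<and> q \<in> Bd F} \<union>
      {Interior_Dof q | q. q \<in> Be})
     (dof_value K nv) (shape_space K nv)"
proof -
  obtain C where C: "\<not> affine_dependent C" "int (card C) = int (CARD('n)) + 1" "K = convex hull C"
    using assms(2) unfolding simplex_def by blast
  then have card: "card C = CARD('n) + 1" by linarith
  obtain a g where bary: "barycentric C a g" using barycentric_exists[OF assms(1) C(1) card] by blast
  have "dof_bases C a g nv Ba Bb Bc Bd Be"
    using bary assms(3-) unfolding C(3)
    by (intro dof_bases.intro framed_simplex.intro framed_simplex_axioms.intro dof_bases_axioms.intro)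
  from dof_bases.unisolvent_dofs[OF this] show ?thesis
    unfolding dof_bases.dofs_def[OF \<open>dof_bases C a g nv Ba Bb Bc Bd Be\<close>] C(3) .
qed

end
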